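(* Let $N\in\mathbb{N}^*$, $A=\{a_j\}_{j\le N}\subset(0,1)$ and $T>0$. Let $\mu\in H^1(A)$ be real-valued, $\psi_0\in H^1$ and $f\in L^2((0,T),H^1(A))$. For any $u\in L^2((0,T),\mathbb{R})$, there exists a unique mild solution $\psi\in C([0,T],H^1)$ of the problem $$i\partial_t\psi=-\Delta\psi+u(t)\mu(x)\psi+f(t,x)\ \ (x\in(0,1),\ t>0),\qquad\partial_x\psi(t,0)=\partial_x\psi(t,1)=0,\qquad\psi(0,\cdot)=\psi_0,$$ that is, a solution of $$\psi(t)=e^{i\Delta t}\psi_0-i\int_0^te^{i\Delta(t-s)}\big(u(s)\mu\psi(s)+f(s)\big)\,ds,\qquad t\in[0,T].$$ Moreover, there is a constant $C_T>0$ such that $$\|\psi\|_{C([0,T],H^1)}\le C_T\big(\|\psi_0\|_{H^1}+\|f\|_{L^2((0,T),H^1(A))}\big).$$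
   Context: $\mathbb{N}^*=\{1,2,\dots\}$. $L^2=L^2((0,1),\mathbb{C})$ with $\langle f,g\rangle_{L^2}=\int_0^1 f\overline{g}\,dx$. $\Delta$ is the Neumann Laplacian on $(0,1)$; $-\Delta$ has eigenvalues $\lambda_k=k^2\pi^2$, $k\in\mathbb{N}=\{0,1,\dots\}$, and Hilbert basis of eigenfunctions $\phi_0=1$, $\phi_k(x)=\sqrt2\cos(k\pi x)$ for $k\in\mathbb{N}^*$; $e^{i\Delta t}\phi_k=e^{-i\lambda_kt}\phi_k$. $H^1=H^1((0,1),\mathbb{C})$ is endowed with the norm $\|\psi\|_{H^1}=\big(|\langle\psi,\phi_0\rangle_{L^2}|^2+\sum_{k\in\mathbb{N}^*}|k\langle\psi,\phi_k\rangle_{L^2}|^2\big)^{1/2}$. For $A=\{a_1<\dots<a_N\}\subset(0,1)$, $H^1(A)$ is the space of functions on $(0,1)$ whose restrictions to $(0,a_1),(a_1,a_2),\dots,(a_N,1)$ are $H^1$, with norm $\|g\|_{H^1(A)}=\big(\|g\|^2_{H^1(0,a_1)}+\dots+\|g\|^2_{H^1(a_N,1)}\big)^{1/2}$. The potential $\mu$ is real-valued, while the source $f$ takes complex-valued $H^1(A)$ functions as values. *)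

theory Defs
  imports "HOL-Analysis.Analysis"
begin

text \<open>
  Elements of the function spaces below are represented by total functions
  \<^typ>\<open>real \<Rightarrow> complex\<close>, of which only the class modulo almost everywhere equality on the
  relevant interval matters. In particular every "norm" below is a seminorm on representatives.
\<close>

type_synonym cfun = "real \<Rightarrow> complex"

definition L2_on :: "real \<Rightarrow> real \<Rightarrow> cfun set" where
  "L2_on a b = {g. g \<in> borel_measurable (lebesgue_on {a<..<b}) \<and>
                   integrable (lebesgue_on {a<..<b}) (\<lambda>x. (cmod (g x))\<^sup>2)}"

definition L2_norm_on :: "real \<Rightarrow> real \<Rightarrow> cfun \<Rightarrow> real" where
  "L2_norm_on a b g = sqrt (LINT x|lebesgue_on {a<..<b}. (cmod (g x))\<^sup>2)"

definition L2_inner :: "cfun \<Rightarrow> cfun \<Rightarrow> complex" where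
  "L2_inner f g = (LINT x|lebesgue_on {0<..<1}. f x * cnj (g x))"


subsection \<open>Sobolev spaces\<close>

text \<open>
  On an interval one may test weak derivatives against compactly supported functions of class
  $C^1$ (as in Brezis' textbook) rather than $C^\infty$. The pair consists of a test function
  and its derivative.
\<close>

definition test_fun :: "real \<Rightarrow> real \<Rightarrow> (real \<Rightarrow> real) \<Rightarrow> (real \<Rightarrow> real) \<Rightarrow> bool" where
  "test_fun a b \<phi> \<phi>' \<longleftrightarrow>
     (\<forall>x. (\<phi> has_real_derivative \<phi>' x) (at x)) \<and> continuous_on UNIV \<phi>' \<and>
     compact (closure {x. \<phi> x \<noteq> 0}) \<and> closure {x. \<phi> x \<noteq> 0} \<subseteq> {a<..<b}"

definition is_weak_deriv :: "real \<Rightarrow> real \<Rightarrow> cfun \<Rightarrow> cfun \<Rightarrow> bool" where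
  "is_weak_deriv a b g h \<longleftrightarrow>
     (\<forall>\<phi> \<phi>'. test_fun a b \<phi> \<phi>' \<longrightarrow>
        (LINT x|lebesgue_on {a<..<b}. g x * of_real (\<phi>' x)) =
        - (LINT x|lebesgue_on {a<..<b}. h x * of_real (\<phi> x)))"

definition H1_on :: "real \<Rightarrow> real \<Rightarrow> cfun set" where
  "H1_on a b = {g \<in> L2_on a b. \<exists>h \<in> L2_on a b. is_weak_deriv a b g h}"

text \<open>The weak derivative of \<open>g \<in> H1_on a b\<close>; unique up to a null set of the interval.\<close>

definition weak_deriv :: "real \<Rightarrow> real \<Rightarrow> cfun \<Rightarrow> cfun" where
  "weak_deriv a b g = (SOME h. h \<in> L2_on a b \<and> is_weak_deriv a b g h)"

definition H1_norm_on :: "real \<Rightarrow> real \<Rightarrow> cfun \<Rightarrow> real" where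
  "H1_norm_on a b g = sqrt ((L2_norm_on a b g)\<^sup>2 + (L2_norm_on a b (weak_deriv a b g))\<^sup>2)"

text \<open>$0 = a_0 < a_1 < \dots < a_N < a_{N+1} = 1$ for $A = \{a_1 < \dots < a_N\}$.\<close>

definition breakpt :: "real set \<Rightarrow> nat \<Rightarrow> real" where
  "breakpt A j = (0 # sorted_list_of_set A @ [1]) ! j"

definition H1_pw :: "real set \<Rightarrow> cfun set" where
  "H1_pw A = {g. \<forall>j\<le>card A. g \<in> H1_on (breakpt A j) (breakpt A (Suc j))}"

definition H1_pw_norm :: "real set \<Rightarrow> cfun \<Rightarrow> real" where
  "H1_pw_norm A g = sqrt (\<Sum>j\<le>card A. (H1_norm_on (breakpt A j) (breakpt A (Suc j)) g)\<^sup>2)"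


subsection \<open>Spectral data of the Neumann Laplacian and its unitary group\<close>

definition eigval :: "nat \<Rightarrow> real" where
  "eigval k = (real k)\<^sup>2 * pi\<^sup>2"

definition eigfun :: "nat \<Rightarrow> cfun" where
  "eigfun k x = (if k = 0 then 1 else of_real (sqrt 2 * cos (real k * pi * x)))"

text \<open>
  The norm chosen on $H^1(0,1)$; meaningful for members of \<open>H1_on 0 1\<close>, for which the series
  converges.
\<close>

definition H1_norm :: "cfun \<Rightarrow> real" where
  "H1_norm g = sqrt ((cmod (L2_inner g (eigfun 0)))\<^sup>2 +
     (\<Sum>k. (cmod (of_nat (Suc k) * L2_inner g (eigfun (Suc k))))\<^sup>2))"

text \<open>
  $e^{i\Delta t} g$: a representative of the $L^2$-convergent series
  $\sum_k e^{-i\lambda_k t} \langle g, \phi_k\rangle \phi_k$.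
\<close>

definition schroedinger_group :: "real \<Rightarrow> cfun \<Rightarrow> cfun" where
  "schroedinger_group t g =
     (SOME h. h \<in> L2_on 0 1 \<and>
        (\<lambda>n. L2_norm_on 0 1 (\<lambda>x. h x -
           (\<Sum>k<n. exp (- \<i> * of_real (eigval k * t)) * L2_inner g (eigfun k) * eigfun k x)))
        \<longlonglongrightarrow> 0)"


subsection \<open>Functions of time with values in a function space\<close>

text \<open>
  The Bochner integral of the library needs the range to be a normed space given as a type.
  The following transcribes its definition (approximation by simple functions) to a space \<open>X\<close>
  of representatives with seminorm \<open>nrm\<close>. It is only used over measures that are finite, so no
  condition on the support of simple functions is required.
\<close>

definition simple_in :: "cfun set \<Rightarrow> 't measure \<Rightarrow> ('t \<Rightarrow> cfun) \<Rightarrow> bool" where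
  "simple_in X M s \<longleftrightarrow> simple_function M s \<and> s ` space M \<subseteq> X"

definition strongly_measurable ::
    "cfun set \<Rightarrow> (cfun \<Rightarrow> real) \<Rightarrow> 't measure \<Rightarrow> ('t \<Rightarrow> cfun) \<Rightarrow> bool" where
  "strongly_measurable X nrm M F \<longleftrightarrow>
     (\<exists>s. (\<forall>n. simple_in X M (s n)) \<and>
          (AE t in M. F t \<in> X \<and> (\<lambda>n::nat. nrm (\<lambda>x. F t x - s n t x)) \<longlonglongrightarrow> 0))"

definition simple_integral_fun :: "'t measure \<Rightarrow> ('t \<Rightarrow> cfun) \<Rightarrow> cfun" where
  "simple_integral_fun M s =
     (\<lambda>x. \<Sum>v\<in>s ` space M. of_real (measure M (s -` {v} \<inter> space M)) * v x)"

definition has_bochner_integral_in ::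
    "cfun set \<Rightarrow> (cfun \<Rightarrow> real) \<Rightarrow> 't measure \<Rightarrow> ('t \<Rightarrow> cfun) \<Rightarrow> cfun \<Rightarrow> bool" where
  "has_bochner_integral_in X nrm M F I \<longleftrightarrow>
     strongly_measurable X nrm M F \<and> I \<in> X \<and>
     (\<exists>s. (\<forall>n. simple_in X M (s n)) \<and>
          (\<lambda>n::nat. \<integral>\<^sup>+t. ennreal (nrm (\<lambda>x. F t x - s n t x)) \<partial>M) \<longlonglongrightarrow> 0 \<and>
          (\<lambda>n. nrm (\<lambda>x. I x - simple_integral_fun M (s n) x)) \<longlonglongrightarrow> 0)"

definition L2_time_H1_pw :: "real \<Rightarrow> real set \<Rightarrow> (real \<Rightarrow> cfun) set" where
  "L2_time_H1_pw T A =
     {f. strongly_measurable (H1_pw A) (H1_pw_norm A) (lebesgue_on {0<..<T}) f \<and>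
         integrable (lebesgue_on {0<..<T}) (\<lambda>t. (H1_pw_norm A (f t))\<^sup>2)}"

definition L2_time_H1_pw_norm :: "real \<Rightarrow> real set \<Rightarrow> (real \<Rightarrow> cfun) \<Rightarrow> real" where
  "L2_time_H1_pw_norm T A f = sqrt (LINT t|lebesgue_on {0<..<T}. (H1_pw_norm A (f t))\<^sup>2)"

definition L2_time_real :: "real \<Rightarrow> (real \<Rightarrow> real) set" where
  "L2_time_real T = {u. u \<in> borel_measurable (lebesgue_on {0<..<T}) \<and>
                        integrable (lebesgue_on {0<..<T}) (\<lambda>t. (u t)\<^sup>2)}"

definition C_time_H1 :: "real \<Rightarrow> (real \<Rightarrow> cfun) set" where
  "C_time_H1 T = {\<psi>. (\<forall>t\<in>{0..T}. \<psi> t \<in> H1_on 0 1) \<and>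
     (\<forall>t\<in>{0..T}. ((\<lambda>s. H1_norm (\<lambda>x. \<psi> s x - \<psi> t x)) \<longlongrightarrow> 0) (at t within {0..T}))}"

definition C_time_H1_norm :: "real \<Rightarrow> (real \<Rightarrow> cfun) \<Rightarrow> real" where
  "C_time_H1_norm T \<psi> = (SUP t\<in>{0..T}. H1_norm (\<psi> t))"


subsection \<open>Mild solutions\<close>

text \<open>
  The Duhamel integral is a Bochner integral in $L^2(0,1)$, the space on which $e^{i\Delta t}$
  acts; its integrand takes values in $H^1(A)$ before the group is applied.
\<close>

definition mild_solution ::
    "real \<Rightarrow> (real \<Rightarrow> real) \<Rightarrow> (real \<Rightarrow> real) \<Rightarrow> cfun \<Rightarrow> (real \<Rightarrow> cfun) \<Rightarrow> (real \<Rightarrow> cfun) \<Rightarrow> bool"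
  where
  "mild_solution T \<mu> u \<psi>0 f \<psi> \<longleftrightarrow>
     \<psi> \<in> C_time_H1 T \<and>
     (\<forall>t\<in>{0..T}. \<exists>I.
        has_bochner_integral_in (L2_on 0 1) (L2_norm_on 0 1) (lebesgue_on {0<..<t})
          (\<lambda>s. schroedinger_group (t - s)
                 (\<lambda>x. of_real (u s) * of_real (\<mu> x) * \<psi> s x + f s x)) I \<and>
        (AE x in lebesgue_on {0<..<1}. \<psi> t x = schroedinger_group t \<psi>0 x - \<i> * I x))"

end

theory Submission
  imports Defs
begin

text \<open>
  In the cosine basis the equation becomes $c_k(t) = e^{-i\lambda_k t} (c_k(0) - i \int_0^t
  e^{i\lambda_k s} \langle u(s)\mu\psi(s) + f(s), \phi_k\rangle ds)$. The source is only
  piecewise $H^1$, so $k \langle g, \phi_k \rangle$ is not square summable: integration by parts on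
  each piece leaves boundary terms of size one. They are harmless after integration in time, because
  the exponentials $e^{i k^2 \pi^2 s}$ are orthogonal on intervals whose length is a multiple of
  $2/\pi$, and Bessel's inequality bounds $\sum_k |\int_r^t e^{i\lambda_k s} p(s) ds|^2$ by a constant
  times $\int_r^t |p|^2$ for every trace $p$ of the source. Hence the Duhamel integral maps
  $L^2((0,T), H^1(A))$ into $C([0,T], H^1)$, with a squared norm at time $t$ at most
  $C \int_0^t \|g(s)\|^2 ds$. As multiplication by $\mu$ maps $H^1$ into $H^1(A)$, the
  problem is solved by a Picard iteration that contracts in the norm weighted by
  $\exp(-\lambda \int_0^t u^2)$, and the same weight gives Gronwall's inequality, hence
  uniqueness and the bound.
\<close>

section \<open>Square-integrable functions\<close>

text \<open>Elements of the function spaces are representatives, the group and the weak derivative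
  are values of a choice operator, and the Duhamel integral is specified through approximations.
  None of these can be handled pointwise, so the problem is moved to the weighted cosine
  coefficients \<open>wcoef\<close>: there \<open>H1_norm\<close> is the plain norm of
  square-summable sequences, the group is multiplication by phases, and equality almost everywhere
  becomes equality. \<open>mild_solution_iff\<close> makes this transfer in both directions.

  The bound on the Duhamel integral has to hold on every time interval \<open>(r, t)\<close> with a
  constant that depends only on the horizon, since continuity in time comes from the smallness of
  the source on short intervals. Extension by zero to a fixed period provides this uniformity.

  As \<open>u\<close> is merely square integrable, the Lipschitz density \<open>\<kappa>\<close> is
  merely integrable and its primitive merely absolutely continuous. The exponential of that
  primitive is therefore integrated through its power series rather than by a pointwise chain
  rule.\<close>

definition sqint :: "'a measure \<Rightarrow> ('a \<Rightarrow> complex) set" where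
  "sqint M = {f \<in> borel_measurable M. integrable M (\<lambda>x. (cmod (f x))\<^sup>2)}"

text \<open>The measure is left arbitrary because three spaces share these facts: functions of
  position on an interval, functions of time on an interval, and sequences, seen as functions on
  \<open>count_space UNIV\<close>.\<close>

definition l2norm :: "'a measure \<Rightarrow> ('a \<Rightarrow> complex) \<Rightarrow> real" where
  "l2norm M f = sqrt (LINT x|M. (cmod (f x))\<^sup>2)"

lemma L2_on_sqint: "L2_on a b = sqint (lebesgue_on {a<..<b})"
  by (auto simp: L2_on_def sqint_def)

lemma L2_norm_on_l2norm: "L2_norm_on a b = l2norm (lebesgue_on {a<..<b})"
  by (auto simp: L2_norm_on_def l2norm_def)

lemma sqintI:
  "f \<in> borel_measurable M \<Longrightarrow> integrable M (\<lambda>x. (cmod (f x))\<^sup>2) \<Longrightarrow> f \<in> sqint M"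
  by (simp add: sqint_def)

lemma sqintD [simp]:
  assumes "f \<in> sqint M"
  shows "f \<in> borel_measurable M" "integrable M (\<lambda>x. (cmod (f x))\<^sup>2)"
  using assms by (auto simp: sqint_def)

declare sqintD(1) [measurable_dest]

lemma l2norm_nonneg [simp]: "0 \<le> l2norm M f"
  by (simp add: l2norm_def)

lemma l2norm_sq: "(l2norm M f)\<^sup>2 = (LINT x|M. (cmod (f x))\<^sup>2)"
  by (simp add: l2norm_def)

lemma sqint_bound:
  assumes "g \<in> borel_measurable M" "f \<in> sqint M" "AE x in M. cmod (g x) \<le> C * cmod (f x)"
  shows "g \<in> sqint M"
proof -
  have i: "integrable M (\<lambda>x. C\<^sup>2 * (cmod (f x))\<^sup>2)"
    using assms by simp
  have b: "AE x in M. norm ((cmod (g x))\<^sup>2) \<le> norm (C\<^sup>2 * (cmod (f x))\<^sup>2)"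
    using assms(3)
  proof eventually_elim
    case (elim x)
    then have "(cmod (g x))\<^sup>2 \<le> (C * cmod (f x))\<^sup>2" by (intro power_mono) auto
    then show ?case by (simp add: power_mult_distrib)
  qed
  have "(\<lambda>x. (cmod (g x))\<^sup>2) \<in> borel_measurable M"
    using assms(1) by measurable
  from Bochner_Integration.integrable_bound[OF i this b]
  have "integrable M (\<lambda>x. (cmod (g x))\<^sup>2)" .
  then show ?thesis using assms(1) by (intro sqintI)
qed

lemma sqint_zero [simp]: "(\<lambda>x. 0) \<in> sqint M"
  by (rule sqintI) auto

lemma cmod_add_sq_le: "(cmod (a + b))\<^sup>2 \<le> 2 * (cmod a)\<^sup>2 + 2 * (cmod b)\<^sup>2"
proof -
  have "(cmod (a + b))\<^sup>2 \<le> (cmod a + cmod b)\<^sup>2"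
    by (intro power_mono norm_triangle_ineq) auto
  also have "\<dots> \<le> 2 * (cmod a)\<^sup>2 + 2 * (cmod b)\<^sup>2"
    using sum_squares_bound[of "cmod a" "cmod b"] by (simp add: power2_sum)
  finally show ?thesis .
qed

lemma sqint_add:
  assumes "f \<in> sqint M" "g \<in> sqint M"
  shows "(\<lambda>x. f x + g x) \<in> sqint M"
proof -
  have m: "f \<in> borel_measurable M" "g \<in> borel_measurable M" using assms by auto
  have "integrable M (\<lambda>x. 2 * (cmod (f x))\<^sup>2 + 2 * (cmod (g x))\<^sup>2)"
    using assms by auto
  then have "integrable M (\<lambda>x. (cmod (f x + g x))\<^sup>2)"
  proof (rule Bochner_Integration.integrable_bound)
    show "(\<lambda>x. (cmod (f x + g x))\<^sup>2) \<in> borel_measurable M" using m by measurable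
    show "AE x in M. norm ((cmod (f x + g x))\<^sup>2) \<le> norm (2 * (cmod (f x))\<^sup>2 + 2 * (cmod (g x))\<^sup>2)"
      using cmod_add_sq_le by (intro AE_I2) simp
  qed
  then show ?thesis using m by (intro sqintI) auto
qed

lemma sqint_cmult:
  assumes "f \<in> sqint M" shows "(\<lambda>x. c * f x) \<in> sqint M"
  using assms by (intro sqintI) (auto simp: norm_mult power_mult_distrib)

lemma sqint_uminus:
  assumes "f \<in> sqint M" shows "(\<lambda>x. - f x) \<in> sqint M"
  using assms by (intro sqintI) auto

lemma borel_measurable_cnj [measurable (raw)]:
  "f \<in> borel_measurable M \<Longrightarrow> (\<lambda>x. cnj (f x)) \<in> borel_measurable M"
  by (rule borel_measurable_continuous_on[of cnj]) (auto intro!: continuous_intros)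

lemma sqint_cnj:
  assumes "f \<in> sqint M" shows "(\<lambda>x. cnj (f x)) \<in> sqint M"
  using assms by (intro sqintI) auto

lemma sqint_diff:
  assumes "f \<in> sqint M" "g \<in> sqint M"
  shows "(\<lambda>x. f x - g x) \<in> sqint M"
  using sqint_add[OF assms(1) sqint_uminus[OF assms(2)]] by simp

lemma sqint_sum:
  assumes "\<And>i. i \<in> I \<Longrightarrow> f i \<in> sqint M"
  shows "(\<lambda>x. \<Sum>i\<in>I. f i x) \<in> sqint M"
  using assms by (induction I rule: infinite_finite_induct) (auto intro: sqint_add)

lemma sqint_cong_AE:
  assumes "f \<in> sqint M" "g \<in> borel_measurable M" "AE x in M. f x = g x"
  shows "g \<in> sqint M"
  using assms(3) by (intro sqint_bound[OF assms(2,1), of 1]) auto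

lemma l2norm_cong_AE:
  assumes "f \<in> borel_measurable M" "g \<in> borel_measurable M" "AE x in M. f x = g x"
  shows "l2norm M f = l2norm M g"
  unfolding l2norm_def using assms by (intro arg_cong[of _ _ sqrt] integral_cong_AE) auto

lemma sqint_mult:
  assumes "f \<in> sqint M" "g \<in> sqint M"
  shows "integrable M (\<lambda>x. f x * g x)"
proof -
  have m: "f \<in> borel_measurable M" "g \<in> borel_measurable M" using assms by auto
  have "integrable M (\<lambda>x. (cmod (f x))\<^sup>2 + (cmod (g x))\<^sup>2)"
    using assms by auto
  then show ?thesis
  proof (rule Bochner_Integration.integrable_bound)
    show "AE x in M. norm (f x * g x) \<le> norm ((cmod (f x))\<^sup>2 + (cmod (g x))\<^sup>2)"
    proof (rule AE_I2)
      fix x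
      have "2 * (cmod (f x) * cmod (g x)) \<le> (cmod (f x))\<^sup>2 + (cmod (g x))\<^sup>2"
        using sum_squares_bound[of "cmod (f x)" "cmod (g x)"] by (simp add: mult.assoc)
      moreover have "0 \<le> cmod (f x) * cmod (g x)" by simp
      ultimately have "cmod (f x) * cmod (g x) \<le> (cmod (f x))\<^sup>2 + (cmod (g x))\<^sup>2" by linarith
      then show "norm (f x * g x) \<le> norm ((cmod (f x))\<^sup>2 + (cmod (g x))\<^sup>2)"
        by (simp add: norm_mult)
    qed
  qed (use m in measurable)
qed

lemma sqint_mult_cnj:
  assumes "f \<in> sqint M" "g \<in> sqint M"
  shows "integrable M (\<lambda>x. f x * cnj (g x))"
  using sqint_mult[OF assms(1) sqint_cnj[OF assms(2)]] .

lemma sqint_real_mult: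
  assumes "f \<in> sqint M" "g \<in> sqint M"
  shows "integrable M (\<lambda>x. cmod (f x) * cmod (g x))"
  using integrable_norm[OF sqint_mult[OF assms]] by (simp add: norm_mult)

lemma l2_Cauchy_Schwarz_norm:
  assumes "f \<in> sqint M" "g \<in> sqint M"
  shows "(LINT x|M. cmod (f x) * cmod (g x)) \<le> l2norm M f * l2norm M g"
proof -
  have [measurable]: "f \<in> borel_measurable M" "g \<in> borel_measurable M" using assms by auto
  let ?I = "LINT x|M. cmod (f x) * cmod (g x)"
  have nn: "0 \<le> ?I" by (intro Bochner_Integration.integral_nonneg) auto
  have "(\<integral>\<^sup>+x. ennreal (cmod (f x)) * ennreal (cmod (g x)) \<partial>M)\<^sup>2
     \<le> (\<integral>\<^sup>+x. (ennreal (cmod (f x)))\<^sup>2 \<partial>M) * (\<integral>\<^sup>+x. (ennreal (cmod (g x)))\<^sup>2 \<partial>M)"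
    by (rule Cauchy_Schwarz_nn_integral) measurable
  also have "(\<integral>\<^sup>+x. ennreal (cmod (f x)) * ennreal (cmod (g x)) \<partial>M) = ennreal ?I"
    using sqint_real_mult[OF assms]
    by (subst nn_integral_eq_integral[symmetric]) (auto simp: ennreal_mult)
  also have "(\<integral>\<^sup>+x. (ennreal (cmod (f x)))\<^sup>2 \<partial>M) = ennreal ((l2norm M f)\<^sup>2)"
    using assms unfolding l2norm_sq
    by (subst nn_integral_eq_integral[symmetric]) (auto simp: ennreal_power)
  also have "(\<integral>\<^sup>+x. (ennreal (cmod (g x)))\<^sup>2 \<partial>M) = ennreal ((l2norm M g)\<^sup>2)"
    using assms unfolding l2norm_sq
    by (subst nn_integral_eq_integral[symmetric]) (auto simp: ennreal_power)
  finally have "?I\<^sup>2 \<le> (l2norm M f)\<^sup>2 * (l2norm M g)\<^sup>2"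
    using nn by (simp add: ennreal_power ennreal_mult[symmetric])
  then have "?I\<^sup>2 \<le> (l2norm M f * l2norm M g)\<^sup>2" by (simp add: power_mult_distrib)
  then show ?thesis by (rule power2_le_imp_le) simp
qed

lemma l2_Cauchy_Schwarz:
  assumes "f \<in> sqint M" "g \<in> sqint M"
  shows "cmod (LINT x|M. f x * g x) \<le> l2norm M f * l2norm M g"
proof -
  have "cmod (LINT x|M. f x * g x) \<le> (LINT x|M. cmod (f x) * cmod (g x))"
    using integral_norm_bound[of M "\<lambda>x. f x * g x"] by (simp add: norm_mult)
  then show ?thesis using l2_Cauchy_Schwarz_norm[OF assms] by linarith
qed

lemma l2norm_cnj [simp]: "l2norm M (\<lambda>x. cnj (f x)) = l2norm M f"
  by (simp add: l2norm_def)

lemma l2norm_uminus [simp]: "l2norm M (\<lambda>x. - f x) = l2norm M f"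
  by (simp add: l2norm_def)

lemma l2norm_cmult: "l2norm M (\<lambda>x. c * f x) = cmod c * l2norm M f"
  by (simp add: l2norm_def norm_mult power_mult_distrib real_sqrt_mult)

lemma l2norm_triangle:
  assumes "f \<in> sqint M" "g \<in> sqint M"
  shows "l2norm M (\<lambda>x. f x + g x) \<le> l2norm M f + l2norm M g"
proof (rule power2_le_imp_le)
  have i: "integrable M (\<lambda>x. (cmod (f x))\<^sup>2)" "integrable M (\<lambda>x. (cmod (g x))\<^sup>2)"
    "integrable M (\<lambda>x. cmod (f x) * cmod (g x))"
    "integrable M (\<lambda>x. (cmod (f x + g x))\<^sup>2)"
    using assms sqint_add[OF assms] sqint_real_mult[OF assms] by auto
  have "(l2norm M (\<lambda>x. f x + g x))\<^sup>2 \<le>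
      (LINT x|M. (cmod (f x))\<^sup>2 + (cmod (g x))\<^sup>2 + 2 * (cmod (f x) * cmod (g x)))"
    unfolding l2norm_sq
  proof (rule integral_mono)
    fix x
    have "(cmod (f x + g x))\<^sup>2 \<le> (cmod (f x) + cmod (g x))\<^sup>2"
      by (intro power_mono norm_triangle_ineq) auto
    then show "(cmod (f x + g x))\<^sup>2 \<le> (cmod (f x))\<^sup>2 + (cmod (g x))\<^sup>2 + 2 * (cmod (f x) * cmod (g x))"
      by (simp add: power2_sum mult.assoc)
  qed (use i in auto)
  also have "\<dots> = (l2norm M f)\<^sup>2 + (l2norm M g)\<^sup>2 + 2 * (LINT x|M. cmod (f x) * cmod (g x))"
    using i by (simp add: l2norm_sq)
  also have "\<dots> \<le> (l2norm M f + l2norm M g)\<^sup>2"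
    using l2_Cauchy_Schwarz_norm[OF assms] by (simp add: power2_sum)
  finally show "(l2norm M (\<lambda>x. f x + g x))\<^sup>2 \<le> (l2norm M f + l2norm M g)\<^sup>2" .
qed auto

lemma l2norm_triangle_diff:
  assumes "f \<in> sqint M" "g \<in> sqint M" "h \<in> sqint M"
  shows "l2norm M (\<lambda>x. f x - h x) \<le> l2norm M (\<lambda>x. f x - g x) + l2norm M (\<lambda>x. g x - h x)"
  using l2norm_triangle[OF sqint_diff[OF assms(1,2)] sqint_diff[OF assms(2,3)]] by simp

lemma l2norm_minus_commute: "l2norm M (\<lambda>x. f x - g x) = l2norm M (\<lambda>x. g x - f x)"
  by (simp add: l2norm_def norm_minus_commute)

lemma l2norm_reverse_triangle:
  assumes "f \<in> sqint M" "g \<in> sqint M"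
  shows "\<bar>l2norm M f - l2norm M g\<bar> \<le> l2norm M (\<lambda>x. f x - g x)"
  using l2norm_triangle[OF sqint_diff[OF assms] assms(2)]
    l2norm_triangle[OF sqint_diff[OF assms(2,1)] assms(1)]
    l2norm_minus_commute[of M f g] by simp

lemma l2norm_eq_0_imp_AE:
  assumes "f \<in> sqint M" "l2norm M f = 0"
  shows "AE x in M. f x = 0"
proof -
  have "(LINT x|M. (cmod (f x))\<^sup>2) = 0" using assms(2) l2norm_sq[of M f] by simp
  then have "AE x in M. (cmod (f x))\<^sup>2 = 0"
    using assms(1) by (subst (asm) integral_nonneg_eq_0_iff_AE) auto
  then show ?thesis by simp
qed

lemma (in finite_measure) sqint_const: "(\<lambda>x. c) \<in> sqint M"
  by (rule sqintI) auto

lemma (in finite_measure) sqint_bounded: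
  assumes "f \<in> borel_measurable M" "AE x in M. cmod (f x) \<le> C"
  shows "f \<in> sqint M"
proof -
  have "AE x in M. cmod (f x) \<le> C * cmod 1" using assms(2) by simp
  from sqint_bound[OF assms(1) sqint_const this] show ?thesis .
qed

lemma (in finite_measure) sqint_integrable:
  assumes "f \<in> sqint M" shows "integrable M f"
  using sqint_mult[OF assms sqint_const[of 1]] by simp

lemma (in finite_measure) sqint_integral_norm_le:
  assumes "f \<in> sqint M"
  shows "(LINT x|M. cmod (f x)) \<le> sqrt (measure M (space M)) * l2norm M f"
  using l2_Cauchy_Schwarz_norm[OF sqint_const[of 1] assms]
  by (simp add: l2norm_def)

lemma sqint_mult_bounded:
  assumes "f \<in> sqint M" "g \<in> borel_measurable M" "AE x in M. cmod (g x) \<le> C"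
  shows "(\<lambda>x. g x * f x) \<in> sqint M" "l2norm M (\<lambda>x. g x * f x) \<le> C * l2norm M f"
proof -
  have b: "AE x in M. cmod (g x * f x) \<le> C * cmod (f x)"
    using assms(3) by eventually_elim (simp add: norm_mult mult_right_mono)
  have [measurable]: "f \<in> borel_measurable M" "g \<in> borel_measurable M" using assms by auto
  show s: "(\<lambda>x. g x * f x) \<in> sqint M"
    by (rule sqint_bound[OF _ assms(1) b]) measurable
  show "l2norm M (\<lambda>x. g x * f x) \<le> C * l2norm M f"
  \<comment> \<open>The bound almost everywhere forces \<open>0 \<le> C\<close> unless the measure
    is zero; in that case \<open>C\<close> may be negative, but both norms vanish.\<close>
  proof (cases "AE x in M. False")
    case True
    then have "l2norm M h = 0" for h
      unfolding l2norm_def by (subst integral_eq_zero_AE) auto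
    then show ?thesis by simp
  next
    case False
    have C: "0 \<le> C"
    proof (rule ccontr)
      assume "\<not> 0 \<le> C"
      have "AE x in M. False" using assms(3)
      proof eventually_elim
        case (elim x)
        with \<open>\<not> 0 \<le> C\<close> norm_ge_zero[of "g x"] show ?case by linarith
      qed
      with False show False by simp
    qed
    have "(LINT x|M. (cmod (g x * f x))\<^sup>2) \<le> (LINT x|M. C\<^sup>2 * (cmod (f x))\<^sup>2)"
    proof (rule integral_mono_AE)
      show "AE x in M. (cmod (g x * f x))\<^sup>2 \<le> C\<^sup>2 * (cmod (f x))\<^sup>2"
        using b
      proof eventually_elim
        case (elim x)
        from power_mono[OF elim, of 2] show ?case by (simp add: power_mult_distrib)
      qed
    qed (use s assms(1) in auto)
    then have "(l2norm M (\<lambda>x. g x * f x))\<^sup>2 \<le> (C * l2norm M f)\<^sup>2"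
      by (simp add: l2norm_sq power_mult_distrib)
    then show ?thesis by (rule power2_le_imp_le) (use C in simp)
  qed
qed

section \<open>Inner products, orthogonal families and Bessel's inequality\<close>

definition l2inner :: "'a measure \<Rightarrow> ('a \<Rightarrow> complex) \<Rightarrow> ('a \<Rightarrow> complex) \<Rightarrow> complex" where
  "l2inner M f g = (LINT x|M. f x * cnj (g x))"

lemma l2inner_diff_left:
  assumes "f \<in> sqint M" "g \<in> sqint M" "h \<in> sqint M"
  shows "l2inner M (\<lambda>x. f x - g x) h = l2inner M f h - l2inner M g h"
  using sqint_mult_cnj[OF assms(1,3)] sqint_mult_cnj[OF assms(2,3)]
  by (simp add: l2inner_def left_diff_distrib)

lemma l2inner_cmult_left: "l2inner M (\<lambda>x. c * f x) h = c * l2inner M f h"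
  by (simp add: l2inner_def mult.assoc)

lemma l2inner_sum_left:
  assumes "\<And>i. i \<in> I \<Longrightarrow> f i \<in> sqint M" "h \<in> sqint M"
  shows "l2inner M (\<lambda>x. \<Sum>i\<in>I. c i * f i x) h = (\<Sum>i\<in>I. c i * l2inner M (f i) h)"
proof -
  have "l2inner M (\<lambda>x. \<Sum>i\<in>I. c i * f i x) h = (LINT x|M. (\<Sum>i\<in>I. c i * (f i x * cnj (h x))))"
    by (simp add: l2inner_def sum_distrib_right mult.assoc)
  also have "\<dots> = (\<Sum>i\<in>I. c i * l2inner M (f i) h)"
    unfolding l2inner_def
    by (subst Bochner_Integration.integral_sum) (auto intro!: sqint_mult_cnj assms)
  finally show ?thesis .
qed

lemma l2inner_cnj: "l2inner M f g = cnj (l2inner M g f)"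
proof -
  have "cnj (l2inner M g f) = (LINT x|M. cnj (g x * cnj (f x)))"
    unfolding l2inner_def using Bochner_Integration.integral_cnj[of M "\<lambda>x. g x * cnj (f x)"] by simp
  then show ?thesis by (simp add: l2inner_def mult.commute)
qed

lemma mult_cnj_cmod: "z * cnj z = (of_real (cmod z))\<^sup>2"
  using complex_norm_square[of z] by simp

lemma l2inner_self: "l2inner M f f = of_real ((l2norm M f)\<^sup>2)"
  unfolding l2inner_def l2norm_sq integral_complex_of_real[symmetric]
  by (simp add: mult_cnj_cmod)

lemma l2inner_bound:
  assumes "f \<in> sqint M" "g \<in> sqint M"
  shows "cmod (l2inner M f g) \<le> l2norm M f * l2norm M g"
  unfolding l2inner_def using l2_Cauchy_Schwarz[OF assms(1) sqint_cnj[OF assms(2)]] by simp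

text \<open>The common squared norm \<open>L\<close> stays a parameter: it is 1 for the cosines and
  sines on the unit interval, but equals the length of the period for the exponentials in
  time.\<close>

definition orthogonal_family :: "'a measure \<Rightarrow> (nat \<Rightarrow> 'a \<Rightarrow> complex) \<Rightarrow> real \<Rightarrow> bool" where
  "orthogonal_family M e L \<longleftrightarrow> 0 < L \<and> (\<forall>k. e k \<in> sqint M) \<and>
     (\<forall>j k. l2inner M (e j) (e k) = (if j = k then of_real L else 0))"

lemma orthogonal_familyD:
  assumes "orthogonal_family M e L"
  shows "0 < L" "e k \<in> sqint M" "l2inner M (e j) (e k) = (if j = k then of_real L else 0)"
    "l2norm M (e k) = sqrt L"
proof -
  show "0 < L" "e k \<in> sqint M" "l2inner M (e j) (e k) = (if j = k then of_real L else 0)"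
    using assms by (auto simp: orthogonal_family_def)
  have "complex_of_real ((l2norm M (e k))\<^sup>2) = of_real L"
    using assms l2inner_self[of M "e k"] by (simp add: orthogonal_family_def)
  then have "(l2norm M (e k))\<^sup>2 = L" using of_real_eq_iff by blast
  then show "l2norm M (e k) = sqrt L" by (metis l2norm_nonneg real_sqrt_unique)
qed

lemma orthogonal_family_sum_sqint:
  assumes "orthogonal_family M e L"
  shows "(\<lambda>x. \<Sum>k\<in>I. c k * e k x) \<in> sqint M"
  by (intro sqint_sum sqint_cmult orthogonal_familyD(2)[OF assms])

lemma orthogonal_family_l2inner_sum:
  assumes "orthogonal_family M e L" "finite I"
  shows "l2inner M (\<lambda>x. \<Sum>k\<in>I. c k * e k x) (e j) = (if j \<in> I then of_real L * c j else 0)"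
proof -
  have "l2inner M (\<lambda>x. \<Sum>k\<in>I. c k * e k x) (e j) = (\<Sum>k\<in>I. c k * l2inner M (e k) (e j))"
    by (rule l2inner_sum_left) (use orthogonal_familyD[OF assms(1)] in auto)
  also have "\<dots> = (\<Sum>k\<in>I. if k = j then of_real L * c j else 0)"
    by (intro sum.cong) (auto simp: orthogonal_familyD(3)[OF assms(1)])
  finally show ?thesis using assms(2) by simp
qed

lemma orthogonal_family_l2norm_sum:
  assumes "orthogonal_family M e L" "finite I"
  shows "(l2norm M (\<lambda>x. \<Sum>k\<in>I. c k * e k x))\<^sup>2 = L * (\<Sum>k\<in>I. (cmod (c k))\<^sup>2)"
proof -
  let ?S = "\<lambda>x. \<Sum>k\<in>I. c k * e k x"
  have S: "?S \<in> sqint M" by (rule orthogonal_family_sum_sqint[OF assms(1)])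
  have "l2inner M ?S ?S = (\<Sum>k\<in>I. c k * l2inner M (e k) ?S)"
    by (rule l2inner_sum_left) (use orthogonal_familyD[OF assms(1)] S in auto)
  also have "\<dots> = (\<Sum>k\<in>I. of_real (L * (cmod (c k))\<^sup>2))"
  proof (intro sum.cong refl)
    fix k assume "k \<in> I"
    then have "l2inner M (e k) ?S = cnj (of_real L * c k)"
      using orthogonal_family_l2inner_sum[OF assms, of c k] by (subst l2inner_cnj) simp
    then show "c k * l2inner M (e k) ?S = of_real (L * (cmod (c k))\<^sup>2)"
      using mult_cnj_cmod[of "c k"] by (simp add: algebra_simps)
  qed
  finally have "complex_of_real ((l2norm M ?S)\<^sup>2) = of_real (\<Sum>k\<in>I. L * (cmod (c k))\<^sup>2)"
    by (simp only: l2inner_self of_real_sum)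
  then show ?thesis by (simp only: of_real_eq_iff sum_distrib_left)
qed

text \<open>The residual \<open>p - S\<close> of the projection is orthogonal to \<open>S\<close>,
  so its squared norm is that of \<open>p\<close> minus the sum of squares divided by
  \<open>L\<close>; this difference cannot be negative.\<close>

lemma bessel_finite:
  assumes e: "orthogonal_family M e L" and p: "p \<in> sqint M" and I: "finite I"
  shows "(\<Sum>k\<in>I. (cmod (l2inner M p (e k)))\<^sup>2) \<le> L * (l2norm M p)\<^sup>2"
proof -
  have L: "0 < L" using orthogonal_familyD[OF e] by simp
  define c where "c k = l2inner M p (e k) / of_real L" for k
  let ?S = "\<lambda>x. \<Sum>k\<in>I. c k * e k x"
  let ?r = "\<lambda>x. p x - ?S x"
  have S: "?S \<in> sqint M" by (rule orthogonal_family_sum_sqint[OF e])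
  have r: "?r \<in> sqint M" by (rule sqint_diff[OF p S])
  have 1: "l2inner M ?r (e k) = 0" if "k \<in> I" for k
    using that L orthogonal_familyD[OF e] S p orthogonal_family_l2inner_sum[OF e I, of c k]
    by (simp add: l2inner_diff_left c_def)
  have "l2inner M ?S ?r = (\<Sum>k\<in>I. c k * l2inner M (e k) ?r)"
    by (rule l2inner_sum_left) (use orthogonal_familyD[OF e] r in auto)
  also have "\<dots> = 0"
    using 1 by (intro sum.neutral ballI) (subst l2inner_cnj, simp)
  finally have "l2inner M ?S ?r = 0" .
  then have 2: "l2inner M ?r ?r = l2inner M p ?r"
    using p S r by (simp add: l2inner_diff_left)
  have "l2inner M ?r p = l2inner M p p - (\<Sum>k\<in>I. c k * l2inner M (e k) p)"
    using p S l2inner_sum_left[of I e M p c] orthogonal_familyD[OF e] by (simp add: l2inner_diff_left)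
  also have "(\<Sum>k\<in>I. c k * l2inner M (e k) p) = (\<Sum>k\<in>I. of_real ((cmod (l2inner M p (e k)))\<^sup>2 / L))"
  proof (intro sum.cong refl)
    fix k
    show "c k * l2inner M (e k) p = of_real ((cmod (l2inner M p (e k)))\<^sup>2 / L)"
      by (subst l2inner_cnj[of M "e k"]) (simp add: c_def mult_cnj_cmod)
  qed
  finally have "l2inner M ?r p = of_real ((l2norm M p)\<^sup>2 - (\<Sum>k\<in>I. (cmod (l2inner M p (e k)))\<^sup>2 / L))"
    by (simp only: l2inner_self of_real_sum of_real_diff)
  then have "l2inner M p ?r = of_real ((l2norm M p)\<^sup>2 - (\<Sum>k\<in>I. (cmod (l2inner M p (e k)))\<^sup>2 / L))"
    by (subst l2inner_cnj) simp
  with 2 have "complex_of_real ((l2norm M ?r)\<^sup>2) =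
      of_real ((l2norm M p)\<^sup>2 - (\<Sum>k\<in>I. (cmod (l2inner M p (e k)))\<^sup>2 / L))"
    by (simp only: l2inner_self)
  then have "(l2norm M ?r)\<^sup>2 = (l2norm M p)\<^sup>2 - (\<Sum>k\<in>I. (cmod (l2inner M p (e k)))\<^sup>2 / L)"
    by (simp only: of_real_eq_iff)
  then have "(\<Sum>k\<in>I. (cmod (l2inner M p (e k)))\<^sup>2) / L \<le> (l2norm M p)\<^sup>2"
    using zero_le_power2[of "l2norm M ?r"] unfolding sum_divide_distrib by linarith
  then show ?thesis using L by (simp add: field_simps)
qed

lemma summable_bounded_partial_sums:
  fixes f :: "nat \<Rightarrow> real"
  assumes "\<And>k. 0 \<le> f k" "\<And>n. (\<Sum>k<n. f k) \<le> B"
  shows "summable f" "suminf f \<le> B"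
proof -
  show "summable f" using assms by (rule summableI_nonneg_bounded)
  then show "suminf f \<le> B" using assms(2) by (rule suminf_le_const)
qed

lemma bessel:
  assumes "orthogonal_family M e L" "p \<in> sqint M"
  shows "summable (\<lambda>k. (cmod (l2inner M p (e k)))\<^sup>2)"
    "(\<Sum>k. (cmod (l2inner M p (e k)))\<^sup>2) \<le> L * (l2norm M p)\<^sup>2"
  by (rule summable_bounded_partial_sums[OF _ bessel_finite[OF assms]]; simp)+

section \<open>Square-summable sequences and convergence of orthogonal series\<close>

lemma sqint_count_space: "x \<in> sqint (count_space UNIV) \<longleftrightarrow> summable (\<lambda>k::nat. (cmod (x k))\<^sup>2)"
  by (simp add: sqint_def integrable_count_space_nat_iff)

lemma l2norm_count_space:
  "summable (\<lambda>k::nat. (cmod (x k))\<^sup>2) \<Longrightarrow>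
   l2norm (count_space UNIV) x = sqrt (\<Sum>k. (cmod (x k))\<^sup>2)"
  by (simp add: l2norm_def integral_count_space_nat integrable_count_space_nat_iff)

text \<open>The tails \<open>R\<close> make the partial sums Cauchy. A subsequence with tails at
  most \<open>(1/4)^j\<close> has absolutely summable increments almost everywhere, which yields a
  pointwise limit \<open>h\<close>; Fatou's lemma then carries the Cauchy bound over to the distance
  from \<open>h\<close>.\<close>

lemma (in finite_measure) riesz_fischer:
  assumes e: "orthogonal_family M e L" and c: "summable (\<lambda>k. (cmod (c k))\<^sup>2)"
  shows "\<exists>h\<in>sqint M. (\<lambda>n. l2norm M (\<lambda>x. h x - (\<Sum>k<n. c k * e k x))) \<longlonglongrightarrow> 0"
proof -
  have L: "0 < L" using orthogonal_familyD[OF e] by simp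
  define S where "S n x = (\<Sum>k<n. c k * e k x)" for n x
  define R where "R n = (\<Sum>k. (cmod (c (k + n)))\<^sup>2)" for n
  have S: "S n \<in> sqint M" for n
    unfolding S_def by (rule orthogonal_family_sum_sqint[OF e])
  note [measurable] = sqintD(1)[OF S]
  have R0: "0 \<le> R n" for n unfolding R_def
    by (intro suminf_nonneg summable_ignore_initial_segment[OF c]) auto
  have R_lim: "R \<longlonglongrightarrow> 0"
    unfolding R_def using suminf_exist_split2[OF c] .
  have aux: "(l2norm M (\<lambda>x. S n x - S m x))\<^sup>2 \<le> L * R m" if "m \<le> n" for m n
  proof -
    have "S n x - S m x = (\<Sum>k\<in>{m..<n}. c k * e k x)" for x
    proof -
      have "{..<n} = {..<m} \<union> {m..<n}" "{..<m} \<inter> {m..<n} = {}" using that by auto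
      then show ?thesis unfolding S_def by (simp add: sum.union_disjoint)
    qed
    then have "(l2norm M (\<lambda>x. S n x - S m x))\<^sup>2 = L * (\<Sum>k\<in>{m..<n}. (cmod (c k))\<^sup>2)"
      using orthogonal_family_l2norm_sum[OF e, of "{m..<n}" c] by simp
    also have "(\<Sum>k\<in>{m..<n}. (cmod (c k))\<^sup>2) = (\<Sum>k<n-m. (cmod (c (k + m)))\<^sup>2)"
      using sum.shift_bounds_nat_ivl[of "\<lambda>k. (cmod (c k))\<^sup>2" 0 m "n - m"] that
      by (simp add: lessThan_atLeast0)
    also have "\<dots> \<le> R m" unfolding R_def
      by (intro sum_le_suminf summable_ignore_initial_segment[OF c]) auto
    finally show ?thesis using L by (simp add: mult_left_mono)
  qed
  have diff: "(l2norm M (\<lambda>x. S n x - S m x))\<^sup>2 \<le> L * (R m + R n)" for m n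
  proof (cases "m \<le> n")
    case True
    then have "L * R m \<le> L * (R m + R n)" using R0 L by simp
    with aux[OF True] show ?thesis by linarith
  next
    case False
    then have "L * R n \<le> L * (R m + R n)" using R0 L by simp
    with False aux[of n m] show ?thesis
      by (subst l2norm_minus_commute) linarith
  qed
  have "\<exists>n. R n \<le> (1/4)^j" for j :: nat
  proof -
    have "eventually (\<lambda>n. R n < (1/4)^j) sequentially"
      by (rule order_tendstoD(2)[OF R_lim]) simp
    then show ?thesis by (metis eventually_sequentially less_imp_le order_refl)
  qed
  then obtain r where r: "\<And>j. R (r j) \<le> (1/4)^j" by metis
  define d where "d j x = S (r (Suc j)) x - S (r j) x" for j x
  have dS: "d j \<in> sqint M" for j unfolding d_def by (intro sqint_diff S)
  note [measurable] = sqintD(1)[OF dS]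
  have dn: "l2norm M (d j) \<le> sqrt (2 * L) * (1/2)^j" for j
  proof -
    have "(l2norm M (d j))\<^sup>2 \<le> L * (R (r j) + R (r (Suc j)))"
      unfolding d_def by (rule diff)
    also have "\<dots> \<le> L * (2 * (1/4)^j)"
      using r[of j] r[of "Suc j"] L R0[of "r (Suc j)"] by (intro mult_left_mono) auto
    also have "\<dots> = (sqrt (2 * L) * (1/2)^j)\<^sup>2"
    proof -
      have "((1/2)^j)\<^sup>2 = (1/4::real)^j"
        by (simp add: power2_eq_square flip: power_mult_distrib)
      then show ?thesis using L by (simp add: power_mult_distrib)
    qed
    finally show ?thesis by (rule power2_le_imp_le) (use L in simp)
  qed
  have dI: "integrable M (\<lambda>x. cmod (d j x))" for j using sqint_integrable[OF dS] by simp
  \<comment> \<open>On a finite measure space Cauchy-Schwarz turns the geometric bound on the norms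
    of the increments into one on the integrals of their moduli. The sum of the moduli thus has a
    finite integral and is finite almost everywhere.\<close>
  define C where "C = sqrt (measure M (space M)) * sqrt (2 * L)"
  have "(\<integral>\<^sup>+x. (\<Sum>j. ennreal (cmod (d j x))) \<partial>M) = (\<Sum>j. \<integral>\<^sup>+x. ennreal (cmod (d j x)) \<partial>M)"
    by (rule nn_integral_suminf) measurable
  also have "\<dots> \<le> (\<Sum>j. ennreal (C * (1/2)^j))"
  proof (intro suminf_le)
    fix j
    have "(LINT x|M. cmod (d j x)) \<le> sqrt (measure M (space M)) * l2norm M (d j)"
      by (rule sqint_integral_norm_le[OF dS])
    also have "\<dots> \<le> sqrt (measure M (space M)) * (sqrt (2 * L) * (1/2)^j)"
      by (intro mult_left_mono dn) auto
    finally have "(LINT x|M. cmod (d j x)) \<le> C * (1/2)^j"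
      unfolding C_def by (simp add: mult.assoc)
    then show "(\<integral>\<^sup>+x. ennreal (cmod (d j x)) \<partial>M) \<le> ennreal (C * (1/2)^j)"
      using dI[of j] by (subst nn_integral_eq_integral) (auto intro: ennreal_leI)
  qed auto
  also have "\<dots> = ennreal (\<Sum>j. C * (1/2)^j)"
    by (rule suminf_ennreal2) (use L in \<open>auto simp: C_def intro!: summable_mult summable_geometric\<close>)
  finally have "(\<integral>\<^sup>+x. (\<Sum>j. ennreal (cmod (d j x))) \<partial>M) \<noteq> \<infinity>"
    using ennreal_less_top le_less_trans by (metis infinity_ennreal_def less_irrefl)
  then have "AE x in M. (\<Sum>j. ennreal (cmod (d j x))) \<noteq> \<infinity>"
    by (rule nn_integral_noteq_infinite[rotated]) measurable
  then have conv: "AE x in M. convergent (\<lambda>j. S (r j) x)"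
  proof eventually_elim
    case (elim x)
    then have "summable (\<lambda>j. cmod (d j x))"
      by (intro summable_suminf_not_top) auto
    then have "summable (\<lambda>j. d j x)" by (rule summable_norm_cancel)
    then have "convergent (\<lambda>n. \<Sum>j<n. d j x)" by (simp add: summable_iff_convergent)
    moreover have "(\<Sum>j<n. d j x) = S (r n) x - S (r 0) x" for n
      unfolding d_def by (rule sum_lessThan_telescope)
    ultimately have "convergent (\<lambda>n. S (r n) x - S (r 0) x)" by simp
    then have "convergent (\<lambda>n. (S (r n) x - S (r 0) x) + S (r 0) x)"
      by (rule convergent_add) (rule convergent_const)
    then show ?case by simp
  qed
  define h where "h x = lim (\<lambda>j. S (r j) x)" for x
  have [measurable]: "h \<in> borel_measurable M"
    unfolding h_def by (rule borel_measurable_lim_metric) measurable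
  \<comment> \<open>Fatou's lemma along the subsequence \<open>r\<close>, whose partial sums
    converge to \<open>h\<close> almost everywhere; the extra \<open>(1/4)^j\<close> disappears in
    the limit.\<close>
  have hS: "(\<integral>\<^sup>+x. ennreal ((cmod (h x - S n x))\<^sup>2) \<partial>M) \<le> ennreal (L * R n)" for n
  proof -
    have "(\<integral>\<^sup>+x. ennreal ((cmod (h x - S n x))\<^sup>2) \<partial>M) =
        (\<integral>\<^sup>+x. liminf (\<lambda>j. ennreal ((cmod (S (r j) x - S n x))\<^sup>2)) \<partial>M)"
    proof (rule nn_integral_cong_AE)
      show "AE x in M. ennreal ((cmod (h x - S n x))\<^sup>2) =
          liminf (\<lambda>j. ennreal ((cmod (S (r j) x - S n x))\<^sup>2))"
        using conv
      proof eventually_elim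
        case (elim x)
        then have "(\<lambda>j. S (r j) x) \<longlonglongrightarrow> h x" unfolding h_def by (simp add: convergent_LIMSEQ_iff)
        then have "(\<lambda>j. ennreal ((cmod (S (r j) x - S n x))\<^sup>2)) \<longlonglongrightarrow> ennreal ((cmod (h x - S n x))\<^sup>2)"
          by (intro tendsto_intros tendsto_ennrealI)
        then show ?case by (intro lim_imp_Liminf[symmetric]) auto
      qed
    qed
    also have "\<dots> \<le> liminf (\<lambda>j. \<integral>\<^sup>+x. ennreal ((cmod (S (r j) x - S n x))\<^sup>2) \<partial>M)"
      by (rule nn_integral_liminf) measurable
    also have "\<dots> \<le> liminf (\<lambda>j. ennreal (L * (R n + (1/4)^j)))"
    proof (rule Liminf_mono, rule always_eventually, rule allI)
      fix j
      have "(\<integral>\<^sup>+x. ennreal ((cmod (S (r j) x - S n x))\<^sup>2) \<partial>M) =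
          ennreal ((l2norm M (\<lambda>x. S (r j) x - S n x))\<^sup>2)"
        unfolding l2norm_sq
        by (rule nn_integral_eq_integral) (use sqintD(2)[OF sqint_diff[OF S S]] in auto)
      also have "\<dots> \<le> ennreal (L * (R n + R (r j)))"
        by (intro ennreal_leI diff)
      also have "\<dots> \<le> ennreal (L * (R n + (1/4)^j))"
        using r[of j] L by (intro ennreal_leI mult_left_mono) auto
      finally show "(\<integral>\<^sup>+x. ennreal ((cmod (S (r j) x - S n x))\<^sup>2) \<partial>M) \<le> ennreal (L * (R n + (1/4)^j))" .
    qed
    also have "\<dots> = ennreal (L * (R n + 0))"
      by (intro lim_imp_Liminf tendsto_ennrealI tendsto_intros LIMSEQ_realpow_zero) auto
    finally show ?thesis by simp
  qed
  have hSn: "(\<lambda>x. h x - S n x) \<in> sqint M" for n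
  proof (rule sqintI)
    show "integrable M (\<lambda>x. (cmod (h x - S n x))\<^sup>2)"
    proof (rule integrableI_bounded)
      have "(\<integral>\<^sup>+x. ennreal (norm ((cmod (h x - S n x))\<^sup>2)) \<partial>M) \<le> ennreal (L * R n)"
        using hS[of n] by simp
      then show "(\<integral>\<^sup>+x. ennreal (norm ((cmod (h x - S n x))\<^sup>2)) \<partial>M) < \<infinity>"
        using ennreal_less_top le_less_trans by (metis infinity_ennreal_def)
    qed measurable
  qed measurable
  have h: "h \<in> sqint M" using sqint_add[OF hSn[of 0] S[of 0]] by simp
  have hn: "(l2norm M (\<lambda>x. h x - S n x))\<^sup>2 \<le> L * R n" for n
  proof -
    have "ennreal ((l2norm M (\<lambda>x. h x - S n x))\<^sup>2) \<le> ennreal (L * R n)"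
      unfolding l2norm_sq using hS[of n]
      by (subst nn_integral_eq_integral[symmetric]) (use sqintD(2)[OF hSn] in auto)
    then show ?thesis using L R0 by (subst (asm) ennreal_le_iff) auto
  qed
  have "(\<lambda>n. l2norm M (\<lambda>x. h x - S n x)) \<longlonglongrightarrow> 0"
  proof (rule real_tendsto_sandwich[of "\<lambda>_. 0"])
    show "\<forall>\<^sub>F n in sequentially. l2norm M (\<lambda>x. h x - S n x) \<le> sqrt (L * R n)"
      using hn by (intro always_eventually allI real_le_rsqrt)
    show "(\<lambda>n. sqrt (L * R n)) \<longlonglongrightarrow> 0"
      using tendsto_real_sqrt[OF tendsto_mult[OF tendsto_const R_lim, of L]] by simp
  qed auto
  then show ?thesis using h unfolding S_def by blast
qed

lemma l2inner_limit:
  assumes "h \<in> sqint M" "\<And>n. S n \<in> sqint M" "g \<in> sqint M"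
    "(\<lambda>n. l2norm M (\<lambda>x. h x - S n x)) \<longlonglongrightarrow> 0"
  shows "(\<lambda>n. l2inner M (S n) g) \<longlonglongrightarrow> l2inner M h g"
proof -
  have "(\<lambda>n. l2inner M h g - l2inner M (S n) g) \<longlonglongrightarrow> 0"
  proof (rule Lim_null_comparison)
    show "\<forall>\<^sub>F n in sequentially. norm (l2inner M h g - l2inner M (S n) g)
        \<le> l2norm M (\<lambda>x. h x - S n x) * l2norm M g"
    proof (intro always_eventually allI)
      fix n
      show "norm (l2inner M h g - l2inner M (S n) g) \<le> l2norm M (\<lambda>x. h x - S n x) * l2norm M g"
        using l2inner_bound[OF sqint_diff[OF assms(1) assms(2)[of n]] assms(3)]
          l2inner_diff_left[OF assms(1) assms(2)[of n] assms(3)] by simp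
    qed
    show "(\<lambda>n. l2norm M (\<lambda>x. h x - S n x) * l2norm M g) \<longlonglongrightarrow> 0"
      using tendsto_mult[OF assms(4) tendsto_const, of "l2norm M g"] by simp
  qed
  from tendsto_diff[OF tendsto_const[of "l2inner M h g"] this] show ?thesis by simp
qed

lemma l2norm_limit:
  assumes "h \<in> sqint M" "\<And>n. S n \<in> sqint M"
    "(\<lambda>n. l2norm M (\<lambda>x. h x - S n x)) \<longlonglongrightarrow> 0"
  shows "(\<lambda>n. l2norm M (S n)) \<longlonglongrightarrow> l2norm M h"
proof -
  have "(\<lambda>n. l2norm M (S n) - l2norm M h) \<longlonglongrightarrow> 0"
  proof (rule Lim_null_comparison[OF _ assms(3)], intro always_eventually allI)
    fix n
    show "norm (l2norm M (S n) - l2norm M h) \<le> l2norm M (\<lambda>x. h x - S n x)"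
      using l2norm_reverse_triangle[OF assms(1) assms(2)[of n]] by simp
  qed
  then show ?thesis by (simp add: LIM_zero_iff)
qed

lemma orthogonal_series_l2inner:
  assumes e: "orthogonal_family M e L" and h: "h \<in> sqint M"
    and lim: "(\<lambda>n. l2norm M (\<lambda>x. h x - (\<Sum>k<n. c k * e k x))) \<longlonglongrightarrow> 0"
  shows "l2inner M h (e k) = of_real L * c k"
proof -
  have "(\<lambda>n. l2inner M (\<lambda>x. \<Sum>k<n. c k * e k x) (e k)) \<longlonglongrightarrow> l2inner M h (e k)"
    by (rule l2inner_limit[OF h orthogonal_family_sum_sqint[OF e] orthogonal_familyD(2)[OF e] lim])
  moreover have "(\<lambda>n. l2inner M (\<lambda>x. \<Sum>k<n. c k * e k x) (e k)) \<longlonglongrightarrow> of_real L * c k"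
  proof (rule tendsto_eventually)
    show "\<forall>\<^sub>F n in sequentially. l2inner M (\<lambda>x. \<Sum>k<n. c k * e k x) (e k) = of_real L * c k"
      using eventually_gt_at_top[of k]
      by eventually_elim (simp add: orthogonal_family_l2inner_sum[OF e])
  qed
  ultimately show ?thesis by (rule LIMSEQ_unique)
qed

lemma orthogonal_series_l2norm:
  assumes e: "orthogonal_family M e L" and h: "h \<in> sqint M"
    and lim: "(\<lambda>n. l2norm M (\<lambda>x. h x - (\<Sum>k<n. c k * e k x))) \<longlonglongrightarrow> 0"
  shows "(\<lambda>k. L * (cmod (c k))\<^sup>2) sums (l2norm M h)\<^sup>2"
proof -
  have "(\<lambda>n. (l2norm M (\<lambda>x. \<Sum>k<n. c k * e k x))\<^sup>2) \<longlonglongrightarrow> (l2norm M h)\<^sup>2"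
    by (intro tendsto_power l2norm_limit[OF h orthogonal_family_sum_sqint[OF e] lim])
  then show ?thesis
    by (simp add: sums_def orthogonal_family_l2norm_sum[OF e] sum_distrib_left)
qed

section \<open>Absolutely continuous functions on an interval\<close>

abbreviation ivl :: "real \<Rightarrow> real \<Rightarrow> real measure" where
  "ivl a b \<equiv> lebesgue_on {a<..<b}"

lemma finite_measure_ivl: "finite_measure (ivl a b)"
  by (rule finite_measure_lebesgue_on) simp

lemma measure_ivl: "a \<le> b \<Longrightarrow> measure (ivl a b) (space (ivl a b)) = b - a"
  by (simp add: measure_restrict_space)

lemma ivl_restrict:
  assumes "a \<le> c" "d \<le> b"
  shows "ivl c d = restrict_space (ivl a b) {c<..<d}"
proof -
  have "{a<..<b} \<inter> {c<..<d} = {c<..<d}" using assms by auto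
  then show ?thesis by (subst restrict_restrict_space) auto
qed

lemma sets_ivl_sub: "{c<..<d} \<inter> space (ivl a b) \<in> sets (ivl a b)"
  by (auto simp: sets_restrict_space)

lemma integrable_ivl_sub:
  fixes f :: "real \<Rightarrow> 'b::{banach, second_countable_topology}"
  assumes "integrable (ivl a b) f" "a \<le> c" "d \<le> b"
  shows "integrable (ivl c d) f"
  unfolding ivl_restrict[OF assms(2,3)]
  by (subst integrable_restrict_space[OF sets_ivl_sub])
     (rule integrable_mult_indicator[of _ _ f],
      use assms sets_ivl_sub[of c d a b] in \<open>auto simp: sets_restrict_space\<close>)

lemma integral_ivl_sub:
  fixes f :: "real \<Rightarrow> 'b::{banach, second_countable_topology}"
  assumes "a \<le> c" "d \<le> b"
  shows "(LINT x|ivl c d. f x) = (LINT x|ivl a b. indicator {c<..<d} x *\<^sub>R f x)"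
  unfolding ivl_restrict[OF assms] by (rule integral_restrict_space[OF sets_ivl_sub])

lemma integrable_ivl_sub_iff:
  fixes f :: "real \<Rightarrow> 'b::{banach, second_countable_topology}"
  assumes "a \<le> c" "d \<le> b"
  shows "integrable (ivl c d) f \<longleftrightarrow> integrable (ivl a b) (\<lambda>x. indicator {c<..<d} x *\<^sub>R f x)"
  unfolding ivl_restrict[OF assms] by (rule integrable_restrict_space[OF sets_ivl_sub])

lemma measurable_ivl_sub:
  assumes "f \<in> borel_measurable (ivl a b)" "a \<le> c" "d \<le> b"
  shows "f \<in> borel_measurable (ivl c d)"
  unfolding ivl_restrict[OF assms(2,3)] by (rule measurable_restrict_space1[OF assms(1)])

lemma measurable_ivl_sub_iff:
  fixes f :: "real \<Rightarrow> complex"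
  assumes "a \<le> c" "d \<le> b"
  shows "f \<in> borel_measurable (ivl c d) \<longleftrightarrow>
    (\<lambda>x. indicator {c<..<d} x *\<^sub>R f x) \<in> borel_measurable (ivl a b)"
  unfolding ivl_restrict[OF assms] by (rule borel_measurable_restrict_space_iff[OF sets_ivl_sub])

lemma AE_ivl_sub:
  assumes "AE x in ivl a b. P x" "a \<le> c" "d \<le> b"
  shows "AE x in ivl c d. P x"
  unfolding ivl_restrict[OF assms(2,3)]
  using assms(1) by (subst AE_restrict_space_iff[OF sets_ivl_sub]) auto

lemma AE_ivl_iff: "(AE x in ivl a b. P x) \<longleftrightarrow> (AE x in lebesgue. x \<in> {a<..<b} \<longrightarrow> P x)"
  by (subst AE_restrict_space_iff) auto

lemma sqint_ivl_sub:
  assumes "f \<in> sqint (ivl a b)" "a \<le> c" "d \<le> b"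
  shows "f \<in> sqint (ivl c d)"
  by (rule sqintI[OF measurable_ivl_sub[OF sqintD(1)[OF assms(1)] assms(2,3)]
        integrable_ivl_sub[OF sqintD(2)[OF assms(1)] assms(2,3)]])

lemma integral_ivl_mono:
  fixes f :: "real \<Rightarrow> real"
  assumes "integrable (ivl a b) f" "a \<le> c" "d \<le> b" "\<And>x. 0 \<le> f x"
  shows "(LINT x|ivl c d. f x) \<le> (LINT x|ivl a b. f x)"
proof -
  have "integrable (ivl a b) (\<lambda>x. indicator {c<..<d} x *\<^sub>R f x)"
    using integrable_ivl_sub[OF assms(1-3)] integrable_ivl_sub_iff[OF assms(2,3)] by blast
  then show ?thesis unfolding integral_ivl_sub[OF assms(2,3)]
    by (intro integral_mono[OF _ assms(1)]) (use assms(4) in \<open>auto simp: indicator_def\<close>)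
qed

lemma l2norm_ivl_sub:
  assumes "f \<in> sqint (ivl a b)" "a \<le> c" "d \<le> b"
  shows "l2norm (ivl c d) f \<le> l2norm (ivl a b) f"
  unfolding l2norm_def
  by (rule real_sqrt_le_mono[OF integral_ivl_mono[OF sqintD(2)[OF assms(1)] assms(2,3)]]) simp

lemma AE_ivl_neq: "AE x in ivl a b. x \<noteq> c"
  unfolding AE_ivl_iff
proof -
  have "AE x in lebesgue. x \<noteq> c"
    by (rule AE_I'[of "{c}"]) auto
  then show "AE x in lebesgue. x \<in> {a<..<b} \<longrightarrow> x \<noteq> c" by eventually_elim simp
qed

lemma integral_ivl_split:
  fixes f :: "real \<Rightarrow> 'b::{banach, second_countable_topology}"
  assumes "integrable (ivl a b) f" "a \<le> c" "c \<le> b"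
  shows "(LINT x|ivl a b. f x) = (LINT x|ivl a c. f x) + (LINT x|ivl c b. f x)"
proof -
  have i: "integrable (ivl a b) (\<lambda>x. indicator {a<..<c} x *\<^sub>R f x)"
    "integrable (ivl a b) (\<lambda>x. indicator {c<..<b} x *\<^sub>R f x)"
    using integrable_ivl_sub[OF assms(1)] integrable_ivl_sub_iff[of a _ _ b f] assms by auto
  have "(LINT x|ivl a b. f x) =
      (LINT x|ivl a b. indicator {a<..<c} x *\<^sub>R f x + indicator {c<..<b} x *\<^sub>R f x)"
  proof (rule integral_cong_AE)
    show "AE x in ivl a b. f x = indicator {a<..<c} x *\<^sub>R f x + indicator {c<..<b} x *\<^sub>R f x"
      using AE_ivl_neq[of c a b] AE_space[of "ivl a b"]
      by eventually_elim (auto simp: indicator_def)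
  qed (use i assms(1) in \<open>auto intro!: borel_measurable_add borel_measurable_integrable\<close>)
  then show ?thesis
    using i assms by (simp add: integral_ivl_sub[of a a c b] integral_ivl_sub[of a c b b])
qed

lemma continuous_on_ivl_measurable:
  fixes f :: "real \<Rightarrow> complex"
  assumes "continuous_on {a..b} f" shows "f \<in> borel_measurable (ivl a b)"
  by (rule continuous_imp_measurable_on_sets_lebesgue)
     (auto intro: continuous_on_subset[OF assms])

lemma integrable_ivl_integrable_on:
  fixes h :: "real \<Rightarrow> complex"
  assumes "integrable (ivl a b) h" shows "h integrable_on {a..b}"
  using integrable_on_lebesgue_on[OF assms] by (simp add: integrable_on_Icc_iff_Ioo)

lemma integral_ivl_HK:
  fixes h :: "real \<Rightarrow> complex"
  assumes "integrable (ivl a b) h" shows "(LINT x|ivl a b. h x) = integral {a..b} h"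
  using lebesgue_integral_eq_integral[OF assms] by (simp add: integral_open_interval_real)

lemma continuous_on_ivl_bounded:
  fixes f :: "real \<Rightarrow> complex"
  assumes "continuous_on {a..b} f"
  obtains B where "\<And>x. x \<in> {a..b} \<Longrightarrow> cmod (f x) \<le> B" "0 \<le> B"
proof -
  have "bounded (f ` {a..b})"
    by (intro compact_imp_bounded compact_continuous_image assms) auto
  then obtain B where "\<forall>x\<in>{a..b}. cmod (f x) \<le> B" unfolding bounded_iff by auto
  then have "cmod (f x) \<le> \<bar>B\<bar>" if "x \<in> {a..b}" for x using that by fastforce
  then show ?thesis using that[of "\<bar>B\<bar>"] by simp
qed

lemma continuous_on_ivl_sqint:
  fixes f :: "real \<Rightarrow> complex"
  assumes "continuous_on {a..b} f" shows "f \<in> sqint (ivl a b)"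
proof -
  interpret finite_measure "ivl a b" by (rule finite_measure_ivl)
  obtain B where B: "\<And>x. x \<in> {a..b} \<Longrightarrow> cmod (f x) \<le> B"
    using continuous_on_ivl_bounded[OF assms] by blast
  show ?thesis
    by (rule sqint_bounded[OF continuous_on_ivl_measurable[OF assms], of B])
       (use AE_space in eventually_elim, use B in auto)
qed

lemma integrable_ivl_mult_continuous:
  fixes h f :: "real \<Rightarrow> complex"
  assumes "integrable (ivl a b) h" "continuous_on {a..b} f"
  shows "integrable (ivl a b) (\<lambda>x. h x * f x)"
proof -
  obtain B where B: "\<And>x. x \<in> {a..b} \<Longrightarrow> cmod (f x) \<le> B" "0 \<le> B"
    using continuous_on_ivl_bounded[OF assms(2)] by blast
  have "integrable (ivl a b) (\<lambda>x. of_real B * h x)" using assms(1) by simp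
  then show ?thesis
  proof (rule Bochner_Integration.integrable_bound)
    show "(\<lambda>x. h x * f x) \<in> borel_measurable (ivl a b)"
      using continuous_on_ivl_measurable[OF assms(2)] assms(1) by measurable
    show "AE x in ivl a b. norm (h x * f x) \<le> norm (of_real B * h x)"
      using AE_space
    proof eventually_elim
      case (elim x)
      then have "cmod (f x) \<le> B" using B by auto
      then show ?case using B(2) by (simp add: norm_mult mult.commute mult_right_mono)
    qed
  qed
qed

section \<open>Primitives of integrable functions and integration by parts\<close>

text \<open>Absolute continuity is stated as being a primitive of \<open>h\<close>, so that
  differentiation almost everywhere never enters. The identity holds at every point of the closed
  interval, hence the end point values of \<open>G\<close> are meaningful.\<close>

definition abs_cont :: "real \<Rightarrow> real \<Rightarrow> cfun \<Rightarrow> cfun \<Rightarrow> bool" where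
  "abs_cont a b G h \<longleftrightarrow> integrable (ivl a b) h \<and> (\<forall>x\<in>{a..b}. G x = G a + (LINT y|ivl a x. h y))"

lemma abs_cont_integrable: "abs_cont a b G h \<Longrightarrow> integrable (ivl a b) h"
  by (simp add: abs_cont_def)

lemma abs_cont_eq: "abs_cont a b G h \<Longrightarrow> x \<in> {a..b} \<Longrightarrow> G x = G a + (LINT y|ivl a x. h y)"
  unfolding abs_cont_def by blast

lemma abs_cont_continuous:
  assumes "abs_cont a b G h" shows "continuous_on {a..b} G"
proof -
  have "continuous_on {a..b} (\<lambda>x. G a + integral {a..x} h)"
    by (intro continuous_intros indefinite_integral_continuous_1 integrable_ivl_integrable_on
        abs_cont_integrable[OF assms])
  then show ?thesis
  proof (rule continuous_on_eq)
    fix x assume x: "x \<in> {a..b}"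
    show "G a + integral {a..x} h = G x"
      using x abs_cont_eq[OF assms x]
        integral_ivl_HK[OF integrable_ivl_sub[OF abs_cont_integrable[OF assms], of a x]] by auto
  qed
qed

lemma abs_cont_primitive:
  assumes "integrable (ivl a b) h" "\<And>x. x \<in> {a..b} \<Longrightarrow> G x = c + (LINT y|ivl a x. h y)"
  shows "abs_cont a b G h"
  using assms by (cases "a \<le> b") (auto simp: abs_cont_def)

lemma abs_cont_smooth:
  assumes "\<And>x. x \<in> {a..b} \<Longrightarrow> (G has_vector_derivative h x) (at x within {a..b})"
    "continuous_on {a..b} h"
  shows "abs_cont a b G h"
  unfolding abs_cont_def
proof (intro conjI ballI)
  interpret finite_measure "ivl a b" by (rule finite_measure_ivl)
  show i: "integrable (ivl a b) h" using sqint_integrable continuous_on_ivl_sqint assms(2) by blast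
  fix x assume x: "x \<in> {a..b}"
  have "(h has_integral (G x - G a)) {a..x}"
    using x by (intro fundamental_theorem_of_calculus)
      (auto intro: has_vector_derivative_within_subset[OF assms(1)])
  then have "integral {a..x} h = G x - G a" by (rule integral_unique)
  then show "G x = G a + (LINT y|ivl a x. h y)"
    using integral_ivl_HK[OF integrable_ivl_sub[OF i, of a x]] x by auto
qed

text \<open>Fubini on the triangle \<open>z < y\<close> and its complement; the diagonal is a null set.\<close>

lemma ivl_triangle_integral:
  fixes h k :: cfun
  assumes h: "integrable (ivl a x) h" and k: "integrable (ivl a x) k"
  shows "(LINT y|ivl a x. h y * (LINT z|ivl a y. k z)) + (LINT z|ivl a x. (LINT y|ivl a z. h y) * k z)
    = (LINT y|ivl a x. h y) * (LINT z|ivl a x. k z)"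
    "integrable (ivl a x) (\<lambda>y. h y * (LINT z|ivl a y. k z))"
    "integrable (ivl a x) (\<lambda>z. (LINT y|ivl a z. h y) * k z)"
proof -
  let ?M = "ivl a x"
  interpret finite_measure ?M by (rule finite_measure_ivl)
  interpret P: pair_sigma_finite ?M ?M ..
  have m [measurable]: "h \<in> borel_measurable ?M" "k \<in> borel_measurable ?M"
    using h k by auto
  have [measurable]: "(\<lambda>x. x) \<in> borel_measurable ?M"
    using id_borel_measurable_lebesgue_on[of "{a<..<x}"] by (simp add: id_def)
  define f where "f y z = h y * k z" for y z
  define f1 where "f1 y z = indicator {z. z < y} z *\<^sub>R f y z" for y z :: real
  define f2 where "f2 y z = indicator {z. \<not> z < y} z *\<^sub>R f y z" for y z :: real
  have int: "integrable (?M \<Otimes>\<^sub>M ?M) (case_prod f)"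
  proof (rule P.Fubini_integrable)
    show "case_prod f \<in> borel_measurable (?M \<Otimes>\<^sub>M ?M)" unfolding f_def by measurable
    show "integrable ?M (\<lambda>y. LINT z|?M. norm (case_prod f (y, z)))"
      using h unfolding f_def by (simp add: norm_mult)
    show "AE y in ?M. integrable ?M (\<lambda>z. case_prod f (y, z))"
      using k unfolding f_def by auto
  qed
  have meas: "case_prod f1 \<in> borel_measurable (?M \<Otimes>\<^sub>M ?M)" "case_prod f2 \<in> borel_measurable (?M \<Otimes>\<^sub>M ?M)"
    unfolding f1_def f2_def f_def indicator_def by measurable
  have int1: "integrable (?M \<Otimes>\<^sub>M ?M) (case_prod f1)"
    by (rule Bochner_Integration.integrable_bound[OF int meas(1)])
       (auto simp: f1_def indicator_def)
  have int2: "integrable (?M \<Otimes>\<^sub>M ?M) (case_prod f2)"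
    by (rule Bochner_Integration.integrable_bound[OF int meas(2)])
       (auto simp: f2_def indicator_def)
  have e1: "(LINT z|?M. f1 y z) = h y * (LINT z|ivl a y. k z)" if y: "y \<in> {a<..<x}" for y
  proof -
    have "(LINT z|?M. f1 y z) = (LINT z|?M. h y * (indicator {a<..<y} z *\<^sub>R k z))"
      by (rule Bochner_Integration.integral_cong) (auto simp: f1_def f_def indicator_def)
    also have "\<dots> = h y * (LINT z|?M. indicator {a<..<y} z *\<^sub>R k z)"
      by (rule integral_mult_right_zero)
    also have "(LINT z|?M. indicator {a<..<y} z *\<^sub>R k z) = (LINT z|ivl a y. k z)"
      using y by (intro integral_ivl_sub[symmetric]) auto
    finally show ?thesis .
  qed
  have e2: "(LINT y|?M. f2 y z) = (LINT y|ivl a z. h y) * k z" if z: "z \<in> {a<..<x}" for z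
  proof -
    have "(LINT y|?M. f2 y z) = (LINT y|?M. (indicator {a<..<z} y *\<^sub>R h y) * k z)"
    proof (rule integral_cong_AE)
      show "AE y in ?M. f2 y z = (indicator {a<..<z} y *\<^sub>R h y) * k z"
        using AE_ivl_neq[of z a x] AE_space
        by eventually_elim (auto simp: f2_def f_def indicator_def)
    qed (auto simp: f2_def f_def indicator_def)
    also have "\<dots> = (LINT y|?M. indicator {a<..<z} y *\<^sub>R h y) * k z"
      by (rule integral_mult_left_zero)
    also have "(LINT y|?M. indicator {a<..<z} y *\<^sub>R h y) = (LINT y|ivl a z. h y)"
      using z by (intro integral_ivl_sub[symmetric]) auto
    finally show ?thesis .
  qed
  have I1: "(LINT y|?M. h y * (LINT z|ivl a y. k z)) = (LINT y|?M. LINT z|?M. f1 y z)"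
    by (rule Bochner_Integration.integral_cong) (auto simp: e1)
  have "(LINT z|?M. (LINT y|ivl a z. h y) * k z) = (LINT z|?M. LINT y|?M. f2 y z)"
    by (rule Bochner_Integration.integral_cong) (auto simp: e2)
  also have "\<dots> = (LINT y|?M. LINT z|?M. f2 y z)"
    by (rule P.Fubini_integral[OF int2])
  finally have I2: "(LINT z|?M. (LINT y|ivl a z. h y) * k z) = (LINT y|?M. LINT z|?M. f2 y z)" .
  have J1: "integrable ?M (\<lambda>y. LINT z|?M. f1 y z)" "integrable ?M (\<lambda>y. LINT z|?M. f2 y z)"
    using P.integrable_fst[OF int1] P.integrable_fst[OF int2] by auto
  have J2: "integrable ?M (\<lambda>z. LINT y|?M. f2 y z)"
    using P.integrable_snd[OF int2] by auto
  show "integrable ?M (\<lambda>y. h y * (LINT z|ivl a y. k z))"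
    by (rule Bochner_Integration.integrable_cong[THEN iffD1, OF refl _ J1(1)]) (auto simp: e1)
  show "integrable ?M (\<lambda>z. (LINT y|ivl a z. h y) * k z)"
    by (rule Bochner_Integration.integrable_cong[THEN iffD1, OF refl _ J2]) (auto simp: e2)
  have "(LINT y|?M. LINT z|?M. f1 y z) + (LINT y|?M. LINT z|?M. f2 y z) =
      (LINT y|?M. (LINT z|?M. f1 y z) + (LINT z|?M. f2 y z))"
    by (rule Bochner_Integration.integral_add[symmetric, OF J1])
  also have "\<dots> = (LINT y|?M. h y * (LINT z|?M. k z))"
  proof (rule Bochner_Integration.integral_cong[OF refl])
    fix y
    have ky: "integrable ?M (\<lambda>z. h y * k z)" using k by simp
    have "integrable ?M (\<lambda>z. f1 y z)"
      unfolding f1_def f_def indicator_def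
      by (rule Bochner_Integration.integrable_bound[OF ky]) auto
    moreover have "integrable ?M (\<lambda>z. f2 y z)"
      unfolding f2_def f_def indicator_def
      by (rule Bochner_Integration.integrable_bound[OF ky]) auto
    ultimately have "(LINT z|?M. f1 y z) + (LINT z|?M. f2 y z) = (LINT z|?M. f1 y z + f2 y z)"
      by simp
    also have "\<dots> = (LINT z|?M. h y * k z)"
      by (rule Bochner_Integration.integral_cong) (auto simp: f1_def f2_def f_def indicator_def)
    finally show "(LINT z|?M. f1 y z) + (LINT z|?M. f2 y z) = h y * (LINT z|?M. k z)" by simp
  qed
  finally show "(LINT y|ivl a x. h y * (LINT z|ivl a y. k z)) + (LINT z|ivl a x. (LINT y|ivl a z. h y) * k z)
    = (LINT y|ivl a x. h y) * (LINT z|ivl a x. k z)"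
    by (simp add: I1 I2)
qed

text \<open>Writing both factors as initial value plus integral, the product of the two integrals
  splits into the two iterated integrals over the triangle and its complement.\<close>

lemma abs_cont_mult:
  assumes G: "abs_cont a b G h" and K: "abs_cont a b K k"
  shows "abs_cont a b (\<lambda>x. G x * K x) (\<lambda>x. h x * K x + G x * k x)"
  unfolding abs_cont_def
proof (intro conjI ballI)
  have i: "integrable (ivl a b) (\<lambda>x. h x * K x)" "integrable (ivl a b) (\<lambda>x. G x * k x)"
    using integrable_ivl_mult_continuous[OF abs_cont_integrable[OF G] abs_cont_continuous[OF K]]
      integrable_ivl_mult_continuous[OF abs_cont_integrable[OF K] abs_cont_continuous[OF G]]
    by (auto simp: mult.commute)
  then show "integrable (ivl a b) (\<lambda>x. h x * K x + G x * k x)" by simp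
  fix x assume x: "x \<in> {a..b}"
  have h: "integrable (ivl a x) h" and k: "integrable (ivl a x) k"
    using integrable_ivl_sub[of a b _ a x] abs_cont_integrable[OF G] abs_cont_integrable[OF K] x by auto
  note T = ivl_triangle_integral[OF h k]
  have ix: "integrable (ivl a x) (\<lambda>x. h x * K x)" "integrable (ivl a x) (\<lambda>x. G x * k x)"
    using integrable_ivl_sub[of a b _ a x] i x by auto
  have "(LINT y|ivl a x. h y * K y) = (LINT y|ivl a x. h y * K a + h y * (LINT z|ivl a y. k z))"
  proof (rule Bochner_Integration.integral_cong[OF refl])
    fix y assume "y \<in> space (ivl a x)"
    then have "K y = K a + (LINT z|ivl a y. k z)" using x by (intro abs_cont_eq[OF K]) auto
    then show "h y * K y = h y * K a + h y * (LINT z|ivl a y. k z)"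
      by (simp only: distrib_left)
  qed
  also have "\<dots> = (LINT y|ivl a x. h y) * K a + (LINT y|ivl a x. h y * (LINT z|ivl a y. k z))"
    using T(2) h by simp
  finally have 1: "(LINT y|ivl a x. h y * K y) =
      (LINT y|ivl a x. h y) * K a + (LINT y|ivl a x. h y * (LINT z|ivl a y. k z))" .
  have "(LINT y|ivl a x. G y * k y) = (LINT y|ivl a x. G a * k y + (LINT z|ivl a y. h z) * k y)"
  proof (rule Bochner_Integration.integral_cong[OF refl])
    fix y assume "y \<in> space (ivl a x)"
    then have "G y = G a + (LINT z|ivl a y. h z)" using x by (intro abs_cont_eq[OF G]) auto
    then show "G y * k y = G a * k y + (LINT z|ivl a y. h z) * k y"
      by (simp only: distrib_right)
  qed
  also have "\<dots> = G a * (LINT y|ivl a x. k y) + (LINT y|ivl a x. (LINT z|ivl a y. h z) * k y)"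
    using T(3) k by simp
  finally have 2: "(LINT y|ivl a x. G y * k y) =
      G a * (LINT y|ivl a x. k y) + (LINT y|ivl a x. (LINT z|ivl a y. h z) * k y)" .
  have "G x * K x = (G a + (LINT y|ivl a x. h y)) * (K a + (LINT y|ivl a x. k y))"
    using abs_cont_eq[OF G x] abs_cont_eq[OF K x] by simp
  also have "\<dots> = G a * K a + ((LINT y|ivl a x. h y * K y) + (LINT y|ivl a x. G y * k y))"
    unfolding 1 2 using T(1) by (simp add: algebra_simps)
  finally show "G x * K x = G a * K a + (LINT y|ivl a x. h y * K y + G y * k y)"
    using ix by simp
qed

lemma abs_cont_integration_by_parts:
  assumes "abs_cont a b G h" "abs_cont a b K k" "a \<le> b"
  shows "(LINT x|ivl a b. h x * K x) + (LINT x|ivl a b. G x * k x) = G b * K b - G a * K a"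
    "integrable (ivl a b) (\<lambda>x. h x * K x)" "integrable (ivl a b) (\<lambda>x. G x * k x)"
proof -
  show i: "integrable (ivl a b) (\<lambda>x. h x * K x)" "integrable (ivl a b) (\<lambda>x. G x * k x)"
    using integrable_ivl_mult_continuous[OF abs_cont_integrable[OF assms(1)] abs_cont_continuous[OF assms(2)]]
      integrable_ivl_mult_continuous[OF abs_cont_integrable[OF assms(2)] abs_cont_continuous[OF assms(1)]]
    by (auto simp: mult.commute)
  show "(LINT x|ivl a b. h x * K x) + (LINT x|ivl a b. G x * k x) = G b * K b - G a * K a"
    using abs_cont_eq[OF abs_cont_mult[OF assms(1,2)], of b] assms(3) i by simp
qed

section \<open>The fundamental lemma and weak derivatives\<close>

text \<open>Zero integrals over subintervals extend to all Borel sets by induction on their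
  generation, then to Lebesgue sets, and a function whose integral vanishes over every measurable
  set is zero almost everywhere.\<close>

lemma AE_zero_if_integrals_zero:
  fixes w :: cfun
  assumes w: "integrable (ivl a b) w"
    and zero: "\<And>p q. a \<le> p \<Longrightarrow> p < q \<Longrightarrow> q \<le> b \<Longrightarrow> (LINT x|ivl p q. w x) = 0"
  shows "AE x in ivl a b. w x = 0"
proof -
  let ?M = "ivl a b"
  interpret finite_measure ?M by (rule finite_measure_ivl)
  have ind [measurable]: "B \<inter> space ?M \<in> sets ?M" if "B \<in> sets borel" for B :: "real set"
    using that by (auto simp: sets_restrict_space)
  have int: "integrable ?M (\<lambda>x. indicat_real B x *\<^sub>R w x)" if "B \<in> sets borel" for B
  proof -
    have "integrable ?M (\<lambda>x. indicat_real (B \<inter> space ?M) x *\<^sub>R w x)"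
      by (rule integrable_mult_indicator[OF ind[OF that] w])
    then show ?thesis
      by (rule Bochner_Integration.integrable_cong[THEN iffD1, OF refl, rotated])
         (auto simp: indicator_def)
  qed
  have whole: "(LINT x|?M. w x) = 0"
  proof (cases "a < b")
    case False
    then have "{a<..<b} = {}" by auto
    then show ?thesis by simp
  qed (use zero in simp)
  have borel: "(LINT x|?M. indicat_real B x *\<^sub>R w x) = 0" if "B \<in> sets borel" for B
    using that
  proof (induction rule: borel_set_induct)
    case (interval c d)
    define p where "p = max a c"
    define q where "q = min b d"
    show ?case
    proof (cases "p < q")
      case True
      have "(LINT x|?M. indicat_real {c..d} x *\<^sub>R w x) = (LINT x|?M. indicat_real {p<..<q} x *\<^sub>R w x)"
      proof (rule integral_cong_AE)
        show "AE x in ?M. indicat_real {c..d} x *\<^sub>R w x = indicat_real {p<..<q} x *\<^sub>R w x"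
          using AE_ivl_neq[of c a b] AE_ivl_neq[of d a b] AE_space
          by eventually_elim (auto simp: indicator_def p_def q_def)
      qed (use int[of "{c..d}"] int[of "{p<..<q}"] in auto)
      also have "\<dots> = (LINT x|ivl p q. w x)"
        by (rule integral_ivl_sub[symmetric]) (auto simp: p_def q_def)
      also have "\<dots> = 0" by (rule zero) (use True in \<open>auto simp: p_def q_def\<close>)
      finally show ?thesis .
    next
      case False
      have "AE x in ?M. indicat_real {c..d} x *\<^sub>R w x = 0"
        using AE_ivl_neq[of c a b] AE_ivl_neq[of d a b] AE_space
      proof eventually_elim
        case (elim x)
        then show ?case using False by (auto simp: indicator_def p_def q_def)
      qed
      then show ?thesis by (rule integral_eq_zero_AE)
    qed
  next
    case (compl B)
    have "(LINT x|?M. indicat_real (- B) x *\<^sub>R w x) = (LINT x|?M. w x - indicat_real B x *\<^sub>R w x)"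
      by (rule Bochner_Integration.integral_cong) (auto simp: indicator_def)
    also have "\<dots> = 0" using int[OF compl(1)] w compl(2) whole by simp
    finally show ?case .
  next
    case (union f)
    have fb: "f i \<in> sets borel" for i using union(2) .
    have U: "(\<Union>i. f i) \<in> sets borel" using fb by auto
    have "(LINT x:(\<Union>i. f i \<inter> space ?M)|?M. w x) = (\<Sum>i. (LINT x:(f i \<inter> space ?M)|?M. w x))"
    proof (rule lebesgue_integral_countable_add)
      show "f i \<inter> space ?M \<inter> (f j \<inter> space ?M) = {}" if "i \<noteq> j" for i j
        using union(1) that by (auto simp: disjoint_family_on_def)
      have "(\<Union>i. f i \<inter> space ?M) = (\<Union>i. f i) \<inter> space ?M" by auto
      then show "set_integrable ?M (\<Union>i. f i \<inter> space ?M) w"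
        unfolding set_integrable_def
        using integrable_mult_indicator[OF ind[OF U] w] by simp
    qed (use ind fb in auto)
    moreover have "(LINT x:(B \<inter> space ?M)|?M. w x) = (LINT x|?M. indicat_real B x *\<^sub>R w x)" for B
      unfolding set_lebesgue_integral_def
      by (rule Bochner_Integration.integral_cong) (auto simp: indicator_def)
    moreover have "(\<Union>i. f i \<inter> space ?M) = (\<Union>i. f i) \<inter> space ?M" by auto
    ultimately show ?case using union(3) by simp
  qed simp
  have sets: "set_lebesgue_integral ?M A w = 0" if A: "A \<in> sets ?M" for A
  proof -
    from A have "A \<in> sets lebesgue" by (auto simp: sets_restrict_space)
    \<comment> \<open>A Lebesgue set is a Borel set up to a subset of a null set, so the Borel case
      carries over.\<close>
    then obtain B N N' where B: "A = B \<union> N" "N \<subseteq> N'" "N' \<in> null_sets lborel" "B \<in> sets lborel"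
      by (rule sets_completionE)
    have "AE x in lebesgue. x \<notin> N'"
      by (rule AE_not_in) (use B(3) null_sets_completionI in blast)
    then have N: "AE x in ?M. x \<notin> N'" unfolding AE_ivl_iff by eventually_elim simp
    have "set_lebesgue_integral ?M A w = (LINT x|?M. indicat_real B x *\<^sub>R w x)"
      unfolding set_lebesgue_integral_def
    proof (rule integral_cong_AE)
      show "AE x in ?M. indicat_real A x *\<^sub>R w x = indicat_real B x *\<^sub>R w x"
        using N by eventually_elim (use B in \<open>auto simp: indicator_def\<close>)
    qed (use int[of B] B(4) integrable_mult_indicator[OF A w] in
        \<open>simp_all add: borel_measurable_integrable\<close>)
    then show ?thesis using borel[of B] B(4) by simp
  qed
  show ?thesis by (rule density_zero[OF w sets])
qed

section \<open>Test functions that approximate indicators\<close>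

lemma has_real_derivative_max_0_squared:
  "((\<lambda>t. (max 0 t)\<^sup>2) has_real_derivative 2 * max 0 t) (at t)"
proof -
  consider "t < 0" | "t = 0" | "t > 0" by linarith
  then show ?thesis
  proof cases
    case 1
    have "((\<lambda>t. 0) has_real_derivative 0) (at t)" by simp
    then have "((\<lambda>t. (max 0 t)\<^sup>2) has_real_derivative 0) (at t)"
      by (rule has_field_derivative_transform_within_open[of _ _ _ "{..<0}"]) (use 1 in auto)
    then show ?thesis using 1 by simp
  next
    case 2
    have "((\<lambda>h. ((max 0 (0 + h))\<^sup>2 - (max 0 0)\<^sup>2) / h) \<longlongrightarrow> 0) (at (0::real))"
    proof (rule Lim_null_comparison)
      show "\<forall>\<^sub>F h in at (0::real). norm (((max 0 (0 + h))\<^sup>2 - (max 0 0)\<^sup>2) / h) \<le> \<bar>h\<bar>"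
        by (intro always_eventually allI) (auto simp: max_def power2_eq_square)
      show "((\<lambda>h. \<bar>h\<bar>) \<longlongrightarrow> 0) (at (0::real))" by (intro tendsto_rabs_zero tendsto_ident_at)
    qed
    then show ?thesis using 2 by (simp add: DERIV_def)
  next
    case 3
    have "((\<lambda>t. t\<^sup>2) has_real_derivative 2 * t) (at t)" by (auto intro!: derivative_eq_intros)
    then have "((\<lambda>t. (max 0 t)\<^sup>2) has_real_derivative 2 * t) (at t)"
      by (rule has_field_derivative_transform_within_open[of _ _ _ "{0<..}"]) (use 3 in auto)
    then show ?thesis using 3 by simp
  qed
qed

text \<open>Only one continuous derivative is required of a test function, so a rational cutoff will
  do: the squared positive part of the parabola \<open>(x - p) * (q - x)\<close> is continuously
  differentiable, and \<open>s \<mapsto> n * s / (1 + n * s)\<close> saturates it towards 1 on the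
  open interval as \<open>n\<close> grows.\<close>

definition bump :: "real \<Rightarrow> real \<Rightarrow> nat \<Rightarrow> real \<Rightarrow> real" where
  "bump p q n x = real n * (max 0 ((x - p) * (q - x)))\<^sup>2 / (1 + real n * (max 0 ((x - p) * (q - x)))\<^sup>2)"

lemma bump_range: "0 \<le> bump p q n x" "bump p q n x \<le> 1"
proof -
  have *: "0 \<le> s / (1 + s) \<and> s / (1 + s) \<le> 1" if "0 \<le> s" for s :: real
    using that by (auto simp: divide_le_eq)
  have "0 \<le> real n * (max 0 ((x - p) * (q - x)))\<^sup>2" by simp
  from *[OF this] show "0 \<le> bump p q n x" "bump p q n x \<le> 1" unfolding bump_def by auto
qed

lemma bump_support: "bump p q n x \<noteq> 0 \<Longrightarrow> p < q \<Longrightarrow> x \<in> {p..q}"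
  by (auto simp: bump_def max_def zero_le_mult_iff split: if_splits)

lemma test_funI:
  assumes "\<And>x. (\<phi> has_real_derivative \<phi>' x) (at x)" "continuous_on UNIV \<phi>'"
    "\<And>x. \<phi> x \<noteq> 0 \<Longrightarrow> x \<in> {p..q}" "a < p" "q < b"
  shows "test_fun a b \<phi> \<phi>'"
proof -
  have "closure {x. \<phi> x \<noteq> 0} \<subseteq> {p..q}"
    using assms(3) by (intro closure_minimal) auto
  moreover from this have "compact (closure {x. \<phi> x \<noteq> 0})"
    by (meson bounded_closed_interval bounded_subset closed_closure compact_eq_bounded_closed)
  ultimately show ?thesis using assms by (force simp: test_fun_def)
qed

lemma test_fun_bump:
  assumes "a < p" "p < q" "q < b"
  shows "\<exists>\<phi>'. test_fun a b (bump p q n) \<phi>'"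
proof -
  define s where "s x = (max 0 ((x - p) * (q - x)))\<^sup>2" for x
  define s' where "s' x = 2 * max 0 ((x - p) * (q - x)) * ((q - x) - (x - p))" for x
  have s: "(s has_real_derivative s' x) (at x)" for x
  proof -
    have "((\<lambda>x. (x - p) * (q - x)) has_real_derivative ((q - x) - (x - p))) (at x)"
      by (auto intro!: derivative_eq_intros)
    from DERIV_chain2[OF has_real_derivative_max_0_squared this]
    show ?thesis unfolding s_def s'_def .
  qed
  have s0: "0 \<le> s x" for x by (simp add: s_def)
  then have pos: "1 + real n * s x \<noteq> 0" for x
    by (metis add_nonneg_eq_0_iff mult_nonneg_nonneg of_nat_0_le_iff zero_le_one zero_neq_one)
  define \<phi>' where "\<phi>' x = real n * s' x / (1 + real n * s x)\<^sup>2" for x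
  have "test_fun a b (bump p q n) \<phi>'"
  proof (rule test_funI[of _ _ p q])
    fix x
    have "((\<lambda>x. real n * s x / (1 + real n * s x)) has_real_derivative \<phi>' x) (at x)"
      unfolding \<phi>'_def using pos[of x]
      by (auto intro!: derivative_eq_intros s simp: field_simps power2_eq_square)
    then show "(bump p q n has_real_derivative \<phi>' x) (at x)"
      by (simp add: bump_def[abs_def] s_def)
  next
    have "continuous_on UNIV s" "continuous_on UNIV s'"
      unfolding s_def s'_def by (intro continuous_intros)+
    then show "continuous_on UNIV \<phi>'" unfolding \<phi>'_def
      by (intro continuous_intros) (use pos in auto)
  qed (use bump_support assms in auto)
  then show ?thesis by blast
qed

text \<open>The margin \<open>(q - p) / (real n + 3)\<close> keeps the support away from
  \<open>p\<close> and \<open>q\<close>, which may be end points of the domain. At an interior point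
  the squared parabola has a positive limit, so \<open>n\<close> times it tends to infinity; at an
  outer point every bump vanishes.\<close>

lemma bump_tendsto_indicator:
  assumes "p < q"
  shows "(\<lambda>n. bump (p + (q - p) / (real n + 3)) (q - (q - p) / (real n + 3)) n x) \<longlonglongrightarrow> indicator {p<..<q} x"
proof -
  define e where "e n = (q - p) / (real n + 3)" for n
  define s where "s n = (max 0 ((x - (p + e n)) * (q - e n - x)))\<^sup>2" for n
  have e0: "e \<longlonglongrightarrow> 0"
  proof -
    have "filterlim (\<lambda>n. real n + 3) at_top sequentially"
      using filterlim_tendsto_add_at_top[OF tendsto_const[of 3] filterlim_real_sequentially]
      by (simp add: add.commute)
    then show ?thesis unfolding e_def by (rule real_tendsto_divide_at_top[OF tendsto_const])
  qed
  have epos: "0 < e n" "e n < q - p" for n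
  proof -
    show "0 < e n" using assms by (simp add: e_def)
    have "(q - p) * 1 < (q - p) * (real n + 3)" using assms by (intro mult_strict_left_mono) auto
    then show "e n < q - p" by (simp add: e_def field_simps)
  qed
  have B: "bump (p + e n) (q - e n) n x = real n * s n / (1 + real n * s n)" for n
    by (simp add: bump_def s_def)
  have "(\<lambda>n. bump (p + e n) (q - e n) n x) \<longlonglongrightarrow> indicator {p<..<q} x"
  proof (cases "x \<in> {p<..<q}")
    case True
    define L where "L = ((x - p) * (q - x))\<^sup>2"
    have L: "0 < L" using True by (simp add: L_def)
    have "s \<longlonglongrightarrow> (max 0 ((x - (p + 0)) * (q - 0 - x)))\<^sup>2"
      unfolding s_def by (intro tendsto_intros e0)
    also have "(max 0 ((x - (p + 0)) * (q - 0 - x)))\<^sup>2 = L"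
      using True by (simp add: L_def max_def mult_nonneg_nonneg not_le)
    finally have sL: "s \<longlonglongrightarrow> L" .
    have "filterlim (\<lambda>n. s n * real n) at_top sequentially"
      by (rule filterlim_tendsto_pos_mult_at_top[OF sL L filterlim_real_sequentially])
    then have "filterlim (\<lambda>n. 1 + s n * real n) at_top sequentially"
      by (intro filterlim_tendsto_add_at_top[OF tendsto_const])
    then have "(\<lambda>n. 1 / (1 + s n * real n)) \<longlonglongrightarrow> 0"
      by (rule real_tendsto_divide_at_top[OF tendsto_const])
    from tendsto_diff[OF tendsto_const[of 1] this]
    have "(\<lambda>n. 1 - 1 / (1 + s n * real n)) \<longlonglongrightarrow> 1" by simp
    moreover have "1 - 1 / (1 + s n * real n) = bump (p + e n) (q - e n) n x" for n
    proof -
      have "0 \<le> s n * real n" by (simp add: s_def)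
      then have "1 + s n * real n \<noteq> 0" by linarith
      then show ?thesis unfolding B by (simp add: field_simps)
    qed
    ultimately show ?thesis using True by simp
  next
    case False
    have "bump (p + e n) (q - e n) n x = 0" for n
    proof (rule ccontr)
      assume *: "bump (p + e n) (q - e n) n x \<noteq> 0"
      then have "s n \<noteq> 0" by (auto simp: B)
      moreover have "max 0 P \<noteq> 0 \<Longrightarrow> 0 < P" for P :: real by (auto simp: max_def split: if_splits)
      ultimately have "0 < (x - (p + e n)) * (q - e n - x)" unfolding s_def by simp
      then have "(p + e n < x \<and> x < q - e n) \<or> (x < p + e n \<and> q - e n < x)"
        by (auto simp: zero_less_mult_iff)
      then show False using False epos[of n] 
        by auto
    qed
    then show ?thesis using False by simp
  qed
  then show ?thesis by (simp add: e_def)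
qed

text \<open>The bumps converge boundedly to the indicator of a subinterval, so dominated convergence
  shows that \<open>w\<close> has zero integral over each of them.\<close>

lemma fundamental_lemma:
  fixes w :: cfun
  assumes w: "integrable (ivl a b) w"
    and zero: "\<And>\<phi> \<phi>'. test_fun a b \<phi> \<phi>' \<Longrightarrow> (LINT x|ivl a b. w x * of_real (\<phi> x)) = 0"
  shows "AE x in ivl a b. w x = 0"
proof (rule AE_zero_if_integrals_zero[OF w])
  fix p q :: real assume pq: "a \<le> p" "p < q" "q \<le> b"
  define e where "e n = (q - p) / (real n + 3)" for n
  have e: "0 < e n" "p + e n < q - e n" for n
  proof -
    show "0 < e n" using pq by (simp add: e_def)
    \<comment> \<open>The shift by 3 in the denominator guarantees that the two margins do not meet,
      even for \<open>n = 0\<close>.\<close>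
    have "e n \<le> (q - p) / 3" unfolding e_def using pq by (intro divide_left_mono) auto
    then show "p + e n < q - e n" using pq by (simp add: field_simps) 
  qed
  define \<beta> where "\<beta> n x = bump (p + e n) (q - e n) n x" for n x
  have t: "\<exists>\<phi>'. test_fun a b (\<beta> n) \<phi>'" for n
    unfolding \<beta>_def[abs_def] using e[of n] pq by (intro test_fun_bump) auto
  have m: "\<beta> n \<in> borel_measurable (ivl a b)" for n
  proof -
    obtain \<phi>' where "test_fun a b (\<beta> n) \<phi>'" using t by blast
    then have "continuous_on UNIV (\<beta> n)"
      by (intro continuous_at_imp_continuous_on ballI) (auto simp: test_fun_def intro: DERIV_isCont)
    then have "\<beta> n \<in> borel_measurable borel" by (rule borel_measurable_continuous_onI)
    then show ?thesis by (intro measurable_restrict_space1 measurable_completion) simp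
  qed
  have "(\<lambda>n. LINT x|ivl a b. w x * of_real (\<beta> n x)) \<longlonglongrightarrow> (LINT x|ivl a b. indicat_real {p<..<q} x *\<^sub>R w x)"
  proof (rule integral_dominated_convergence)
    show "integrable (ivl a b) (\<lambda>x. cmod (w x))" using w by simp
    show "AE x in ivl a b. (\<lambda>n. w x * of_real (\<beta> n x)) \<longlonglongrightarrow> indicat_real {p<..<q} x *\<^sub>R w x"
    proof (rule AE_I2)
      fix x
      have "(\<lambda>n. \<beta> n x) \<longlonglongrightarrow> indicat_real {p<..<q} x"
        unfolding \<beta>_def e_def by (rule bump_tendsto_indicator[OF pq(2)])
      then have "(\<lambda>n. w x * of_real (\<beta> n x)) \<longlonglongrightarrow> w x * of_real (indicat_real {p<..<q} x)"
        by (intro tendsto_intros)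
      then show "(\<lambda>n. w x * of_real (\<beta> n x)) \<longlonglongrightarrow> indicat_real {p<..<q} x *\<^sub>R w x"
        by (simp add: scaleR_conv_of_real mult.commute)
    qed
    show "(\<lambda>x. w x * of_real (\<beta> n x)) \<in> borel_measurable (ivl a b)" for n
      using w m[of n] by measurable
    show "AE x in ivl a b. norm (w x * of_real (\<beta> n x)) \<le> cmod (w x)" for n
      using bump_range[of "p + e n" "q - e n" n]
      by (intro AE_I2) (auto simp: norm_mult \<beta>_def intro!: mult_left_le)
    show "(\<lambda>x. indicat_real {p<..<q} x *\<^sub>R w x) \<in> borel_measurable (ivl a b)"
      using integrable_ivl_sub_iff[of a p q b w] integrable_ivl_sub[OF w, of p q] pq by auto
  qed
  moreover have "(LINT x|ivl a b. w x * of_real (\<beta> n x)) = 0" for n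
    using t[of n] zero by blast
  ultimately have "(LINT x|ivl a b. indicat_real {p<..<q} x *\<^sub>R w x) = 0"
    by (simp add: LIMSEQ_const_iff)
  then show "(LINT x|ivl p q. w x) = 0" using pq by (simp add: integral_ivl_sub[of a p q b])
qed

section \<open>Antiderivatives of test functions and du Bois-Reymond's lemma\<close>

lemma test_fun_support:
  assumes "test_fun a b \<phi> \<phi>'" "a < b"
  obtains p q where "a < p" "p < q" "q < b" "\<And>x. x \<notin> {p<..<q} \<Longrightarrow> \<phi> x = 0"
proof -
  let ?K = "closure {x. \<phi> x \<noteq> 0}"
  have K: "compact ?K" "?K \<subseteq> {a<..<b}" using assms(1) by (auto simp: test_fun_def)
  show ?thesis
  proof (cases "?K = {}")
    case True
    then have "\<phi> x = 0" for x using closure_subset[of "{x. \<phi> x \<noteq> 0}"] by auto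
    moreover obtain p where p: "a < p" "p < b" using dense[OF assms(2)] by blast
    moreover obtain q where "p < q" "q < b" using dense[OF p(2)] by blast
    ultimately show ?thesis using that by blast
  next
    case False
    obtain l u where l: "l \<in> ?K" "\<And>x. x \<in> ?K \<Longrightarrow> l \<le> x" and u: "u \<in> ?K" "\<And>x. x \<in> ?K \<Longrightarrow> x \<le> u"
      using compact_attains_inf[OF K(1) False] compact_attains_sup[OF K(1) False] by blast
    have "a < l" "l \<le> u" "u < b" using l u K by auto
    obtain p where p: "a < p" "p < l" using dense[OF \<open>a < l\<close>] by blast
    obtain q where q: "u < q" "q < b" using dense[OF \<open>u < b\<close>] by blast
    have "\<phi> x = 0" if "x \<notin> {p<..<q}" for x
    proof (rule ccontr)
      assume "\<phi> x \<noteq> 0"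
      then have "x \<in> ?K" using closure_subset[of "{x. \<phi> x \<noteq> 0}"] by auto
      then have "l \<le> x" "x \<le> u" using l u by auto
      with p q that show False by auto
    qed
    then show ?thesis using that[of p q] p q \<open>l \<le> u\<close> by auto
  qed
qed

lemma test_fun_zero_outside:
  assumes "test_fun a b \<phi> \<phi>'" "x \<notin> {a<..<b}" shows "\<phi> x = 0"
  using assms closure_subset[of "{x. \<phi> x \<noteq> 0}"] by (auto simp: test_fun_def)

lemma test_fun_continuous:
  assumes "test_fun a b \<phi> \<phi>'"
  shows "continuous_on S \<phi>" "continuous_on S \<phi>'"
proof -
  show "continuous_on S \<phi>"
    using assms by (intro continuous_at_imp_continuous_on ballI) (auto simp: test_fun_def intro: DERIV_isCont)
  show "continuous_on S \<phi>'"
    using assms by (auto simp: test_fun_def intro: continuous_on_subset)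
qed

lemma test_fun_abs_cont:
  assumes "test_fun a b \<phi> \<phi>'"
  shows "abs_cont a b (\<lambda>x. of_real (\<phi> x)) (\<lambda>x. of_real (\<phi>' x))"
proof (rule abs_cont_smooth)
  fix x
  have "(\<phi> has_vector_derivative \<phi>' x) (at x)"
    using assms by (simp add: test_fun_def has_real_derivative_iff_has_vector_derivative)
  then show "((\<lambda>x. complex_of_real (\<phi> x)) has_vector_derivative of_real (\<phi>' x)) (at x within {a..b})"
    using bounded_linear.has_vector_derivative[OF bounded_linear_of_real]
    by (blast intro: has_vector_derivative_at_within)
qed (intro continuous_intros test_fun_continuous[OF assms])

lemma integral_ivl_HK_real:
  fixes h :: "real \<Rightarrow> real"
  assumes "continuous_on {a..b} h" shows "(LINT x|ivl a b. h x) = integral {a..b} h"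
proof -
  interpret finite_measure "ivl a b" by (rule finite_measure_ivl)
  have "integrable (ivl a b) (\<lambda>x. complex_of_real (h x))"
    by (intro sqint_integrable continuous_on_ivl_sqint continuous_intros assms)
  then have "integrable (ivl a b) h" by (simp add: complex_of_real_integrable_eq)
  from lebesgue_integral_eq_integral[OF this] show ?thesis
    by (simp add: integral_open_interval_real)
qed

text \<open>The primitive vanishes to the left of the support by construction and to its right
  because the total integral is zero, so it is compactly supported again.\<close>

lemma test_fun_antiderivative:
  assumes ab: "a < b" and t: "test_fun a b \<theta> \<theta>'" and zero: "(LINT x|ivl a b. \<theta> x) = 0"
  shows "\<exists>\<Theta>. test_fun a b \<Theta> \<theta>"
proof -
  obtain p q where pq: "a < p" "p < q" "q < b" and supp: "\<And>x. x \<notin> {p<..<q} \<Longrightarrow> \<theta> x = 0"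
    using test_fun_support[OF t ab] by blast
  define \<Theta> where "\<Theta> x = integral {a..x} \<theta>" for x
  have left: "\<Theta> x = 0" if "x \<le> p" for x
    unfolding \<Theta>_def
    by (rule integral_unique, rule has_integral_is_0) (use that supp in auto)
  have comb: "\<Theta> x = \<Theta> y + integral {y..x} \<theta>" if "a \<le> y" "y \<le> x" for x y
    unfolding \<Theta>_def
    by (rule Henstock_Kurzweil_Integration.integral_combine[symmetric])
       (use that test_fun_continuous(1)[OF t] in \<open>auto intro: integrable_continuous_real\<close>)
  have "integral {a..b} \<theta> = 0"
    using zero integral_ivl_HK_real[OF test_fun_continuous(1)[OF t], of a b] by simp
  moreover have "integral {q..x} \<theta> = 0" for x
    by (rule integral_unique, rule has_integral_is_0) (use supp in auto)
  ultimately have right: "\<Theta> x = 0" if "q \<le> x" for x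
    using comb[of q x] comb[of q b] that pq by (simp add: \<Theta>_def)
  have "test_fun a b \<Theta> \<theta>"
  proof (rule test_funI[of _ _ p q])
    fix x
    show "(\<Theta> has_real_derivative \<theta> x) (at x)"
    proof (cases "x < p")
      case True
      have "((\<lambda>t. 0) has_real_derivative 0) (at x)" by simp
      then have "(\<Theta> has_real_derivative 0) (at x)"
        by (rule has_field_derivative_transform_within_open[of _ _ _ "{..<p}"])
           (use True left in auto)
      then show ?thesis using supp[of x] True by simp
    next
      case False
      have "((\<lambda>u. integral {a..u} \<theta>) has_real_derivative \<theta> x) (at x within {a..x+1})"
        by (rule integral_has_real_derivative[OF test_fun_continuous(1)[OF t]])
           (use False pq in auto)
      moreover have "at x within {a..x+1} = at x"
        using False pq by (intro at_within_interior) auto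
      ultimately show ?thesis unfolding \<Theta>_def by simp
    qed
  next
    show "continuous_on UNIV \<theta>" by (rule test_fun_continuous(1)[OF t])
    show "x \<in> {p..q}" if "\<Theta> x \<noteq> 0" for x using that left[of x] right[of x] by force
  qed (use pq in auto)
  then show ?thesis by blast
qed

text \<open>Subtracting a multiple of a fixed bump \<open>\<eta>\<close> makes any test function
  \<open>\<psi>\<close> mean-free, hence the derivative of a test function. The hypothesis then says
  that \<open>w\<close> acts on \<open>\<psi>\<close> exactly as the constant \<open>c\<close>
  does.\<close>

lemma du_bois_reymond:
  fixes w :: cfun
  assumes ab: "a < b" and w: "integrable (ivl a b) w"
    and zero: "\<And>\<phi> \<phi>'. test_fun a b \<phi> \<phi>' \<Longrightarrow> (LINT x|ivl a b. w x * of_real (\<phi>' x)) = 0"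
  shows "\<exists>c. AE x in ivl a b. w x = c"
proof -
  let ?M = "ivl a b"
  interpret finite_measure ?M by (rule finite_measure_ivl)
  have tint: "integrable ?M \<phi>" if "test_fun a b \<phi> \<phi>'" for \<phi> \<phi>'
  proof -
    have "integrable ?M (\<lambda>x. complex_of_real (\<phi> x))"
      by (intro sqint_integrable continuous_on_ivl_sqint continuous_intros test_fun_continuous(1)[OF that])
    then show ?thesis by (simp add: complex_of_real_integrable_eq)
  qed
  have twint: "integrable ?M (\<lambda>x. w x * of_real (\<phi> x))" if "test_fun a b \<phi> \<phi>'" for \<phi> \<phi>'
    by (intro integrable_ivl_mult_continuous w continuous_intros test_fun_continuous(1)[OF that])
  obtain p where p: "a < p" "p < b" using dense[OF ab] by blast
  obtain q where q: "p < q" "q < b" using dense[OF p(2)] by blast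
  obtain \<eta>' where \<eta>: "test_fun a b (bump p q 1) \<eta>'" using test_fun_bump[OF p(1) q] by blast
  define \<eta> where "\<eta> = bump p q 1"
  have \<eta>: "test_fun a b \<eta> \<eta>'" using \<eta> by (simp add: \<eta>_def)
  define m where "m = (LINT x|?M. \<eta> x)"
  \<comment> \<open>The bump is nonnegative, and strictly positive on \<open>{p<..<q}\<close>, which
    has positive measure.\<close>
  have m: "m \<noteq> 0"
  proof
    assume "m = 0"
    then have "AE x in ?M. \<eta> x = 0"
      unfolding m_def using tint[OF \<eta>] bump_range
      by (subst (asm) integral_nonneg_eq_0_iff_AE) (auto simp: \<eta>_def)
    then have "AE x in ivl p q. \<eta> x = 0" by (rule AE_ivl_sub) (use p q in auto)
    then have "AE x in ivl p q. False"
      using AE_space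
    proof eventually_elim
      case (elim x)
      then have "0 < (x - p) * (q - x)" by auto
      then have "0 < max 0 ((x - p) * (q - x))" by linarith
      then have "0 < (max 0 ((x - p) * (q - x)))\<^sup>2" by (rule zero_less_power)
      then have "\<eta> x \<noteq> 0" unfolding \<eta>_def bump_def
        by (metis add_pos_pos divide_eq_0_iff less_irrefl mult_1 of_nat_1 zero_less_one)
      with elim show ?case by simp
    qed
    then have "space (ivl p q) \<in> null_sets (ivl p q)"
      by (simp add: AE_iff_null_sets eventually_ae_filter)
    then have "measure (ivl p q) (space (ivl p q)) = 0" by (simp add: null_sets_def measure_def)
    then show False using measure_ivl[of p q] q by simp
  qed
  define c where "c = (LINT x|?M. w x * of_real (\<eta> x)) / of_real m"
  have "AE x in ?M. w x - c = 0"
  proof (rule fundamental_lemma)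
    show "integrable ?M (\<lambda>x. w x - c)" using w by simp
    fix \<psi> \<psi>' assume \<psi>: "test_fun a b \<psi> \<psi>'"
    define r where "r = (LINT x|?M. \<psi> x) / m"
    define \<theta> where "\<theta> x = \<psi> x - r * \<eta> x" for x
    obtain p1 q1 where 1: "a < p1" "p1 < q1" "q1 < b" "\<And>x. x \<notin> {p1<..<q1} \<Longrightarrow> \<psi> x = 0"
      using test_fun_support[OF \<psi> ab] by blast
    obtain p2 q2 where 2: "a < p2" "p2 < q2" "q2 < b" "\<And>x. x \<notin> {p2<..<q2} \<Longrightarrow> \<eta> x = 0"
      using test_fun_support[OF \<eta> ab] by blast
    have "test_fun a b \<theta> (\<lambda>x. \<psi>' x - r * \<eta>' x)"
    proof (rule test_funI[of _ _ "min p1 p2" "max q1 q2"])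
      fix x
      show "(\<theta> has_real_derivative \<psi>' x - r * \<eta>' x) (at x)"
        unfolding \<theta>_def[abs_def] using \<psi> \<eta>
        by (auto intro!: derivative_eq_intros simp: test_fun_def)
      show "x \<in> {min p1 p2..max q1 q2}" if "\<theta> x \<noteq> 0"
      proof (rule ccontr)
        assume "x \<notin> {min p1 p2..max q1 q2}"
        then have "x \<notin> {p1<..<q1}" "x \<notin> {p2<..<q2}" by auto
        then have "\<psi> x = 0" "\<eta> x = 0" using 1(4) 2(4) by blast+
        with that show False by (simp add: \<theta>_def)
      qed
    qed (use 1 2 test_fun_continuous[OF \<psi>] test_fun_continuous[OF \<eta>] in \<open>auto intro!: continuous_intros\<close>)
    moreover have "(LINT x|?M. \<theta> x) = 0"
      unfolding \<theta>_def using tint[OF \<psi>] tint[OF \<eta>] m by (simp add: r_def m_def)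
    ultimately obtain \<Theta> where "test_fun a b \<Theta> \<theta>" using test_fun_antiderivative[OF ab] by blast
    from zero[OF this] have "(LINT x|?M. w x * of_real (\<psi> x) - of_real r * (w x * of_real (\<eta> x))) = 0"
      by (simp add: \<theta>_def algebra_simps)
    then have "(LINT x|?M. w x * of_real (\<psi> x)) = of_real r * (LINT x|?M. w x * of_real (\<eta> x))"
      using twint[OF \<psi>] twint[OF \<eta>] by simp
    also have "\<dots> = c * of_real (LINT x|?M. \<psi> x)"
      using m by (simp add: r_def c_def)
    finally have *: "(LINT x|?M. w x * of_real (\<psi> x)) = c * of_real (LINT x|?M. \<psi> x)" .
    have "(LINT x|?M. (w x - c) * of_real (\<psi> x)) = (LINT x|?M. w x * of_real (\<psi> x) - c * of_real (\<psi> x))"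
      by (simp add: algebra_simps)
    also have "\<dots> = 0" using * twint[OF \<psi>] tint[OF \<psi>] by simp
    finally show "(LINT x|?M. (w x - c) * of_real (\<psi> x)) = 0" .
  qed
  then show ?thesis by auto
qed

section \<open>Weak derivatives and primitives\<close>

lemma abs_cont_weak_deriv:
  assumes "abs_cont a b G h" "AE x in ivl a b. g x = G x" "g \<in> borel_measurable (ivl a b)" "a < b"
  shows "is_weak_deriv a b g h"
  unfolding is_weak_deriv_def
proof (intro allI impI)
  fix \<phi> \<phi>' assume t: "test_fun a b \<phi> \<phi>'"
  have G: "G \<in> borel_measurable (ivl a b)"
    by (rule continuous_on_ivl_measurable[OF abs_cont_continuous[OF assms(1)]])
  have \<phi>': "(\<lambda>x. complex_of_real (\<phi>' x)) \<in> borel_measurable (ivl a b)"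
    by (intro continuous_on_ivl_measurable continuous_intros test_fun_continuous(2)[OF t])
  have "(LINT x|ivl a b. g x * of_real (\<phi>' x)) = (LINT x|ivl a b. G x * of_real (\<phi>' x))"
    by (rule integral_cong_AE) (use assms(2,3) G \<phi>' in auto)
  then show "(LINT x|ivl a b. g x * of_real (\<phi>' x)) = - (LINT x|ivl a b. h x * of_real (\<phi> x))"
    using abs_cont_integration_by_parts(1)[OF assms(1) test_fun_abs_cont[OF t]] assms(4)
      test_fun_zero_outside[OF t, of a] test_fun_zero_outside[OF t, of b]
    by (simp add: eq_neg_iff_add_eq_0 add.commute)
qed

text \<open>The primitive \<open>H\<close> of \<open>h\<close> has the same weak derivative as
  \<open>g\<close>, and du Bois-Reymond's lemma makes the difference constant.\<close>

lemma weak_deriv_abs_cont: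
  assumes ab: "a < b" and g: "g \<in> sqint (ivl a b)" and h: "h \<in> sqint (ivl a b)"
    and wd: "is_weak_deriv a b g h"
  shows "\<exists>G. abs_cont a b G h \<and> (AE x in ivl a b. g x = G x)"
proof -
  let ?M = "ivl a b"
  interpret finite_measure ?M by (rule finite_measure_ivl)
  define H where "H x = (LINT y|ivl a x. h y)" for x
  have ih: "integrable ?M h" and ig: "integrable ?M g" using g h sqint_integrable by auto
  have H: "abs_cont a b H h" by (rule abs_cont_primitive[OF ih, of _ 0]) (simp add: H_def)
  have cH: "continuous_on {a..b} H" by (rule abs_cont_continuous[OF H])
  have iH: "integrable ?M H" using continuous_on_ivl_sqint[OF cH] sqint_integrable by blast
  have "\<exists>c. AE x in ?M. g x - H x = c"
  proof (rule du_bois_reymond[OF ab])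
    show "integrable ?M (\<lambda>x. g x - H x)" using ig iH by simp
    fix \<phi> \<phi>' assume t: "test_fun a b \<phi> \<phi>'"
    have c: "continuous_on {a..b} (\<lambda>x. complex_of_real (\<phi>' x))"
      by (intro continuous_intros test_fun_continuous[OF t])
    note i = integrable_ivl_mult_continuous[OF ig c] integrable_ivl_mult_continuous[OF iH c]
    have "is_weak_deriv a b H h"
      by (rule abs_cont_weak_deriv[OF H _ _ ab]) (use continuous_on_ivl_measurable[OF cH] in auto)
    then have "(LINT x|?M. g x * of_real (\<phi>' x)) = (LINT x|?M. H x * of_real (\<phi>' x))"
      using wd t by (simp add: is_weak_deriv_def)
    then show "(LINT x|?M. (g x - H x) * of_real (\<phi>' x)) = 0"
      using i by (simp add: left_diff_distrib)
  qed
  then obtain c where c: "AE x in ?M. g x - H x = c" by blast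
  have "abs_cont a b (\<lambda>x. c + H x) h"
    by (rule abs_cont_primitive[OF ih, of _ c]) (simp add: H_def)
  moreover have "AE x in ?M. g x = c + H x" using c by eventually_elim (simp add: algebra_simps)
  ultimately show ?thesis by (intro exI[of _ "\<lambda>x. c + H x"]) simp
qed

lemma weak_deriv_unique:
  assumes h: "h \<in> sqint (ivl a b)" and k: "k \<in> sqint (ivl a b)"
    and wd: "is_weak_deriv a b g h" "is_weak_deriv a b g k"
  shows "AE x in ivl a b. h x = k x"
proof -
  let ?M = "ivl a b"
  interpret finite_measure ?M by (rule finite_measure_ivl)
  have i: "integrable ?M h" "integrable ?M k" using h k sqint_integrable by auto
  have "AE x in ?M. h x - k x = 0"
  proof (rule fundamental_lemma)
    show "integrable ?M (\<lambda>x. h x - k x)" using i by simp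
    fix \<phi> \<phi>' assume t: "test_fun a b \<phi> \<phi>'"
    have c: "continuous_on {a..b} (\<lambda>x. complex_of_real (\<phi> x))"
      by (intro continuous_intros test_fun_continuous[OF t])
    have "- (LINT x|?M. h x * of_real (\<phi> x)) = - (LINT x|?M. k x * of_real (\<phi> x))"
      using wd t unfolding is_weak_deriv_def by metis
    then show "(LINT x|?M. (h x - k x) * of_real (\<phi> x)) = 0"
      using integrable_ivl_mult_continuous[OF i(1) c] integrable_ivl_mult_continuous[OF i(2) c]
      by (simp add: left_diff_distrib)
  qed
  then show ?thesis by simp
qed

section \<open>The spaces $H^1(a,b)$\<close>

lemma H1_onD:
  assumes "g \<in> H1_on a b"
  shows "g \<in> sqint (ivl a b)" "weak_deriv a b g \<in> sqint (ivl a b)" "is_weak_deriv a b g (weak_deriv a b g)"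
proof -
  show "g \<in> sqint (ivl a b)" using assms by (auto simp: H1_on_def L2_on_sqint)
  have "\<exists>h. h \<in> L2_on a b \<and> is_weak_deriv a b g h" using assms by (auto simp: H1_on_def)
  from someI_ex[OF this] show "weak_deriv a b g \<in> sqint (ivl a b)"
    "is_weak_deriv a b g (weak_deriv a b g)"
    unfolding weak_deriv_def L2_on_sqint by auto
qed

lemma H1_norm_on_nonneg [simp]: "0 \<le> H1_norm_on a b g"
  by (simp add: H1_norm_on_def)

lemma H1_norm_on_sq: "(H1_norm_on a b g)\<^sup>2 = (l2norm (ivl a b) g)\<^sup>2 + (l2norm (ivl a b) (weak_deriv a b g))\<^sup>2"
  by (simp add: H1_norm_on_def L2_norm_on_l2norm)

lemma l2norm_le_H1_norm_on:
  "l2norm (ivl a b) g \<le> H1_norm_on a b g" "l2norm (ivl a b) (weak_deriv a b g) \<le> H1_norm_on a b g"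
  by (rule power2_le_imp_le; simp add: H1_norm_on_sq)+

text \<open>As \<open>weak_deriv\<close> is a choice, it is known only up to a null set. A primitive
  \<open>G\<close> of a square-integrable \<open>h\<close> settles membership, weak derivative and
  norm at once, without reference to that choice; closure properties of the space are proved by
  exhibiting such a \<open>G\<close>.\<close>

lemma H1_onI:
  assumes "a < b" "abs_cont a b G h" "h \<in> sqint (ivl a b)" "AE x in ivl a b. g x = G x"
    "g \<in> borel_measurable (ivl a b)"
  shows "g \<in> H1_on a b" "AE x in ivl a b. weak_deriv a b g x = h x"
    "(H1_norm_on a b g)\<^sup>2 = (l2norm (ivl a b) G)\<^sup>2 + (l2norm (ivl a b) h)\<^sup>2"
proof -
  have G: "G \<in> sqint (ivl a b)" by (rule continuous_on_ivl_sqint[OF abs_cont_continuous[OF assms(2)]])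
  have g: "g \<in> sqint (ivl a b)"
    by (rule sqint_cong_AE[OF G assms(5)]) (use assms(4) in eventually_elim, simp)
  have wd: "is_weak_deriv a b g h" by (rule abs_cont_weak_deriv[OF assms(2,4,5,1)])
  show H: "g \<in> H1_on a b" using g assms(3) wd by (auto simp: H1_on_def L2_on_sqint)
  show w: "AE x in ivl a b. weak_deriv a b g x = h x"
    by (rule weak_deriv_unique[OF H1_onD(2)[OF H] assms(3) H1_onD(3)[OF H] wd])
  have "l2norm (ivl a b) (weak_deriv a b g) = l2norm (ivl a b) h"
    by (rule l2norm_cong_AE) (use w H1_onD(2)[OF H] assms(3) in auto)
  moreover have "l2norm (ivl a b) g = l2norm (ivl a b) G"
    by (rule l2norm_cong_AE) (use assms(4,5) G in auto)
  ultimately show "(H1_norm_on a b g)\<^sup>2 = (l2norm (ivl a b) G)\<^sup>2 + (l2norm (ivl a b) h)\<^sup>2"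
    by (simp add: H1_norm_on_sq)
qed

lemma H1_on_representative:
  assumes "a < b" "g \<in> H1_on a b"
  obtains G where "abs_cont a b G (weak_deriv a b g)" "AE x in ivl a b. g x = G x"
  using weak_deriv_abs_cont[OF assms(1) H1_onD[OF assms(2)]] by blast

lemma abs_cont_add:
  assumes "abs_cont a b G h" "abs_cont a b K k"
  shows "abs_cont a b (\<lambda>x. G x + K x) (\<lambda>x. h x + k x)"
  unfolding abs_cont_def
proof (intro conjI ballI)
  note i = abs_cont_integrable[OF assms(1)] abs_cont_integrable[OF assms(2)]
  show "integrable (ivl a b) (\<lambda>x. h x + k x)" using i by simp
  fix x assume x: "x \<in> {a..b}"
  have "integrable (ivl a x) h" "integrable (ivl a x) k"
    using integrable_ivl_sub[OF i(1), of a x] integrable_ivl_sub[OF i(2), of a x] x by auto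
  then show "G x + K x = G a + K a + (LINT y|ivl a x. h y + k y)"
    using abs_cont_eq[OF assms(1) x] abs_cont_eq[OF assms(2) x] by simp
qed

lemma abs_cont_cmult:
  assumes "abs_cont a b G h"
  shows "abs_cont a b (\<lambda>x. c * G x) (\<lambda>x. c * h x)"
  unfolding abs_cont_def
proof (intro conjI ballI)
  note i = abs_cont_integrable[OF assms(1)]
  show "integrable (ivl a b) (\<lambda>x. c * h x)" using i by simp
  fix x assume x: "x \<in> {a..b}"
  show "c * G x = c * G a + (LINT y|ivl a x. c * h y)"
    by (subst abs_cont_eq[OF assms(1) x]) (simp only: distrib_left integral_mult_right_zero)
qed

lemma abs_cont_sub:
  assumes "abs_cont a b G h" "a \<le> c" "d \<le> b"
  shows "abs_cont c d G h"
  unfolding abs_cont_def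
proof (intro conjI ballI)
  show i: "integrable (ivl c d) h" by (rule integrable_ivl_sub[OF abs_cont_integrable[OF assms(1)] assms(2,3)])
  fix x assume x: "x \<in> {c..d}"
  have "integrable (ivl a x) h" by (rule integrable_ivl_sub[OF abs_cont_integrable[OF assms(1)]]) (use x assms in auto)
  then have "(LINT y|ivl a x. h y) = (LINT y|ivl a c. h y) + (LINT y|ivl c x. h y)"
    by (rule integral_ivl_split) (use x assms in auto)
  then show "G x = G c + (LINT y|ivl c x. h y)"
    using abs_cont_eq[OF assms(1), of x] abs_cont_eq[OF assms(1), of c] x assms by (auto simp: add.assoc)
qed

lemma H1_on_add:
  assumes "a < b" "f \<in> H1_on a b" "g \<in> H1_on a b"
  shows "(\<lambda>x. f x + g x) \<in> H1_on a b"
proof -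
  obtain F G where F: "abs_cont a b F (weak_deriv a b f)" "AE x in ivl a b. f x = F x"
    and G: "abs_cont a b G (weak_deriv a b g)" "AE x in ivl a b. g x = G x"
    using H1_on_representative[OF assms(1)] assms(2,3) by metis
  show ?thesis
  proof (rule H1_onI(1)[OF assms(1) abs_cont_add[OF F(1) G(1)]])
    show "AE x in ivl a b. f x + g x = F x + G x" using F(2) G(2) by eventually_elim simp
    show "(\<lambda>x. f x + g x) \<in> borel_measurable (ivl a b)"
      using H1_onD(1)[OF assms(2)] H1_onD(1)[OF assms(3)] by measurable
  qed (intro sqint_add H1_onD assms)
qed

lemma H1_on_cmult:
  assumes "a < b" "f \<in> H1_on a b"
  shows "(\<lambda>x. c * f x) \<in> H1_on a b" "H1_norm_on a b (\<lambda>x. c * f x) = cmod c * H1_norm_on a b f"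
proof -
  obtain F where F: "abs_cont a b F (weak_deriv a b f)" "AE x in ivl a b. f x = F x"
    using H1_on_representative[OF assms] by metis
  have c: "AE x in ivl a b. c * f x = c * F x" using F(2) by eventually_elim simp
  have m: "(\<lambda>x. c * f x) \<in> borel_measurable (ivl a b)"
    using H1_onD(1)[OF assms(2)] by measurable
  have s: "(\<lambda>x. c * weak_deriv a b f x) \<in> sqint (ivl a b)"
    by (intro sqint_cmult H1_onD assms)
  note R = H1_onI[OF assms(1) abs_cont_cmult[OF F(1), of c] s c m]
  show "(\<lambda>x. c * f x) \<in> H1_on a b" by (rule R(1))
  have FS: "F \<in> sqint (ivl a b)" by (rule continuous_on_ivl_sqint[OF abs_cont_continuous[OF F(1)]])
  have "l2norm (ivl a b) f = l2norm (ivl a b) F"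
    by (rule l2norm_cong_AE) (use F(2) H1_onD(1)[OF assms(2)] FS in auto)
  then have "(H1_norm_on a b (\<lambda>x. c * f x))\<^sup>2 = (cmod c * H1_norm_on a b f)\<^sup>2"
    unfolding R(3) by (simp add: l2norm_cmult power_mult_distrib H1_norm_on_sq distrib_left)
  then show "H1_norm_on a b (\<lambda>x. c * f x) = cmod c * H1_norm_on a b f"
    by (rule power2_eq_imp_eq) auto
qed

lemma H1_on_diff:
  assumes "a < b" "f \<in> H1_on a b" "g \<in> H1_on a b"
  shows "(\<lambda>x. f x - g x) \<in> H1_on a b"
  using H1_on_add[OF assms(1,2) H1_on_cmult(1)[OF assms(1,3), of "-1"]] by simp

lemma H1_norm_on_triangle:
  assumes ab: "a < b" and f: "f \<in> H1_on a b" and g: "g \<in> H1_on a b"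
  shows "H1_norm_on a b (\<lambda>x. f x + g x) \<le> H1_norm_on a b f + H1_norm_on a b g"
proof -
  let ?f' = "weak_deriv a b f" and ?g' = "weak_deriv a b g" and ?M = "ivl a b"
  obtain F where F: "abs_cont a b F ?f'" "AE x in ivl a b. f x = F x"
    using H1_on_representative[OF ab f] by blast
  obtain G where G: "abs_cont a b G ?g'" "AE x in ivl a b. g x = G x"
    using H1_on_representative[OF ab g] by blast
  have c: "AE x in ivl a b. f x + g x = F x + G x" using F(2) G(2) by eventually_elim simp
  have w: "AE x in ?M. weak_deriv a b (\<lambda>x. f x + g x) x = ?f' x + ?g' x"
    by (rule H1_onI(2)[OF ab abs_cont_add[OF F(1) G(1)] sqint_add[OF H1_onD(2)[OF f] H1_onD(2)[OF g]] c])
       (use sqint_add[OF H1_onD(1)[OF f] H1_onD(1)[OF g]] in simp)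
  note fg = H1_on_add[OF ab f g]
  have "l2norm ?M (weak_deriv a b (\<lambda>x. f x + g x)) = l2norm ?M (\<lambda>x. ?f' x + ?g' x)"
    by (rule l2norm_cong_AE)
       (use w H1_onD(2)[OF fg] sqint_add[OF H1_onD(2)[OF f] H1_onD(2)[OF g]] in auto)
  also have "\<dots> \<le> l2norm ?M ?f' + l2norm ?M ?g'"
    by (rule l2norm_triangle[OF H1_onD(2)[OF f] H1_onD(2)[OF g]])
  finally have 1: "l2norm ?M (weak_deriv a b (\<lambda>x. f x + g x)) \<le> l2norm ?M ?f' + l2norm ?M ?g'" .
  have 2: "l2norm ?M (\<lambda>x. f x + g x) \<le> l2norm ?M f + l2norm ?M g"
    by (rule l2norm_triangle[OF H1_onD(1)[OF f] H1_onD(1)[OF g]])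
  have "H1_norm_on a b (\<lambda>x. f x + g x) \<le>
      sqrt ((l2norm ?M f + l2norm ?M g)\<^sup>2 + (l2norm ?M ?f' + l2norm ?M ?g')\<^sup>2)"
    unfolding H1_norm_on_def L2_norm_on_l2norm
    using 1 2 by (intro real_sqrt_le_mono add_mono power_mono) auto
  also have "\<dots> \<le> H1_norm_on a b f + H1_norm_on a b g"
    unfolding H1_norm_on_def L2_norm_on_l2norm by (rule real_sqrt_sum_squares_triangle_ineq)
  finally show ?thesis .
qed

lemma H1_norm_on_cong_AE:
  assumes "a < b" "f \<in> H1_on a b" "g \<in> borel_measurable (ivl a b)" "AE x in ivl a b. f x = g x"
  shows "g \<in> H1_on a b" "H1_norm_on a b g = H1_norm_on a b f"
proof -
  obtain F where F: "abs_cont a b F (weak_deriv a b f)" "AE x in ivl a b. f x = F x"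
    using H1_on_representative[OF assms(1,2)] by metis
  have c: "AE x in ivl a b. g x = F x" using F(2) assms(4) by eventually_elim simp
  show "g \<in> H1_on a b" by (rule H1_onI(1)[OF assms(1) F(1) H1_onD(2)[OF assms(2)] c assms(3)])
  have "(H1_norm_on a b g)\<^sup>2 = (H1_norm_on a b f)\<^sup>2"
    using H1_onI(3)[OF assms(1) F(1) H1_onD(2)[OF assms(2)] c assms(3)]
      H1_onI(3)[OF assms(1) F(1) H1_onD(2)[OF assms(2)] F(2)] H1_onD(1)[OF assms(2)] by simp
  then show "H1_norm_on a b g = H1_norm_on a b f" by (rule power2_eq_imp_eq) auto
qed

section \<open>Sobolev embedding, traces and bounded functionals\<close>

lemma abs_cont_diff_bound:
  assumes "abs_cont a b G h" "h \<in> sqint (ivl a b)" "x \<in> {a..b}" "y \<in> {a..b}"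
  shows "cmod (G x - G y) \<le> sqrt (b - a) * l2norm (ivl a b) h"
proof -
  interpret finite_measure "ivl a b" by (rule finite_measure_ivl)
  have *: "cmod (G x - G y) \<le> sqrt (b - a) * l2norm (ivl a b) h"
    if xy: "x \<in> {a..b}" "y \<in> {a..b}" "y \<le> x" for x y
  proof -
    have "abs_cont y b G h" by (rule abs_cont_sub[OF assms(1)]) (use xy in auto)
    from abs_cont_eq[OF this, of x] xy have "G x - G y = (LINT z|ivl y x. h z)" by simp
    then have "cmod (G x - G y) \<le> (LINT z|ivl y x. cmod (h z))" by simp
    also have "\<dots> \<le> (LINT z|ivl a b. cmod (h z))"
      by (rule integral_ivl_mono) (use xy sqint_integrable[OF assms(2)] in auto)
    also have "\<dots> \<le> sqrt (b - a) * l2norm (ivl a b) h"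
      using sqint_integral_norm_le[OF assms(2)] measure_ivl[of a b] xy by simp
    finally show ?thesis .
  qed
  show ?thesis
  proof (cases "y \<le> x")
    case False
    then show ?thesis using *[of y x] assms by (simp add: norm_minus_commute)
  qed (use * assms in simp)
qed

text \<open>The modulus at \<open>x\<close> exceeds that at \<open>y\<close> by at most the
  oscillation bound; this is averaged over \<open>y\<close>, and Cauchy-Schwarz bounds the average
  of the modulus.\<close>

lemma abs_cont_sup_bound:
  assumes "a < b" "abs_cont a b G h" "h \<in> sqint (ivl a b)" "x \<in> {a..b}"
  shows "cmod (G x) \<le> (1 / sqrt (b - a)) * l2norm (ivl a b) G + sqrt (b - a) * l2norm (ivl a b) h"
proof -
  interpret finite_measure "ivl a b" by (rule finite_measure_ivl)
  let ?D = "sqrt (b - a) * l2norm (ivl a b) h"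
  have G: "G \<in> sqint (ivl a b)" by (rule continuous_on_ivl_sqint[OF abs_cont_continuous[OF assms(2)]])
  have "cmod (G x) - ?D \<le> cmod (G y)" if "y \<in> {a..b}" for y
    using abs_cont_diff_bound[OF assms(2,3,4) that] norm_triangle_ineq2[of "G x" "G y"] by linarith
  then have "(LINT y|ivl a b. cmod (G x) - ?D) \<le> (LINT y|ivl a b. cmod (G y))"
    by (intro integral_mono) (use sqint_integrable[OF G] in auto)
  then have "(b - a) * (cmod (G x) - ?D) \<le> (LINT y|ivl a b. cmod (G y))"
    using measure_ivl[of a b] assms(1) by (simp add: lebesgue_integral_const)
  also have "\<dots> \<le> sqrt (b - a) * l2norm (ivl a b) G"
    using sqint_integral_norm_le[OF G] measure_ivl[of a b] assms(1) by simp
  finally have "cmod (G x) - ?D \<le> (sqrt (b - a) / (b - a)) * l2norm (ivl a b) G"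
    using assms(1) by (simp add: field_simps)
  also have "sqrt (b - a) / (b - a) = 1 / sqrt (b - a)"
    using assms(1) by (simp add: field_simps flip: power2_eq_square)
  finally show ?thesis by linarith
qed

text \<open>Constant of the embedding of the Sobolev space of the interval into the bounded
  functions. It blows up as the interval shrinks, and through it the position of the breakpoints
  enters the later constants.\<close>

definition sup_const :: "real \<Rightarrow> real \<Rightarrow> real" where
  "sup_const a b = 1 / sqrt (b - a) + sqrt (b - a)"

lemma sup_const_nonneg: "a < b \<Longrightarrow> 0 \<le> sup_const a b"
  by (simp add: sup_const_def)

lemma H1_sup_bound:
  assumes "a < b" "g \<in> H1_on a b" "abs_cont a b G (weak_deriv a b g)" "AE x in ivl a b. g x = G x" "x \<in> {a..b}"
  shows "cmod (G x) \<le> sup_const a b * H1_norm_on a b g"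
proof -
  have G: "G \<in> sqint (ivl a b)" by (rule continuous_on_ivl_sqint[OF abs_cont_continuous[OF assms(3)]])
  have "l2norm (ivl a b) G = l2norm (ivl a b) g"
    by (rule l2norm_cong_AE) (use assms(4) G H1_onD(1)[OF assms(2)] in auto)
  then have "cmod (G x) \<le> (1 / sqrt (b - a)) * l2norm (ivl a b) g + sqrt (b - a) * l2norm (ivl a b) (weak_deriv a b g)"
    using abs_cont_sup_bound[OF assms(1,3) H1_onD(2)[OF assms(2)] assms(5)] by simp
  also have "\<dots> \<le> (1 / sqrt (b - a)) * H1_norm_on a b g + sqrt (b - a) * H1_norm_on a b g"
    using assms(1) by (intro add_mono mult_left_mono l2norm_le_H1_norm_on) auto
  finally show ?thesis by (simp add: sup_const_def distrib_right)
qed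

text \<open>
  Boundary values of the continuous representative, written as integrals of the function and its
  weak derivative so that no choice of representative is needed.
\<close>

definition trace_right :: "real \<Rightarrow> real \<Rightarrow> cfun \<Rightarrow> complex" where
  "trace_right a b g =
     (LINT y|ivl a b. weak_deriv a b g y * of_real ((y - a) / (b - a)) + g y * of_real (1 / (b - a)))"

definition trace_left :: "real \<Rightarrow> real \<Rightarrow> cfun \<Rightarrow> complex" where
  "trace_left a b g =
     (LINT y|ivl a b. weak_deriv a b g y * of_real ((y - b) / (b - a)) + g y * of_real (1 / (b - a)))"

text \<open>The affine weight \<open>(y - a) / (b - a)\<close> is 0 at \<open>a\<close> and 1 at
  \<open>b\<close>, while \<open>(y - b) / (b - a)\<close> is -1 at \<open>a\<close> and 0 at
  \<open>b\<close>. Integration by parts against either of them leaves a single end point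
  value.\<close>

lemma trace_eq:
  assumes "a < b" "g \<in> H1_on a b" "abs_cont a b G h" "h \<in> sqint (ivl a b)" "AE x in ivl a b. g x = G x"
  shows "trace_right a b g = G b" "trace_left a b g = G a"
proof -
  have w: "AE x in ivl a b. weak_deriv a b g x = h x"
    by (rule H1_onI(2)[OF assms(1,3,4,5)]) (use H1_onD(1)[OF assms(2)] in simp)
  have lin: "abs_cont a b (\<lambda>x. complex_of_real ((x - c) / (b - a))) (\<lambda>x. of_real (1 / (b - a)))" for c
  proof (rule abs_cont_smooth)
    fix x
    have "((\<lambda>x. (x - c) / (b - a)) has_real_derivative (1 / (b - a))) (at x within {a..b})"
      using assms(1) by (auto intro!: derivative_eq_intros)
    then show "((\<lambda>x. complex_of_real ((x - c) / (b - a))) has_vector_derivative of_real (1 / (b - a))) (at x within {a..b})"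
      by (rule has_vector_derivative_of_real)
  qed (intro continuous_intros)
  have *: "(LINT y|ivl a b. weak_deriv a b g y * of_real ((y - c) / (b - a)) + g y * of_real (1 / (b - a)))
     = G b * of_real ((b - c) / (b - a)) - G a * of_real ((a - c) / (b - a))" for c
  proof -
    let ?l = "\<lambda>x. complex_of_real ((x - c) / (b - a))" and ?l' = "\<lambda>x::real. complex_of_real (1 / (b - a))"
    have m: "?l \<in> borel_measurable (ivl a b)" "G \<in> borel_measurable (ivl a b)"
      using continuous_on_ivl_measurable[OF abs_cont_continuous] lin assms(3) by blast+
    have m2: "weak_deriv a b g \<in> borel_measurable (ivl a b)" "h \<in> borel_measurable (ivl a b)"
      "g \<in> borel_measurable (ivl a b)"
      using H1_onD[OF assms(2)] assms(4) by auto
    have "(LINT y|ivl a b. weak_deriv a b g y * ?l y + g y * ?l' y) = (LINT y|ivl a b. h y * ?l y + G y * ?l' y)"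
    proof (rule integral_cong_AE)
      show "(\<lambda>y. weak_deriv a b g y * ?l y + g y * ?l' y) \<in> borel_measurable (ivl a b)"
        by (intro borel_measurable_add borel_measurable_times m m2 borel_measurable_const)
      show "(\<lambda>y. h y * ?l y + G y * ?l' y) \<in> borel_measurable (ivl a b)"
        by (intro borel_measurable_add borel_measurable_times m m2 borel_measurable_const)
      show "AE y in ivl a b. weak_deriv a b g y * ?l y + g y * ?l' y = h y * ?l y + G y * ?l' y"
        using w assms(5) by eventually_elim simp
    qed
    also have "\<dots> = G b * ?l b - G a * ?l a"
      using abs_cont_integration_by_parts[OF assms(3) lin[of c]] assms(1) by simp
    finally show ?thesis .
  qed
  show "trace_right a b g = G b" unfolding trace_right_def *[of a] using assms(1) by simp
  have "(a - b) / (b - a) = -1" using assms(1) by (simp add: field_simps)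
  then show "trace_left a b g = G a" unfolding trace_left_def *[of b] by simp
qed

text \<open>Bounded linear functionals on representatives; they serve to express weak measurability
  in time. Independence of the representative follows from linearity and the bound, since a function
  that vanishes almost everywhere has norm zero.\<close>

definition H1_functional :: "real \<Rightarrow> real \<Rightarrow> (cfun \<Rightarrow> complex) \<Rightarrow> bool" where
  "H1_functional a b \<Lambda> \<longleftrightarrow>
     (\<forall>f\<in>H1_on a b. \<forall>g\<in>H1_on a b. \<Lambda> (\<lambda>x. f x + g x) = \<Lambda> f + \<Lambda> g) \<and>
     (\<forall>f\<in>H1_on a b. \<forall>c. \<Lambda> (\<lambda>x. c * f x) = c * \<Lambda> f) \<and>
     (\<exists>C\<ge>0. \<forall>f\<in>H1_on a b. cmod (\<Lambda> f) \<le> C * H1_norm_on a b f)"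

lemma H1_functional_diff:
  assumes "H1_functional a b \<Lambda>" "a < b" "f \<in> H1_on a b" "g \<in> H1_on a b"
  shows "\<Lambda> (\<lambda>x. f x - g x) = \<Lambda> f - \<Lambda> g"
proof -
  have "\<Lambda> (\<lambda>x. f x + (-1) * g x) = \<Lambda> f + (-1) * \<Lambda> g"
    using assms H1_on_cmult(1)[OF assms(2,4), of "-1"] unfolding H1_functional_def by metis
  then show ?thesis by simp
qed

lemma trace_bound:
  assumes "a < b" "g \<in> H1_on a b"
  shows "cmod (trace_right a b g) \<le> sup_const a b * H1_norm_on a b g"
    "cmod (trace_left a b g) \<le> sup_const a b * H1_norm_on a b g"
proof -
  obtain G where G: "abs_cont a b G (weak_deriv a b g)" "AE x in ivl a b. g x = G x"
    using H1_on_representative[OF assms] by blast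
  show "cmod (trace_right a b g) \<le> sup_const a b * H1_norm_on a b g"
    "cmod (trace_left a b g) \<le> sup_const a b * H1_norm_on a b g"
    using trace_eq[OF assms G(1) H1_onD(2)[OF assms(2)] G(2)] H1_sup_bound[OF assms G] assms(1) by auto
qed

lemma H1_functional_trace:
  assumes "a < b"
  shows "H1_functional a b (trace_right a b)" "H1_functional a b (trace_left a b)"
proof -
  have add: "trace_right a b (\<lambda>x. f x + g x) = trace_right a b f + trace_right a b g"
    "trace_left a b (\<lambda>x. f x + g x) = trace_left a b f + trace_left a b g"
    if f: "f \<in> H1_on a b" and g: "g \<in> H1_on a b" for f g
  proof -
    obtain F where F: "abs_cont a b F (weak_deriv a b f)" "AE x in ivl a b. f x = F x"
      using H1_on_representative[OF assms f] by blast
    obtain G where G: "abs_cont a b G (weak_deriv a b g)" "AE x in ivl a b. g x = G x"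
      using H1_on_representative[OF assms g] by blast
    have "AE x in ivl a b. f x + g x = F x + G x" using F(2) G(2) by eventually_elim simp
    note T = trace_eq[OF assms H1_on_add[OF assms f g] abs_cont_add[OF F(1) G(1)]
        sqint_add[OF H1_onD(2)[OF f] H1_onD(2)[OF g]] this]
    note TF = trace_eq[OF assms f F(1) H1_onD(2)[OF f] F(2)]
    note TG = trace_eq[OF assms g G(1) H1_onD(2)[OF g] G(2)]
    show "trace_right a b (\<lambda>x. f x + g x) = trace_right a b f + trace_right a b g"
      "trace_left a b (\<lambda>x. f x + g x) = trace_left a b f + trace_left a b g"
      unfolding T TF TG by simp_all
  qed
  have cm: "trace_right a b (\<lambda>x. c * f x) = c * trace_right a b f"
    "trace_left a b (\<lambda>x. c * f x) = c * trace_left a b f"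
    if f: "f \<in> H1_on a b" for f c
  proof -
    obtain F where F: "abs_cont a b F (weak_deriv a b f)" "AE x in ivl a b. f x = F x"
      using H1_on_representative[OF assms f] by blast
    have "AE x in ivl a b. c * f x = c * F x" using F(2) by eventually_elim simp
    note T = trace_eq[OF assms H1_on_cmult(1)[OF assms f] abs_cont_cmult[OF F(1)]
        sqint_cmult[OF H1_onD(2)[OF f]] this]
    note TF = trace_eq[OF assms f F(1) H1_onD(2)[OF f] F(2)]
    show "trace_right a b (\<lambda>x. c * f x) = c * trace_right a b f"
      "trace_left a b (\<lambda>x. c * f x) = c * trace_left a b f"
      unfolding T TF by simp_all
  qed
  show "H1_functional a b (trace_right a b)" "H1_functional a b (trace_left a b)"
    unfolding H1_functional_def using add cm trace_bound[OF assms] sup_const_nonneg[OF assms]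
    by blast+
qed

lemma H1_functional_integral:
  assumes "a < b" "\<phi> \<in> sqint (ivl a b)"
  shows "H1_functional a b (\<lambda>g. LINT x|ivl a b. g x * \<phi> x)"
  unfolding H1_functional_def
proof (intro conjI ballI allI exI[of _ "l2norm (ivl a b) \<phi>"])
  fix f g assume fg: "f \<in> H1_on a b" "g \<in> H1_on a b"
  show "(LINT x|ivl a b. (f x + g x) * \<phi> x) = (LINT x|ivl a b. f x * \<phi> x) + (LINT x|ivl a b. g x * \<phi> x)"
    using sqint_mult[OF H1_onD(1)[OF fg(1)] assms(2)] sqint_mult[OF H1_onD(1)[OF fg(2)] assms(2)]
    by (simp add: distrib_right)
next
  fix f c assume f: "f \<in> H1_on a b"
  show "(LINT x|ivl a b. c * f x * \<phi> x) = c * (LINT x|ivl a b. f x * \<phi> x)"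
    by (simp add: mult.assoc)
next
  fix f assume f: "f \<in> H1_on a b"
  have "cmod (LINT x|ivl a b. f x * \<phi> x) \<le> l2norm (ivl a b) f * l2norm (ivl a b) \<phi>"
    by (rule l2_Cauchy_Schwarz[OF H1_onD(1)[OF f] assms(2)])
  also have "\<dots> \<le> l2norm (ivl a b) \<phi> * H1_norm_on a b f"
    unfolding mult.commute[of "l2norm (ivl a b) f"]
    by (intro mult_left_mono l2norm_le_H1_norm_on) simp
  finally show "cmod (LINT x|ivl a b. f x * \<phi> x) \<le> l2norm (ivl a b) \<phi> * H1_norm_on a b f" .
qed simp

lemma H1_on_sub:
  assumes "a < b" "g \<in> H1_on a b" "a \<le> c" "c < d" "d \<le> b"
  shows "g \<in> H1_on c d" "H1_norm_on c d g \<le> H1_norm_on a b g"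
proof -
  obtain G where G: "abs_cont a b G (weak_deriv a b g)" "AE x in ivl a b. g x = G x"
    using H1_on_representative[OF assms(1,2)] by blast
  have s: "weak_deriv a b g \<in> sqint (ivl c d)"
    by (rule sqint_ivl_sub[OF H1_onD(2)[OF assms(2)] assms(3,5)])
  have m: "g \<in> borel_measurable (ivl c d)"
    by (rule measurable_ivl_sub[OF _ assms(3,5)]) (use H1_onD(1)[OF assms(2)] in simp)
  note R = H1_onI[OF assms(4) abs_cont_sub[OF G(1) assms(3,5)] s AE_ivl_sub[OF G(2) assms(3,5)] m]
  show "g \<in> H1_on c d" by (rule R(1))
  have GS: "G \<in> sqint (ivl a b)" by (rule continuous_on_ivl_sqint[OF abs_cont_continuous[OF G(1)]])
  have "(H1_norm_on c d g)\<^sup>2 \<le> (H1_norm_on a b g)\<^sup>2"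
    unfolding R(3) H1_onI(3)[OF assms(1) G(1) H1_onD(2)[OF assms(2)] G(2) sqintD(1)[OF H1_onD(1)[OF assms(2)]]]
    by (intro add_mono power_mono l2norm_ivl_sub GS H1_onD(2) assms) auto
  then show "H1_norm_on c d g \<le> H1_norm_on a b g" by (rule power2_le_imp_le) simp
qed

text \<open>Leibniz' rule with the continuous factor of each term bounded by the embedding. The
  product contributes one such bound and its derivative two, and \<open>1 + 4 \<le> 9\<close> gives
  the factor 3.\<close>

lemma H1_on_mult:
  assumes ab: "a < b" and f: "f \<in> H1_on a b" and g: "g \<in> H1_on a b"
  shows "(\<lambda>x. f x * g x) \<in> H1_on a b"
    "H1_norm_on a b (\<lambda>x. f x * g x) \<le> 3 * sup_const a b * H1_norm_on a b f * H1_norm_on a b g"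
proof -
  let ?M = "ivl a b" and ?f' = "weak_deriv a b f" and ?g' = "weak_deriv a b g"
  let ?nf = "H1_norm_on a b f" and ?ng = "H1_norm_on a b g" and ?S = "sup_const a b"
  obtain F where F: "abs_cont a b F ?f'" "AE x in ?M. f x = F x"
    using H1_on_representative[OF ab f] by blast
  obtain G where G: "abs_cont a b G ?g'" "AE x in ?M. g x = G x"
    using H1_on_representative[OF ab g] by blast
  have S: "0 \<le> ?S" by (rule sup_const_nonneg[OF ab])
  have mF: "F \<in> borel_measurable ?M" and mG: "G \<in> borel_measurable ?M"
    using continuous_on_ivl_measurable[OF abs_cont_continuous] F(1) G(1) by blast+
  have bF: "AE x in ?M. cmod (F x) \<le> ?S * ?nf"
    using AE_space by eventually_elim (rule H1_sup_bound[OF ab f F], simp)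
  have bG: "AE x in ?M. cmod (G x) \<le> ?S * ?ng"
    using AE_space by eventually_elim (rule H1_sup_bound[OF ab g G], simp)
  note 1 = sqint_mult_bounded[OF H1_onD(2)[OF f] mG bG]
  note 2 = sqint_mult_bounded[OF H1_onD(2)[OF g] mF bF]
  have GS: "G \<in> sqint ?M" by (rule continuous_on_ivl_sqint[OF abs_cont_continuous[OF G(1)]])
  note 3 = sqint_mult_bounded[OF GS mF bF]
  have s: "(\<lambda>x. ?f' x * G x + F x * ?g' x) \<in> sqint ?M"
    using sqint_add[OF 1(1) 2(1)] by (simp add: mult.commute)
  have e: "AE x in ?M. f x * g x = F x * G x" using F(2) G(2) by eventually_elim simp
  have m: "(\<lambda>x. f x * g x) \<in> borel_measurable ?M"
    using H1_onD(1)[OF f] H1_onD(1)[OF g] by measurable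
  note R = H1_onI[OF ab abs_cont_mult[OF F(1) G(1)] s e m]
  show "(\<lambda>x. f x * g x) \<in> H1_on a b" by (rule R(1))
  have nG: "l2norm ?M G = l2norm ?M g"
    by (rule l2norm_cong_AE) (use G(2) mG H1_onD(1)[OF g] in auto)
  have "l2norm ?M (\<lambda>x. F x * G x) \<le> ?S * ?nf * l2norm ?M G" by (rule 3)
  also have "\<dots> \<le> ?S * ?nf * ?ng" unfolding nG
    using S by (intro mult_left_mono l2norm_le_H1_norm_on) auto
  finally have A: "l2norm ?M (\<lambda>x. F x * G x) \<le> ?S * ?nf * ?ng" .
  have "l2norm ?M (\<lambda>x. ?f' x * G x + F x * ?g' x) \<le> l2norm ?M (\<lambda>x. G x * ?f' x) + l2norm ?M (\<lambda>x. F x * ?g' x)"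
    using l2norm_triangle[OF 1(1) 2(1)] by (simp add: mult.commute)
  also have "\<dots> \<le> ?S * ?ng * l2norm ?M ?f' + ?S * ?nf * l2norm ?M ?g'"
    by (rule add_mono[OF 1(2) 2(2)])
  also have "\<dots> \<le> ?S * ?ng * ?nf + ?S * ?nf * ?ng"
    using S by (intro add_mono mult_left_mono l2norm_le_H1_norm_on) auto
  finally have B: "l2norm ?M (\<lambda>x. ?f' x * G x + F x * ?g' x) \<le> 2 * (?S * ?nf * ?ng)"
    by (simp add: algebra_simps)
  define P where "P = ?S * ?nf * ?ng"
  have P: "0 \<le> P" unfolding P_def using S by simp
  have "(H1_norm_on a b (\<lambda>x. f x * g x))\<^sup>2 \<le> P\<^sup>2 + (2 * P)\<^sup>2"
    unfolding R(3) using A B by (intro add_mono power_mono) (auto simp: P_def)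
  also have "\<dots> \<le> (3 * P)\<^sup>2" using P by (simp add: power_mult_distrib)
  finally have "H1_norm_on a b (\<lambda>x. f x * g x) \<le> 3 * P" by (rule power2_le_imp_le) (use P in simp)
  then show "H1_norm_on a b (\<lambda>x. f x * g x) \<le> 3 * ?S * ?nf * ?ng"
    by (simp add: P_def mult.assoc)
qed

text \<open>
  The expansion behind the smoothing effect: up to a factor $k$, the cosine coefficients consist
  of boundary terms, which are bounded but not square summable, and sine coefficients of the weak
  derivative, which are square summable.
\<close>

lemma cosine_coefficient_by_parts:
  assumes "a < b" "g \<in> H1_on a b"
  shows "of_real (real k * pi) * (LINT x|ivl a b. g x * of_real (cos (real k * pi * x))) =
    trace_right a b g * of_real (sin (real k * pi * b)) - trace_left a b g * of_real (sin (real k * pi * a))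
    - (LINT x|ivl a b. weak_deriv a b g x * of_real (sin (real k * pi * x)))"
proof -
  obtain G where G: "abs_cont a b G (weak_deriv a b g)" "AE x in ivl a b. g x = G x"
    using H1_on_representative[OF assms] by blast
  have s: "abs_cont a b (\<lambda>x. complex_of_real (sin (real k * pi * x))) (\<lambda>x. of_real (real k * pi * cos (real k * pi * x)))"
  proof (rule abs_cont_smooth)
    fix x
    have "((\<lambda>x. sin (real k * pi * x)) has_real_derivative (real k * pi * cos (real k * pi * x))) (at x within {a..b})"
      by (auto intro!: derivative_eq_intros)
    then show "((\<lambda>x. complex_of_real (sin (real k * pi * x))) has_vector_derivative
        of_real (real k * pi * cos (real k * pi * x))) (at x within {a..b})"
      by (rule has_vector_derivative_of_real)
  qed (intro continuous_intros)
  have "(LINT x|ivl a b. g x * of_real (cos (real k * pi * x))) = (LINT x|ivl a b. G x * of_real (cos (real k * pi * x)))"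
  proof (rule integral_cong_AE)
    have c: "(\<lambda>x. complex_of_real (cos (real k * pi * x))) \<in> borel_measurable (ivl a b)"
      by (intro continuous_on_ivl_measurable continuous_intros)
    show "(\<lambda>x. g x * of_real (cos (real k * pi * x))) \<in> borel_measurable (ivl a b)"
      "(\<lambda>x. G x * of_real (cos (real k * pi * x))) \<in> borel_measurable (ivl a b)"
      using c H1_onD(1)[OF assms(2)] continuous_on_ivl_measurable[OF abs_cont_continuous[OF G(1)]]
      by (intro borel_measurable_times; simp)+
    show "AE x in ivl a b. g x * of_real (cos (real k * pi * x)) = G x * of_real (cos (real k * pi * x))"
      using G(2) by eventually_elim simp
  qed
  then have "of_real (real k * pi) * (LINT x|ivl a b. g x * of_real (cos (real k * pi * x))) =
      (LINT x|ivl a b. G x * of_real (real k * pi * cos (real k * pi * x)))"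
    by (simp add: mult.left_commute flip: integral_mult_right_zero)
  also have "\<dots> = G b * of_real (sin (real k * pi * b)) - G a * of_real (sin (real k * pi * a))
    - (LINT x|ivl a b. weak_deriv a b g x * of_real (sin (real k * pi * x)))"
    using abs_cont_integration_by_parts(1)[OF G(1) s] assms(1) by (simp add: algebra_simps)
  finally show ?thesis
    using trace_eq[OF assms G(1) H1_onD(2)[OF assms(2)] G(2)] by simp
qed

section \<open>Cosine series\<close>

abbreviation "I01 \<equiv> ivl 0 1"

lemma ivl_real_integrable:
  fixes h :: "real \<Rightarrow> real"
  assumes "continuous_on {a..b} h" shows "integrable (ivl a b) h"
proof -
  interpret finite_measure "ivl a b" by (rule finite_measure_ivl)
  have "integrable (ivl a b) (\<lambda>x. complex_of_real (h x))"
    by (intro sqint_integrable continuous_on_ivl_sqint continuous_intros assms)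
  then show ?thesis by (simp add: complex_of_real_integrable_eq)
qed

lemma integral_cos_int:
  "(LINT x|I01. cos (of_int m * pi * x)) = (if m = 0 then 1 else 0)"
proof (cases "m = 0")
  case True
  then show ?thesis using measure_ivl[of 0 1] by (simp add: lebesgue_integral_const)
next
  case False
  have "((\<lambda>x. cos (of_int m * pi * x)) has_integral
      (sin (of_int m * pi * 1) / (of_int m * pi) - sin (of_int m * pi * 0) / (of_int m * pi))) {0..1}"
    using False by (intro fundamental_theorem_of_calculus)
      (auto intro!: derivative_eq_intros simp: has_real_derivative_iff_has_vector_derivative[symmetric])
  moreover have "sin (of_int m * pi) = 0" by (simp add: sin_times_pi_eq_0)
  ultimately have "integral {0..1} (\<lambda>x. cos (of_int m * pi * x)) = 0"
    by (intro integral_unique) simp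
  then show ?thesis using False
    by (subst integral_ivl_HK_real) (auto intro!: continuous_intros)
qed

lemma integral_cos_cos:
  "(LINT x|I01. cos (real j * pi * x) * cos (real k * pi * x)) =
     (if j = k then if j = 0 then 1 else 1 / 2 else 0)"
proof -
  have "(LINT x|I01. cos (real j * pi * x) * cos (real k * pi * x)) =
      (LINT x|I01. (cos (of_int (int j - int k) * pi * x) + cos (of_int (int j + int k) * pi * x)) / 2)"
    by (rule Bochner_Integration.integral_cong[OF refl])
       (simp add: cos_times_cos left_diff_distrib distrib_right)
  also have "\<dots> = ((LINT x|I01. cos (of_int (int j - int k) * pi * x)) +
      (LINT x|I01. cos (of_int (int j + int k) * pi * x))) / 2"
    by (subst Bochner_Integration.integral_add[symmetric])
       (auto intro!: ivl_real_integrable continuous_intros)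
  finally show ?thesis by (simp only: integral_cos_int) auto
qed

lemma integral_sin_sin:
  "(LINT x|I01. sin (real (Suc j) * pi * x) * sin (real (Suc k) * pi * x)) = (if j = k then 1 / 2 else 0)"
proof -
  have "(LINT x|I01. sin (real (Suc j) * pi * x) * sin (real (Suc k) * pi * x)) =
      (LINT x|I01. (cos (of_int (int j - int k) * pi * x) - cos (of_int (int j + int k + 2) * pi * x)) / 2)"
    by (rule Bochner_Integration.integral_cong[OF refl])
       (simp add: sin_times_sin algebra_simps)
  also have "\<dots> = ((LINT x|I01. cos (of_int (int j - int k) * pi * x)) -
      (LINT x|I01. cos (of_int (int j + int k + 2) * pi * x))) / 2"
    by (subst Bochner_Integration.integral_diff[symmetric])
       (auto intro!: ivl_real_integrable continuous_intros)
  finally show ?thesis by (simp only: integral_cos_int) simp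
qed

definition sinfun :: "nat \<Rightarrow> cfun" where
  "sinfun k x = of_real (sqrt 2 * sin (real (Suc k) * pi * x))"

definition cos_norm :: "nat \<Rightarrow> real" where
  "cos_norm k = (if k = 0 then 1 else sqrt 2)"

lemma eigfun_eq: "eigfun k x = of_real (cos_norm k * cos (real k * pi * x))"
  by (simp add: eigfun_def cos_norm_def)

lemma continuous_on_eigfun [continuous_intros]: "continuous_on S (eigfun k)"
  unfolding eigfun_eq[abs_def] by (intro continuous_intros)

lemma continuous_on_sinfun [continuous_intros]: "continuous_on S (sinfun k)"
  unfolding sinfun_def[abs_def] by (intro continuous_intros)

lemma eigfun_bound: "cmod (eigfun k x) \<le> sqrt 2"
proof -
  have "\<bar>cos_norm k\<bar> * \<bar>cos (real k * pi * x)\<bar> \<le> sqrt 2 * 1"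
    by (intro mult_mono) (auto simp: cos_norm_def)
  then show ?thesis by (simp add: eigfun_eq abs_mult del: of_real_mult)
qed

lemma eigfun_sqint: "eigfun k \<in> sqint I01"
  by (intro continuous_on_ivl_sqint continuous_intros)

lemma sinfun_sqint: "sinfun k \<in> sqint I01"
  by (intro continuous_on_ivl_sqint continuous_intros)

lemma cnj_eigfun [simp]: "cnj (eigfun k x) = eigfun k x"
  by (simp add: eigfun_eq)

lemma cnj_sinfun [simp]: "cnj (sinfun k x) = sinfun k x"
  by (simp add: sinfun_def)

lemma orthogonal_family_eigfun: "orthogonal_family I01 eigfun 1"
  unfolding orthogonal_family_def
proof (intro conjI allI)
  fix j k
  have "l2inner I01 (eigfun j) (eigfun k) =
      (LINT x|I01. complex_of_real (cos_norm j * cos_norm k * (cos (real j * pi * x) * cos (real k * pi * x))))"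
    unfolding l2inner_def cnj_eigfun by (rule Bochner_Integration.integral_cong) (auto simp: eigfun_eq)
  also have "\<dots> = of_real (cos_norm j * cos_norm k * (LINT x|I01. cos (real j * pi * x) * cos (real k * pi * x)))"
    by (simp only: integral_complex_of_real integral_mult_right_zero)
  finally show "l2inner I01 (eigfun j) (eigfun k) = (if j = k then of_real 1 else 0)"
    by (simp only: integral_cos_cos) (auto simp: cos_norm_def simp flip: of_real_mult)
qed (auto intro: eigfun_sqint)

lemma orthogonal_family_sinfun: "orthogonal_family I01 sinfun 1"
  unfolding orthogonal_family_def
proof (intro conjI allI)
  fix j k
  have "l2inner I01 (sinfun j) (sinfun k) =
      (LINT x|I01. complex_of_real (2 * (sin (real (Suc j) * pi * x) * sin (real (Suc k) * pi * x))))"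
    unfolding l2inner_def cnj_sinfun
    by (rule Bochner_Integration.integral_cong) (auto simp: sinfun_def simp flip: of_real_mult)
  also have "\<dots> = of_real (2 * (LINT x|I01. sin (real (Suc j) * pi * x) * sin (real (Suc k) * pi * x)))"
    by (simp only: integral_complex_of_real integral_mult_right_zero)
  finally show "l2inner I01 (sinfun j) (sinfun k) = (if j = k then of_real 1 else 0)"
    by (simp only: integral_sin_sin) simp
qed (auto intro: sinfun_sqint)

text \<open>The span of the cosines consists of the polynomials in \<open>cos (pi * x)\<close>. A
  test function is a continuous function of \<open>cos (pi * x)\<close>, hence a uniform limit of
  such polynomials by Stone-Weierstrass, and the fundamental lemma concludes.\<close>

lemma cosine_complete:
  assumes w: "w \<in> sqint I01" and orth: "\<And>k. l2inner I01 w (eigfun k) = 0"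
  shows "AE x in I01. w x = 0"
proof -
  interpret finite_measure I01 by (rule finite_measure_ivl)
  have iw: "integrable I01 w" using w by (rule sqint_integrable)
  have i: "integrable I01 (\<lambda>x. w x * of_real (f x))" if "continuous_on {0..1} f" for f
    by (intro integrable_ivl_mult_continuous iw continuous_intros that)
  have cos0: "(LINT x|I01. w x * of_real (cos (real k * pi * x))) = 0" for k
  proof -
    have "0 = (LINT x|I01. of_real (cos_norm k) * (w x * of_real (cos (real k * pi * x))))"
      using orth[of k] unfolding l2inner_def cnj_eigfun by (simp add: eigfun_eq mult_ac)
    also have "\<dots> = of_real (cos_norm k) * (LINT x|I01. w x * of_real (cos (real k * pi * x)))"
      by (rule integral_mult_right_zero)
    finally show ?thesis by (auto simp: cos_norm_def split: if_splits)
  qed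
  \<comment> \<open>The extra factor \<open>cos (real k * pi * x)\<close> with arbitrary
    \<open>k\<close> makes the induction work: the product formula trades one power of
    \<open>cos (pi * x)\<close> for the two neighbouring frequencies.\<close>
  have pow: "(LINT x|I01. w x * of_real ((cos (pi * x))^n * cos (real k * pi * x))) = 0" for n k
  proof (induction n arbitrary: k)
    case 0
    then show ?case using cos0 by simp
  next
    case (Suc n)
    show ?case
    proof (cases k)
      case 0
      then show ?thesis using Suc.IH[of 1] by (simp add: mult.commute)
    next
      case (Suc j)
      have e: "cos (pi * x) * cos (real (Suc j) * pi * x) =
          (cos (real j * pi * x) + cos (real (Suc (Suc j)) * pi * x)) / 2" for x
        by (subst mult.commute, subst cos_times_cos) (simp add: algebra_simps)
      have "(LINT x|I01. w x * of_real ((cos (pi * x))^Suc n * cos (real k * pi * x))) =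
          (LINT x|I01. (w x * of_real ((cos (pi * x))^n * cos (real j * pi * x)) +
            w x * of_real ((cos (pi * x))^n * cos (real (Suc (Suc j)) * pi * x))) / 2)"
      proof (rule Bochner_Integration.integral_cong[OF refl])
        fix x
        have "(cos (pi * x))^Suc n * cos (real k * pi * x) =
          ((cos (pi * x))^n * cos (real j * pi * x) + (cos (pi * x))^n * cos (real (Suc (Suc j)) * pi * x)) / 2"
          using e[of x] unfolding Suc power_Suc
          by (simp only: mult.assoc mult.left_commute[of "cos (pi * x)"]) (simp add: distrib_left)
        then show "w x * of_real ((cos (pi * x))^Suc n * cos (real k * pi * x)) =
          (w x * of_real ((cos (pi * x))^n * cos (real j * pi * x)) +
            w x * of_real ((cos (pi * x))^n * cos (real (Suc (Suc j)) * pi * x))) / 2"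
          by (simp only: of_real_add of_real_divide of_real_numeral distrib_left times_divide_eq_right)
      qed
      also have "\<dots> = ((LINT x|I01. w x * of_real ((cos (pi * x))^n * cos (real j * pi * x))) +
            (LINT x|I01. w x * of_real ((cos (pi * x))^n * cos (real (Suc (Suc j)) * pi * x)))) / 2"
        by (subst Bochner_Integration.integral_add[symmetric])
           (auto intro!: i continuous_intros simp del: of_real_mult of_real_power)
      finally show ?thesis by (simp only: Suc.IH) simp
    qed
  qed
  have poly: "(LINT x|I01. w x * of_real (p (cos (pi * x)))) = 0" if "real_polynomial_function p" for p
  proof -
    obtain a n where p: "p = (\<lambda>x. \<Sum>i\<le>n::nat. a i * x^i)"
      using real_polynomial_function_imp_sum[OF \<open>real_polynomial_function p\<close>] by blast
    have "(LINT x|I01. w x * of_real (p (cos (pi * x)))) =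
        (LINT x|I01. (\<Sum>i\<le>n. of_real (a i) * (w x * of_real ((cos (pi * x))^i * cos (real 0 * pi * x)))))"
      unfolding p by (rule Bochner_Integration.integral_cong) (auto simp: sum_distrib_left mult_ac)
    also have "\<dots> = (\<Sum>i\<le>n. LINT x|I01. of_real (a i) * (w x * of_real ((cos (pi * x))^i * cos (real 0 * pi * x))))"
      by (rule Bochner_Integration.integral_sum)
         (intro integrable_mult_right i continuous_intros)
    also have "\<dots> = 0" unfolding integral_mult_right_zero pow by simp
    finally show ?thesis .
  qed
  show ?thesis
  proof (rule fundamental_lemma[OF iw])
    fix \<phi> \<phi>' assume t: "test_fun 0 1 \<phi> \<phi>'"
    \<comment> \<open>On \<open>{0..1}\<close> the map \<open>x \<mapsto> cos (pi * x)\<close> is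
      injective, so \<open>arccos\<close> expresses the test function through it.\<close>
    define F where "F y = \<phi> (arccos y / pi)" for y
    have F: "F (cos (pi * x)) = \<phi> x" if "x \<in> {0..1}" for x
    proof -
      have "arccos (cos (pi * x)) = pi * x" using that by (intro arccos_cos) (auto intro: mult_left_le)
      then show ?thesis by (simp add: F_def)
    qed
    have cF: "continuous_on {-1..1} F"
      unfolding F_def by (rule continuous_on_compose2[OF test_fun_continuous(1)[OF t, of UNIV]])
        (auto intro!: continuous_intros)
    let ?J = "LINT x|I01. w x * of_real (\<phi> x)"
    define W where "W = (LINT x|I01. cmod (w x))"
    have W: "0 \<le> W" unfolding W_def by simp
    have *: "cmod ?J \<le> e * W" if e: "0 < e" for e
    proof -
      obtain p where p: "real_polynomial_function p" "\<And>y. y \<in> {-1..1} \<Longrightarrow> \<bar>F y - p y\<bar> < e"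
        using Stone_Weierstrass_real_polynomial_function[OF _ cF e] by auto
      have cp: "continuous_on {0..1} (\<lambda>x. p (cos (pi * x)))"
        by (rule continuous_on_compose2[OF continuous_on_polymonial_function[of p UNIV]])
           (use p(1) in \<open>auto simp: real_polynomial_function_eq intro!: continuous_intros\<close>)
      have c\<phi>: "continuous_on {0..1} \<phi>" by (rule test_fun_continuous[OF t])
      have "?J = ?J - (LINT x|I01. w x * of_real (p (cos (pi * x))))" using poly[OF p(1)] by simp
      also have "\<dots> = (LINT x|I01. w x * of_real (\<phi> x - p (cos (pi * x))))"
        using i[OF c\<phi>] i[OF cp] by (simp add: right_diff_distrib)
      finally have "cmod ?J \<le> (LINT x|I01. cmod (w x * of_real (\<phi> x - p (cos (pi * x)))))"
        by simp
      also have "\<dots> \<le> (LINT x|I01. e * cmod (w x))"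
      proof (rule integral_mono)
        show "integrable I01 (\<lambda>x. cmod (w x * of_real (\<phi> x - p (cos (pi * x)))))"
          by (intro integrable_norm i continuous_on_diff c\<phi> cp)
        fix x :: real assume "x \<in> space I01"
        then have x: "x \<in> {0..1}" by auto
        have "\<bar>\<phi> x - p (cos (pi * x))\<bar> \<le> e" using p(2)[of "cos (pi * x)"] F[OF x] by auto
        then have "cmod (w x) * \<bar>\<phi> x - p (cos (pi * x))\<bar> \<le> cmod (w x) * e"
          by (intro mult_left_mono) auto
        then show "cmod (w x * of_real (\<phi> x - p (cos (pi * x)))) \<le> e * cmod (w x)"
          by (simp add: norm_mult mult.commute del: of_real_diff)
      qed (use iw in simp)
      also have "\<dots> = e * W" by (simp add: W_def)
      finally show ?thesis .
    qed
    have "cmod ?J \<le> 0 + d" if d: "0 < d" for d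
    proof -
      have "cmod ?J \<le> d / (W + 1) * W" by (rule *) (use d W in simp)
      also have "\<dots> \<le> d" using d W by (simp add: field_simps)
      finally show ?thesis by simp
    qed
    then have "cmod ?J \<le> 0" by (rule field_le_epsilon)
    then show "?J = 0" by simp
  qed
qed

section \<open>Cosine coefficients and Parseval's identity\<close>

lemma L2_inner_l2inner: "L2_inner f g = l2inner I01 f g"
  by (simp add: L2_inner_def l2inner_def)

definition coef :: "cfun \<Rightarrow> nat \<Rightarrow> complex" where
  "coef g k = L2_inner g (eigfun k)"

lemma coef_l2inner: "coef g k = l2inner I01 g (eigfun k)"
  by (simp add: coef_def L2_inner_l2inner)

lemma coef_integral: "coef g k = (LINT x|I01. g x * eigfun k x)"
  by (simp add: coef_def L2_inner_def)

lemma coef_diff: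
  assumes "f \<in> sqint I01" "g \<in> sqint I01"
  shows "coef (\<lambda>x. f x - g x) k = coef f k - coef g k"
  unfolding coef_l2inner by (rule l2inner_diff_left[OF assms eigfun_sqint])

lemma coef_cmult: "coef (\<lambda>x. c * f x) k = c * coef f k"
  unfolding coef_l2inner by (rule l2inner_cmult_left)

lemma coef_cong_AE:
  assumes "AE x in I01. f x = g x" "f \<in> borel_measurable I01" "g \<in> borel_measurable I01"
  shows "coef f k = coef g k"
proof -
  have e: "eigfun k \<in> borel_measurable I01" using eigfun_sqint[of k] by simp
  show ?thesis unfolding coef_integral
    by (rule integral_cong_AE)
       (use assms e in \<open>auto intro!: borel_measurable_times\<close>)
qed

lemma coef_eq_imp_AE:
  assumes "f \<in> sqint I01" "g \<in> sqint I01" "\<And>k. coef f k = coef g k"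
  shows "AE x in I01. f x = g x"
proof -
  have "AE x in I01. f x - g x = 0"
    by (rule cosine_complete[OF sqint_diff[OF assms(1,2)]])
       (use coef_diff[OF assms(1,2)] assms(3) in \<open>simp add: coef_l2inner\<close>)
  then show ?thesis by simp
qed

lemma coef_summable:
  assumes "g \<in> sqint I01" shows "summable (\<lambda>k. (cmod (coef g k))\<^sup>2)"
  unfolding coef_l2inner by (rule bessel(1)[OF orthogonal_family_eigfun assms])

lemma coef_bound:
  assumes "g \<in> sqint I01" shows "cmod (coef g k) \<le> l2norm I01 g"
  unfolding coef_l2inner using l2inner_bound[OF assms eigfun_sqint[of k]]
    orthogonal_familyD(4)[OF orthogonal_family_eigfun, of k] by simp

lemma cosine_series_exists:
  assumes "summable (\<lambda>k. (cmod (c k))\<^sup>2)"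
  shows "\<exists>h\<in>sqint I01. (\<forall>k. coef h k = c k) \<and>
    (\<lambda>n. l2norm I01 (\<lambda>x. h x - (\<Sum>k<n. c k * eigfun k x))) \<longlonglongrightarrow> 0"
proof -
  interpret finite_measure I01 by (rule finite_measure_ivl)
  obtain h where h: "h \<in> sqint I01"
    "(\<lambda>n. l2norm I01 (\<lambda>x. h x - (\<Sum>k<n. c k * eigfun k x))) \<longlonglongrightarrow> 0"
    using riesz_fischer[OF orthogonal_family_eigfun assms] by blast
  have "coef h k = c k" for k
    using orthogonal_series_l2inner[OF orthogonal_family_eigfun h] by (simp add: coef_l2inner)
  with h show ?thesis by auto
qed

text \<open>Riesz-Fischer produces some function with the coefficients of \<open>g\<close>, and
  completeness identifies it with \<open>g\<close>.\<close>

lemma cosine_expansion: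
  assumes "g \<in> sqint I01"
  shows "(\<lambda>n. l2norm I01 (\<lambda>x. g x - (\<Sum>k<n. coef g k * eigfun k x))) \<longlonglongrightarrow> 0"
proof -
  obtain h where h: "h \<in> sqint I01" "\<And>k. coef h k = coef g k"
    "(\<lambda>n. l2norm I01 (\<lambda>x. h x - (\<Sum>k<n. coef g k * eigfun k x))) \<longlonglongrightarrow> 0"
    using cosine_series_exists[OF coef_summable[OF assms]] by auto
  have e: "AE x in I01. h x = g x" by (rule coef_eq_imp_AE[OF h(1) assms h(2)])
  have s: "(\<lambda>x. \<Sum>k<n. coef g k * eigfun k x) \<in> sqint I01" for n
    by (rule orthogonal_family_sum_sqint[OF orthogonal_family_eigfun])
  have "l2norm I01 (\<lambda>x. g x - (\<Sum>k<n. coef g k * eigfun k x)) =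
      l2norm I01 (\<lambda>x. h x - (\<Sum>k<n. coef g k * eigfun k x))" for n
  proof (rule l2norm_cong_AE)
    show "AE x in I01. g x - (\<Sum>k<n. coef g k * eigfun k x) = h x - (\<Sum>k<n. coef g k * eigfun k x)"
      using e by eventually_elim simp
  qed (use sqint_diff[OF assms s] sqint_diff[OF h(1) s] in auto)
  then show ?thesis using h(3) by simp
qed

lemma parseval:
  assumes "g \<in> sqint I01"
  shows "(\<lambda>k. (cmod (coef g k))\<^sup>2) sums (l2norm I01 g)\<^sup>2"
  using orthogonal_series_l2norm[OF orthogonal_family_eigfun assms cosine_expansion[OF assms]] by simp

section \<open>Spectral description of the Sobolev space on the unit interval\<close>

definition weight :: "nat \<Rightarrow> real" where "weight k = (if k = 0 then 1 else real k)"

lemma weight_ge_1: "1 \<le> weight k" by (simp add: weight_def)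

text \<open>These are the coordinates in which the equation is solved: with
  \<open>weight 0 = 1\<close> for the mean and \<open>weight k = k\<close> otherwise, the square sum
  of \<open>wcoef g\<close> is the square of \<open>H1_norm g\<close>.\<close>

definition wcoef :: "cfun \<Rightarrow> nat \<Rightarrow> complex" where
  "wcoef g k = of_real (weight k) * coef g k"

abbreviation nat_measure :: "nat measure" where "nat_measure \<equiv> count_space UNIV"

lemma H1_norm_wcoef:
  assumes "wcoef g \<in> sqint nat_measure"
  shows "H1_norm g = l2norm nat_measure (wcoef g)"
proof -
  have s: "summable (\<lambda>k. (cmod (wcoef g k))\<^sup>2)" using assms by (simp add: sqint_count_space)
  have "(\<Sum>k. (cmod (wcoef g k))\<^sup>2) = (cmod (wcoef g 0))\<^sup>2 + (\<Sum>k. (cmod (wcoef g (Suc k)))\<^sup>2)"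
    using suminf_split_head[OF s] by simp
  then show ?thesis
    by (simp add: H1_norm_def l2norm_count_space[OF s] wcoef_def weight_def coef_def)
qed

text \<open>On the whole unit interval the boundary terms of the integration by parts vanish,
  because the sines do so at 0 and 1. What remains are sine coefficients of the weak derivative,
  which Bessel's inequality controls.\<close>

lemma H1_wcoef_sqint:
  assumes g: "g \<in> H1_on 0 1" shows "wcoef g \<in> sqint nat_measure"
proof -
  have "summable (\<lambda>k. (cmod (l2inner I01 (weak_deriv 0 1 g) (sinfun k)))\<^sup>2)"
    by (rule bessel(1)[OF orthogonal_family_sinfun H1_onD(2)[OF g]])
  then have s: "summable (\<lambda>k. (cmod (l2inner I01 (weak_deriv 0 1 g) (sinfun k)))\<^sup>2 / pi\<^sup>2)"
    by (rule summable_divide)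
  have "cmod (wcoef g (Suc k)) = cmod (l2inner I01 (weak_deriv 0 1 g) (sinfun k)) / pi" for k
  proof -
    have z: "sin (real (Suc k) * pi * 1) = 0" using sin_times_pi_eq_0[of "real (Suc k)"] by simp
    have "of_real (real (Suc k) * pi) * (LINT x|I01. g x * of_real (cos (real (Suc k) * pi * x))) =
        - (LINT x|I01. weak_deriv 0 1 g x * of_real (sin (real (Suc k) * pi * x)))"
      using cosine_coefficient_by_parts[OF _ g, of "Suc k"] unfolding z by simp
    then have "of_real (sqrt 2) * (of_real (real (Suc k) * pi) * (LINT x|I01. g x * of_real (cos (real (Suc k) * pi * x)))) =
        - (of_real (sqrt 2) * (LINT x|I01. weak_deriv 0 1 g x * of_real (sin (real (Suc k) * pi * x))))"
      by simp
    moreover have "of_real (sqrt 2) * (LINT x|I01. g x * of_real (cos (real (Suc k) * pi * x))) = coef g (Suc k)"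
      unfolding coef_integral integral_mult_right_zero[symmetric]
      by (rule Bochner_Integration.integral_cong) (simp_all add: eigfun_eq cos_norm_def)
    moreover have "of_real (sqrt 2) * (LINT x|I01. weak_deriv 0 1 g x * of_real (sin (real (Suc k) * pi * x)))
        = l2inner I01 (weak_deriv 0 1 g) (sinfun k)"
      unfolding l2inner_def integral_mult_right_zero[symmetric] cnj_sinfun
      by (rule Bochner_Integration.integral_cong) (simp_all add: sinfun_def)
    ultimately have "of_real pi * wcoef g (Suc k) = - l2inner I01 (weak_deriv 0 1 g) (sinfun k)"
      by (simp add: wcoef_def weight_def mult_ac)
    then have "pi * cmod (wcoef g (Suc k)) = cmod (l2inner I01 (weak_deriv 0 1 g) (sinfun k))"
      using norm_mult[of "of_real pi" "wcoef g (Suc k)"] by simp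
    then show ?thesis by (simp add: field_simps)
  qed
  then have "summable (\<lambda>k. (cmod (wcoef g (Suc k)))\<^sup>2)"
    using s by (simp add: power_divide)
  then show ?thesis by (simp add: sqint_count_space summable_Suc_iff[of "\<lambda>k. (cmod (wcoef g k))\<^sup>2"])
qed

definition cosine_series :: "(nat \<Rightarrow> complex) \<Rightarrow> cfun" where
  "cosine_series c x = (\<Sum>k. c k * eigfun k x)"

text \<open>Young's inequality for the factors \<open>weight k * cmod (c k)\<close> and
  \<open>1 / weight k\<close>, both of which are square summable.\<close>

lemma weighted_l2_imp_l1:
  assumes "(\<lambda>k. of_real (weight k) * c k) \<in> sqint nat_measure"
  shows "summable (\<lambda>k. cmod (c k))"
proof -
  have a: "summable (\<lambda>k. (cmod (of_real (weight k) * c k))\<^sup>2)"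
    using assms by (simp add: sqint_count_space)
  have "summable (\<lambda>k. 1 / (weight (Suc k))\<^sup>2)"
    using sums_summable[OF inverse_squares_sums] by (simp add: weight_def add.commute)
  then have b: "summable (\<lambda>k. 1 / (weight k)\<^sup>2)" using summable_Suc_iff[of "\<lambda>k. 1 / (weight k)\<^sup>2"] by simp
  show ?thesis
  proof (rule summable_comparison_test_ev[OF _ summable_add[OF a b]], rule always_eventually, rule allI)
    fix k
    have w: "0 < weight k" using weight_ge_1[of k] by linarith
    have "2 * (weight k * cmod (c k)) * (1 / weight k) \<le> (weight k * cmod (c k))\<^sup>2 + (1 / weight k)\<^sup>2"
      by (rule sum_squares_bound)
    moreover have "2 * (weight k * cmod (c k)) * (1 / weight k) = 2 * cmod (c k)" using w by simp
    moreover have "0 \<le> cmod (c k)" by simp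
    ultimately have "cmod (c k) \<le> (weight k * cmod (c k))\<^sup>2 + (1 / weight k)\<^sup>2" by linarith
    then show "norm (cmod (c k)) \<le> (cmod (of_real (weight k) * c k))\<^sup>2 + 1 / (weight k)\<^sup>2"
      using w by (simp add: norm_mult power_divide)
  qed
qed

lemma weighted_l2_imp_l2:
  assumes "(\<lambda>k. of_real (weight k) * c k) \<in> sqint nat_measure"
  shows "summable (\<lambda>k. (cmod (c k))\<^sup>2)"
proof (rule summable_comparison_test_ev)
  show "summable (\<lambda>k. (cmod (of_real (weight k) * c k))\<^sup>2)"
    using assms by (simp add: sqint_count_space)
  show "\<forall>\<^sub>F k in sequentially. norm ((cmod (c k))\<^sup>2) \<le> (cmod (of_real (weight k) * c k))\<^sup>2"
  proof (intro always_eventually allI)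
    fix k
    have "1 * cmod (c k) \<le> weight k * cmod (c k)" using weight_ge_1 by (intro mult_right_mono) auto
    then have "(cmod (c k))\<^sup>2 \<le> (weight k * cmod (c k))\<^sup>2" by (intro power_mono) auto
    then show "norm ((cmod (c k))\<^sup>2) \<le> (cmod (of_real (weight k) * c k))\<^sup>2"
      using weight_ge_1[of k] by (simp add: norm_mult)
  qed
qed

text \<open>The formal derivative is a sine series with square-summable coefficients, so it has a
  limit \<open>h\<close> by Riesz-Fischer. Passing to the limit in the integrated identity between
  partial sums shows that the pointwise cosine sum is a primitive of \<open>h\<close>. The factor
  \<open>1 + pi\<close> stems from \<open>1 + pi^2 \<le> (1 + pi)^2\<close>.\<close>

lemma cosine_series_H1:
  assumes c: "(\<lambda>k. of_real (weight k) * c k) \<in> sqint nat_measure"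
  shows "cosine_series c \<in> H1_on 0 1" "coef (cosine_series c) k = c k"
    "H1_norm_on 0 1 (cosine_series c) \<le> (1 + pi) * l2norm nat_measure (\<lambda>k. of_real (weight k) * c k)"
proof -
  interpret finite_measure I01 by (rule finite_measure_ivl)
  define S where "S n x = (\<Sum>k<n. c k * eigfun k x)" for n x
  define d where "d k = - of_real (real (Suc k) * pi) * c (Suc k)" for k
  define D where "D n x = (\<Sum>k<n. d k * sinfun k x)" for n x
  let ?N = "l2norm nat_measure (\<lambda>k. of_real (weight k) * c k)"
  note l1 = weighted_l2_imp_l1[OF c] and l2 = weighted_l2_imp_l2[OF c]
  have w2: "summable (\<lambda>k. (cmod (of_real (weight k) * c k))\<^sup>2)"
    using c by (simp add: sqint_count_space)
  have N2: "?N\<^sup>2 = (\<Sum>k. (cmod (of_real (weight k) * c k))\<^sup>2)"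
    unfolding l2norm_count_space[OF w2] using w2 by (simp add: suminf_nonneg)
  have ds: "(cmod (d k))\<^sup>2 = pi\<^sup>2 * (cmod (of_real (weight (Suc k)) * c (Suc k)))\<^sup>2" for k
    by (simp add: d_def weight_def norm_mult power_mult_distrib mult_ac)
  have sum_d: "summable (\<lambda>k. (cmod (d k))\<^sup>2)"
    unfolding ds by (intro summable_mult summable_ignore_initial_segment[OF w2, of 1, simplified])
  obtain h where h: "h \<in> sqint I01" and hD: "(\<lambda>n. l2norm I01 (\<lambda>x. h x - D n x)) \<longlonglongrightarrow> 0"
    using riesz_fischer[OF orthogonal_family_sinfun sum_d] unfolding D_def by blast
  have conv: "summable (\<lambda>k. c k * eigfun k x)" for x
  proof (rule summable_comparison_test_ev[OF _ summable_mult[OF l1, of "sqrt 2"]], intro always_eventually allI)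
    fix k
    show "norm (c k * eigfun k x) \<le> sqrt 2 * cmod (c k)"
      unfolding norm_mult mult.commute[of "sqrt 2"] by (intro mult_left_mono eigfun_bound) auto
  qed
  have Slim: "(\<lambda>n. S n x) \<longlonglongrightarrow> cosine_series c x" for x
    unfolding S_def cosine_series_def using conv by (rule summable_LIMSEQ)
  have DS: "D n \<in> sqint I01" for n
    unfolding D_def by (rule orthogonal_family_sum_sqint[OF orthogonal_family_sinfun])
  have SS: "S n \<in> sqint I01" for n
    unfolding S_def by (rule orthogonal_family_sum_sqint[OF orthogonal_family_eigfun])
  \<comment> \<open>The indices are shifted: \<open>S (Suc n)\<close> has frequencies 0 to
    \<open>n\<close>, of which 0 drops out on differentiation, and \<open>D n\<close> has
    frequencies 1 to \<open>n\<close> because \<open>sinfun k\<close> has frequency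
    \<open>Suc k\<close>.\<close>
  have acS: "abs_cont 0 1 (S (Suc n)) (D n)" for n
  proof (rule abs_cont_smooth)
    show "continuous_on {0..1} (D n)" unfolding D_def by (intro continuous_intros)
    fix x
    have e: "(eigfun (Suc k) has_vector_derivative (- of_real (real (Suc k) * pi)) * sinfun k x) (at x within {0..1})" for k
    proof -
      have "((\<lambda>x. sqrt 2 * cos (real (Suc k) * pi * x)) has_real_derivative
          - (real (Suc k) * pi) * (sqrt 2 * sin (real (Suc k) * pi * x))) (at x within {0..1})"
        by (auto intro!: derivative_eq_intros)
      then have "((\<lambda>x. complex_of_real (sqrt 2 * cos (real (Suc k) * pi * x))) has_vector_derivative
          of_real (- (real (Suc k) * pi) * (sqrt 2 * sin (real (Suc k) * pi * x)))) (at x within {0..1})"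
        by (rule has_vector_derivative_of_real)
      then show ?thesis by (simp add: eigfun_def[abs_def] sinfun_def)
    qed
    have e0: "(eigfun 0 has_vector_derivative 0) (at x within {0..1})"
      by (simp add: eigfun_def[abs_def])
    have "((\<lambda>x. c 0 * eigfun 0 x + (\<Sum>k<n. c (Suc k) * eigfun (Suc k) x)) has_vector_derivative
       c 0 * 0 + (\<Sum>k<n. c (Suc k) * ((- of_real (real (Suc k) * pi)) * sinfun k x))) (at x within {0..1})"
      by (intro has_vector_derivative_add has_vector_derivative_sum has_vector_derivative_mult_right e e0)
    moreover have "c 0 * 0 + (\<Sum>k<n. c (Suc k) * ((- of_real (real (Suc k) * pi)) * sinfun k x)) = D n x"
      by (simp add: D_def d_def mult_ac)
    moreover have "(\<lambda>x. c 0 * eigfun 0 x + (\<Sum>k<n. c (Suc k) * eigfun (Suc k) x)) = S (Suc n)"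
      unfolding S_def by (simp add: sum.lessThan_Suc_shift del: sum.lessThan_Suc)
    ultimately show "(S (Suc n) has_vector_derivative D n x) (at x within {0..1})" by simp
  qed
  have abs_cont: "abs_cont 0 1 (cosine_series c) h"
    unfolding abs_cont_def
  proof (intro conjI ballI)
    show "integrable I01 h" using h by (rule sqint_integrable)
    fix x :: real assume x: "x \<in> {0..1}"
    have "(\<lambda>n. LINT y|ivl 0 x. D n y) \<longlonglongrightarrow> (LINT y|ivl 0 x. h y)"
    proof -
      have "(\<lambda>n. (LINT y|ivl 0 x. h y) - (LINT y|ivl 0 x. D n y)) \<longlonglongrightarrow> 0"
      proof (rule Lim_null_comparison[OF _ hD], intro always_eventually allI)
        fix n
        have i: "integrable (ivl 0 x) h" "integrable (ivl 0 x) (D n)"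
          using integrable_ivl_sub[OF sqint_integrable, of _ 0 x] h DS[of n] x by auto
        have "norm ((LINT y|ivl 0 x. h y) - (LINT y|ivl 0 x. D n y)) = norm (LINT y|ivl 0 x. h y - D n y)"
          using i by simp
        also have "\<dots> \<le> (LINT y|ivl 0 x. cmod (h y - D n y))" by simp
        also have "\<dots> \<le> (LINT y|I01. cmod (h y - D n y))"
          by (rule integral_ivl_mono) (use x sqint_integrable[OF sqint_diff[OF h DS]] in auto)
        also have "\<dots> \<le> l2norm I01 (\<lambda>x. h x - D n x)"
          using sqint_integral_norm_le[OF sqint_diff[OF h DS]] measure_ivl[of 0 1] by simp
        finally show "norm ((LINT y|ivl 0 x. h y) - (LINT y|ivl 0 x. D n y)) \<le> l2norm I01 (\<lambda>x. h x - D n x)" .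
      qed
      from tendsto_diff[OF tendsto_const[of "LINT y|ivl 0 x. h y"] this] show ?thesis by simp
    qed
    then have "(\<lambda>n. S (Suc n) 0 + (LINT y|ivl 0 x. D n y)) \<longlonglongrightarrow> cosine_series c 0 + (LINT y|ivl 0 x. h y)"
      by (intro tendsto_add LIMSEQ_Suc Slim)
    moreover have "S (Suc n) 0 + (LINT y|ivl 0 x. D n y) = S (Suc n) x" for n
      using abs_cont_eq[OF acS x, of n] by simp
    ultimately have "(\<lambda>n. S (Suc n) x) \<longlonglongrightarrow> cosine_series c 0 + (LINT y|ivl 0 x. h y)" by simp
    with LIMSEQ_Suc[OF Slim[of x]] show "cosine_series c x = cosine_series c 0 + (LINT y|ivl 0 x. h y)"
      by (rule LIMSEQ_unique)
  qed
  have cs: "continuous_on {0..1} (cosine_series c)" by (rule abs_cont_continuous[OF abs_cont])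
  have ss: "cosine_series c \<in> sqint I01" by (rule continuous_on_ivl_sqint[OF cs])
  note R = H1_onI[OF _ abs_cont h, of "cosine_series c"]
  show "cosine_series c \<in> H1_on 0 1" by (rule R(1)) (use ss in auto)
  obtain g where g: "g \<in> sqint I01" "\<And>k. coef g k = c k"
    "(\<lambda>n. l2norm I01 (\<lambda>x. g x - (\<Sum>k<n. c k * eigfun k x))) \<longlonglongrightarrow> 0"
    using cosine_series_exists[OF l2] by auto
  \<comment> \<open>Absolute summability gives uniform convergence, hence convergence in the mean to
    the pointwise sum; this allows its coefficients and its norm to be read off.\<close>
  have Sl2: "(\<lambda>n. l2norm I01 (\<lambda>x. cosine_series c x - S n x)) \<longlonglongrightarrow> 0"
  proof (rule Lim_null_comparison)
    show "(\<lambda>n. sqrt 2 * (\<Sum>k. cmod (c (k + n)))) \<longlonglongrightarrow> 0"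
      using tendsto_mult[OF tendsto_const suminf_exist_split2[OF l1], of "sqrt 2"] by simp
    show "\<forall>\<^sub>F n in sequentially. norm (l2norm I01 (\<lambda>x. cosine_series c x - S n x)) \<le> sqrt 2 * (\<Sum>k. cmod (c (k + n)))"
    proof (intro always_eventually allI)
      fix n
      let ?t = "sqrt 2 * (\<Sum>k. cmod (c (k + n)))"
      have t0: "0 \<le> ?t"
        by (intro mult_nonneg_nonneg suminf_nonneg summable_ignore_initial_segment[OF l1]) auto
      have b: "cmod (cosine_series c x - S n x) \<le> ?t" for x
      proof -
        have "cosine_series c x - S n x = (\<Sum>k. c (k + n) * eigfun (k + n) x)"
          unfolding cosine_series_def S_def using suminf_split_initial_segment[OF conv, of x n] by simp
        also have "cmod \<dots> \<le> (\<Sum>k. sqrt 2 * cmod (c (k + n)))"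
        proof (rule norm_suminf_le)
          show "norm (c (k + n) * eigfun (k + n) x) \<le> sqrt 2 * cmod (c (k + n))" for k
            unfolding norm_mult mult.commute[of "sqrt 2"] by (intro mult_left_mono eigfun_bound) auto
          show "summable (\<lambda>k. sqrt 2 * cmod (c (k + n)))"
            by (intro summable_mult summable_ignore_initial_segment[OF l1])
        qed
        also have "\<dots> = ?t" by (intro suminf_mult summable_ignore_initial_segment[OF l1])
        finally show ?thesis .
      qed
      have "(l2norm I01 (\<lambda>x. cosine_series c x - S n x))\<^sup>2 \<le> (LINT x|I01. ?t\<^sup>2)"
        unfolding l2norm_sq
        by (rule integral_mono) (use b sqint_diff[OF ss SS] in \<open>auto intro!: power_mono\<close>)
      also have "\<dots> = ?t\<^sup>2" using measure_ivl[of 0 1] by (simp add: lebesgue_integral_const)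
      finally have "l2norm I01 (\<lambda>x. cosine_series c x - S n x) \<le> ?t" by (rule power2_le_imp_le) (rule t0)
      then show "norm (l2norm I01 (\<lambda>x. cosine_series c x - S n x)) \<le> ?t" by simp
    qed
  qed
  note Sl2' = Sl2[unfolded S_def]
  show cf: "coef (cosine_series c) k = c k" for k
    using orthogonal_series_l2inner[OF orthogonal_family_eigfun ss Sl2'] by (simp add: coef_l2inner)
  have A: "(l2norm I01 (cosine_series c))\<^sup>2 \<le> ?N\<^sup>2"
  proof -
    have "(\<lambda>k. (cmod (c k))\<^sup>2) sums (l2norm I01 (cosine_series c))\<^sup>2"
      using orthogonal_series_l2norm[OF orthogonal_family_eigfun ss Sl2'] by simp
    then have "(l2norm I01 (cosine_series c))\<^sup>2 = (\<Sum>k. (cmod (c k))\<^sup>2)" by (simp add: sums_iff)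
    also have "\<dots> \<le> ?N\<^sup>2" unfolding N2
    proof (rule suminf_le[OF _ l2 w2])
      fix k
      have "1 * cmod (c k) \<le> weight k * cmod (c k)" using weight_ge_1 by (intro mult_right_mono) auto
      then have "(cmod (c k))\<^sup>2 \<le> (weight k * cmod (c k))\<^sup>2" by (intro power_mono) auto
      then show "(cmod (c k))\<^sup>2 \<le> (cmod (of_real (weight k) * c k))\<^sup>2"
        using weight_ge_1[of k] by (simp add: norm_mult)
    qed
    finally show ?thesis .
  qed
  have B: "(l2norm I01 h)\<^sup>2 \<le> pi\<^sup>2 * ?N\<^sup>2"
  proof -
    have "(\<lambda>k. (cmod (d k))\<^sup>2) sums (l2norm I01 h)\<^sup>2"
      using orthogonal_series_l2norm[OF orthogonal_family_sinfun h hD[unfolded D_def]] by simp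
    then have "(l2norm I01 h)\<^sup>2 = (\<Sum>k. (cmod (d k))\<^sup>2)" by (simp add: sums_iff)
    also have "\<dots> = pi\<^sup>2 * (\<Sum>k. (cmod (of_real (weight (Suc k)) * c (Suc k)))\<^sup>2)"
      unfolding ds by (intro suminf_mult summable_ignore_initial_segment[OF w2, of 1, simplified])
    also have "\<dots> \<le> pi\<^sup>2 * ?N\<^sup>2"
      using suminf_split_head[OF w2] unfolding N2 by (intro mult_left_mono) auto
    finally show ?thesis .
  qed
  have "(H1_norm_on 0 1 (cosine_series c))\<^sup>2 = (l2norm I01 (cosine_series c))\<^sup>2 + (l2norm I01 h)\<^sup>2"
    using R(3) ss by simp
  also have "\<dots> \<le> ?N\<^sup>2 + pi\<^sup>2 * ?N\<^sup>2" by (rule add_mono[OF A B])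
  also have "\<dots> \<le> ((1 + pi) * ?N)\<^sup>2"
  proof -
    have "1 + pi\<^sup>2 \<le> (1 + pi)\<^sup>2" by (simp add: power2_sum)
    then have "(1 + pi\<^sup>2) * ?N\<^sup>2 \<le> (1 + pi)\<^sup>2 * ?N\<^sup>2" by (intro mult_right_mono) auto
    then show ?thesis unfolding power_mult_distrib by (simp only: distrib_right mult_1)
  qed
  finally show "H1_norm_on 0 1 (cosine_series c) \<le> (1 + pi) * ?N"
    by (rule power2_le_imp_le) simp
qed

lemma H1_eq_cosine_series:
  assumes g: "g \<in> H1_on 0 1"
  shows "AE x in I01. cosine_series (coef g) x = g x"
proof -
  have c: "(\<lambda>k. of_real (weight k) * coef g k) \<in> sqint nat_measure"
    using H1_wcoef_sqint[OF g] by (simp add: wcoef_def[abs_def])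
  show ?thesis
    by (rule coef_eq_imp_AE[OF H1_onD(1)[OF cosine_series_H1(1)[OF c]] H1_onD(1)[OF g] cosine_series_H1(2)[OF c]])
qed

text \<open>Solutions are measured spectrally, but the product estimate on the pieces needs the
  Sobolev norm with the weak derivative; this comparison links the two.\<close>

lemma H1_norm_on_le_H1_norm:
  assumes g: "g \<in> H1_on 0 1"
  shows "H1_norm_on 0 1 g \<le> (1 + pi) * H1_norm g"
proof -
  have c: "(\<lambda>k. of_real (weight k) * coef g k) \<in> sqint nat_measure"
    using H1_wcoef_sqint[OF g] by (simp add: wcoef_def[abs_def])
  have "H1_norm_on 0 1 g = H1_norm_on 0 1 (cosine_series (coef g))"
    by (rule H1_norm_on_cong_AE(2)[OF _ cosine_series_H1(1)[OF c] _ H1_eq_cosine_series[OF g]])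
       (use H1_onD(1)[OF g] in auto)
  also have "\<dots> \<le> (1 + pi) * l2norm nat_measure (\<lambda>k. of_real (weight k) * coef g k)"
    by (rule cosine_series_H1(3)[OF c])
  finally show ?thesis by (simp add: H1_norm_wcoef[OF H1_wcoef_sqint[OF g]] wcoef_def[abs_def])
qed

lemma H1_norm_nonneg: "g \<in> H1_on 0 1 \<Longrightarrow> 0 \<le> H1_norm g"
  by (simp add: H1_norm_wcoef[OF H1_wcoef_sqint])

lemma wcoef_diff:
  assumes "f \<in> sqint I01" "g \<in> sqint I01"
  shows "wcoef (\<lambda>x. f x - g x) = (\<lambda>k. wcoef f k - wcoef g k)"
  by (auto simp: wcoef_def coef_diff[OF assms] right_diff_distrib)

text \<open>The group is a chosen limit of a series. The phases have modulus 1, so the series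
  converges and the choice is legitimate; its coefficients are then all that is ever needed about
  it.\<close>

lemma schroedinger_group_L2:
  assumes "g \<in> sqint I01"
  shows "schroedinger_group t g \<in> sqint I01"
    "coef (schroedinger_group t g) k = exp (- \<i> * of_real (eigval k * t)) * coef g k"
proof -
  define c where "c k = exp (- \<i> * of_real (eigval k * t)) * coef g k" for k
  have n1: "cmod (exp (- \<i> * of_real (eigval k * t))) = 1" for k
    by (simp add: norm_exp_eq_Re)
  have "summable (\<lambda>k. (cmod (c k))\<^sup>2)"
    using coef_summable[OF assms] by (simp add: c_def norm_mult n1)
  then obtain h where h: "h \<in> sqint I01" "\<And>k. coef h k = c k"
    "(\<lambda>n. l2norm I01 (\<lambda>x. h x - (\<Sum>k<n. c k * eigfun k x))) \<longlonglongrightarrow> 0"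
    using cosine_series_exists by blast
  have "\<exists>h. h \<in> L2_on 0 1 \<and> (\<lambda>n. L2_norm_on 0 1 (\<lambda>x. h x -
           (\<Sum>k<n. exp (- \<i> * of_real (eigval k * t)) * L2_inner g (eigfun k) * eigfun k x))) \<longlonglongrightarrow> 0"
    using h(1,3) unfolding L2_on_sqint L2_norm_on_l2norm c_def coef_def by blast
  from someI_ex[OF this, folded schroedinger_group_def]
  have s: "schroedinger_group t g \<in> sqint I01" and
    l: "(\<lambda>n. l2norm I01 (\<lambda>x. schroedinger_group t g x - (\<Sum>k<n. c k * eigfun k x))) \<longlonglongrightarrow> 0"
    unfolding L2_on_sqint L2_norm_on_l2norm c_def coef_def by auto
  show "schroedinger_group t g \<in> sqint I01" by (rule s)
  show "coef (schroedinger_group t g) k = exp (- \<i> * of_real (eigval k * t)) * coef g k"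
    using orthogonal_series_l2inner[OF orthogonal_family_eigfun s l] by (simp add: coef_l2inner c_def)
qed

section \<open>Smoothing of the Duhamel integral on one interval\<close>

definition zero_ext :: "real \<Rightarrow> real \<Rightarrow> cfun \<Rightarrow> cfun" where
  "zero_ext c d f x = indicat_real {c<..<d} x *\<^sub>R f x"

lemma zero_ext_sqint:
  assumes f: "f \<in> sqint (ivl c d)" and "a \<le> c" "d \<le> b"
  shows "zero_ext c d f \<in> sqint (ivl a b)" "l2norm (ivl a b) (zero_ext c d f) = l2norm (ivl c d) f"
proof -
  have e: "(cmod (zero_ext c d f x))\<^sup>2 = indicat_real {c<..<d} x *\<^sub>R (cmod (f x))\<^sup>2" for x
    by (simp add: zero_ext_def indicator_def)
  show "zero_ext c d f \<in> sqint (ivl a b)"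
  proof (rule sqintI)
    show "zero_ext c d f \<in> borel_measurable (ivl a b)"
      unfolding zero_ext_def[abs_def]
      by (rule measurable_ivl_sub_iff[OF assms(2,3), THEN iffD1, OF sqintD(1)[OF f]])
    show "integrable (ivl a b) (\<lambda>x. (cmod (zero_ext c d f x))\<^sup>2)"
      unfolding e by (rule integrable_ivl_sub_iff[OF assms(2,3), THEN iffD1, OF sqintD(2)[OF f]])
  qed
  show "l2norm (ivl a b) (zero_ext c d f) = l2norm (ivl c d) f"
    unfolding l2norm_def e by (simp add: integral_ivl_sub[OF assms(2,3)])
qed

lemma zero_ext_integral:
  assumes "a \<le> c" "d \<le> b"
  shows "(LINT x|ivl a b. zero_ext c d f x * g x) = (LINT x|ivl c d. f x * g x)"
  unfolding integral_ivl_sub[OF assms]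
  by (rule Bochner_Integration.integral_cong) (auto simp: zero_ext_def)

text \<open>This rests on the completeness of Lebesgue measure. It is needed because quantities
  built from chosen representatives are often identified with measurable ones only almost
  everywhere.\<close>

lemma measurable_ivl_cong_AE:
  fixes f g :: cfun
  assumes "f \<in> borel_measurable (ivl a b)" "AE x in ivl a b. f x = g x"
  shows "g \<in> borel_measurable (ivl a b)"
proof -
  have "(\<lambda>x. if x \<in> {a<..<b} then f x else 0) \<in> borel_measurable lebesgue"
    using assms(1) by (subst borel_measurable_if) auto
  moreover have "AE x in lebesgue. (if x \<in> {a<..<b} then f x else 0) = (if x \<in> {a<..<b} then g x else 0)"
    using assms(2) unfolding AE_ivl_iff by eventually_elim auto
  ultimately have "(\<lambda>x. if x \<in> {a<..<b} then g x else 0) \<in> borel_measurable lebesgue"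
    by (rule borel_measurable_AE)
  then show ?thesis by (subst (asm) borel_measurable_if) auto
qed

lemma measurable_ivl_AE_limit:
  fixes F :: "nat \<Rightarrow> cfun"
  assumes "\<And>n. F n \<in> borel_measurable (ivl a b)" "AE x in ivl a b. (\<lambda>n. F n x) \<longlonglongrightarrow> g x"
  shows "g \<in> borel_measurable (ivl a b)"
proof (rule measurable_ivl_cong_AE)
  show "(\<lambda>x. lim (\<lambda>n. F n x)) \<in> borel_measurable (ivl a b)"
    by (rule borel_measurable_lim_metric) (rule assms(1))
  show "AE x in ivl a b. lim (\<lambda>n. F n x) = g x"
    using assms(2) by eventually_elim (rule limI)
qed

lemma sqint_ivl_join:
  assumes f: "f \<in> sqint (ivl a c)" "f \<in> sqint (ivl c b)" and "a \<le> c" "c \<le> b"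
  shows "f \<in> sqint (ivl a b)"
proof -
  have s: "(\<lambda>x. zero_ext a c f x + zero_ext c b f x) \<in> sqint (ivl a b)"
    by (intro sqint_add zero_ext_sqint f) (use assms in auto)
  have e: "AE x in ivl a b. zero_ext a c f x + zero_ext c b f x = f x"
    using AE_ivl_neq[of c a b] AE_space
    by eventually_elim (auto simp: zero_ext_def indicator_def)
  show ?thesis
    by (rule sqint_cong_AE[OF s measurable_ivl_cong_AE[OF sqintD(1)[OF s] e] e])
qed

text \<open>A common period of all \<open>exp (\<i> * eigval k * s)\<close>, not smaller than \<open>T\<close>.\<close>

definition time_period :: "real \<Rightarrow> real" where
  "time_period T = real (nat \<lceil>T\<rceil> * 2 + 1) * (2 / pi)"

lemma time_period: "0 < time_period T" "T \<le> time_period T"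
proof -
  show "0 < time_period T" unfolding time_period_def by (intro mult_pos_pos) auto
  have "T \<le> real (nat \<lceil>T\<rceil>)" by (rule real_nat_ceiling_ge)
  also have "\<dots> \<le> real (nat \<lceil>T\<rceil> * 2 + 1) * (1 / 2)" by simp
  \<comment> \<open>As \<open>pi < 4\<close>, the unit \<open>2 / pi\<close> is at least
    \<open>1 / 2\<close>, which the doubled ceiling compensates; the added 1 keeps the period
    positive for every \<open>T\<close>.\<close>
  also have "\<dots> \<le> time_period T" unfolding time_period_def
    by (intro mult_left_mono) (use pi_less_4 in \<open>auto simp: field_simps\<close>)
  finally show "T \<le> time_period T" .
qed

section \<open>Orthogonal exponentials in time\<close>

definition texp :: "nat \<Rightarrow> real \<Rightarrow> complex" where
  "texp k s = exp (\<i> * of_real (eigval k * s))"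

lemma texp_norm [simp]: "cmod (texp k s) = 1"
  by (simp add: texp_def norm_exp_eq_Re)

lemma cnj_texp: "cnj (texp k s) = exp (- \<i> * of_real (eigval k * s))"
  by (simp add: texp_def exp_cnj)

lemma texp_cnj [simp]: "texp k s * cnj (texp k s) = 1" "cnj (texp k s) * texp k s = 1"
  by (simp_all add: mult_cnj_cmod mult.commute[of "cnj _"])

lemma texp_diff: "exp (- \<i> * of_real (eigval k * (t - s))) = cnj (texp k t) * texp k s"
  unfolding cnj_texp unfolding texp_def exp_add[symmetric]
  by (simp add: algebra_simps)

lemma continuous_on_texp [continuous_intros]: "continuous_on S (texp k)"
  unfolding texp_def[abs_def] by (intro continuous_intros)

lemma texp_measurable: "texp k \<in> borel_measurable (ivl a b)"
  by (intro continuous_on_ivl_measurable continuous_intros)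

text \<open>Differences of distinct eigenvalues are nonzero integer multiples of
  \<open>pi^2\<close>, so each product of two distinct members oscillates a whole number of times
  over the period. The members are conjugated because \<open>l2inner\<close> conjugates its second
  argument: pairing with them integrates against \<open>texp k\<close>.\<close>

lemma orthogonal_family_texp: "orthogonal_family (ivl 0 (time_period T)) (\<lambda>k s. cnj (texp k s)) (time_period T)"
  unfolding orthogonal_family_def
proof (intro conjI allI)
  show "0 < time_period T" by (rule time_period)
  show "(\<lambda>s. cnj (texp k s)) \<in> sqint (ivl 0 (time_period T))" for k
    by (intro continuous_on_ivl_sqint continuous_intros)
  fix j k
  let ?L = "time_period T"
  show "l2inner (ivl 0 ?L) (\<lambda>s. cnj (texp j s)) (\<lambda>s. cnj (texp k s)) = (if j = k then of_real ?L else 0)"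
  proof (cases "j = k")
    case True
    then show ?thesis using measure_ivl[of 0 ?L] time_period(1)[of T]
      by (simp add: l2inner_def lebesgue_integral_const scaleR_conv_of_real)
  next
    case False
    define m where "m = int k ^ 2 - int j ^ 2"
    have m: "m \<noteq> 0" using False by (simp add: m_def)
    define z where "z = \<i> * of_real (of_int m * pi\<^sup>2)"
    have z: "z \<noteq> 0" using m by (simp add: z_def)
    have e: "cnj (texp j s) * texp k s = exp (z * of_real s)" for s
      unfolding cnj_texp unfolding texp_def exp_add[symmetric]
      by (simp add: z_def m_def eigval_def algebra_simps)
    have "((\<lambda>s. exp (z * of_real s)) has_integral (exp (z * of_real ?L) / z - exp (z * of_real 0) / z)) {0..?L}"
    proof (rule fundamental_theorem_of_calculus)
      fix s
      have "((\<lambda>w. exp (z * w) / z) has_field_derivative exp (z * of_real s)) (at (of_real s))"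
        using z by (auto intro!: derivative_eq_intros)
      then show "((\<lambda>s. exp (z * of_real s) / z) has_vector_derivative exp (z * of_real s)) (at s within {0..?L})"
        by (rule has_vector_derivative_at_within[OF has_vector_derivative_real_field])
    qed (use time_period(1)[of T] in simp)
    moreover have "exp (z * of_real ?L) = 1"
    proof -
      \<comment> \<open>An integer multiple of \<open>pi^2\<close> times an integer multiple of
        \<open>2 / pi\<close> is an integer multiple of \<open>2 * pi\<close>.\<close>
      have "z * of_real ?L = of_int (m * (int (nat \<lceil>T\<rceil>) * 2 + 1)) * (2 * of_real pi * \<i>)"
        by (simp add: z_def time_period_def power2_eq_square field_simps)
      also have "exp \<dots> = 1" by (subst exp_eq_1) (auto intro!: exI[of _ "m * (int (nat \<lceil>T\<rceil>) * 2 + 1)"])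
      finally show ?thesis .
    qed
    ultimately have "integral {0..?L} (\<lambda>s. exp (z * of_real s)) = 0"
      by (intro integral_unique) simp
    moreover have "integrable (ivl 0 ?L) (\<lambda>s. exp (z * of_real s))"
      by (intro finite_measure.sqint_integrable[OF finite_measure_ivl] continuous_on_ivl_sqint continuous_intros)
    ultimately have "(LINT s|ivl 0 ?L. exp (z * of_real s)) = 0"
      using integral_ivl_HK by metis
    then show ?thesis using False by (simp add: l2inner_def e)
  qed
qed

text \<open>Extension by zero to the full period does not change the norm, so the constant depends
  on the horizon only and not on the subinterval. This replaces the missing decay in
  \<open>k\<close> of the trace terms.\<close>

lemma bessel_time:
  assumes "p \<in> sqint (ivl r t)" "0 \<le> r" "t \<le> T"
  shows "(\<Sum>k<n. (cmod (LINT s|ivl r t. texp k s * p s))\<^sup>2) \<le> time_period T * (l2norm (ivl r t) p)\<^sup>2"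
proof -
  have tT: "t \<le> time_period T" using time_period(2)[of T] assms(3) by simp
  note E = zero_ext_sqint[OF assms(1,2) tT]
  have "l2inner (ivl 0 (time_period T)) (zero_ext r t p) (\<lambda>s. cnj (texp k s)) = (LINT s|ivl r t. texp k s * p s)" for k
    unfolding l2inner_def complex_cnj_cnj zero_ext_integral[OF assms(2) tT] by (simp only: mult.commute)
  then show ?thesis
    using bessel_finite[OF orthogonal_family_texp[of T] E(1), of "{..<n}"] E(2) by simp
qed

section \<open>Boundary and remainder terms of the coefficients on one piece\<close>

definition piece_coef :: "real \<Rightarrow> real \<Rightarrow> nat \<Rightarrow> cfun \<Rightarrow> complex" where
  "piece_coef a b k g = (LINT x|ivl a b. g x * eigfun k x)"

text \<open>The normalisation \<open>sqrt 2\<close> of the eigenfunction divided by the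
  \<open>pi\<close> of the frequency, times the sine left by integration by parts. It vanishes for
  \<open>k = 0\<close>, where no integration by parts takes place.\<close>

definition boundary_factor :: "nat \<Rightarrow> real \<Rightarrow> complex" where
  "boundary_factor k x = of_real (sqrt 2 / pi * sin (real k * pi * x))"

lemma sqrt2_le_pi: "sqrt 2 / pi \<le> 1"
proof -
  have "sqrt 2 \<le> sqrt 4" by (rule real_sqrt_le_mono) simp
  also have "\<dots> = 2" by simp
  also have "\<dots> \<le> pi" using pi_ge_two .
  finally show ?thesis by simp
qed

lemma boundary_factor_bound: "cmod (boundary_factor k x) \<le> 1"
proof -
  have "sqrt 2 / pi * \<bar>sin (real k * pi * x)\<bar> \<le> 1 * 1"
    by (intro mult_mono sqrt2_le_pi) auto
  then show ?thesis by (simp add: boundary_factor_def abs_mult norm_divide norm_mult)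
qed

text \<open>The part of the weighted coefficient that is square summable at each instant: the
  integral over the piece for \<open>k = 0\<close>, and otherwise a sine coefficient of the weak
  derivative divided by \<open>- pi\<close>.\<close>

definition rest_coef :: "real \<Rightarrow> real \<Rightarrow> nat \<Rightarrow> cfun \<Rightarrow> complex" where
  "rest_coef a b k g = of_real (weight k) * piece_coef a b k g
     - boundary_factor k b * trace_right a b g + boundary_factor k a * trace_left a b g"

lemma rest_coef_0: "rest_coef a b 0 g = (LINT x|ivl a b. g x)"
  by (simp add: rest_coef_def boundary_factor_def piece_coef_def weight_def eigfun_def)

lemma rest_coef_Suc:
  assumes "0 \<le> a" "a < b" "b \<le> 1" "g \<in> H1_on a b"
  shows "rest_coef a b (Suc k) g = - l2inner I01 (zero_ext a b (weak_deriv a b g)) (sinfun k) / of_real pi"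
proof -
  let ?s = "complex_of_real (sqrt 2 / pi)"
  let ?C = "LINT x|ivl a b. g x * of_real (cos (real (Suc k) * pi * x))"
  let ?D = "LINT x|ivl a b. weak_deriv a b g x * of_real (sin (real (Suc k) * pi * x))"
  have "piece_coef a b (Suc k) g = of_real (sqrt 2) * ?C"
    unfolding piece_coef_def integral_mult_right_zero[symmetric]
    by (rule Bochner_Integration.integral_cong) (auto simp: eigfun_eq cos_norm_def)
  then have "of_real (weight (Suc k)) * piece_coef a b (Suc k) g = ?s * (of_real (real (Suc k) * pi) * ?C)"
    by (simp add: weight_def field_simps)
  also have "\<dots> = boundary_factor (Suc k) b * trace_right a b g - boundary_factor (Suc k) a * trace_left a b g - ?s * ?D"
    unfolding cosine_coefficient_by_parts[OF assms(2,4)] boundary_factor_def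
    by (simp only: right_diff_distrib of_real_mult mult_ac)
  finally have 1: "rest_coef a b (Suc k) g = - (?s * ?D)" by (simp add: rest_coef_def)
  have "l2inner I01 (zero_ext a b (weak_deriv a b g)) (sinfun k) = (LINT x|ivl a b. weak_deriv a b g x * sinfun k x)"
    unfolding l2inner_def cnj_sinfun by (rule zero_ext_integral[OF assms(1,3)])
  also have "\<dots> = of_real (sqrt 2) * ?D"
    unfolding integral_mult_right_zero[symmetric]
    by (rule Bochner_Integration.integral_cong) (auto simp: sinfun_def)
  finally show ?thesis unfolding 1 by simp
qed

text \<open>Index 0 is bounded through the function itself, the other indices through the weak
  derivative by Bessel's inequality for sines after extension by zero; together they give exactly
  the two terms of the squared Sobolev norm.\<close>

lemma rest_coef_sum_bound:
  assumes "0 \<le> a" "a < b" "b \<le> 1" "g \<in> H1_on a b"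
  shows "(\<Sum>k<n. (cmod (rest_coef a b k g))\<^sup>2) \<le> (H1_norm_on a b g)\<^sup>2"
proof -
  interpret finite_measure "ivl a b" by (rule finite_measure_ivl)
  note g = H1_onD[OF assms(4)]
  \<comment> \<open>The sum runs one index too far so that index 0 can be split off; the surplus
    last term is dropped at the end.\<close>
  have "(\<Sum>k<Suc n. (cmod (rest_coef a b k g))\<^sup>2) =
      (cmod (rest_coef a b 0 g))\<^sup>2 + (\<Sum>k<n. (cmod (rest_coef a b (Suc k) g))\<^sup>2)"
    by (simp only: sum.lessThan_Suc_shift)
  also have "\<dots> \<le> (l2norm (ivl a b) g)\<^sup>2 + (l2norm (ivl a b) (weak_deriv a b g))\<^sup>2"
  proof (rule add_mono)
    have "cmod (LINT x|ivl a b. g x) \<le> (LINT x|ivl a b. cmod (g x))" by simp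
    also have "\<dots> \<le> sqrt (b - a) * l2norm (ivl a b) g"
      using sqint_integral_norm_le[OF g(1)] measure_ivl[of a b] assms by simp
    also have "\<dots> \<le> 1 * l2norm (ivl a b) g" using assms by (intro mult_right_mono) auto
    finally show "(cmod (rest_coef a b 0 g))\<^sup>2 \<le> (l2norm (ivl a b) g)\<^sup>2"
      unfolding rest_coef_0 by (intro power_mono) auto
    note E = zero_ext_sqint[OF g(2) assms(1,3)]
    have "(\<Sum>k<n. (cmod (rest_coef a b (Suc k) g))\<^sup>2) \<le>
        (\<Sum>k<n. (cmod (l2inner I01 (zero_ext a b (weak_deriv a b g)) (sinfun k)))\<^sup>2)"
    proof (intro sum_mono power_mono)
      fix k
      have "cmod (rest_coef a b (Suc k) g) = cmod (l2inner I01 (zero_ext a b (weak_deriv a b g)) (sinfun k)) / pi"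
        unfolding rest_coef_Suc[OF assms] by (simp add: norm_divide)
      also have "\<dots> \<le> cmod (l2inner I01 (zero_ext a b (weak_deriv a b g)) (sinfun k)) / 1"
        using pi_ge_two by (intro divide_left_mono) auto
      finally show "cmod (rest_coef a b (Suc k) g) \<le> cmod (l2inner I01 (zero_ext a b (weak_deriv a b g)) (sinfun k))"
        by simp
    qed auto
    also have "\<dots> \<le> (l2norm (ivl a b) (weak_deriv a b g))\<^sup>2"
      using bessel_finite[OF orthogonal_family_sinfun E(1), of "{..<n}"] E(2) by simp
    finally show "(\<Sum>k<n. (cmod (rest_coef a b (Suc k) g))\<^sup>2) \<le> (l2norm (ivl a b) (weak_deriv a b g))\<^sup>2" .
  qed
  also have "\<dots> = (H1_norm_on a b g)\<^sup>2" by (simp add: H1_norm_on_sq)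
  finally show ?thesis
    unfolding sum.lessThan_Suc using zero_le_power2[of "cmod (rest_coef a b n g)"] by linarith
qed

lemma H1_functional_bound:
  "H1_functional a b \<Lambda> \<Longrightarrow> \<exists>C\<ge>0. \<forall>f\<in>H1_on a b. cmod (\<Lambda> f) \<le> C * H1_norm_on a b f"
  by (simp add: H1_functional_def)

lemma H1_functional_lincomb:
  assumes "a < b" "H1_functional a b \<Lambda>" "H1_functional a b \<Lambda>'"
  shows "H1_functional a b (\<lambda>g. c * \<Lambda> g + d * \<Lambda>' g)"
proof -
  obtain C where C: "0 \<le> C" "\<forall>f\<in>H1_on a b. cmod (\<Lambda> f) \<le> C * H1_norm_on a b f"
    using H1_functional_bound[OF assms(2)] by blast
  obtain C' where C': "0 \<le> C'" "\<forall>f\<in>H1_on a b. cmod (\<Lambda>' f) \<le> C' * H1_norm_on a b f"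
    using H1_functional_bound[OF assms(3)] by blast
  show ?thesis
    unfolding H1_functional_def
  proof (intro conjI ballI allI exI[of _ "cmod c * C + cmod d * C'"])
    show "0 \<le> cmod c * C + cmod d * C'" using C C' by simp
    fix f assume f: "f \<in> H1_on a b"
    have "cmod (c * \<Lambda> f + d * \<Lambda>' f) \<le> cmod c * cmod (\<Lambda> f) + cmod d * cmod (\<Lambda>' f)"
      by (metis norm_mult norm_triangle_ineq)
    also have "\<dots> \<le> cmod c * (C * H1_norm_on a b f) + cmod d * (C' * H1_norm_on a b f)"
      using C(2) C'(2) f by (intro add_mono mult_left_mono) auto
    finally show "cmod (c * \<Lambda> f + d * \<Lambda>' f) \<le> (cmod c * C + cmod d * C') * H1_norm_on a b f"
      by (simp add: algebra_simps)
  qed (use assms(2,3) in \<open>auto simp: H1_functional_def algebra_simps\<close>)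
qed

lemma H1_functional_piece_coef:
  assumes "a < b" shows "H1_functional a b (piece_coef a b k)"
  unfolding piece_coef_def[abs_def]
  by (rule H1_functional_integral[OF assms]) (intro continuous_on_ivl_sqint continuous_intros)

lemma H1_functional_rest_coef:
  assumes "a < b" shows "H1_functional a b (rest_coef a b k)"
proof -
  have "H1_functional a b (\<lambda>g. of_real (weight k) * piece_coef a b k g +
      1 * ((- boundary_factor k b) * trace_right a b g + boundary_factor k a * trace_left a b g))"
    by (intro H1_functional_lincomb assms H1_functional_piece_coef H1_functional_trace)
  then show ?thesis by (simp add: rest_coef_def[abs_def] algebra_simps)
qed

section \<open>Weakly measurable sources and their estimate on one piece\<close>

text \<open>Measurability is demanded only after applying bounded functionals. Every scalar that
  enters the Duhamel integral is of this form, and the property passes easily to sums, multiples by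
  scalar functions of time and continuous trajectories.\<close>

definition source :: "real \<Rightarrow> real \<Rightarrow> real \<Rightarrow> (real \<Rightarrow> cfun) \<Rightarrow> bool" where
  "source a b T g \<longleftrightarrow> (AE s in ivl 0 T. g s \<in> H1_on a b) \<and>
     (\<forall>\<Lambda>. H1_functional a b \<Lambda> \<longrightarrow> (\<lambda>s. \<Lambda> (g s)) \<in> borel_measurable (ivl 0 T))"

text \<open>A square-integrable majorant \<open>m\<close> of the norm of a source is carried
  separately, so that the norm of a weakly measurable source need not itself be shown measurable in
  time.\<close>

definition time_bound :: "real \<Rightarrow> (real \<Rightarrow> real) \<Rightarrow> bool" where
  "time_bound T m \<longleftrightarrow> m \<in> borel_measurable (ivl 0 T) \<and> integrable (ivl 0 T) (\<lambda>s. (m s)\<^sup>2)"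

lemma time_bound_sub:
  assumes "time_bound T m" "0 \<le> r" "t \<le> T"
  shows "m \<in> borel_measurable (ivl r t)" "integrable (ivl r t) (\<lambda>s. (m s)\<^sup>2)"
proof -
  have m: "m \<in> borel_measurable (ivl 0 T)" "integrable (ivl 0 T) (\<lambda>s. (m s)\<^sup>2)"
    using assms(1) by (auto simp: time_bound_def)
  show "m \<in> borel_measurable (ivl r t)" by (rule measurable_ivl_sub[OF m(1) assms(2,3)])
  show "integrable (ivl r t) (\<lambda>s. (m s)\<^sup>2)" by (rule integrable_ivl_sub[OF m(2) assms(2,3)])
qed

lemma add_sq_le: "(x + y)\<^sup>2 \<le> 2 * x\<^sup>2 + 2 * y\<^sup>2" for x y :: real
  using sum_squares_bound[of x y] by (simp add: power2_sum)

lemma time_bound_add: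
  assumes "time_bound T m" "time_bound T m'"
  shows "time_bound T (\<lambda>s. m s + m' s)"
  unfolding time_bound_def
proof
  have m: "m \<in> borel_measurable (ivl 0 T)" "m' \<in> borel_measurable (ivl 0 T)"
    "integrable (ivl 0 T) (\<lambda>s. (m s)\<^sup>2)" "integrable (ivl 0 T) (\<lambda>s. (m' s)\<^sup>2)"
    using assms by (auto simp: time_bound_def)
  show meas: "(\<lambda>s. m s + m' s) \<in> borel_measurable (ivl 0 T)" using m by measurable
  have "integrable (ivl 0 T) (\<lambda>s. 2 * (m s)\<^sup>2 + 2 * (m' s)\<^sup>2)" using m by simp
  then show "integrable (ivl 0 T) (\<lambda>s. (m s + m' s)\<^sup>2)"
  proof (rule Bochner_Integration.integrable_bound)
    show "AE s in ivl 0 T. norm ((m s + m' s)\<^sup>2) \<le> norm (2 * (m s)\<^sup>2 + 2 * (m' s)\<^sup>2)"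
      using add_sq_le by (intro AE_I2) simp
  qed (use meas in measurable)
qed

lemma sqint_time_bound:
  assumes m: "integrable M (\<lambda>s. (m s)\<^sup>2)" "m \<in> borel_measurable M"
    and f: "f \<in> borel_measurable M" "AE s in M. cmod (f s) \<le> C * m s"
  shows "f \<in> sqint M" "(l2norm M f)\<^sup>2 \<le> C\<^sup>2 * (LINT s|M. (m s)\<^sup>2)"
proof -
  have ms: "(\<lambda>s. complex_of_real (m s)) \<in> sqint M"
    by (rule sqintI) (use m in auto)
  show s: "f \<in> sqint M"
  proof (rule sqint_bound[OF f(1) ms, of "\<bar>C\<bar>"])
    show "AE s in M. cmod (f s) \<le> \<bar>C\<bar> * cmod (complex_of_real (m s))"
      using f(2) by eventually_elim (metis abs_ge_self abs_mult norm_of_real order_trans)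
  qed
  have "(l2norm M f)\<^sup>2 \<le> (LINT s|M. C\<^sup>2 * (m s)\<^sup>2)"
    unfolding l2norm_sq
  proof (rule integral_mono_AE)
    show "AE s in M. (cmod (f s))\<^sup>2 \<le> C\<^sup>2 * (m s)\<^sup>2"
      using f(2)
    proof eventually_elim
      case (elim s)
      from power_mono[OF elim norm_ge_zero, of 2] show ?case by (simp add: power_mult_distrib)
    qed
  qed (use s m in auto)
  then show "(l2norm M f)\<^sup>2 \<le> C\<^sup>2 * (LINT s|M. (m s)\<^sup>2)" by simp
qed

lemma cmod_add3_sq_le: "(cmod (x + y + z))\<^sup>2 \<le> 3 * ((cmod x)\<^sup>2 + (cmod y)\<^sup>2 + (cmod z)\<^sup>2)"
proof -
  have "cmod (x + y + z) \<le> cmod x + cmod y + cmod z"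
    by (meson add_right_mono norm_triangle_ineq order_trans)
  then have "(cmod (x + y + z))\<^sup>2 \<le> (cmod x + cmod y + cmod z)\<^sup>2" by (intro power_mono) auto
  also have "\<dots> \<le> 3 * ((cmod x)\<^sup>2 + (cmod y)\<^sup>2 + (cmod z)\<^sup>2)"
    using sum_squares_bound[of "cmod x" "cmod y"] sum_squares_bound[of "cmod x" "cmod z"]
      sum_squares_bound[of "cmod y" "cmod z"]
    by (simp add: power2_eq_square algebra_simps)
  finally show ?thesis .
qed

lemma source_piece_sqint:
  assumes ab: "a < b" and g: "source a b T g" and m: "time_bound T m"
    and gm: "AE s in ivl 0 T. H1_norm_on a b (g s) \<le> m s" and rt: "0 \<le> r" "t \<le> T"
    and \<Lambda>: "H1_functional a b \<Lambda>" "0 \<le> C" "\<And>f. f \<in> H1_on a b \<Longrightarrow> cmod (\<Lambda> f) \<le> C * H1_norm_on a b f"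
  shows "(\<lambda>s. \<Lambda> (g s)) \<in> sqint (ivl r t)"
    "(l2norm (ivl r t) (\<lambda>s. \<Lambda> (g s)))\<^sup>2 \<le> C\<^sup>2 * (LINT s|ivl r t. (m s)\<^sup>2)"
proof -
  have meas: "(\<lambda>s. \<Lambda> (g s)) \<in> borel_measurable (ivl r t)"
    by (rule measurable_ivl_sub[OF _ rt]) (use g \<Lambda> in \<open>auto simp: source_def\<close>)
  have "AE s in ivl 0 T. cmod (\<Lambda> (g s)) \<le> C * m s"
    using gm g[unfolded source_def, THEN conjunct1]
    by eventually_elim (use \<Lambda> in \<open>meson mult_left_mono order_trans\<close>)
  note b = AE_ivl_sub[OF this rt]
  show "(\<lambda>s. \<Lambda> (g s)) \<in> sqint (ivl r t)"
    "(l2norm (ivl r t) (\<lambda>s. \<Lambda> (g s)))\<^sup>2 \<le> C\<^sup>2 * (LINT s|ivl r t. (m s)\<^sup>2)"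
    using sqint_time_bound[OF time_bound_sub(2,1)[OF m rt] meas b] by auto
qed

text \<open>The weighted coefficient splits into two traces with bounded factors and
  \<open>rest_coef\<close>. The traces are summed over \<open>k\<close> by orthogonality in time,
  each at the cost of \<open>time_period T\<close> times the squared embedding constant. For the
  remainder, Cauchy-Schwarz in time costs at most \<open>T\<close>, after which the sum over
  \<open>k\<close> is bounded at each instant. The leading 3 comes from squaring a sum of three
  terms.\<close>

lemma piece_estimate:
  assumes ab: "0 \<le> a" "a < b" "b \<le> 1" and g: "source a b T g" and m: "time_bound T m"
    and gm: "AE s in ivl 0 T. H1_norm_on a b (g s) \<le> m s" and rt: "0 \<le> r" "r \<le> t" "t \<le> T"
  shows "(\<Sum>k<n. (cmod (of_real (weight k) * (LINT s|ivl r t. texp k s * piece_coef a b k (g s))))\<^sup>2)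
     \<le> 3 * (2 * time_period T * (sup_const a b)\<^sup>2 + T) * (LINT s|ivl r t. (m s)\<^sup>2)"
    "integrable (ivl r t) (\<lambda>s. texp k s * piece_coef a b k (g s))"
proof -
  let ?N = "ivl r t" and ?S = "sup_const a b"
  let ?m2 = "LINT s|ivl r t. (m s)\<^sup>2"
  interpret finite_measure ?N by (rule finite_measure_ivl)
  have S: "0 \<le> ?S" by (rule sup_const_nonneg[OF ab(2)])
  note sp = source_piece_sqint[OF ab(2) g m gm rt(1,3)]
  note R = sp[OF H1_functional_trace(1)[OF ab(2)] S trace_bound(1)[OF ab(2)]]
  note L = sp[OF H1_functional_trace(2)[OF ab(2)] S trace_bound(2)[OF ab(2)]]
  \<comment> \<open>A single remainder coefficient is one summand of the bounded square sum, so it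
    is a bounded functional with constant 1.\<close>
  have rb: "cmod (rest_coef a b k f) \<le> 1 * H1_norm_on a b f" if f: "f \<in> H1_on a b" for f k
  proof (rule power2_le_imp_le)
    have "(cmod (rest_coef a b k f))\<^sup>2 \<le> (\<Sum>k<Suc k. (cmod (rest_coef a b k f))\<^sup>2)"
      by (rule member_le_sum) auto
    also have "\<dots> \<le> (H1_norm_on a b f)\<^sup>2" by (rule rest_coef_sum_bound[OF ab f])
    finally show "(cmod (rest_coef a b k f))\<^sup>2 \<le> (1 * H1_norm_on a b f)\<^sup>2" by simp
  qed simp
  note D = sp[OF H1_functional_rest_coef[OF ab(2)] zero_le_one rb]
  have ie: "integrable ?N (\<lambda>s. texp k s * f s)" if "f \<in> sqint ?N" for f k
    by (rule sqint_integrable[OF sqint_mult_bounded(1)[OF that texp_measurable, of _ 1]]) simp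
  have dec: "of_real (weight k) * (texp k s * piece_coef a b k f) =
      boundary_factor k b * (texp k s * trace_right a b f) + (- boundary_factor k a) * (texp k s * trace_left a b f)
      + texp k s * rest_coef a b k f" for k s f
    by (simp add: rest_coef_def algebra_simps)
  have i3: "integrable ?N (\<lambda>s. boundary_factor k b * (texp k s * trace_right a b (g s)))"
    "integrable ?N (\<lambda>s. (- boundary_factor k a) * (texp k s * trace_left a b (g s)))"
    "integrable ?N (\<lambda>s. texp k s * rest_coef a b k (g s))" for k
    using ie[OF R(1)] ie[OF L(1)] ie[OF D(1)] by (auto simp del: mult_minus_left)
  have pc: "integrable ?N (\<lambda>s. of_real (weight k) * (texp k s * piece_coef a b k (g s)))" for k
    unfolding dec by (intro Bochner_Integration.integrable_add i3)
  show "integrable (ivl r t) (\<lambda>s. texp k s * piece_coef a b k (g s))"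
  proof -
    have w: "complex_of_real (weight k) \<noteq> 0" using weight_ge_1[of k] by auto
    have "integrable ?N (\<lambda>s. inverse (of_real (weight k)) * (of_real (weight k) * (texp k s * piece_coef a b k (g s))))"
      by (rule integrable_mult_right) (rule pc)
    then show ?thesis unfolding mult.assoc[symmetric] left_inverse[OF w] mult_1 .
  qed
  define P Q V where "P k = (LINT s|?N. texp k s * trace_right a b (g s))"
    and "Q k = (LINT s|?N. texp k s * trace_left a b (g s))"
    and "V k = (LINT s|?N. texp k s * rest_coef a b k (g s))" for k
  have "(cmod (of_real (weight k) * (LINT s|?N. texp k s * piece_coef a b k (g s))))\<^sup>2
      \<le> 3 * ((cmod (P k))\<^sup>2 + (cmod (Q k))\<^sup>2 + (cmod (V k))\<^sup>2)" for k
  proof -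
    have eq: "of_real (weight k) * (LINT s|?N. texp k s * piece_coef a b k (g s)) =
        boundary_factor k b * P k + (- boundary_factor k a) * Q k + V k"
      unfolding P_def Q_def V_def integral_mult_right_zero[symmetric] dec
      using i3[of k] by (simp del: mult_minus_left integral_mult_right_zero)
    have "(cmod (of_real (weight k) * (LINT s|?N. texp k s * piece_coef a b k (g s))))\<^sup>2
        \<le> 3 * ((cmod (boundary_factor k b * P k))\<^sup>2 + (cmod ((- boundary_factor k a) * Q k))\<^sup>2 + (cmod (V k))\<^sup>2)"
      unfolding eq by (rule cmod_add3_sq_le)
    also have "\<dots> \<le> 3 * ((cmod (P k))\<^sup>2 + (cmod (Q k))\<^sup>2 + (cmod (V k))\<^sup>2)"
    proof (intro mult_left_mono add_mono power_mono order_refl)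
      show "cmod (boundary_factor k b * P k) \<le> cmod (P k)" "cmod ((- boundary_factor k a) * Q k) \<le> cmod (Q k)"
        using boundary_factor_bound by (simp_all add: norm_mult mult_left_le_one_le)
    qed auto
    finally show ?thesis .
  qed
  then have "(\<Sum>k<n. (cmod (of_real (weight k) * (LINT s|?N. texp k s * piece_coef a b k (g s))))\<^sup>2)
      \<le> (\<Sum>k<n. 3 * ((cmod (P k))\<^sup>2 + (cmod (Q k))\<^sup>2 + (cmod (V k))\<^sup>2))"
    by (rule sum_mono)
  also have "\<dots> = 3 * ((\<Sum>k<n. (cmod (P k))\<^sup>2) + (\<Sum>k<n. (cmod (Q k))\<^sup>2) + (\<Sum>k<n. (cmod (V k))\<^sup>2))"
    by (simp add: sum.distrib sum_distrib_left)
  also have "\<dots> \<le> 3 * (time_period T * (?S\<^sup>2 * ?m2) + time_period T * (?S\<^sup>2 * ?m2) + T * ?m2)"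
  proof (intro mult_left_mono add_mono)
    show "(\<Sum>k<n. (cmod (P k))\<^sup>2) \<le> time_period T * (?S\<^sup>2 * ?m2)"
      unfolding P_def using bessel_time[OF R(1) rt(1,3), of n] R(2) time_period(1)[of T]
      by (meson less_imp_le mult_left_mono order_trans)
    show "(\<Sum>k<n. (cmod (Q k))\<^sup>2) \<le> time_period T * (?S\<^sup>2 * ?m2)"
      unfolding Q_def using bessel_time[OF L(1) rt(1,3), of n] L(2) time_period(1)[of T]
      by (meson less_imp_le mult_left_mono order_trans)
    \<comment> \<open>The exponential is estimated by its modulus here: no oscillation in time is
      needed for the remainder.\<close>
    have V: "(cmod (V k))\<^sup>2 \<le> T * (LINT s|?N. (cmod (rest_coef a b k (g s)))\<^sup>2)" for k
    proof -
      have "cmod (V k) \<le> (LINT s|?N. cmod (rest_coef a b k (g s)))"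
        unfolding V_def using integral_norm_bound[of ?N "\<lambda>s. texp k s * rest_coef a b k (g s)"]
        by (simp add: norm_mult)
      also have "\<dots> \<le> sqrt (t - r) * l2norm ?N (\<lambda>s. rest_coef a b k (g s))"
        using sqint_integral_norm_le[OF D(1)] measure_ivl[OF rt(2)] by simp
      finally have "(cmod (V k))\<^sup>2 \<le> (sqrt (t - r) * l2norm ?N (\<lambda>s. rest_coef a b k (g s)))\<^sup>2"
        by (intro power_mono) auto
      also have "\<dots> = (t - r) * (LINT s|?N. (cmod (rest_coef a b k (g s)))\<^sup>2)"
        using rt by (simp add: power_mult_distrib l2norm_sq)
      also have "\<dots> \<le> T * (LINT s|?N. (cmod (rest_coef a b k (g s)))\<^sup>2)"
        using rt by (intro mult_right_mono Bochner_Integration.integral_nonneg) auto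
      finally show ?thesis .
    qed
    \<comment> \<open>The finite sum is taken inside the time integral, where the spatial Bessel
      bound applies at almost every instant.\<close>
    have "(\<Sum>k<n. (cmod (V k))\<^sup>2) \<le> (\<Sum>k<n. T * (LINT s|?N. (cmod (rest_coef a b k (g s)))\<^sup>2))"
      by (intro sum_mono V)
    also have "\<dots> = T * (LINT s|?N. (\<Sum>k<n. (cmod (rest_coef a b k (g s)))\<^sup>2))"
      using sqintD(2)[OF D(1)] by (simp add: sum_distrib_left)
    also have "\<dots> \<le> T * ?m2"
    proof (intro mult_left_mono integral_mono_AE)
      have "AE s in ivl 0 T. (\<Sum>k<n. (cmod (rest_coef a b k (g s)))\<^sup>2) \<le> (m s)\<^sup>2"
        using gm g[unfolded source_def, THEN conjunct1]
      proof eventually_elim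
        case (elim s)
        have "(H1_norm_on a b (g s))\<^sup>2 \<le> (m s)\<^sup>2" by (intro power_mono elim) simp
        then show ?case using rest_coef_sum_bound[OF ab elim(2), of n] by linarith
      qed
      then show "AE s in ?N. (\<Sum>k<n. (cmod (rest_coef a b k (g s)))\<^sup>2) \<le> (m s)\<^sup>2"
        by (rule AE_ivl_sub[OF _ rt(1,3)])
    qed (use rt time_bound_sub(2)[OF m rt(1,3)] sqintD(2)[OF D(1)] in auto)
    finally show "(\<Sum>k<n. (cmod (V k))\<^sup>2) \<le> T * ?m2" .
  qed auto
  also have "\<dots> = 3 * (2 * time_period T * ?S\<^sup>2 + T) * ?m2" by (simp add: algebra_simps)
  finally show "(\<Sum>k<n. (cmod (of_real (weight k) * (LINT s|?N. texp k s * piece_coef a b k (g s))))\<^sup>2)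
     \<le> 3 * (2 * time_period T * ?S\<^sup>2 + T) * ?m2" .
qed

section \<open>Piecewise $H^1$ sources\<close>

lemma cmod_sum_sq_le: "(cmod (\<Sum>i\<in>I. f i))\<^sup>2 \<le> real (card I) * (\<Sum>i\<in>I. (cmod (f i))\<^sup>2)"
proof -
  have "(cmod (\<Sum>i\<in>I. f i))\<^sup>2 \<le> (\<Sum>i\<in>I. cmod (f i))\<^sup>2"
    by (intro power_mono norm_sum) auto
  also have "\<dots> \<le> (\<Sum>i\<in>I. (cmod (f i))\<^sup>2) * real (card I)"
    by (rule sum_squared_le_sum_of_squares)
  finally show ?thesis by (simp add: mult.commute)
qed

lemma sqint_nat_bounded:
  assumes "\<And>n. (\<Sum>k<n. (cmod (x k))\<^sup>2) \<le> B"
  shows "x \<in> sqint nat_measure" "(l2norm nat_measure x)\<^sup>2 \<le> B"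
proof -
  note s = summable_bounded_partial_sums[of "\<lambda>k. (cmod (x k))\<^sup>2", OF _ assms]
  show "x \<in> sqint nat_measure" unfolding sqint_count_space by (rule s(1)) simp
  have "(l2norm nat_measure x)\<^sup>2 = (\<Sum>k. (cmod (x k))\<^sup>2)"
    using s(1) by (subst l2norm_count_space) (auto simp: suminf_nonneg)
  also have "\<dots> \<le> B" by (rule s(2)) simp
  finally show "(l2norm nat_measure x)\<^sup>2 \<le> B" .
qed

lemma source_add:
  assumes "a < b" "source a b T f" "source a b T g"
  shows "source a b T (\<lambda>s x. f s x + g s x)"
  unfolding source_def
proof (intro conjI allI impI)
  have AE: "AE s in ivl 0 T. f s \<in> H1_on a b \<and> g s \<in> H1_on a b"
    using assms(2,3) by (auto simp: source_def)
  then show "AE s in ivl 0 T. (\<lambda>x. f s x + g s x) \<in> H1_on a b"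
    by eventually_elim (auto intro: H1_on_add[OF assms(1)])
  fix \<Lambda> assume \<Lambda>: "H1_functional a b \<Lambda>"
  show "(\<lambda>s. \<Lambda> (\<lambda>x. f s x + g s x)) \<in> borel_measurable (ivl 0 T)"
  proof (rule measurable_ivl_cong_AE)
    show "(\<lambda>s. \<Lambda> (f s) + \<Lambda> (g s)) \<in> borel_measurable (ivl 0 T)"
      using assms(2,3) \<Lambda> by (intro borel_measurable_add) (auto simp: source_def)
    show "AE s in ivl 0 T. \<Lambda> (f s) + \<Lambda> (g s) = \<Lambda> (\<lambda>x. f s x + g s x)"
      using AE by eventually_elim (use \<Lambda> in \<open>simp add: H1_functional_def\<close>)
  qed
qed

lemma source_cmult:
  assumes "a < b" "source a b T g" "c \<in> borel_measurable (ivl 0 T)"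
  shows "source a b T (\<lambda>s x. c s * g s x)"
  unfolding source_def
proof (intro conjI allI impI)
  have AE: "AE s in ivl 0 T. g s \<in> H1_on a b"
    using assms(2) by (auto simp: source_def)
  then show "AE s in ivl 0 T. (\<lambda>x. c s * g s x) \<in> H1_on a b"
    by eventually_elim (auto intro: H1_on_cmult[OF assms(1)])
  fix \<Lambda> assume \<Lambda>: "H1_functional a b \<Lambda>"
  show "(\<lambda>s. \<Lambda> (\<lambda>x. c s * g s x)) \<in> borel_measurable (ivl 0 T)"
  proof (rule measurable_ivl_cong_AE)
    show "(\<lambda>s. c s * \<Lambda> (g s)) \<in> borel_measurable (ivl 0 T)"
      using assms(2,3) \<Lambda> by (intro borel_measurable_times) (auto simp: source_def)
    show "AE s in ivl 0 T. c s * \<Lambda> (g s) = \<Lambda> (\<lambda>x. c s * g s x)"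
      using AE by eventually_elim (use \<Lambda> in \<open>simp add: H1_functional_def\<close>)
  qed
qed

text \<open>Along a trajectory that is continuous in norm every bounded functional is continuous in
  time, hence measurable.\<close>

lemma source_continuous:
  assumes ab: "a < b" and G: "\<And>s. s \<in> {0..T} \<Longrightarrow> G s \<in> H1_on a b"
    and cont: "\<And>t. t \<in> {0..T} \<Longrightarrow> ((\<lambda>s. H1_norm_on a b (\<lambda>x. G s x - G t x)) \<longlongrightarrow> 0) (at t within {0..T})"
  shows "source a b T G"
  unfolding source_def
proof (intro conjI allI impI)
  show "AE s in ivl 0 T. G s \<in> H1_on a b"
    using AE_space by eventually_elim (use G in auto)
  fix \<Lambda> assume \<Lambda>: "H1_functional a b \<Lambda>"
  obtain C where C: "\<forall>f\<in>H1_on a b. cmod (\<Lambda> f) \<le> C * H1_norm_on a b f"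
    using H1_functional_bound[OF \<Lambda>] by blast
  show "(\<lambda>s. \<Lambda> (G s)) \<in> borel_measurable (ivl 0 T)"
  proof (rule continuous_on_ivl_measurable, unfold continuous_on_def, rule ballI)
    fix t assume t: "t \<in> {0..T}"
    have "((\<lambda>s. \<Lambda> (G s) - \<Lambda> (G t)) \<longlongrightarrow> 0) (at t within {0..T})"
    proof (rule Lim_null_comparison)
      show "((\<lambda>s. C * H1_norm_on a b (\<lambda>x. G s x - G t x)) \<longlongrightarrow> 0) (at t within {0..T})"
        using tendsto_mult[OF tendsto_const cont[OF t], of C] by simp
      show "\<forall>\<^sub>F s in at t within {0..T}. norm (\<Lambda> (G s) - \<Lambda> (G t)) \<le> C * H1_norm_on a b (\<lambda>x. G s x - G t x)"
        unfolding eventually_at_filter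
      proof (intro always_eventually allI impI)
        fix s assume s: "s \<in> {0..T}"
        have "\<Lambda> (G s) - \<Lambda> (G t) = \<Lambda> (\<lambda>x. G s x - G t x)"
          by (rule H1_functional_diff[OF \<Lambda> ab G[OF s] G[OF t], symmetric])
        then show "norm (\<Lambda> (G s) - \<Lambda> (G t)) \<le> C * H1_norm_on a b (\<lambda>x. G s x - G t x)"
          using C H1_on_diff[OF ab G[OF s] G[OF t]] by simp
      qed
    qed
    then show "((\<lambda>s. \<Lambda> (G s)) \<longlongrightarrow> \<Lambda> (G t)) (at t within {0..T})"
      by (simp add: LIM_zero_iff)
  qed
qed

section \<open>The partition by the breakpoints and the piecewise norm\<close>

locale breakpoints =
  fixes A :: "real set"
  assumes finite_A: "finite A" and A_sub: "A \<subseteq> {0<..<1}"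
begin

abbreviation bp :: "nat \<Rightarrow> real" where "bp j \<equiv> breakpt A j"
abbreviation piece :: "nat \<Rightarrow> real measure" where "piece j \<equiv> ivl (bp j) (bp (Suc j))"
abbreviation piece_norm :: "nat \<Rightarrow> cfun \<Rightarrow> real" where "piece_norm j g \<equiv> H1_norm_on (bp j) (bp (Suc j)) g"

lemma bp_0: "bp 0 = 0" by (simp add: breakpt_def)

lemma bp_last: "bp (Suc (card A)) = 1"
  using finite_A by (simp add: breakpt_def nth_append)

lemma bp_less:
  assumes "i < j" "j \<le> Suc (card A)" shows "bp i < bp j"
proof -
  have "sorted_wrt (<) (0 # sorted_list_of_set A @ [1])"
    using finite_A A_sub by (auto simp: sorted_wrt_append)
  from sorted_wrt_nth_less[OF this assms(1)] show ?thesis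
    using assms(2) finite_A by (simp add: breakpt_def)
qed

lemma bp_range:
  assumes "j \<le> Suc (card A)" shows "0 \<le> bp j" "bp j \<le> 1"
proof -
  show "0 \<le> bp j" using bp_less[of 0 j] assms bp_0 by (cases "j = 0") auto
  show "bp j \<le> 1" using bp_less[of j "Suc (card A)"] assms bp_last by (cases "j = Suc (card A)") auto
qed

lemma piece_range:
  assumes "j \<le> card A" shows "0 \<le> bp j" "bp j < bp (Suc j)" "bp (Suc j) \<le> 1"
  using bp_range[of j] bp_range[of "Suc j"] bp_less[of j "Suc j"] assms by auto

lemma pieces_sqint:
  assumes "\<And>j. j \<le> card A \<Longrightarrow> f \<in> sqint (piece j)"
  shows "f \<in> sqint I01"
proof -
  have "m \<le> Suc (card A) \<Longrightarrow> f \<in> sqint (ivl 0 (bp m))" for m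
  proof (induction m)
    case 0
    have "{0<..<0::real} = {}" by auto
    then show ?case unfolding bp_0 by (intro sqintI) (simp_all add: measurable_def)
  next
    case (Suc m)
    show ?case
      by (rule sqint_ivl_join[of _ _ "bp m"]) (use Suc assms[of m] piece_range[of m] in auto)
  qed
  from this[of "Suc (card A)"] show ?thesis by (simp add: bp_last)
qed

lemma pieces_integral:
  fixes f :: "real \<Rightarrow> 'b::{banach, second_countable_topology}"
  assumes f: "integrable I01 f"
  shows "(LINT x|I01. f x) = (\<Sum>j\<le>card A. LINT x|piece j. f x)"
proof -
  have "m \<le> Suc (card A) \<Longrightarrow> (LINT x|ivl 0 (bp m). f x) = (\<Sum>j<m. LINT x|piece j. f x)" for m
  proof (induction m)
    case 0
    have "{0<..<0::real} = {}" by auto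
    then show ?case unfolding bp_0 by simp
  next
    case (Suc m)
    have m: "m \<le> card A" using Suc.prems by simp
    have "integrable (ivl 0 (bp (Suc m))) f"
      by (rule integrable_ivl_sub[OF f]) (use piece_range[OF m] in auto)
    then have "(LINT x|ivl 0 (bp (Suc m)). f x) = (LINT x|ivl 0 (bp m). f x) + (LINT x|piece m. f x)"
      by (rule integral_ivl_split) (use piece_range[OF m] in auto)
    then show ?case using Suc by simp
  qed
  from this[of "Suc (card A)"] show ?thesis by (simp add: bp_last lessThan_Suc_atMost)
qed

lemma H1_pw_sqint: "g \<in> H1_pw A \<Longrightarrow> g \<in> sqint I01"
  by (rule pieces_sqint) (auto simp: H1_pw_def intro: H1_onD(1))

lemma coef_pieces:
  assumes "g \<in> sqint I01"
  shows "coef g k = (\<Sum>j\<le>card A. piece_coef (bp j) (bp (Suc j)) k g)"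
  unfolding coef_integral piece_coef_def
  by (rule pieces_integral[OF sqint_mult[OF assms eigfun_sqint]])

lemma H1_pw_norm_nonneg [simp]: "0 \<le> H1_pw_norm A g"
  by (simp add: H1_pw_norm_def sum_nonneg)

lemma H1_pw_norm_sq: "(H1_pw_norm A g)\<^sup>2 = (\<Sum>j\<le>card A. (piece_norm j g)\<^sup>2)"
  by (simp add: H1_pw_norm_def sum_nonneg)

lemma piece_norm_le:
  assumes "j \<le> card A" shows "piece_norm j g \<le> H1_pw_norm A g"
proof (rule power2_le_imp_le)
  show "(piece_norm j g)\<^sup>2 \<le> (H1_pw_norm A g)\<^sup>2"
    unfolding H1_pw_norm_sq by (rule member_le_sum) (use assms in auto)
qed simp

lemma H1_pw_norm_le_sum: "H1_pw_norm A g \<le> (\<Sum>j\<le>card A. piece_norm j g)"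
  using L2_set_le_sum[of "{..card A}" "\<lambda>j. piece_norm j g"] by (simp add: H1_pw_norm_def L2_set_def)

lemma l2norm_le_H1_pw_norm:
  assumes "g \<in> H1_pw A" shows "l2norm I01 g \<le> H1_pw_norm A g"
proof (rule power2_le_imp_le)
  have "(l2norm I01 g)\<^sup>2 = (\<Sum>j\<le>card A. (l2norm (piece j) g)\<^sup>2)"
    unfolding l2norm_sq by (rule pieces_integral) (use H1_pw_sqint[OF assms] in simp)
  also have "\<dots> \<le> (\<Sum>j\<le>card A. (piece_norm j g)\<^sup>2)"
    by (intro sum_mono power_mono l2norm_le_H1_norm_on) auto
  finally show "(l2norm I01 g)\<^sup>2 \<le> (H1_pw_norm A g)\<^sup>2" by (simp add: H1_pw_norm_sq)
qed simp

lemma H1_pw_cmult: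
  assumes "g \<in> H1_pw A"
  shows "(\<lambda>x. c * g x) \<in> H1_pw A" "H1_pw_norm A (\<lambda>x. c * g x) = cmod c * H1_pw_norm A g"
proof -
  show "(\<lambda>x. c * g x) \<in> H1_pw A"
    using assms piece_range(2) by (auto simp: H1_pw_def intro: H1_on_cmult)
  have "(H1_pw_norm A (\<lambda>x. c * g x))\<^sup>2 = (\<Sum>j\<le>card A. (cmod c * piece_norm j g)\<^sup>2)"
    unfolding H1_pw_norm_sq using assms piece_range(2)
    by (intro sum.cong refl arg_cong[of _ _ "\<lambda>x. x\<^sup>2"] H1_on_cmult(2)) (auto simp: H1_pw_def)
  also have "\<dots> = (cmod c * H1_pw_norm A g)\<^sup>2"
    by (simp add: power_mult_distrib sum_distrib_left H1_pw_norm_sq)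
  finally show "H1_pw_norm A (\<lambda>x. c * g x) = cmod c * H1_pw_norm A g"
    by (rule power2_eq_imp_eq) auto
qed

lemma H1_pw_norm_triangle:
  assumes "f \<in> H1_pw A" "g \<in> H1_pw A"
  shows "H1_pw_norm A (\<lambda>x. f x + g x) \<le> H1_pw_norm A f + H1_pw_norm A g"
proof -
  have "H1_pw_norm A (\<lambda>x. f x + g x) \<le> L2_set (\<lambda>j. piece_norm j f + piece_norm j g) {..card A}"
    unfolding H1_pw_norm_def L2_set_def using assms piece_range(2)
    by (intro real_sqrt_le_mono sum_mono power_mono H1_norm_on_triangle) (auto simp: H1_pw_def)
  also have "\<dots> \<le> H1_pw_norm A f + H1_pw_norm A g"
    unfolding H1_pw_norm_def using L2_set_triangle_ineq by (simp add: L2_set_def)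
  finally show ?thesis .
qed

definition pw_source :: "real \<Rightarrow> (real \<Rightarrow> cfun) \<Rightarrow> bool" where
  "pw_source T g \<longleftrightarrow> (\<forall>j\<le>card A. source (bp j) (bp (Suc j)) T g)"

lemma pw_source_AE:
  assumes "pw_source T g" shows "AE s in ivl 0 T. g s \<in> H1_pw A"
proof -
  have "AE s in ivl 0 T. \<forall>j\<in>{..card A}. g s \<in> H1_on (bp j) (bp (Suc j))"
    by (rule AE_finite_allI) (use assms in \<open>auto simp: pw_source_def source_def\<close>)
  then show ?thesis by eventually_elim (auto simp: H1_pw_def)
qed

lemma pw_source_add:
  "pw_source T f \<Longrightarrow> pw_source T g \<Longrightarrow> pw_source T (\<lambda>s x. f s x + g s x)"
  using piece_range(2) by (auto simp: pw_source_def intro: source_add)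

lemma pw_source_cmult:
  "pw_source T g \<Longrightarrow> c \<in> borel_measurable (ivl 0 T) \<Longrightarrow> pw_source T (\<lambda>s x. c s * g s x)"
  using piece_range(2) by (auto simp: pw_source_def intro: source_cmult)

section \<open>The Duhamel integral in coordinates\<close>

text \<open>The outer phase of the free evolution up to time \<open>t\<close> is left out, so that
  the integrand does not depend on \<open>t\<close> and the quantity is additive over adjacent time
  intervals.\<close>

definition duhamel :: "real \<Rightarrow> real \<Rightarrow> (real \<Rightarrow> cfun) \<Rightarrow> nat \<Rightarrow> complex" where
  "duhamel r t g k = (LINT s|ivl r t. texp k s * coef (g s) k)"

text \<open>\<open>real (Suc (card A))\<close> is the number of pieces, which appears when a sum
  over the pieces is squared; each summand is the constant of \<open>piece_estimate\<close>.\<close>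

definition duhamel_const :: "real \<Rightarrow> real" where
  "duhamel_const T = real (Suc (card A)) *
     (\<Sum>j\<le>card A. 3 * (2 * time_period T * (sup_const (bp j) (bp (Suc j)))\<^sup>2 + T))"

lemma duhamel_const_nonneg: "0 \<le> T \<Longrightarrow> 0 \<le> duhamel_const T"
  unfolding duhamel_const_def using time_period(1)[of T] by (intro mult_nonneg_nonneg sum_nonneg) auto

text \<open>The smoothing estimate, obtained by summing over the pieces. The lower limit
  \<open>r\<close> is kept free because continuity in time is deduced from the integral over the
  interval between two instants.\<close>

lemma duhamel_estimate:
  assumes g: "pw_source T g" and m: "time_bound T m"
    and gm: "AE s in ivl 0 T. H1_pw_norm A (g s) \<le> m s" and rt: "0 \<le> r" "r \<le> t" "t \<le> T"
  shows "integrable (ivl r t) (\<lambda>s. texp k s * coef (g s) k)"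
    "(\<lambda>k. of_real (weight k) * duhamel r t g k) \<in> sqint nat_measure"
    "(l2norm nat_measure (\<lambda>k. of_real (weight k) * duhamel r t g k))\<^sup>2 \<le> duhamel_const T * (LINT s|ivl r t. (m s)\<^sup>2)"
proof -
  let ?N = "ivl r t" and ?m2 = "LINT s|ivl r t. (m s)\<^sup>2"
  let ?p = "\<lambda>j k s. piece_coef (bp j) (bp (Suc j)) k (g s)"
  define c where "c j = 3 * (2 * time_period T * (sup_const (bp j) (bp (Suc j)))\<^sup>2 + T)" for j
  have gj: "source (bp j) (bp (Suc j)) T g" if "j \<le> card A" for j
    using g that by (simp add: pw_source_def)
  have gmj: "AE s in ivl 0 T. piece_norm j (g s) \<le> m s" if "j \<le> card A" for j
    using gm by eventually_elim (use piece_norm_le[OF that] order_trans in blast)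
  note est = piece_estimate[OF piece_range gj m gmj rt]
  have pi: "integrable ?N (\<lambda>s. texp k s * ?p j k s)" if "j \<le> card A" for j k
    using est(2)[of j k] that by simp
  have ps: "integrable ?N (\<lambda>s. \<Sum>j\<le>card A. texp k s * ?p j k s)" for k
    by (rule Bochner_Integration.integrable_sum) (use pi in auto)
  have "AE s in ivl 0 T. \<forall>k. (\<Sum>j\<le>card A. texp k s * ?p j k s) = texp k s * coef (g s) k"
    using pw_source_AE[OF g]
    by eventually_elim (simp add: coef_pieces[OF H1_pw_sqint] sum_distrib_left)
  from AE_ivl_sub[OF this rt(1,3)]
  have AE: "AE s in ?N. (\<Sum>j\<le>card A. texp k s * ?p j k s) = texp k s * coef (g s) k" for k
    by eventually_elim simp
  have meas: "(\<lambda>s. texp k s * coef (g s) k) \<in> borel_measurable ?N" for k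
    by (rule measurable_ivl_cong_AE[OF borel_measurable_integrable[OF ps] AE])
  show "integrable ?N (\<lambda>s. texp k s * coef (g s) k)"
    by (rule integrable_cong_AE_imp[OF ps meas]) (use AE[of k] in eventually_elim, simp)
  have d: "duhamel r t g k = (\<Sum>j\<le>card A. LINT s|?N. texp k s * ?p j k s)" for k
  proof -
    have "duhamel r t g k = (LINT s|?N. (\<Sum>j\<le>card A. texp k s * ?p j k s))"
      unfolding duhamel_def
      by (rule integral_cong_AE[OF meas borel_measurable_integrable[OF ps]])
         (use AE[of k] in eventually_elim, simp)
    also have "\<dots> = (\<Sum>j\<le>card A. LINT s|?N. texp k s * ?p j k s)"
      by (rule Bochner_Integration.integral_sum) (use pi in auto)
    finally show ?thesis .
  qed
  have "(\<Sum>k<n. (cmod (of_real (weight k) * duhamel r t g k))\<^sup>2) \<le> duhamel_const T * ?m2" for n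
  proof -
    have "(\<Sum>k<n. (cmod (of_real (weight k) * duhamel r t g k))\<^sup>2) \<le>
        (\<Sum>k<n. real (Suc (card A)) * (\<Sum>j\<le>card A. (cmod (of_real (weight k) * (LINT s|?N. texp k s * ?p j k s)))\<^sup>2))"
    proof (rule sum_mono)
      fix k
      show "(cmod (of_real (weight k) * duhamel r t g k))\<^sup>2 \<le>
        real (Suc (card A)) * (\<Sum>j\<le>card A. (cmod (of_real (weight k) * (LINT s|?N. texp k s * ?p j k s)))\<^sup>2)"
        unfolding d sum_distrib_left
        using cmod_sum_sq_le[of "\<lambda>j. of_real (weight k) * (LINT s|?N. texp k s * ?p j k s)" "{..card A}"]
        by (simp add: sum_distrib_left)
    qed
    also have "\<dots> = real (Suc (card A)) * (\<Sum>j\<le>card A. \<Sum>k<n. (cmod (of_real (weight k) * (LINT s|?N. texp k s * ?p j k s)))\<^sup>2)"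
      by (subst sum.swap) (simp only: sum_distrib_left)
    also have "\<dots> \<le> real (Suc (card A)) * (\<Sum>j\<le>card A. c j * ?m2)"
      unfolding c_def by (intro mult_left_mono sum_mono est(1)) auto
    also have "\<dots> = duhamel_const T * ?m2"
      by (simp only: duhamel_const_def c_def sum_distrib_right mult.assoc)
    finally show ?thesis .
  qed
  note b = sqint_nat_bounded[of "\<lambda>k. of_real (weight k) * duhamel r t g k", OF this]
  show "(\<lambda>k. of_real (weight k) * duhamel r t g k) \<in> sqint nat_measure"
    "(l2norm nat_measure (\<lambda>k. of_real (weight k) * duhamel r t g k))\<^sup>2 \<le> duhamel_const T * ?m2"
    by (rule b)+
qed

text \<open>Strong measurability implies the weak form: a functional of a simple function is simple,
  and boundedness lets the functionals pass to the limit almost everywhere.\<close>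

lemma pw_source_L2_time:
  assumes "f \<in> L2_time_H1_pw T A"
  shows "pw_source T f" "time_bound T (\<lambda>s. H1_pw_norm A (f s))"
proof -
  have sm: "strongly_measurable (H1_pw A) (H1_pw_norm A) (ivl 0 T) f"
    and i: "integrable (ivl 0 T) (\<lambda>t. (H1_pw_norm A (f t))\<^sup>2)"
    using assms by (auto simp: L2_time_H1_pw_def)
  have "(\<lambda>t. sqrt ((H1_pw_norm A (f t))\<^sup>2)) \<in> borel_measurable (ivl 0 T)"
    using borel_measurable_integrable[OF i] by (rule measurable_compose) (rule borel_measurable_sqrt)
  then show "time_bound T (\<lambda>s. H1_pw_norm A (f s))" using i by (simp add: time_bound_def)
  obtain S where S: "\<And>n. simple_in (H1_pw A) (ivl 0 T) (S n)"
    and AE: "AE t in ivl 0 T. f t \<in> H1_pw A \<and> (\<lambda>n::nat. H1_pw_norm A (\<lambda>x. f t x - S n t x)) \<longlonglongrightarrow> 0"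
    using sm unfolding strongly_measurable_def by blast
  have SH: "S n t \<in> H1_pw A" if "t \<in> {0<..<T}" for n t
    using S[of n] that by (auto simp: simple_in_def)
  show "pw_source T f"
    unfolding pw_source_def source_def
  proof (intro allI impI conjI)
    fix j assume j: "j \<le> card A"
    let ?a = "bp j" and ?b = "bp (Suc j)"
    have ab: "?a < ?b" by (rule piece_range(2)[OF j])
    show "AE s in ivl 0 T. f s \<in> H1_on ?a ?b"
      using AE by eventually_elim (use j in \<open>auto simp: H1_pw_def\<close>)
    fix \<Lambda> assume \<Lambda>: "H1_functional ?a ?b \<Lambda>"
    obtain C where C: "0 \<le> C" "\<forall>f\<in>H1_on ?a ?b. cmod (\<Lambda> f) \<le> C * H1_norm_on ?a ?b f"
      using H1_functional_bound[OF \<Lambda>] by blast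
    show "(\<lambda>s. \<Lambda> (f s)) \<in> borel_measurable (ivl 0 T)"
    proof (rule measurable_ivl_AE_limit)
      fix n
      have "simple_function (ivl 0 T) (\<Lambda> \<circ> S n)"
        by (rule simple_function_compose) (use S[of n] in \<open>simp add: simple_in_def\<close>)
      then show "(\<lambda>s. \<Lambda> (S n s)) \<in> borel_measurable (ivl 0 T)"
        by (simp add: comp_def borel_measurable_simple_function)
    next
      show "AE s in ivl 0 T. (\<lambda>n. \<Lambda> (S n s)) \<longlonglongrightarrow> \<Lambda> (f s)"
        using AE AE_space
      proof eventually_elim
        case (elim s)
        then have fs: "f s \<in> H1_on ?a ?b" and l: "(\<lambda>n. H1_pw_norm A (\<lambda>x. f s x - S n s x)) \<longlonglongrightarrow> 0"
          and Ss: "\<And>n. S n s \<in> H1_on ?a ?b"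
          using j SH[of s] by (auto simp: H1_pw_def)
        have "(\<lambda>n. \<Lambda> (f s) - \<Lambda> (S n s)) \<longlonglongrightarrow> 0"
        proof (rule Lim_null_comparison)
          show "(\<lambda>n. C * H1_pw_norm A (\<lambda>x. f s x - S n s x)) \<longlonglongrightarrow> 0"
            using tendsto_mult[OF tendsto_const l, of C] by simp
          show "\<forall>\<^sub>F n in sequentially. norm (\<Lambda> (f s) - \<Lambda> (S n s)) \<le> C * H1_pw_norm A (\<lambda>x. f s x - S n s x)"
          proof (intro always_eventually allI)
            fix n
            have "norm (\<Lambda> (f s) - \<Lambda> (S n s)) = cmod (\<Lambda> (\<lambda>x. f s x - S n s x))"
              using H1_functional_diff[OF \<Lambda> ab fs Ss] by simp
            also have "\<dots> \<le> C * piece_norm j (\<lambda>x. f s x - S n s x)"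
              using C(2) H1_on_diff[OF ab fs Ss] by blast
            also have "\<dots> \<le> C * H1_pw_norm A (\<lambda>x. f s x - S n s x)"
              by (intro mult_left_mono piece_norm_le j C)
            finally show "norm (\<Lambda> (f s) - \<Lambda> (S n s)) \<le> C * H1_pw_norm A (\<lambda>x. f s x - S n s x)" .
          qed
        qed
        from tendsto_diff[OF tendsto_const[of "\<Lambda> (f s)"] this] show ?case by simp
      qed
    qed
  qed
qed

section \<open>Multiplication by the potential\<close>

text \<open>On each piece \<open>3 * sup_const\<close> comes from the product estimate and
  \<open>1 + pi\<close> from comparing the Sobolev norm with the spectral one; the pieces are added
  since the piecewise norm is at most the sum of the piece norms.\<close>

definition mult_const :: "cfun \<Rightarrow> real" where
  "mult_const \<mu> = (\<Sum>j\<le>card A. 3 * sup_const (bp j) (bp (Suc j)) * piece_norm j \<mu> * (1 + pi))"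

lemma H1_pw_mult_piece:
  assumes \<mu>: "\<mu> \<in> H1_pw A" and v: "v \<in> H1_on 0 1" and j: "j \<le> card A"
  shows "(\<lambda>x. \<mu> x * v x) \<in> H1_on (bp j) (bp (Suc j))"
    "piece_norm j (\<lambda>x. \<mu> x * v x) \<le> 3 * sup_const (bp j) (bp (Suc j)) * piece_norm j \<mu> * (1 + pi) * H1_norm v"
proof -
  note r = piece_range[OF j]
  have vj: "v \<in> H1_on (bp j) (bp (Suc j))" and vn: "piece_norm j v \<le> (1 + pi) * H1_norm v"
    using H1_on_sub[OF _ v r] H1_norm_on_le_H1_norm[OF v] by auto
  have \<mu>j: "\<mu> \<in> H1_on (bp j) (bp (Suc j))" using \<mu> j by (simp add: H1_pw_def)
  show "(\<lambda>x. \<mu> x * v x) \<in> H1_on (bp j) (bp (Suc j))" by (rule H1_on_mult(1)[OF r(2) \<mu>j vj])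
  have "piece_norm j (\<lambda>x. \<mu> x * v x) \<le> 3 * sup_const (bp j) (bp (Suc j)) * piece_norm j \<mu> * piece_norm j v"
    by (rule H1_on_mult(2)[OF r(2) \<mu>j vj])
  also have "\<dots> \<le> 3 * sup_const (bp j) (bp (Suc j)) * piece_norm j \<mu> * ((1 + pi) * H1_norm v)"
    using sup_const_nonneg[OF r(2)] by (intro mult_left_mono vn) auto
  finally show "piece_norm j (\<lambda>x. \<mu> x * v x) \<le> 3 * sup_const (bp j) (bp (Suc j)) * piece_norm j \<mu> * (1 + pi) * H1_norm v"
    by (simp add: mult.assoc)
qed

lemma H1_pw_mult:
  assumes \<mu>: "\<mu> \<in> H1_pw A" and v: "v \<in> H1_on 0 1"
  shows "(\<lambda>x. \<mu> x * v x) \<in> H1_pw A" "H1_pw_norm A (\<lambda>x. \<mu> x * v x) \<le> mult_const \<mu> * H1_norm v"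
proof -
  show "(\<lambda>x. \<mu> x * v x) \<in> H1_pw A" using H1_pw_mult_piece(1)[OF \<mu> v] by (simp add: H1_pw_def)
  have "H1_pw_norm A (\<lambda>x. \<mu> x * v x) \<le> (\<Sum>j\<le>card A. piece_norm j (\<lambda>x. \<mu> x * v x))"
    by (rule H1_pw_norm_le_sum)
  also have "\<dots> \<le> mult_const \<mu> * H1_norm v"
    unfolding mult_const_def sum_distrib_right
    by (intro sum_mono H1_pw_mult_piece(2)[OF \<mu> v]) simp
  finally show "H1_pw_norm A (\<lambda>x. \<mu> x * v x) \<le> mult_const \<mu> * H1_norm v" .
qed

text \<open>Multiplication by \<open>\<mu>\<close> is bounded from the spectral norm to the norm on
  each piece, so the product inherits continuity in time.\<close>

lemma pw_source_mult:
  assumes \<mu>: "\<mu> \<in> H1_pw A" and \<psi>: "\<psi> \<in> C_time_H1 T"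
  shows "pw_source T (\<lambda>s x. \<mu> x * \<psi> s x)"
  unfolding pw_source_def
proof (intro allI impI)
  fix j assume j: "j \<le> card A"
  have \<psi>H: "\<psi> s \<in> H1_on 0 1" if "s \<in> {0..T}" for s using \<psi> that by (simp add: C_time_H1_def)
  let ?K = "3 * sup_const (bp j) (bp (Suc j)) * piece_norm j \<mu> * (1 + pi)"
  show "source (bp j) (bp (Suc j)) T (\<lambda>s x. \<mu> x * \<psi> s x)"
  proof (rule source_continuous[OF piece_range(2)[OF j]])
    show "(\<lambda>x. \<mu> x * \<psi> s x) \<in> H1_on (bp j) (bp (Suc j))" if "s \<in> {0..T}" for s
      by (rule H1_pw_mult_piece(1)[OF \<mu> \<psi>H[OF that] j])
    fix t assume t: "t \<in> {0..T}"
    show "((\<lambda>s. piece_norm j (\<lambda>x. \<mu> x * \<psi> s x - \<mu> x * \<psi> t x)) \<longlongrightarrow> 0) (at t within {0..T})"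
    proof (rule Lim_null_comparison)
      have "((\<lambda>s. H1_norm (\<lambda>x. \<psi> s x - \<psi> t x)) \<longlongrightarrow> 0) (at t within {0..T})"
        using \<psi> t by (simp add: C_time_H1_def)
      from tendsto_mult[OF tendsto_const this, of ?K]
      show "((\<lambda>s. ?K * H1_norm (\<lambda>x. \<psi> s x - \<psi> t x)) \<longlongrightarrow> 0) (at t within {0..T})" by simp
      show "\<forall>\<^sub>F s in at t within {0..T}. norm (piece_norm j (\<lambda>x. \<mu> x * \<psi> s x - \<mu> x * \<psi> t x))
          \<le> ?K * H1_norm (\<lambda>x. \<psi> s x - \<psi> t x)"
        unfolding eventually_at_filter
      proof (intro always_eventually allI impI)
        fix s assume s: "s \<in> {0..T}"
        have "(\<lambda>x. \<psi> s x - \<psi> t x) \<in> H1_on 0 1" by (intro H1_on_diff \<psi>H s t) simp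
        from H1_pw_mult_piece(2)[OF \<mu> this j]
        show "norm (piece_norm j (\<lambda>x. \<mu> x * \<psi> s x - \<mu> x * \<psi> t x)) \<le> ?K * H1_norm (\<lambda>x. \<psi> s x - \<psi> t x)"
          by (simp add: right_diff_distrib)
      qed
    qed
  qed
qed

end

section \<open>Bochner integrals in coordinates\<close>

lemma abs_cont_power:
  assumes "abs_cont a b K k"
  shows "abs_cont a b (\<lambda>x. K x ^ Suc n) (\<lambda>x. of_nat (Suc n) * (k x * K x ^ n))"
proof (induction n)
  case 0
  then show ?case using assms by simp
next
  case (Suc n)
  from abs_cont_mult[OF assms Suc] show ?case by (simp add: algebra_simps)
qed

text \<open>The product rule gives the integral of \<open>k * K^n\<close> as
  \<open>K t^(n+1) / (n+1)\<close>; the exponential series is then integrated term by term under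
  dominated convergence. This is the substitution rule for an absolutely continuous
  \<open>K\<close>.\<close>

lemma integral_exp_primitive_le:
  fixes k :: "real \<Rightarrow> real"
  assumes k: "integrable (ivl 0 T) k" "\<And>x. 0 \<le> k x" and l: "0 < l"
    and K_def: "\<And>x. K x = (LINT y|ivl 0 x. k y)" and t: "t \<in> {0..T}"
  shows "integrable (ivl 0 t) (\<lambda>s. k s * exp (l * K s))"
    "(LINT s|ivl 0 t. k s * exp (l * K s)) \<le> exp (l * K t) / l"
proof -
  let ?N = "ivl 0 t"
  have kt: "integrable ?N k" by (rule integrable_ivl_sub[OF k(1)]) (use t in auto)
  have K0: "0 \<le> K x" for x unfolding K_def using k(2) by simp
  have Kmono: "K s \<le> K t" if "s \<in> {0<..<t}" for s
    unfolding K_def by (rule integral_ivl_mono[OF kt]) (use that k in auto)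
  have abs_cont: "abs_cont 0 t (\<lambda>x. complex_of_real (K x)) (\<lambda>x. of_real (k x))"
    by (rule abs_cont_primitive[of _ _ _ _ 0]) (use kt in \<open>auto simp: K_def\<close>)
  have Kc: "(\<lambda>x. complex_of_real (K x)) \<in> borel_measurable ?N"
    by (rule continuous_on_ivl_measurable[OF abs_cont_continuous[OF abs_cont]])
  have Km: "K \<in> borel_measurable ?N"
    using measurable_compose[OF Kc borel_measurable_Re] by simp
  have pow: "integrable ?N (\<lambda>s. k s * K s ^ n)"
    "(LINT s|?N. k s * K s ^ n) = K t ^ Suc n / real (Suc n)" for n
  proof -
    note a = abs_cont_power[OF abs_cont, of n]
    have e: "of_nat (Suc n) * (complex_of_real (k s) * of_real (K s) ^ n) = complex_of_real (real (Suc n) * (k s * K s ^ n))" for s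
      by simp
    have i0: "integrable ?N (\<lambda>s. real (Suc n) * (k s * K s ^ n))"
      using abs_cont_integrable[OF a] unfolding e complex_of_real_integrable_eq .
    have "integrable ?N (\<lambda>s. inverse (real (Suc n)) * (real (Suc n) * (k s * K s ^ n)))"
      by (rule integrable_mult_right) (rule i0)
    moreover have "real (Suc n) \<noteq> 0" by simp
    ultimately show "integrable ?N (\<lambda>s. k s * K s ^ n)"
      unfolding mult.assoc[symmetric] by (simp only: left_inverse mult_1 not_False_eq_True)
    have "complex_of_real (K t) ^ Suc n = of_real (K 0) ^ Suc n + (LINT s|?N. complex_of_real (real (Suc n) * (k s * K s ^ n)))"
      using abs_cont_eq[OF a, of t] t unfolding e by simp
    then have "complex_of_real (K t ^ Suc n) = of_real (real (Suc n) * (LINT s|?N. k s * K s ^ n))"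
      unfolding integral_complex_of_real integral_mult_right_zero by (simp add: K_def)
    then have "K t ^ Suc n = real (Suc n) * (LINT s|?N. k s * K s ^ n)" by (simp only: of_real_eq_iff)
    then show "(LINT s|?N. k s * K s ^ n) = K t ^ Suc n / real (Suc n)" by simp
  qed
  define S where "S n s = (\<Sum>j<n. k s * ((l * K s)^j /\<^sub>R fact j))" for n s
  have Seq: "S n s = (\<Sum>j<n. (l^j / fact j) * (k s * K s ^ j))" for n s
    unfolding S_def by (intro sum.cong) (simp_all add: power_mult_distrib field_simps)
  have Sint: "integrable ?N (S n)" for n
    unfolding Seq[abs_def] by (intro Bochner_Integration.integrable_sum integrable_mult_right pow(1))
  have Sval: "(LINT s|?N. S n s) \<le> exp (l * K t) / l" for n
  proof -
    have "(LINT s|?N. S n s) = (\<Sum>j<n. LINT s|?N. (l^j / fact j) * (k s * K s ^ j))"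
      unfolding Seq by (rule Bochner_Integration.integral_sum) (intro integrable_mult_right pow(1))
    also have "\<dots> = (\<Sum>j<n. (l^j / fact j) * (K t ^ Suc j / real (Suc j)))"
      by (simp only: integral_mult_right_zero pow(2))
    \<comment> \<open>The integrated term of order \<open>j\<close> is the term of order
      \<open>Suc j\<close> of \<open>exp (l * K t)\<close>, divided by \<open>l\<close>. The term of
      order 0 is absent, so only an inequality remains.\<close>
    also have "\<dots> = (\<Sum>j<n. ((l * K t)^Suc j /\<^sub>R fact (Suc j)) / l)"
      using l by (intro sum.cong) (simp_all add: power_mult_distrib field_simps del: of_nat_Suc)
    also have "\<dots> = (\<Sum>j<n. (l * K t)^Suc j /\<^sub>R fact (Suc j)) / l" by (simp add: sum_divide_distrib)
    also have "(\<Sum>j<n. (l * K t)^Suc j /\<^sub>R fact (Suc j)) \<le> (\<Sum>j<Suc n. (l * K t)^j /\<^sub>R fact j)"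
      unfolding sum.lessThan_Suc_shift by simp
    also have "\<dots> \<le> exp (l * K t)"
      unfolding exp_def by (rule sum_le_suminf[OF summable_exp_generic]) (use l K0 in auto)
    finally show ?thesis using l by (simp add: divide_right_mono)
  qed
  have Slim: "(\<lambda>n. S n s) \<longlonglongrightarrow> k s * exp (l * K s)" for s
    unfolding S_def sum_distrib_left[symmetric] exp_def
    by (intro tendsto_mult tendsto_const summable_LIMSEQ summable_exp_generic)
  have bd: "AE s in ?N. norm (S n s) \<le> k s * exp (l * K t)" for n
    using AE_space
  proof eventually_elim
    case (elim s)
    have 0: "0 \<le> (\<Sum>j<n. (l * K s)^j /\<^sub>R fact j)"
      using l K0 by (intro sum_nonneg) auto
    have "(\<Sum>j<n. (l * K s)^j /\<^sub>R fact j) \<le> exp (l * K s)"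
      unfolding exp_def by (rule sum_le_suminf[OF summable_exp_generic]) (use l K0 in auto)
    also have "\<dots> \<le> exp (l * K t)" using Kmono[of s] elim l by simp
    finally have "k s * (\<Sum>j<n. (l * K s)^j /\<^sub>R fact j) \<le> k s * exp (l * K t)"
      using k(2) by (intro mult_left_mono) auto
    moreover have "0 \<le> k s * (\<Sum>j<n. (l * K s)^j /\<^sub>R fact j)" using 0 k(2) by simp
    ultimately show ?case unfolding S_def sum_distrib_left[symmetric] by simp
  qed
  have dom: "integrable ?N (\<lambda>s. k s * exp (l * K t))" using kt by simp
  have meas: "(\<lambda>s. k s * exp (l * K s)) \<in> borel_measurable ?N" using kt Km by measurable
  have AEl: "AE s in ?N. (\<lambda>n. S n s) \<longlonglongrightarrow> k s * exp (l * K s)" using Slim by simp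
  show "integrable ?N (\<lambda>s. k s * exp (l * K s))"
    by (rule integrable_dominated_convergence[OF meas borel_measurable_integrable[OF Sint] dom AEl bd])
  have "(\<lambda>n. LINT s|?N. S n s) \<longlonglongrightarrow> (LINT s|?N. k s * exp (l * K s))"
    by (rule integral_dominated_convergence[OF meas borel_measurable_integrable[OF Sint] dom AEl bd])
  then show "(LINT s|?N. k s * exp (l * K s)) \<le> exp (l * K t) / l"
    by (rule LIMSEQ_le_const2) (use Sval in auto)
qed

section \<open>Coefficients of Bochner integrals\<close>

lemma l2norm_coef:
  assumes "g \<in> sqint I01"
  shows "coef g \<in> sqint nat_measure" "l2norm nat_measure (coef g) = l2norm I01 g"
proof -
  show "coef g \<in> sqint nat_measure" using coef_summable[OF assms] by (simp add: sqint_count_space)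
  show "l2norm nat_measure (coef g) = l2norm I01 g"
    unfolding l2norm_count_space[OF coef_summable[OF assms]]
    using parseval[OF assms] by (simp add: sums_iff)
qed

lemma coef_sum:
  assumes "\<And>v. v \<in> V \<Longrightarrow> v \<in> sqint I01"
  shows "coef (\<lambda>x. \<Sum>v\<in>V. c v * v x) k = (\<Sum>v\<in>V. c v * coef v k)"
  unfolding coef_l2inner by (rule l2inner_sum_left) (use assms eigfun_sqint in auto)

lemma simple_integral_coef:
  assumes s: "simple_in (sqint I01) N s" and fin: "finite_measure N"
  shows "simple_integral_fun N s \<in> sqint I01"
    "integrable N (\<lambda>\<tau>. coef (s \<tau>) k)"
    "coef (simple_integral_fun N s) k = (LINT \<tau>|N. coef (s \<tau>) k)"
proof -
  interpret finite_measure N by (rule fin)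
  let ?V = "s ` space N"
  have sf: "simple_function N s" and V: "?V \<subseteq> sqint I01" using s by (auto simp: simple_in_def)
  have fV: "finite ?V" using sf by (simp add: simple_function_def)
  define B where "B v = s -` {v} \<inter> space N" for v
  have B: "B v \<in> sets N" for v using simple_functionD(2)[OF sf] by (simp add: B_def)
  show "simple_integral_fun N s \<in> sqint I01"
    unfolding simple_integral_fun_def by (intro sqint_sum sqint_cmult) (use V in auto)
  have e: "coef (s \<tau>) k = (\<Sum>v\<in>?V. indicat_real (B v) \<tau> *\<^sub>R coef v k)" if "\<tau> \<in> space N" for \<tau>
  proof -
    have "(\<Sum>v\<in>?V. indicat_real (B v) \<tau> *\<^sub>R coef v k) = (\<Sum>v\<in>?V. if v = s \<tau> then coef (s \<tau>) k else 0)"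
      by (intro sum.cong) (use that in \<open>auto simp: B_def indicator_def\<close>)
    then show ?thesis using fV that by simp
  qed
  have i: "integrable N (\<lambda>\<tau>. \<Sum>v\<in>?V. indicat_real (B v) \<tau> *\<^sub>R coef v k)"
    by (intro Bochner_Integration.integrable_sum integrable_scaleR_left integrable_real_indicator B)
       (simp add: less_top[symmetric])
  show "integrable N (\<lambda>\<tau>. coef (s \<tau>) k)"
    by (rule Bochner_Integration.integrable_cong[THEN iffD2, OF refl e i])
  have "(LINT \<tau>|N. coef (s \<tau>) k) = (LINT \<tau>|N. (\<Sum>v\<in>?V. indicat_real (B v) \<tau> *\<^sub>R coef v k))"
    by (rule Bochner_Integration.integral_cong[OF refl e])
  also have "\<dots> = (\<Sum>v\<in>?V. (LINT \<tau>|N. indicat_real (B v) \<tau> *\<^sub>R coef v k))"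
    by (intro Bochner_Integration.integral_sum integrable_scaleR_left integrable_real_indicator B)
       (simp add: less_top[symmetric])
  also have "\<dots> = (\<Sum>v\<in>?V. of_real (measure N (B v)) * coef v k)"
    using B by (intro sum.cong refl) (simp add: scaleR_conv_of_real)
  also have "\<dots> = coef (simple_integral_fun N s) k"
    unfolding simple_integral_fun_def B_def by (rule coef_sum[symmetric]) (use V in auto)
  finally show "coef (simple_integral_fun N s) k = (LINT \<tau>|N. coef (s \<tau>) k)" by simp
qed

text \<open>A coefficient is a bounded functional, so it commutes with the integral: the identity is
  clear for simple functions and passes to the limit. Two approximations occur, \<open>S\<close>
  converging pointwise for measurability and \<open>R\<close> converging in the mean for the
  integral.\<close>

lemma bochner_integral_coef:
  assumes H: "has_bochner_integral_in (L2_on 0 1) (L2_norm_on 0 1) (ivl 0 t) F I"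
  shows "I \<in> sqint I01" "coef I k = (LINT s|ivl 0 t. coef (F s) k)"
proof -
  let ?N = "ivl 0 t"
  have sm: "strongly_measurable (sqint I01) (l2norm I01) ?N F" and I: "I \<in> sqint I01"
    using H by (auto simp: has_bochner_integral_in_def L2_on_sqint L2_norm_on_l2norm)
  show "I \<in> sqint I01" by (rule I)
  obtain S where S: "\<And>n. simple_in (sqint I01) ?N (S n)"
    and AE: "AE s in ?N. F s \<in> sqint I01 \<and> (\<lambda>n::nat. l2norm I01 (\<lambda>x. F s x - S n s x)) \<longlonglongrightarrow> 0"
    using sm unfolding strongly_measurable_def by blast
  obtain R where R: "\<And>n. simple_in (sqint I01) ?N (R n)"
    and R1: "(\<lambda>n::nat. \<integral>\<^sup>+s. ennreal (l2norm I01 (\<lambda>x. F s x - R n s x)) \<partial>?N) \<longlonglongrightarrow> 0"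
    and R2: "(\<lambda>n. l2norm I01 (\<lambda>x. I x - simple_integral_fun ?N (R n) x)) \<longlonglongrightarrow> 0"
    using H unfolding has_bochner_integral_in_def L2_on_sqint L2_norm_on_l2norm by blast
  have SH: "S n s \<in> sqint I01" "R n s \<in> sqint I01" if "s \<in> space ?N" for n s
    using S[of n] R[of n] that by (auto simp: simple_in_def)
  note RI = simple_integral_coef[OF R finite_measure_ivl]
  note SI = simple_integral_coef[OF S finite_measure_ivl]
  have meas: "(\<lambda>s. coef (F s) k) \<in> borel_measurable ?N"
  proof (rule measurable_ivl_AE_limit)
    show "(\<lambda>s. coef (S n s) k) \<in> borel_measurable ?N" for n
      using SI(2) by (rule borel_measurable_integrable)
    show "AE s in ?N. (\<lambda>n. coef (S n s) k) \<longlonglongrightarrow> coef (F s) k"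
      using AE AE_space
    proof eventually_elim
      case (elim s)
      then show ?case unfolding coef_l2inner
        using l2inner_limit[of "F s" I01 "\<lambda>n. S n s" "eigfun k"] SH(1)[OF elim(2)] eigfun_sqint by blast
    qed
  qed
  define r where "r n = (\<integral>\<^sup>+s. ennreal (l2norm I01 (\<lambda>x. F s x - R n s x)) \<partial>?N)" for n
  have rb: "(\<integral>\<^sup>+s. ennreal (cmod (coef (F s) k - coef (R n s) k)) \<partial>?N) \<le> r n" for n
    unfolding r_def
  proof (rule nn_integral_mono_AE)
    show "AE s in ?N. ennreal (cmod (coef (F s) k - coef (R n s) k)) \<le> ennreal (l2norm I01 (\<lambda>x. F s x - R n s x))"
      using AE AE_space
    proof eventually_elim
      case (elim s)
      then have d: "(\<lambda>x. F s x - R n s x) \<in> sqint I01" and Fs: "F s \<in> sqint I01"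
        using SH(2)[OF elim(2)] by (auto intro: sqint_diff)
      show ?case
        using coef_bound[OF d, of k] coef_diff[OF Fs SH(2)[OF elim(2)]] by (intro ennreal_leI) simp
    qed
  qed
  have r0: "r \<longlonglongrightarrow> 0" using R1 unfolding r_def .
  have dm: "(\<lambda>s. coef (F s) k - coef (R n s) k) \<in> borel_measurable ?N" for n
    by (intro borel_measurable_diff meas borel_measurable_integrable[OF RI(2)])
  \<comment> \<open>One simple function at finite mean distance suffices to make the coefficient of
    \<open>F\<close> integrable.\<close>
  have "eventually (\<lambda>n. r n < 1) sequentially"
    by (rule order_tendstoD(2)[OF r0]) simp
  then obtain n where n: "r n < 1" by (auto simp: eventually_sequentially)
  have di: "integrable ?N (\<lambda>s. coef (F s) k - coef (R n s) k)"
    by (rule integrableI_bounded[OF dm le_less_trans[OF rb less_trans[OF n]]]) simp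
  have iF: "integrable ?N (\<lambda>s. coef (F s) k)"
    using Bochner_Integration.integrable_add[OF di RI(2)[of n k]] by simp
  let ?d = "cmod (coef I k - (LINT s|?N. coef (F s) k))"
  have "ennreal ?d \<le> ennreal (l2norm I01 (\<lambda>x. I x - simple_integral_fun ?N (R n) x)) + r n" for n
  proof -
    have i: "integrable ?N (\<lambda>s. coef (F s) k - coef (R n s) k)"
      by (rule Bochner_Integration.integrable_diff[OF iF RI(2)])
    have e: "coef I k - (LINT s|?N. coef (F s) k) =
        (coef I k - coef (simple_integral_fun ?N (R n)) k) - (LINT s|?N. coef (F s) k - coef (R n s) k)"
      using RI(3)[of n k] iF RI(2)[of n k] by simp
    have "?d \<le> cmod (coef I k - coef (simple_integral_fun ?N (R n)) k) + cmod (LINT s|?N. coef (F s) k - coef (R n s) k)"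
      unfolding e by (rule norm_triangle_ineq4)
    then have "ennreal ?d \<le> ennreal (cmod (coef I k - coef (simple_integral_fun ?N (R n)) k)) +
        ennreal (cmod (LINT s|?N. coef (F s) k - coef (R n s) k))"
      by (subst ennreal_plus[symmetric], simp, simp) (rule ennreal_leI)
    also have "\<dots> \<le> ennreal (l2norm I01 (\<lambda>x. I x - simple_integral_fun ?N (R n) x)) + r n"
    proof (rule add_mono)
      show "ennreal (cmod (coef I k - coef (simple_integral_fun ?N (R n)) k)) \<le>
          ennreal (l2norm I01 (\<lambda>x. I x - simple_integral_fun ?N (R n) x))"
        using coef_bound[OF sqint_diff[OF I RI(1)[of n]], of k] coef_diff[OF I RI(1)[of n]]
        by (intro ennreal_leI) simp
      show "ennreal (cmod (LINT s|?N. coef (F s) k - coef (R n s) k)) \<le> r n"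
        using integral_norm_bound_ennreal[OF i] rb[of n] by (rule order_trans)
    qed
    finally show ?thesis .
  qed
  moreover have "(\<lambda>n. ennreal (l2norm I01 (\<lambda>x. I x - simple_integral_fun ?N (R n) x)) + r n) \<longlonglongrightarrow> ennreal 0 + 0"
    by (intro tendsto_add tendsto_ennrealI R2 r0)
  ultimately have "ennreal ?d \<le> ennreal 0 + 0"
    by (intro LIMSEQ_le_const) auto
  then have "?d = 0" by (simp add: ennreal_le_iff[of 0, simplified])
  then show "coef I k = (LINT s|?N. coef (F s) k)" by simp
qed

text \<open>
  Pettis' theorem in coordinates: measurability of all coefficients suffices for strong
  measurability because the coefficients determine a function in $L^2$.
\<close>

lemma bochner_integral_from_coef:
  assumes F: "AE s in ivl 0 t. F s \<in> sqint I01"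
    and meas: "\<And>k. (\<lambda>s. coef (F s) k) \<in> borel_measurable (ivl 0 t)"
    and m: "m \<in> borel_measurable (ivl 0 t)" "integrable (ivl 0 t) (\<lambda>s. (m s)\<^sup>2)"
    and Fm: "AE s in ivl 0 t. l2norm I01 (F s) \<le> m s"
    and I: "I \<in> sqint I01" "\<And>k. coef I k = (LINT s|ivl 0 t. coef (F s) k)" and t: "0 \<le> t"
  shows "has_bochner_integral_in (L2_on 0 1) (L2_norm_on 0 1) (ivl 0 t) F I"
proof -
  let ?N = "ivl 0 t"
  interpret finite_measure ?N by (rule finite_measure_ivl)
  define c where "c k s = coef (F s) k" for k s
  have cm [measurable]: "c k \<in> borel_measurable ?N" for k using meas[of k] by (simp add: c_def[abs_def])
  \<comment> \<open>Each coefficient is approximated by scalar simple functions dominated by twice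
    its modulus; this domination later provides an integrable majorant.\<close>
  have "\<exists>C. \<forall>n. simple_function ?N (C n) \<and> (\<forall>s\<in>space ?N. (\<lambda>n. C n s) \<longlonglongrightarrow> c k s) \<and>
      (\<forall>s\<in>space ?N. cmod (C n s) \<le> 2 * cmod (c k s))" for k
  proof -
    obtain G where G: "\<And>n. simple_function ?N (G n)"
      "\<And>s. s \<in> space ?N \<Longrightarrow> (\<lambda>n. G n s) \<longlonglongrightarrow> c k s"
      "\<And>n s. s \<in> space ?N \<Longrightarrow> dist (G n s) 0 \<le> 2 * dist (c k s) 0"
      using borel_measurable_implies_sequence_metric[OF cm[of k], of 0] by blast
    show ?thesis using G by (intro exI[of _ G]) simp
  qed
  then obtain C where C0: "\<And>k. \<forall>n. simple_function ?N (C k n) \<and> (\<forall>s\<in>space ?N. (\<lambda>n. C k n s) \<longlonglongrightarrow> c k s) \<and>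
      (\<forall>s\<in>space ?N. cmod (C k n s) \<le> 2 * cmod (c k s))"
    by metis
  have C: "simple_function ?N (C k n)" "\<And>s. s \<in> space ?N \<Longrightarrow> (\<lambda>n. C k n s) \<longlonglongrightarrow> c k s"
    "\<And>s. s \<in> space ?N \<Longrightarrow> cmod (C k n s) \<le> 2 * cmod (c k s)" for k n
    using C0[of k] by auto
  \<comment> \<open>Diagonal approximation: the \<open>n\<close>-th function uses the first
    \<open>n\<close> modes, each with the \<open>n\<close>-th scalar approximation of its
    coefficient.\<close>
  define S where "S n s x = (\<Sum>k<n. C k n s * eigfun k x)" for n s x
  have Ssf: "simple_function ?N (\<lambda>s x. \<Sum>k<p. C k n s * eigfun k x)" for n p
  proof (induction p)
    case (Suc p)
    have "simple_function ?N (\<lambda>s. (\<lambda>v z x. v x + z * eigfun p x) (\<lambda>x. \<Sum>k<p. C k n s * eigfun k x) (C p n s))"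
      by (rule simple_function_compose2[OF Suc C(1)])
    then show ?case by simp
  qed simp
  have SL: "S n s \<in> sqint I01" for n s
    unfolding S_def by (rule orthogonal_family_sum_sqint[OF orthogonal_family_eigfun])
  have Ssimple: "simple_in (sqint I01) ?N (S n)" for n
    using Ssf[where n=n and p=n] SL unfolding simple_in_def S_def[abs_def] by blast
  have Scoef: "coef (S n s) k = (if k < n then C k n s else 0)" for n s k
    using orthogonal_family_l2inner_sum[OF orthogonal_family_eigfun, of "{..<n}" "\<lambda>k. C k n s" k]
    unfolding coef_l2inner S_def by simp
  define e where "e n s k = c k s - (if k < n then C k n s else 0)" for n s k
  have diff: "(\<lambda>x. F s x - S n s x) \<in> sqint I01" "coef (\<lambda>x. F s x - S n s x) = e n s"
    if "F s \<in> sqint I01" for n s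
    using sqint_diff[OF that SL] coef_diff[OF that SL] by (auto simp: e_def c_def Scoef)
  \<comment> \<open>For \<open>k < n\<close> the factor 3 is one plus the two from the domination of
    \<open>C\<close>; for the remaining \<open>k\<close> the error is the whole coefficient.\<close>
  have eb: "cmod (e n s k) \<le> 3 * cmod (c k s)" if "s \<in> space ?N" for n s k
  proof (cases "k < n")
    case True
    then show ?thesis using C(3)[OF that, of k n] norm_triangle_ineq4[of "c k s" "C k n s"]
      by (simp add: e_def)
  qed (simp add: e_def)
  define \<rho> where "\<rho> n s = l2norm I01 (\<lambda>x. F s x - S n s x)" for n s
  have \<rho>2: "(\<rho> n s)\<^sup>2 = (\<Sum>k. (cmod (e n s k))\<^sup>2)" "summable (\<lambda>k. (cmod (e n s k))\<^sup>2)"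
    if "F s \<in> sqint I01" for n s
    using parseval[OF diff(1)[OF that, of n]] diff(2)[OF that, of n] by (auto simp: \<rho>_def sums_iff)
  have \<rho>b: "\<rho> n s \<le> 3 * l2norm I01 (F s)" if "F s \<in> sqint I01" "s \<in> space ?N" for n s
  proof (rule power2_le_imp_le)
    note pF = parseval[OF that(1)]
    have "(\<rho> n s)\<^sup>2 \<le> (\<Sum>k. 9 * (cmod (c k s))\<^sup>2)"
      unfolding \<rho>2[OF that(1)]
    proof (rule suminf_le[OF _ \<rho>2(2)[OF that(1)]])
      show "(cmod (e n s k))\<^sup>2 \<le> 9 * (cmod (c k s))\<^sup>2" for k
        using power_mono[OF eb[OF that(2)] norm_ge_zero, of n k 2] by (simp add: power_mult_distrib)
      show "summable (\<lambda>k. 9 * (cmod (c k s))\<^sup>2)"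
        using sums_summable[OF pF] by (simp add: c_def summable_mult)
    qed
    also have "\<dots> = (3 * l2norm I01 (F s))\<^sup>2"
      using pF by (simp add: c_def sums_iff suminf_mult power_mult_distrib)
    finally show "(\<rho> n s)\<^sup>2 \<le> (3 * l2norm I01 (F s))\<^sup>2" .
  qed simp
  \<comment> \<open>By Parseval the squared distance is a sum over \<open>k\<close> whose terms tend
    to zero and are dominated by nine times the squared coefficients, so dominated convergence over
    the counting measure applies.\<close>
  have \<rho>lim: "(\<lambda>n. \<rho> n s) \<longlonglongrightarrow> 0" if Fs: "F s \<in> sqint I01" and s: "s \<in> space ?N" for s
  proof -
    have es: "e n s \<in> sqint nat_measure" for n using \<rho>2(2)[OF Fs] by (simp add: sqint_count_space)
    have cs: "c \<in> UNIV \<rightarrow> UNIV" by simp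
    have "(\<lambda>n. LINT k|nat_measure. (cmod (e n s k))\<^sup>2) \<longlonglongrightarrow> (LINT k|nat_measure. 0)"
    proof (rule integral_dominated_convergence)
      show "integrable nat_measure (\<lambda>k. 9 * (cmod (c k s))\<^sup>2)"
        using sqintD(2)[OF l2norm_coef(1)[OF Fs]] by (simp add: c_def)
      show "AE k in nat_measure. (\<lambda>n. (cmod (e n s k))\<^sup>2) \<longlonglongrightarrow> 0"
      proof (rule AE_I2)
        fix k
        have "(\<lambda>n. c k s - C k n s) \<longlonglongrightarrow> c k s - c k s" by (intro tendsto_diff tendsto_const C(2) s)
        moreover have "\<forall>\<^sub>F n in sequentially. c k s - C k n s = e n s k"
          using eventually_gt_at_top[of k] by eventually_elim (simp add: e_def)
        ultimately have "(\<lambda>n. e n s k) \<longlonglongrightarrow> 0" using tendsto_cong by fastforce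
        then have "(\<lambda>n. (cmod (e n s k))\<^sup>2) \<longlonglongrightarrow> (cmod 0)\<^sup>2" by (intro tendsto_intros)
        then show "(\<lambda>n. (cmod (e n s k))\<^sup>2) \<longlonglongrightarrow> 0" by simp
      qed
      show "AE k in nat_measure. norm ((cmod (e n s k))\<^sup>2) \<le> 9 * (cmod (c k s))\<^sup>2" for n
        using power_mono[OF eb[OF s] norm_ge_zero, of n _ 2] by (simp add: power_mult_distrib)
    qed auto
    moreover have "(LINT k|nat_measure. (cmod (e n s k))\<^sup>2) = (\<rho> n s)\<^sup>2" for n
      using l2norm_coef(2)[OF diff(1)[OF Fs, of n]] unfolding diff(2)[OF Fs] \<rho>_def
      by (simp add: l2norm_sq[symmetric])
    ultimately have "(\<lambda>n. (\<rho> n s)\<^sup>2) \<longlonglongrightarrow> 0" by simp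
    then have "(\<lambda>n. sqrt ((\<rho> n s)\<^sup>2)) \<longlonglongrightarrow> sqrt 0" by (rule tendsto_real_sqrt)
    then show ?thesis by (simp add: \<rho>_def)
  qed
  have \<rho>m: "\<rho> n \<in> borel_measurable ?N" for n
  proof -
    have em: "(\<lambda>s. e n s k) \<in> borel_measurable ?N" for k
      unfolding e_def using borel_measurable_simple_function[OF C(1)[of k n]] by (cases "k < n") simp_all
    have "(\<lambda>s. complex_of_real (sqrt (\<Sum>k. (cmod (e n s k))\<^sup>2))) \<in> borel_measurable ?N"
      using em by measurable
    then have "(\<lambda>s. complex_of_real (\<rho> n s)) \<in> borel_measurable ?N"
    proof (rule measurable_ivl_cong_AE)
      show "AE s in ?N. complex_of_real (sqrt (\<Sum>k. (cmod (e n s k))\<^sup>2)) = complex_of_real (\<rho> n s)"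
        using F by eventually_elim (simp add: \<rho>2(1)[symmetric], simp add: \<rho>_def)
    qed
    from measurable_compose[OF this borel_measurable_Re] show ?thesis by simp
  qed
  have \<rho>AE: "AE s in ?N. norm (\<rho> n s) \<le> 3 * m s" for n
    using F Fm AE_space
  proof eventually_elim
    case (elim s)
    then show ?case using \<rho>b[of s n] by (simp add: \<rho>_def)
  qed
  have mi: "integrable ?N m"
  proof -
    have "(\<lambda>s. complex_of_real (m s)) \<in> sqint ?N" by (rule sqintI) (use m in auto)
    from sqint_integrable[OF this] show ?thesis by (simp add: complex_of_real_integrable_eq)
  qed
  have AElim: "AE s in ?N. (\<lambda>n. \<rho> n s) \<longlonglongrightarrow> 0"
    using F AE_space by eventually_elim (rule \<rho>lim)
  have \<rho>i: "integrable ?N (\<rho> n)" for n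
    by (rule Bochner_Integration.integrable_bound[of _ "\<lambda>s. 3 * m s"])
       (use mi \<rho>m \<rho>AE[of n] in \<open>auto elim: eventually_mono\<close>)
  have L1: "(\<lambda>n. LINT s|?N. \<rho> n s) \<longlonglongrightarrow> (LINT s|?N. 0)"
    by (rule integral_dominated_convergence[of _ _ _ "\<lambda>s. 3 * m s"]) (use mi \<rho>m \<rho>AE AElim in auto)
  have 9: "AE s in ?N. norm ((\<rho> n s)\<^sup>2) \<le> 9 * (m s)\<^sup>2" for n
    using \<rho>AE[of n]
  proof eventually_elim
    case (elim s)
    from power_mono[OF elim norm_ge_zero, of 2] show ?case by (simp add: power_mult_distrib)
  qed
  have \<rho>2i: "integrable ?N (\<lambda>s. (\<rho> n s)\<^sup>2)" for n
  proof (rule Bochner_Integration.integrable_bound[of _ "\<lambda>s. 9 * (m s)\<^sup>2"])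
    show "AE s in ?N. norm ((\<rho> n s)\<^sup>2) \<le> norm (9 * (m s)\<^sup>2)" using 9[of n] by eventually_elim simp
  qed (use m \<rho>m in auto)
  have L2: "(\<lambda>n. LINT s|?N. (\<rho> n s)\<^sup>2) \<longlonglongrightarrow> (LINT s|?N. 0)"
  proof (rule integral_dominated_convergence[of _ _ _ "\<lambda>s. 9 * (m s)\<^sup>2"])
    show "AE s in ?N. (\<lambda>n. (\<rho> n s)\<^sup>2) \<longlonglongrightarrow> 0"
      using AElim
    proof eventually_elim
      case (elim s)
      from tendsto_power[OF this, of 2] show ?case by simp
    qed
  qed (use m \<rho>m 9 in auto)
  have sm: "strongly_measurable (sqint I01) (l2norm I01) ?N F"
    unfolding strongly_measurable_def
  proof (intro exI[of _ S] conjI allI Ssimple)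
    show "AE s in ?N. F s \<in> sqint I01 \<and> (\<lambda>n. l2norm I01 (\<lambda>x. F s x - S n s x)) \<longlonglongrightarrow> 0"
      using F AElim by eventually_elim (simp add: \<rho>_def)
  qed
  have nn: "(\<lambda>n. \<integral>\<^sup>+s. ennreal (l2norm I01 (\<lambda>x. F s x - S n s x)) \<partial>?N) \<longlonglongrightarrow> 0"
  proof -
    have "(\<integral>\<^sup>+s. ennreal (\<rho> n s) \<partial>?N) = ennreal (LINT s|?N. \<rho> n s)" for n
      by (rule nn_integral_eq_integral[OF \<rho>i]) (simp add: \<rho>_def)
    then show ?thesis using tendsto_ennrealI[OF L1] by (simp add: \<rho>_def)
  qed
  have Iconv: "(\<lambda>n. l2norm I01 (\<lambda>x. I x - simple_integral_fun ?N (S n) x)) \<longlonglongrightarrow> 0"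
  proof -
    note SI = simple_integral_coef[OF Ssimple finite_measure_ivl]
    have ci: "integrable ?N (c k)" for k
    proof (rule Bochner_Integration.integrable_bound[OF mi cm])
      show "AE s in ?N. norm (c k s) \<le> norm (m s)"
        using F Fm by eventually_elim (use coef_bound[of "F _" k] in \<open>force simp: c_def\<close>)
    qed
    have ei: "(\<lambda>s. e n s k) \<in> sqint ?N" for n k
    proof (rule sqint_time_bound(1)[OF m(2,1), of _ 3])
      show "(\<lambda>s. e n s k) \<in> borel_measurable ?N"
        unfolding e_def using borel_measurable_simple_function[OF C(1)[of k n]] by (cases "k < n") simp_all
      show "AE s in ?N. cmod (e n s k) \<le> 3 * m s"
        using F Fm AE_space
      proof eventually_elim
        case (elim s)
        then show ?case using eb[OF elim(3), of n k] coef_bound[OF elim(1), of k] by (simp add: c_def)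
      qed
    qed
    \<comment> \<open>Cauchy-Schwarz in time for each coefficient of the error, then Parseval at
      each instant; no vector-valued triangle inequality is involved.\<close>
    have bound: "(l2norm I01 (\<lambda>x. I x - simple_integral_fun ?N (S n) x))\<^sup>2 \<le> t * (LINT s|?N. (\<rho> n s)\<^sup>2)" for n
    proof -
      have d: "(\<lambda>x. I x - simple_integral_fun ?N (S n) x) \<in> sqint I01" by (rule sqint_diff[OF I(1) SI(1)])
      have dc: "coef (\<lambda>x. I x - simple_integral_fun ?N (S n) x) k = (LINT s|?N. e n s k)" for k
      proof -
        have "coef (\<lambda>x. I x - simple_integral_fun ?N (S n) x) k = (LINT s|?N. c k s) - (LINT s|?N. coef (S n s) k)"
          using coef_diff[OF I(1) SI(1)] I(2) SI(3) by (simp add: c_def)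
        also have "\<dots> = (LINT s|?N. c k s - coef (S n s) k)"
          by (rule Bochner_Integration.integral_diff[symmetric, OF ci SI(2)])
        finally show ?thesis by (simp add: Scoef e_def)
      qed
      have "(\<Sum>k<p. (cmod (LINT s|?N. e n s k))\<^sup>2) \<le> t * (LINT s|?N. (\<rho> n s)\<^sup>2)" for p
      proof -
        have "(\<Sum>k<p. (cmod (LINT s|?N. e n s k))\<^sup>2) \<le> (\<Sum>k<p. t * (LINT s|?N. (cmod (e n s k))\<^sup>2))"
        proof (rule sum_mono)
          fix k
          have "cmod (LINT s|?N. e n s k) \<le> (LINT s|?N. cmod (e n s k))" by simp
          also have "\<dots> \<le> sqrt t * l2norm ?N (\<lambda>s. e n s k)"
            using sqint_integral_norm_le[OF ei] measure_ivl[OF t] by simp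
          finally have "(cmod (LINT s|?N. e n s k))\<^sup>2 \<le> (sqrt t * l2norm ?N (\<lambda>s. e n s k))\<^sup>2"
            by (intro power_mono) auto
          then show "(cmod (LINT s|?N. e n s k))\<^sup>2 \<le> t * (LINT s|?N. (cmod (e n s k))\<^sup>2)"
            using t by (simp add: power_mult_distrib l2norm_sq)
        qed
        also have "\<dots> = t * (LINT s|?N. (\<Sum>k<p. (cmod (e n s k))\<^sup>2))"
          using sqintD(2)[OF ei] by (simp add: sum_distrib_left)
        also have "\<dots> \<le> t * (LINT s|?N. (\<rho> n s)\<^sup>2)"
        proof (intro mult_left_mono t integral_mono_AE \<rho>2i)
          show "AE s in ?N. (\<Sum>k<p. (cmod (e n s k))\<^sup>2) \<le> (\<rho> n s)\<^sup>2"
            using F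
          proof eventually_elim
            case (elim s)
            show ?case unfolding \<rho>2(1)[OF elim]
              by (rule sum_le_suminf[OF \<rho>2(2)[OF elim]]) auto
          qed
        qed (use sqintD(2)[OF ei] in auto)
        finally show ?thesis .
      qed
      then have "(l2norm nat_measure (coef (\<lambda>x. I x - simple_integral_fun ?N (S n) x)))\<^sup>2 \<le> t * (LINT s|?N. (\<rho> n s)\<^sup>2)"
        by (intro sqint_nat_bounded(2)) (simp add: dc)
      then show ?thesis by (simp add: l2norm_coef(2)[OF d])
    qed
    show ?thesis
    proof (rule real_tendsto_sandwich[of "\<lambda>_. 0"])
      show "\<forall>\<^sub>F n in sequentially. l2norm I01 (\<lambda>x. I x - simple_integral_fun ?N (S n) x) \<le> sqrt (t * (LINT s|?N. (\<rho> n s)\<^sup>2))"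
        using bound by (intro always_eventually allI real_le_rsqrt)
      show "(\<lambda>n. sqrt (t * (LINT s|?N. (\<rho> n s)\<^sup>2))) \<longlonglongrightarrow> 0"
        using tendsto_real_sqrt[OF tendsto_mult[OF tendsto_const L2, of t]] by simp
    qed auto
  qed
  show ?thesis
    unfolding has_bochner_integral_in_def L2_on_sqint L2_norm_on_l2norm
    using sm I(1) Ssimple nn Iconv by blast
qed

section \<open>Gronwall and the mild formulation in coordinates\<close>

text \<open>Geometric steps make every coordinate Cauchy, and the bound survives in the limit on
  each finite section. The explicit rate matters: applied at each instant with the same
  \<open>R\<close>, it makes the convergence of the iterates uniform in time.\<close>

lemma sqint_nat_limit:
  assumes x: "\<And>n. x n \<in> sqint nat_measure"
    and step: "\<And>n. l2norm nat_measure (\<lambda>k. x (Suc n) k - x n k) \<le> R * (1/2)^n"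
  shows "\<exists>y\<in>sqint nat_measure. \<forall>n. l2norm nat_measure (\<lambda>k. y k - x n k) \<le> 2 * R * (1/2)^n"
proof -
  have R: "0 \<le> R" using order_trans[OF l2norm_nonneg step[of 0]] by simp
  \<comment> \<open>The subtracted tail is what lets the induction close: each new step is exactly
    the decrease of \<open>2 * R * (1/2)^(n + m)\<close>.\<close>
  have gap: "l2norm nat_measure (\<lambda>k. x (n + m) k - x n k) \<le> 2 * R * (1/2)^n - 2 * R * (1/2)^(n + m)" for n m
  proof (induction m)
    case 0
    then show ?case by (simp add: l2norm_def)
  next
    case (Suc m)
    have "l2norm nat_measure (\<lambda>k. x (n + Suc m) k - x n k) \<le>
        l2norm nat_measure (\<lambda>k. x (Suc (n + m)) k - x (n + m) k) + l2norm nat_measure (\<lambda>k. x (n + m) k - x n k)"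
      using l2norm_triangle_diff[OF x[of "Suc (n + m)"] x[of "n + m"] x[of n]] by simp
    also have "\<dots> \<le> R * (1/2)^(n + m) + (2 * R * (1/2)^n - 2 * R * (1/2)^(n + m))"
      by (intro add_mono step Suc)
    finally show ?case by (simp add: field_simps)
  qed
  have gap': "l2norm nat_measure (\<lambda>k. x (n + m) k - x n k) \<le> 2 * R * (1/2)^n" for n m
  proof -
    have "0 \<le> 2 * R * (1/2)^(n + m)" using R by simp
    then show ?thesis using gap[of n m] by linarith
  qed
  have partial: "(\<Sum>k<K. (cmod (z k))\<^sup>2) \<le> (l2norm nat_measure z)\<^sup>2" if z: "z \<in> sqint nat_measure" for z K
  proof -
    have s: "summable (\<lambda>k. (cmod (z k))\<^sup>2)" using z by (simp add: sqint_count_space)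
    have "(l2norm nat_measure z)\<^sup>2 = (\<Sum>k. (cmod (z k))\<^sup>2)"
      unfolding l2norm_count_space[OF s] using s by (simp add: suminf_nonneg)
    then show ?thesis using sum_le_suminf[OF s, of "{..<K}"] by simp
  qed
  have gapk: "cmod (x (n + m) k - x n k) \<le> 2 * R * (1/2)^n" for n m k
  proof -
    have d: "(\<lambda>k. x (n + m) k - x n k) \<in> sqint nat_measure" by (intro sqint_diff x)
    have "(cmod (x (n + m) k - x n k))\<^sup>2 \<le> (\<Sum>k<Suc k. (cmod (x (n + m) k - x n k))\<^sup>2)"
      by (rule member_le_sum) auto
    also have "\<dots> \<le> (l2norm nat_measure (\<lambda>k. x (n + m) k - x n k))\<^sup>2" by (rule partial[OF d])
    finally have "cmod (x (n + m) k - x n k) \<le> l2norm nat_measure (\<lambda>k. x (n + m) k - x n k)"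
      by (rule power2_le_imp_le) simp
    then show ?thesis using gap'[of n m] by linarith
  qed
  have geo: "(\<lambda>n. 2 * R * (1/2)^n) \<longlonglongrightarrow> 0"
    using tendsto_mult[OF tendsto_const LIMSEQ_realpow_zero[of "1/2"], of "2 * R"] by simp
  have conv: "convergent (\<lambda>n. x n k)" for k
  proof (rule Cauchy_convergent, rule metric_CauchyI)
    fix e :: real assume e: "0 < e"
    have "eventually (\<lambda>n. 2 * R * (1/2)^n < e / 2) sequentially"
      by (rule order_tendstoD(2)[OF geo]) (use e in simp)
    then obtain N where N: "2 * R * (1/2)^N < e / 2" by (auto simp: eventually_sequentially)
    have h: "dist (x m k) (x N k) < e / 2" if "N \<le> m" for m
      using gapk[of N "m - N" k] N that by (simp add: dist_norm)
    have "dist (x m k) (x n k) < e" if "N \<le> m" "N \<le> n" for m n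
      by (rule dist_triangle_half_l[OF h[OF that(1)] h[OF that(2)]])
    then show "\<exists>M. \<forall>m\<ge>M. \<forall>n\<ge>M. dist (x m k) (x n k) < e" by (intro exI[of _ N]) simp
  qed
  define y where "y k = lim (\<lambda>n. x n k)" for k
  have y: "(\<lambda>n. x n k) \<longlonglongrightarrow> y k" for k
    using conv[of k] unfolding y_def by (simp only: convergent_LIMSEQ_iff)
  have B: "(\<Sum>k<K. (cmod (y k - x n k))\<^sup>2) \<le> (2 * R * (1/2)^n)\<^sup>2" for n K
  proof (rule LIMSEQ_le_const2)
    show "(\<lambda>m. \<Sum>k<K. (cmod (x (n + m) k - x n k))\<^sup>2) \<longlonglongrightarrow> (\<Sum>k<K. (cmod (y k - x n k))\<^sup>2)"
      using LIMSEQ_ignore_initial_segment[OF y, of n]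
      by (intro tendsto_intros) (simp add: add.commute)
    show "\<exists>N. \<forall>m\<ge>N. (\<Sum>k<K. (cmod (x (n + m) k - x n k))\<^sup>2) \<le> (2 * R * (1/2)^n)\<^sup>2"
    proof (intro exI[of _ 0] allI impI)
      fix m
      have "(\<Sum>k<K. (cmod (x (n + m) k - x n k))\<^sup>2) \<le> (l2norm nat_measure (\<lambda>k. x (n + m) k - x n k))\<^sup>2"
        by (intro partial sqint_diff x)
      also have "\<dots> \<le> (2 * R * (1/2)^n)\<^sup>2" by (intro power_mono gap') simp
      finally show "(\<Sum>k<K. (cmod (x (n + m) k - x n k))\<^sup>2) \<le> (2 * R * (1/2)^n)\<^sup>2" .
    qed
  qed
  note D = sqint_nat_bounded[of "\<lambda>k. y k - x n k" for n, OF B]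
  have "y \<in> sqint nat_measure" using sqint_add[OF D(1)[of 0] x[of 0]] by simp
  moreover have "l2norm nat_measure (\<lambda>k. y k - x n k) \<le> 2 * R * (1/2)^n" for n
    by (rule power2_le_imp_le[OF D(2)]) (use R in simp)
  ultimately show ?thesis by blast
qed

lemma l2norm_nat_eq_0:
  assumes "x \<in> sqint nat_measure" "l2norm nat_measure x \<le> 0" shows "x k = 0"
  using l2norm_eq_0_imp_AE[OF assms(1)] assms(2) l2norm_nonneg[of nat_measure x]
  by (simp add: AE_count_space)

lemma l2norm_nat_unimodular:
  assumes "\<And>k. cmod (z k) = 1"
  shows "l2norm nat_measure (\<lambda>k. z k * x k) = l2norm nat_measure x"
  by (simp add: l2norm_def norm_mult assms)

lemma sqint_nat_unimodular:
  assumes "\<And>k. cmod (z k) = 1" "x \<in> sqint nat_measure"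
  shows "(\<lambda>k. z k * x k) \<in> sqint nat_measure"
  using assms by (simp add: sqint_count_space norm_mult)

section \<open>Exponential weights and Gronwall's inequality\<close>

lemma integrable_weight_continuous:
  fixes \<kappa> y :: "real \<Rightarrow> real"
  assumes "integrable (ivl a b) \<kappa>" "continuous_on {a..b} y"
  shows "integrable (ivl a b) (\<lambda>s. \<kappa> s * y s)"
proof -
  have "integrable (ivl a b) (\<lambda>s. complex_of_real (\<kappa> s) * of_real (y s))"
    by (intro integrable_ivl_mult_continuous continuous_intros assms)
       (use assms(1) in \<open>simp add: complex_of_real_integrable_eq\<close>)
  then show ?thesis unfolding of_real_mult[symmetric] complex_of_real_integrable_eq .
qed

text \<open>The source of contraction: integrating against \<open>\<kappa>\<close> preserves growth
  like the exponential weight and gains the factor \<open>1 / l\<close>. It serves both Gronwall's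
  inequality and the Picard iteration.\<close>

lemma weighted_integral_bound:
  fixes \<kappa> y :: "real \<Rightarrow> real"
  assumes \<kappa>: "integrable (ivl 0 T) \<kappa>" "\<And>x. 0 \<le> \<kappa> x" and l: "0 < l"
    and y: "continuous_on {0..T} y" and t: "t \<in> {0..T}" and M: "0 \<le> M"
    and bound: "\<And>s. s \<in> {0..T} \<Longrightarrow> y s \<le> M * exp (l * (LINT r|ivl 0 s. \<kappa> r))"
  shows "(LINT s|ivl 0 t. \<kappa> s * y s) \<le> M / l * exp (l * (LINT r|ivl 0 t. \<kappa> r))"
proof -
  note E = integral_exp_primitive_le[OF \<kappa> l refl t]
  have "integrable (ivl 0 t) (\<lambda>s. \<kappa> s * y s)"
    by (rule integrable_ivl_sub[OF integrable_weight_continuous[OF \<kappa>(1) y]]) (use t in auto)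
  moreover have "integrable (ivl 0 t) (\<lambda>s. M * (\<kappa> s * exp (l * (LINT r|ivl 0 s. \<kappa> r))))"
    using E(1) by simp
  ultimately have "(LINT s|ivl 0 t. \<kappa> s * y s) \<le> (LINT s|ivl 0 t. M * (\<kappa> s * exp (l * (LINT r|ivl 0 s. \<kappa> r))))"
  proof (rule integral_mono)
    fix s assume "s \<in> space (ivl 0 t)"
    then have "y s \<le> M * exp (l * (LINT r|ivl 0 s. \<kappa> r))" using t by (intro bound) auto
    then have "\<kappa> s * y s \<le> \<kappa> s * (M * exp (l * (LINT r|ivl 0 s. \<kappa> r)))"
      by (intro mult_left_mono \<kappa>)
    then show "\<kappa> s * y s \<le> M * (\<kappa> s * exp (l * (LINT r|ivl 0 s. \<kappa> r)))"
      by (simp only: mult.left_commute)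
  qed
  also have "\<dots> = M * (LINT s|ivl 0 t. \<kappa> s * exp (l * (LINT r|ivl 0 s. \<kappa> r)))"
    by (rule integral_mult_right_zero)
  also have "\<dots> \<le> M * (exp (l * (LINT r|ivl 0 t. \<kappa> r)) / l)"
    by (rule mult_left_mono[OF E(2) M])
  finally show ?thesis by simp
qed

text \<open>With rate 2 in the weight, the weighted supremum \<open>S\<close> of \<open>y\<close>
  satisfies \<open>S \<le> a + S / 2\<close>, hence \<open>S \<le> 2 * a\<close>. The factors 2 are
  the price for this argument, which needs only integrability of \<open>\<kappa>\<close>.\<close>

lemma gronwall_integrable:
  fixes \<kappa> y :: "real \<Rightarrow> real"
  assumes \<kappa>: "integrable (ivl 0 T) \<kappa>" "\<And>x. 0 \<le> \<kappa> x" and T: "0 \<le> T" and a: "0 \<le> a"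
    and y: "continuous_on {0..T} y" "\<And>s. 0 \<le> y s"
    and ineq: "\<And>t. t \<in> {0..T} \<Longrightarrow> y t \<le> a + (LINT s|ivl 0 t. \<kappa> s * y s)"
    and t: "t \<in> {0..T}"
  shows "y t \<le> 2 * a * exp (2 * (LINT r|ivl 0 t. \<kappa> r))"
proof -
  define K where "K t = (LINT r|ivl 0 t. \<kappa> r)" for t
  have K0: "0 \<le> K t" for t unfolding K_def using \<kappa>(2) by simp
  define S where "S = (SUP s\<in>{0..T}. y s * exp (- (2 * K s)))"
  \<comment> \<open>Finiteness of the supremum is essential for absorbing \<open>S / 2\<close>; it
    comes from the continuity of \<open>y\<close> on a compact interval.\<close>
  have bdd: "bdd_above ((\<lambda>s. y s * exp (- (2 * K s))) ` {0..T})"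
  proof -
    have "bounded (y ` {0..T})" by (intro compact_imp_bounded compact_continuous_image y) auto
    then obtain B where B: "\<forall>s\<in>{0..T}. \<bar>y s\<bar> \<le> B" by (auto simp: bounded_iff)
    have "y s * exp (- (2 * K s)) \<le> B" if "s \<in> {0..T}" for s
    proof -
      have "y s * exp (- (2 * K s)) \<le> y s * 1" using y(2) K0 by (intro mult_left_mono) auto
      moreover have "\<bar>y s\<bar> \<le> B" using B that by blast
      ultimately show ?thesis by simp
    qed
    then show ?thesis by (intro bdd_aboveI[of _ B]) auto
  qed
  have S: "y s \<le> S * exp (2 * K s)" if "s \<in> {0..T}" for s
  proof -
    have "y s * exp (- (2 * K s)) \<le> S" unfolding S_def by (rule cSUP_upper[OF that bdd])
    then have "y s * exp (- (2 * K s)) * exp (2 * K s) \<le> S * exp (2 * K s)" by (intro mult_right_mono) auto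
    then show ?thesis by (simp add: mult.assoc exp_minus)
  qed
  have S0: "0 \<le> S"
  proof -
    have "0 \<le> S * exp (2 * K 0)" using order_trans[OF y(2) S[of 0]] T by simp
    then show ?thesis by (simp add: zero_le_mult_iff)
  qed
  have "y s * exp (- (2 * K s)) \<le> a + S / 2" if s: "s \<in> {0..T}" for s
  proof -
    have "y s \<le> a + S / 2 * exp (2 * K s)"
      using ineq[OF s] weighted_integral_bound[OF \<kappa> _ y(1) s S0, of 2] S unfolding K_def by fastforce
    then have "y s * exp (- (2 * K s)) \<le> (a + S / 2 * exp (2 * K s)) * exp (- (2 * K s))"
      by (intro mult_right_mono) auto
    also have "\<dots> = a * exp (- (2 * K s)) + S / 2" by (simp add: distrib_right mult.assoc exp_minus)
    also have "\<dots> \<le> a * 1 + S / 2" using a K0 by (intro add_mono mult_left_mono) auto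
    finally show ?thesis by simp
  qed
  then have "S \<le> a + S / 2" unfolding S_def using T by (intro cSUP_least) auto
  then have "S \<le> 2 * a" by simp
  then have "S * exp (2 * K t) \<le> 2 * a * exp (2 * K t)" by (intro mult_right_mono) auto
  from order_trans[OF S[OF t] this] show ?thesis unfolding K_def .
qed

section \<open>Continuous trajectories in coordinates\<close>

text \<open>The inverse of \<open>wcoef\<close> on square-summable sequences; it builds a concrete
  representative from prescribed coordinates.\<close>

definition of_wcoef :: "(nat \<Rightarrow> complex) \<Rightarrow> cfun" where
  "of_wcoef c = cosine_series (\<lambda>k. c k / of_real (weight k))"

lemma of_wcoef:
  assumes "c \<in> sqint nat_measure"
  shows "of_wcoef c \<in> H1_on 0 1" "wcoef (of_wcoef c) = c"
proof -
  have w: "complex_of_real (weight k) \<noteq> 0" for k using weight_ge_1[of k] by auto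
  have "(\<lambda>k. of_real (weight k) * (c k / of_real (weight k))) \<in> sqint nat_measure"
    using assms w by simp
  note S = cosine_series_H1[OF this]
  show "of_wcoef c \<in> H1_on 0 1" unfolding of_wcoef_def by (rule S(1))
  show "wcoef (of_wcoef c) = c" unfolding of_wcoef_def wcoef_def[abs_def] S(2) using w by simp
qed

lemma H1_norm_diff:
  assumes "f \<in> H1_on 0 1" "g \<in> H1_on 0 1"
  shows "H1_norm (\<lambda>x. f x - g x) = l2norm nat_measure (\<lambda>k. wcoef f k - wcoef g k)"
  using H1_norm_wcoef[OF H1_wcoef_sqint[OF H1_on_diff[OF _ assms]]]
    wcoef_diff[OF H1_onD(1)[OF assms(1)] H1_onD(1)[OF assms(2)]] by simp

lemma C_time_H1_D:
  assumes "\<psi> \<in> C_time_H1 T" "t \<in> {0..T}"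
  shows "\<psi> t \<in> H1_on 0 1"
    "((\<lambda>s. l2norm nat_measure (\<lambda>k. wcoef (\<psi> s) k - wcoef (\<psi> t) k)) \<longlongrightarrow> 0) (at t within {0..T})"
proof -
  have H: "\<psi> s \<in> H1_on 0 1" if "s \<in> {0..T}" for s using assms(1) that by (simp add: C_time_H1_def)
  show "\<psi> t \<in> H1_on 0 1" by (rule H[OF assms(2)])
  have "((\<lambda>s. H1_norm (\<lambda>x. \<psi> s x - \<psi> t x)) \<longlongrightarrow> 0) (at t within {0..T})"
    using assms by (simp add: C_time_H1_def)
  then show "((\<lambda>s. l2norm nat_measure (\<lambda>k. wcoef (\<psi> s) k - wcoef (\<psi> t) k)) \<longlongrightarrow> 0) (at t within {0..T})"
  proof (rule Lim_transform_eventually)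
    show "\<forall>\<^sub>F s in at t within {0..T}. H1_norm (\<lambda>x. \<psi> s x - \<psi> t x) =
        l2norm nat_measure (\<lambda>k. wcoef (\<psi> s) k - wcoef (\<psi> t) k)"
      unfolding eventually_at_filter
      by (intro always_eventually allI impI H1_norm_diff H assms(2))
  qed
qed

lemma C_time_H1_I:
  assumes "\<And>t. t \<in> {0..T} \<Longrightarrow> \<psi> t \<in> H1_on 0 1"
    "\<And>t. t \<in> {0..T} \<Longrightarrow> ((\<lambda>s. l2norm nat_measure (\<lambda>k. wcoef (\<psi> s) k - wcoef (\<psi> t) k)) \<longlongrightarrow> 0) (at t within {0..T})"
  shows "\<psi> \<in> C_time_H1 T"
  unfolding C_time_H1_def mem_Collect_eq
proof (intro conjI ballI)
  fix t assume t: "t \<in> {0..T}"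
  show "\<psi> t \<in> H1_on 0 1" by (rule assms(1)[OF t])
  show "((\<lambda>s. H1_norm (\<lambda>x. \<psi> s x - \<psi> t x)) \<longlongrightarrow> 0) (at t within {0..T})"
  proof (rule Lim_transform_eventually[OF assms(2)[OF t]])
    show "\<forall>\<^sub>F s in at t within {0..T}. l2norm nat_measure (\<lambda>k. wcoef (\<psi> s) k - wcoef (\<psi> t) k) =
        H1_norm (\<lambda>x. \<psi> s x - \<psi> t x)"
      unfolding eventually_at_filter
      by (intro always_eventually allI impI H1_norm_diff[symmetric] assms(1) t)
  qed
qed

lemma C_time_H1_diff:
  assumes "\<psi> \<in> C_time_H1 T" "\<psi>' \<in> C_time_H1 T"
  shows "(\<lambda>s x. \<psi> s x - \<psi>' s x) \<in> C_time_H1 T"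
proof (rule C_time_H1_I)
  note H = C_time_H1_D(1)[OF assms(1)] and H' = C_time_H1_D(1)[OF assms(2)]
  show "(\<lambda>x. \<psi> t x - \<psi>' t x) \<in> H1_on 0 1" if "t \<in> {0..T}" for t
    using H1_on_diff[OF _ H H'] that by simp
  fix t assume t: "t \<in> {0..T}"
  let ?n = "l2norm nat_measure"
  show "((\<lambda>s. ?n (\<lambda>k. wcoef (\<lambda>x. \<psi> s x - \<psi>' s x) k - wcoef (\<lambda>x. \<psi> t x - \<psi>' t x) k)) \<longlongrightarrow> 0) (at t within {0..T})"
  proof (rule Lim_null_comparison)
    show "((\<lambda>s. ?n (\<lambda>k. wcoef (\<psi> s) k - wcoef (\<psi> t) k) + ?n (\<lambda>k. wcoef (\<psi>' s) k - wcoef (\<psi>' t) k)) \<longlongrightarrow> 0) (at t within {0..T})"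
      using tendsto_add[OF C_time_H1_D(2)[OF assms(1) t] C_time_H1_D(2)[OF assms(2) t]] by simp
    show "\<forall>\<^sub>F s in at t within {0..T}. norm (?n (\<lambda>k. wcoef (\<lambda>x. \<psi> s x - \<psi>' s x) k - wcoef (\<lambda>x. \<psi> t x - \<psi>' t x) k))
        \<le> ?n (\<lambda>k. wcoef (\<psi> s) k - wcoef (\<psi> t) k) + ?n (\<lambda>k. wcoef (\<psi>' s) k - wcoef (\<psi>' t) k)"
      unfolding eventually_at_filter
    proof (intro always_eventually allI impI)
      fix s assume s: "s \<in> {0..T}"
      have e: "wcoef (\<lambda>x. \<psi> s x - \<psi>' s x) = (\<lambda>k. wcoef (\<psi> s) k - wcoef (\<psi>' s) k)" if "s \<in> {0..T}" for s
        by (rule wcoef_diff) (use H H' that H1_onD in auto)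
      have "?n (\<lambda>k. (wcoef (\<psi> s) k - wcoef (\<psi> t) k) + - (wcoef (\<psi>' s) k - wcoef (\<psi>' t) k)) \<le>
          ?n (\<lambda>k. wcoef (\<psi> s) k - wcoef (\<psi> t) k) + ?n (\<lambda>k. - (wcoef (\<psi>' s) k - wcoef (\<psi>' t) k))"
        by (intro l2norm_triangle sqint_diff sqint_uminus H1_wcoef_sqint H H' s t)
      then show "norm (?n (\<lambda>k. wcoef (\<lambda>x. \<psi> s x - \<psi>' s x) k - wcoef (\<lambda>x. \<psi> t x - \<psi>' t x) k))
        \<le> ?n (\<lambda>k. wcoef (\<psi> s) k - wcoef (\<psi> t) k) + ?n (\<lambda>k. wcoef (\<psi>' s) k - wcoef (\<psi>' t) k)"
        unfolding e[OF s] e[OF t] l2norm_uminus by (simp add: algebra_simps)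
    qed
  qed
qed

lemma C_time_H1_norm_continuous:
  assumes "\<psi> \<in> C_time_H1 T"
  shows "continuous_on {0..T} (\<lambda>s. H1_norm (\<psi> s))"
  unfolding continuous_on_def
proof
  fix t assume t: "t \<in> {0..T}"
  note H = C_time_H1_D(1)[OF assms]
  have "((\<lambda>s. H1_norm (\<psi> s) - H1_norm (\<psi> t)) \<longlongrightarrow> 0) (at t within {0..T})"
  proof (rule Lim_null_comparison[OF _ C_time_H1_D(2)[OF assms t]])
    show "\<forall>\<^sub>F s in at t within {0..T}. norm (H1_norm (\<psi> s) - H1_norm (\<psi> t)) \<le>
        l2norm nat_measure (\<lambda>k. wcoef (\<psi> s) k - wcoef (\<psi> t) k)"
      unfolding eventually_at_filter
    proof (intro always_eventually allI impI)
      fix s assume s: "s \<in> {0..T}"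
      show "norm (H1_norm (\<psi> s) - H1_norm (\<psi> t)) \<le> l2norm nat_measure (\<lambda>k. wcoef (\<psi> s) k - wcoef (\<psi> t) k)"
        using l2norm_reverse_triangle[OF H1_wcoef_sqint[OF H[OF s]] H1_wcoef_sqint[OF H[OF t]]]
        unfolding H1_norm_wcoef[OF H1_wcoef_sqint[OF H[OF s]]] H1_norm_wcoef[OF H1_wcoef_sqint[OF H[OF t]]]
        by simp
    qed
  qed
  then show "((\<lambda>s. H1_norm (\<psi> s)) \<longlongrightarrow> H1_norm (\<psi> t)) (at t within {0..T})"
    by (simp add: LIM_zero_iff)
qed

lemma integrable_primitive_continuous_real:
  fixes h :: "real \<Rightarrow> real"
  assumes "integrable (ivl 0 T) h"
  shows "continuous_on {0..T} (\<lambda>t. LINT s|ivl 0 t. h s)"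
proof -
  have "abs_cont 0 T (\<lambda>t. complex_of_real (LINT s|ivl 0 t. h s)) (\<lambda>s. of_real (h s))"
    by (rule abs_cont_primitive[of _ _ _ _ 0]) (use assms in \<open>simp_all add: complex_of_real_integrable_eq\<close>)
  from continuous_on_Re[OF abs_cont_continuous[OF this]] show ?thesis by simp
qed

context breakpoints
begin

section \<open>The right-hand side of Duhamel's formula\<close>

text \<open>The phase of the free evolution is factored out of both terms; as it has modulus 1,
  norms at a fixed time do not see it.\<close>

definition mild_wcoef :: "(nat \<Rightarrow> complex) \<Rightarrow> (real \<Rightarrow> cfun) \<Rightarrow> real \<Rightarrow> nat \<Rightarrow> complex" where
  "mild_wcoef c g t k = cnj (texp k t) * (c k - \<i> * (of_real (weight k) * duhamel 0 t g k))"

lemma mild_wcoef_sqint: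
  assumes g: "pw_source T g" and m: "time_bound T m"
    and gm: "AE s in ivl 0 T. H1_pw_norm A (g s) \<le> m s"
    and c: "c \<in> sqint nat_measure" and t: "t \<in> {0..T}"
  shows "mild_wcoef c g t \<in> sqint nat_measure"
proof -
  have "(\<lambda>k. cnj (texp k t) * (c k - \<i> * (of_real (weight k) * duhamel 0 t g k))) \<in> sqint nat_measure"
    by (intro sqint_nat_unimodular sqint_diff sqint_cmult c duhamel_estimate(2)[OF g m gm]) (use t in auto)
  then show ?thesis by (simp add: mild_wcoef_def[abs_def])
qed

text \<open>Two effects are separated: the vector \<open>X\<close> behind the phases moves by a
  Duhamel integral over the short interval, controlled by the increment of \<open>V\<close>, and the
  phases rotate the fixed vector \<open>X t\<close>, which is continuous by dominated convergence
  over \<open>k\<close>.\<close>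

lemma mild_wcoef_continuous:
  assumes g: "pw_source T g" and m: "time_bound T m"
    and gm: "AE s in ivl 0 T. H1_pw_norm A (g s) \<le> m s"
    and c: "c \<in> sqint nat_measure" and t: "t \<in> {0..T}"
  shows "((\<lambda>s. l2norm nat_measure (\<lambda>k. mild_wcoef c g s k - mild_wcoef c g t k)) \<longlongrightarrow> 0) (at t within {0..T})"
proof -
  let ?n = "l2norm nat_measure"
  note est = duhamel_estimate[OF g m gm]
  define X where "X s k = c k - \<i> * (of_real (weight k) * duhamel 0 s g k)" for s k
  define D where "D = duhamel_const T"
  have D0: "0 \<le> D" unfolding D_def by (rule duhamel_const_nonneg) (use t in auto)
  have Xs: "X s \<in> sqint nat_measure" if "s \<in> {0..T}" for s
    unfolding X_def[abs_def] by (intro sqint_diff sqint_cmult c est(2)) (use that in auto)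
  define V where "V s = (LINT r|ivl 0 s. (m r)\<^sup>2)" for s
  have mi: "integrable (ivl 0 T) (\<lambda>r. (m r)\<^sup>2)" using m by (simp add: time_bound_def)
  have Xd: "(?n (\<lambda>k. X s k - X r k))\<^sup>2 \<le> D * (V s - V r)" if rs: "r \<in> {0..T}" "s \<in> {0..T}" "r \<le> s" for r s
  proof -
    have "duhamel 0 s g k = duhamel 0 r g k + duhamel r s g k" for k
      unfolding duhamel_def by (rule integral_ivl_split[OF est(1)]) (use rs in auto)
    then have "X s k - X r k = (- \<i>) * (of_real (weight k) * duhamel r s g k)" for k
      by (simp add: X_def algebra_simps)
    then have "(?n (\<lambda>k. X s k - X r k))\<^sup>2 = (?n (\<lambda>k. of_real (weight k) * duhamel r s g k))\<^sup>2"
      using l2norm_cmult[of nat_measure "- \<i>"] by simp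
    also have "\<dots> \<le> D * (LINT q|ivl r s. (m q)\<^sup>2)"
      unfolding D_def by (rule est(3)) (use rs in auto)
    also have "(LINT q|ivl r s. (m q)\<^sup>2) = V s - V r"
    proof -
      have "integrable (ivl 0 s) (\<lambda>r. (m r)\<^sup>2)" by (rule integrable_ivl_sub[OF mi]) (use rs in auto)
      from integral_ivl_split[OF this, of r] rs show ?thesis by (simp add: V_def)
    qed
    finally show ?thesis .
  qed
  have X1: "?n (\<lambda>k. X s k - X t k) \<le> sqrt (D * \<bar>V s - V t\<bar>)" if s: "s \<in> {0..T}" for s
  proof (rule real_le_rsqrt)
    show "(?n (\<lambda>k. X s k - X t k))\<^sup>2 \<le> D * \<bar>V s - V t\<bar>"
    proof (cases "t \<le> s")
      case True
      have "D * (V s - V t) \<le> D * \<bar>V s - V t\<bar>" using D0 by (intro mult_left_mono) auto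
      then show ?thesis using Xd[OF t s True] by linarith
    next
      case False
      have "D * (V t - V s) \<le> D * \<bar>V s - V t\<bar>" using D0 by (intro mult_left_mono) auto
      then show ?thesis using Xd[OF s t] False l2norm_minus_commute[of nat_measure "X s" "X t"] by simp
    qed
  qed
  have V: "continuous_on {0..T} V" unfolding V_def by (rule integrable_primitive_continuous_real[OF mi])
  have L1: "((\<lambda>s. sqrt (D * \<bar>V s - V t\<bar>)) \<longlongrightarrow> 0) (at t within {0..T})"
  proof -
    have "(V \<longlongrightarrow> V t) (at t within {0..T})" using V t by (simp add: continuous_on_def)
    then have "((\<lambda>s. sqrt (D * \<bar>V s - V t\<bar>)) \<longlongrightarrow> sqrt (D * \<bar>V t - V t\<bar>)) (at t within {0..T})"
      by (intro tendsto_intros)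
    then show ?thesis by simp
  qed
  \<comment> \<open>The rotation of the fixed vector. It is not uniform over \<open>k\<close>, since
    the frequencies are unbounded; the square-summable majorant \<open>2 * cmod (X t k)\<close>
    replaces uniformity.\<close>
  define W where "W s k = (cnj (texp k s) - cnj (texp k t)) * X t k" for s k
  have c2: "cmod (cnj (texp k s) - cnj (texp k t)) \<le> 2" for k s
    using norm_triangle_ineq4[of "cnj (texp k s)" "cnj (texp k t)"] by simp
  have Wb: "cmod (W s k) \<le> 2 * cmod (X t k)" for s k
    unfolding W_def norm_mult by (intro mult_right_mono c2) auto
  have Ws: "W s \<in> sqint nat_measure" for s
    by (rule sqint_bound[OF _ Xs[OF t], of _ 2]) (use Wb in auto)
  have L2: "((\<lambda>s. ?n (W s)) \<longlongrightarrow> 0) (at t within {0..T})"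
    unfolding tendsto_at_iff_sequentially comp_def
  proof (intro allI impI)
    fix S :: "nat \<Rightarrow> real" assume S: "S \<longlonglongrightarrow> t"
    have "(\<lambda>n. LINT k|nat_measure. (cmod (W (S n) k))\<^sup>2) \<longlonglongrightarrow> (LINT k|nat_measure. 0)"
    proof (rule integral_dominated_convergence)
      show "integrable nat_measure (\<lambda>k. 4 * (cmod (X t k))\<^sup>2)" using sqintD(2)[OF Xs[OF t]] by simp
      show "AE k in nat_measure. (\<lambda>n. (cmod (W (S n) k))\<^sup>2) \<longlonglongrightarrow> 0"
      proof (rule AE_I2)
        fix k
        have "(\<lambda>n. texp k (S n)) \<longlonglongrightarrow> texp k t"
          using continuous_on_texp[of UNIV k] S by (rule continuous_on_tendsto_compose) auto
        then have "(\<lambda>n. (cmod (W (S n) k))\<^sup>2) \<longlonglongrightarrow> (cmod ((cnj (texp k t) - cnj (texp k t)) * X t k))\<^sup>2"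
          unfolding W_def by (intro tendsto_intros)
        then show "(\<lambda>n. (cmod (W (S n) k))\<^sup>2) \<longlonglongrightarrow> 0" by simp
      qed
      show "AE k in nat_measure. norm ((cmod (W (S n) k))\<^sup>2) \<le> 4 * (cmod (X t k))\<^sup>2" for n
        using power_mono[OF Wb norm_ge_zero, of _ _ 2] by (simp add: power_mult_distrib)
    qed auto
    then have "(\<lambda>n. (?n (W (S n)))\<^sup>2) \<longlonglongrightarrow> 0" by (simp add: l2norm_sq)
    then have "(\<lambda>n. sqrt ((?n (W (S n)))\<^sup>2)) \<longlonglongrightarrow> sqrt 0" by (rule tendsto_real_sqrt)
    then show "(\<lambda>n. ?n (W (S n))) \<longlonglongrightarrow> 0" by simp
  qed
  show ?thesis
  proof (rule Lim_null_comparison)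
    show "((\<lambda>s. sqrt (D * \<bar>V s - V t\<bar>) + ?n (W s)) \<longlongrightarrow> 0) (at t within {0..T})"
      using tendsto_add[OF L1 L2] by simp
    show "\<forall>\<^sub>F s in at t within {0..T}. norm (?n (\<lambda>k. mild_wcoef c g s k - mild_wcoef c g t k))
        \<le> sqrt (D * \<bar>V s - V t\<bar>) + ?n (W s)"
      unfolding eventually_at_filter
    proof (intro always_eventually allI impI)
      fix s assume s: "s \<in> {0..T}"
      have e: "mild_wcoef c g s k - mild_wcoef c g t k = cnj (texp k s) * (X s k - X t k) + W s k" for k
        by (simp add: mild_wcoef_def X_def W_def algebra_simps)
      have "?n (\<lambda>k. mild_wcoef c g s k - mild_wcoef c g t k) \<le> ?n (\<lambda>k. cnj (texp k s) * (X s k - X t k)) + ?n (W s)"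
        unfolding e by (intro l2norm_triangle sqint_nat_unimodular sqint_diff Xs s t Ws) simp
      also have "?n (\<lambda>k. cnj (texp k s) * (X s k - X t k)) = ?n (\<lambda>k. X s k - X t k)"
        by (rule l2norm_nat_unimodular) simp
      finally show "norm (?n (\<lambda>k. mild_wcoef c g s k - mild_wcoef c g t k)) \<le> sqrt (D * \<bar>V s - V t\<bar>) + ?n (W s)"
        using X1[OF s] by simp
    qed
  qed
qed

end

section \<open>Well-posedness\<close>

locale bilinear_control = breakpoints +
  fixes T :: real and \<mu> u :: "real \<Rightarrow> real"
  assumes T: "0 < T" and \<mu>: "(\<lambda>x. complex_of_real (\<mu> x)) \<in> H1_pw A" and u: "u \<in> L2_time_real T"
begin

definition mult_bound :: real where "mult_bound = mult_const (\<lambda>x. complex_of_real (\<mu> x))"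

definition control_source :: "(real \<Rightarrow> cfun) \<Rightarrow> real \<Rightarrow> cfun" where
  "control_source \<psi> s = (\<lambda>x. of_real (u s) * (of_real (\<mu> x) * \<psi> s x))"

definition full_source :: "(real \<Rightarrow> cfun) \<Rightarrow> (real \<Rightarrow> cfun) \<Rightarrow> real \<Rightarrow> cfun" where
  "full_source f \<psi> s = (\<lambda>x. control_source \<psi> s x + f s x)"

text \<open>The density in the Lipschitz estimate for squared norms: the smoothing constant, the
  squared multiplication constant and the squared control.\<close>

definition \<kappa> :: "real \<Rightarrow> real" where "\<kappa> s = duhamel_const T * mult_bound\<^sup>2 * (u s)\<^sup>2"

lemma D_nonneg: "0 \<le> duhamel_const T" using T by (intro duhamel_const_nonneg) simp

lemma u_props: "u \<in> borel_measurable (ivl 0 T)" "integrable (ivl 0 T) (\<lambda>s. (u s)\<^sup>2)"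
  using u by (auto simp: L2_time_real_def)

lemma \<kappa>_props: "integrable (ivl 0 T) \<kappa>" "0 \<le> \<kappa> s"
  using u_props D_nonneg by (auto simp: \<kappa>_def[abs_def])

lemma control_time_bound:
  assumes "continuous_on {0..T} y"
  shows "time_bound T (\<lambda>s. \<bar>u s\<bar> * y s)"
  unfolding time_bound_def
proof
  have "(\<lambda>s. complex_of_real (y s)) \<in> borel_measurable (ivl 0 T)"
    by (intro continuous_on_ivl_measurable continuous_intros assms)
  from measurable_compose[OF this borel_measurable_Re]
  have "y \<in> borel_measurable (ivl 0 T)" by simp
  then show "(\<lambda>s. \<bar>u s\<bar> * y s) \<in> borel_measurable (ivl 0 T)"
    using u_props(1) by measurable
  have "integrable (ivl 0 T) (\<lambda>s. (u s)\<^sup>2 * (y s)\<^sup>2)"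
    by (intro integrable_weight_continuous u_props continuous_intros assms)
  then show "integrable (ivl 0 T) (\<lambda>s. (\<bar>u s\<bar> * y s)\<^sup>2)" by (simp add: power_mult_distrib)
qed

lemma control_source_props:
  assumes \<psi>: "\<psi> \<in> C_time_H1 T"
  shows "pw_source T (control_source \<psi>)"
    "time_bound T (\<lambda>s. \<bar>u s\<bar> * (mult_bound * H1_norm (\<psi> s)))"
    "AE s in ivl 0 T. H1_pw_norm A (control_source \<psi> s) \<le> \<bar>u s\<bar> * (mult_bound * H1_norm (\<psi> s))"
proof -
  have um: "(\<lambda>s. complex_of_real (u s)) \<in> borel_measurable (ivl 0 T)" using u_props(1) by measurable
  show "pw_source T (control_source \<psi>)"
    using pw_source_cmult[OF pw_source_mult[OF \<mu> \<psi>] um] by (simp add: control_source_def[abs_def])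
  show "time_bound T (\<lambda>s. \<bar>u s\<bar> * (mult_bound * H1_norm (\<psi> s)))"
    by (intro control_time_bound continuous_intros C_time_H1_norm_continuous \<psi>)
  show "AE s in ivl 0 T. H1_pw_norm A (control_source \<psi> s) \<le> \<bar>u s\<bar> * (mult_bound * H1_norm (\<psi> s))"
    using AE_space
  proof eventually_elim
    case (elim s)
    then have s: "s \<in> {0..T}" by auto
    note M = H1_pw_mult[OF \<mu> C_time_H1_D(1)[OF \<psi> s]]
    show ?case unfolding control_source_def H1_pw_cmult(2)[OF M(1)]
      using M(2) by (simp add: mult_bound_def mult_left_mono)
  qed
qed

lemma full_source_props:
  assumes \<psi>: "\<psi> \<in> C_time_H1 T" and f: "f \<in> L2_time_H1_pw T A"
  shows "pw_source T (full_source f \<psi>)"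
    "time_bound T (\<lambda>s. \<bar>u s\<bar> * (mult_bound * H1_norm (\<psi> s)) + H1_pw_norm A (f s))"
    "AE s in ivl 0 T. H1_pw_norm A (full_source f \<psi> s) \<le> \<bar>u s\<bar> * (mult_bound * H1_norm (\<psi> s)) + H1_pw_norm A (f s)"
proof -
  note c = control_source_props[OF \<psi>] and fs = pw_source_L2_time[OF f]
  show "pw_source T (full_source f \<psi>)"
    using pw_source_add[OF c(1) fs(1)] by (simp add: full_source_def[abs_def])
  show "time_bound T (\<lambda>s. \<bar>u s\<bar> * (mult_bound * H1_norm (\<psi> s)) + H1_pw_norm A (f s))"
    by (rule time_bound_add[OF c(2) fs(2)])
  show "AE s in ivl 0 T. H1_pw_norm A (full_source f \<psi> s) \<le> \<bar>u s\<bar> * (mult_bound * H1_norm (\<psi> s)) + H1_pw_norm A (f s)"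
    using c(3) pw_source_AE[OF c(1)] pw_source_AE[OF fs(1)]
  proof eventually_elim
    case (elim s)
    then show ?case using H1_pw_norm_triangle[of "control_source \<psi> s" "f s"]
      by (simp add: full_source_def)
  qed
qed

text \<open>Coefficients determine a square-integrable function up to null sets. From left to right
  they are pulled through the Bochner integral; from right to left the integral must be produced,
  which is where measurability in coordinates and the majorant are needed.\<close>

lemma mild_solution_iff:
  assumes \<psi>0: "\<psi>0 \<in> H1_on 0 1" and f: "f \<in> L2_time_H1_pw T A"
  shows "mild_solution T \<mu> u \<psi>0 f \<psi> \<longleftrightarrow>
    \<psi> \<in> C_time_H1 T \<and> (\<forall>t\<in>{0..T}. wcoef (\<psi> t) = mild_wcoef (wcoef \<psi>0) (full_source f \<psi>) t)"
proof (cases "\<psi> \<in> C_time_H1 T")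
  case False
  then show ?thesis by (simp add: mild_solution_def)
next
  case \<psi>: True
  let ?G = "full_source f \<psi>"
  note src = full_source_props[OF \<psi> f]
  have integrand: "(\<lambda>x. of_real (u s) * of_real (\<mu> x) * \<psi> s x + f s x) = ?G s" for s
    by (simp add: full_source_def control_source_def mult.assoc)
  have \<psi>0s: "\<psi>0 \<in> sqint I01" by (rule H1_onD(1)[OF \<psi>0])
  have pt: "(\<exists>I. has_bochner_integral_in (L2_on 0 1) (L2_norm_on 0 1) (ivl 0 t)
          (\<lambda>s. schroedinger_group (t - s) (?G s)) I \<and>
        (AE x in I01. \<psi> t x = schroedinger_group t \<psi>0 x - \<i> * I x)) \<longleftrightarrow>
      wcoef (\<psi> t) = mild_wcoef (wcoef \<psi>0) ?G t" if t: "t \<in> {0..T}" for t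
  proof -
    have \<psi>t: "\<psi> t \<in> sqint I01" by (rule H1_onD(1)[OF C_time_H1_D(1)[OF \<psi> t]])
    note grp = schroedinger_group_L2[OF \<psi>0s, of t]
    have gcoef: "coef (schroedinger_group t \<psi>0) k = cnj (texp k t) * coef \<psi>0 k" for k
      by (simp add: grp(2) cnj_texp)
    have AE: "AE s in ivl 0 t. ?G s \<in> H1_pw A"
      by (rule AE_ivl_sub[OF pw_source_AE[OF src(1)]]) (use t in auto)
    \<comment> \<open>The phase at \<open>t - s\<close> factors into one depending on
      \<open>t\<close> and one depending on \<open>s\<close>, which brings the integrand to the form
      used in \<open>duhamel\<close>. Outside the null set where the source leaves the piecewise
      space nothing has to be known about the chosen group element.\<close>
    have AEF: "AE s in ivl 0 t. schroedinger_group (t - s) (?G s) \<in> sqint I01 \<and>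
        (\<forall>k. coef (schroedinger_group (t - s) (?G s)) k = cnj (texp k t) * (texp k s * coef (?G s) k))"
      using AE
    proof eventually_elim
      case (elim s)
      note S = schroedinger_group_L2[OF H1_pw_sqint[OF elim], of "t - s"]
      then show ?case by (simp only: texp_diff mult.assoc) simp
    qed
    have int: "integrable (ivl 0 t) (\<lambda>s. texp k s * coef (?G s) k)" for k
      by (rule duhamel_estimate(1)[OF src]) (use t in auto)
    have int': "integrable (ivl 0 t) (\<lambda>s. cnj (texp k t) * (texp k s * coef (?G s) k))" for k
      using int by simp
    have meas: "(\<lambda>s. coef (schroedinger_group (t - s) (?G s)) k) \<in> borel_measurable (ivl 0 t)" for k
    proof (rule measurable_ivl_cong_AE[OF borel_measurable_integrable[OF int'[of k]]])
      show "AE s in ivl 0 t. cnj (texp k t) * (texp k s * coef (?G s) k) = coef (schroedinger_group (t - s) (?G s)) k"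
        using AEF by eventually_elim simp
    qed
    have val: "(LINT s|ivl 0 t. coef (schroedinger_group (t - s) (?G s)) k) = cnj (texp k t) * duhamel 0 t ?G k" for k
    proof -
      have "(LINT s|ivl 0 t. coef (schroedinger_group (t - s) (?G s)) k) =
          (LINT s|ivl 0 t. cnj (texp k t) * (texp k s * coef (?G s) k))"
        by (rule integral_cong_AE[OF meas borel_measurable_integrable[OF int']])
           (use AEF in eventually_elim, simp)
      then show ?thesis by (simp only: integral_mult_right_zero duhamel_def)
    qed
    have hs: "wcoef (\<psi> t) = mild_wcoef (wcoef \<psi>0) ?G t \<longleftrightarrow>
        (\<forall>k. coef (\<psi> t) k = cnj (texp k t) * coef \<psi>0 k - \<i> * (cnj (texp k t) * duhamel 0 t ?G k))"
    proof -
      have "(wcoef (\<psi> t) k = mild_wcoef (wcoef \<psi>0) ?G t k) \<longleftrightarrow>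
          coef (\<psi> t) k = cnj (texp k t) * coef \<psi>0 k - \<i> * (cnj (texp k t) * duhamel 0 t ?G k)" for k
      proof -
        have w: "complex_of_real (weight k) \<noteq> 0" using weight_ge_1[of k] by auto
        have "mild_wcoef (wcoef \<psi>0) ?G t k =
            of_real (weight k) * (cnj (texp k t) * coef \<psi>0 k - \<i> * (cnj (texp k t) * duhamel 0 t ?G k))"
          by (simp add: mild_wcoef_def wcoef_def algebra_simps)
        then show ?thesis using w by (simp add: wcoef_def)
      qed
      then show ?thesis by (simp add: fun_eq_iff)
    qed
    show ?thesis
    proof
      assume "\<exists>I. has_bochner_integral_in (L2_on 0 1) (L2_norm_on 0 1) (ivl 0 t)
          (\<lambda>s. schroedinger_group (t - s) (?G s)) I \<and>
        (AE x in I01. \<psi> t x = schroedinger_group t \<psi>0 x - \<i> * I x)"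
      then obtain I where B: "has_bochner_integral_in (L2_on 0 1) (L2_norm_on 0 1) (ivl 0 t)
          (\<lambda>s. schroedinger_group (t - s) (?G s)) I"
        and e: "AE x in I01. \<psi> t x = schroedinger_group t \<psi>0 x - \<i> * I x" by blast
      note BI = bochner_integral_coef[OF B]
      have iI: "(\<lambda>x. \<i> * I x) \<in> sqint I01" by (rule sqint_cmult[OF BI(1)])
      have r: "(\<lambda>x. schroedinger_group t \<psi>0 x - \<i> * I x) \<in> sqint I01" by (rule sqint_diff[OF grp(1) iI])
      have "coef (\<psi> t) k = coef (schroedinger_group t \<psi>0) k - \<i> * coef I k" for k
        using coef_cong_AE[OF e sqintD(1)[OF \<psi>t] sqintD(1)[OF r], of k]
        unfolding coef_diff[OF grp(1) iI] coef_cmult .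
      then show "wcoef (\<psi> t) = mild_wcoef (wcoef \<psi>0) ?G t" unfolding hs gcoef BI(2) val by blast
    next
      assume "wcoef (\<psi> t) = mild_wcoef (wcoef \<psi>0) ?G t"
      then have h: "coef (\<psi> t) k = cnj (texp k t) * coef \<psi>0 k - \<i> * (cnj (texp k t) * duhamel 0 t ?G k)" for k
        unfolding hs by blast
      \<comment> \<open>The only candidate for the integral, obtained by solving Duhamel's formula
        for it: the inverse of \<open>- \<i>\<close> is \<open>\<i>\<close>.\<close>
      define I where "I x = \<i> * (\<psi> t x - schroedinger_group t \<psi>0 x)" for x
      have d: "(\<lambda>x. \<psi> t x - schroedinger_group t \<psi>0 x) \<in> sqint I01" by (rule sqint_diff[OF \<psi>t grp(1)])
      have I: "I \<in> sqint I01" unfolding I_def[abs_def] by (rule sqint_cmult[OF d])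
      have "coef I k = \<i> * (coef (\<psi> t) k - coef (schroedinger_group t \<psi>0) k)" for k
        unfolding I_def[abs_def] coef_cmult coef_diff[OF \<psi>t grp(1)] ..
      then have cI: "coef I k = (LINT s|ivl 0 t. coef (schroedinger_group (t - s) (?G s)) k)" for k
        unfolding val h gcoef by (simp add: algebra_simps)
      have "has_bochner_integral_in (L2_on 0 1) (L2_norm_on 0 1) (ivl 0 t)
          (\<lambda>s. schroedinger_group (t - s) (?G s)) I"
      proof (rule bochner_integral_from_coef[OF _ meas _ _ _ I cI])
        show "AE s in ivl 0 t. schroedinger_group (t - s) (?G s) \<in> sqint I01"
          using AEF by eventually_elim simp
        note tb = time_bound_sub[OF src(2), of 0 t]
        show "(\<lambda>s. \<bar>u s\<bar> * (mult_bound * H1_norm (\<psi> s)) + H1_pw_norm A (f s)) \<in> borel_measurable (ivl 0 t)"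
          "integrable (ivl 0 t) (\<lambda>s. (\<bar>u s\<bar> * (mult_bound * H1_norm (\<psi> s)) + H1_pw_norm A (f s))\<^sup>2)"
          by (rule tb; use t in simp)+
        have b: "AE s in ivl 0 t. H1_pw_norm A (?G s) \<le> \<bar>u s\<bar> * (mult_bound * H1_norm (\<psi> s)) + H1_pw_norm A (f s)"
          by (rule AE_ivl_sub[OF src(3)]) (use t in auto)
        show "AE s in ivl 0 t. l2norm I01 (schroedinger_group (t - s) (?G s)) \<le>
            \<bar>u s\<bar> * (mult_bound * H1_norm (\<psi> s)) + H1_pw_norm A (f s)"
          using b AE AEF
        proof eventually_elim
          case (elim s)
          have S: "schroedinger_group (t - s) (?G s) \<in> sqint I01" using elim(3) by blast
          have "l2norm I01 (schroedinger_group (t - s) (?G s)) = l2norm nat_measure (coef (schroedinger_group (t - s) (?G s)))"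
            by (rule l2norm_coef(2)[OF S, symmetric])
          also have "coef (schroedinger_group (t - s) (?G s)) = (\<lambda>k. (cnj (texp k t) * texp k s) * coef (?G s) k)"
            using elim(3) by (auto simp: mult.assoc)
          also have "l2norm nat_measure (\<lambda>k. (cnj (texp k t) * texp k s) * coef (?G s) k) = l2norm nat_measure (coef (?G s))"
            by (rule l2norm_nat_unimodular) (simp add: norm_mult)
          also have "\<dots> = l2norm I01 (?G s)" by (rule l2norm_coef(2)[OF H1_pw_sqint[OF elim(2)]])
          also have "\<dots> \<le> H1_pw_norm A (?G s)" by (rule l2norm_le_H1_pw_norm[OF elim(2)])
          finally show ?case using elim(1) by linarith
        qed
        show "0 \<le> t" using t by simp
      qed
      moreover have "AE x in I01. \<psi> t x = schroedinger_group t \<psi>0 x - \<i> * I x"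
        unfolding I_def by (intro AE_I2) (simp add: mult.assoc[symmetric])
      ultimately show "\<exists>I. has_bochner_integral_in (L2_on 0 1) (L2_norm_on 0 1) (ivl 0 t)
          (\<lambda>s. schroedinger_group (t - s) (?G s)) I \<and>
        (AE x in I01. \<psi> t x = schroedinger_group t \<psi>0 x - \<i> * I x)" by blast
    qed
  qed
  show ?thesis unfolding mild_solution_def integrand using \<psi> pt by simp
qed

lemma mild_wcoef_sqint':
  assumes "\<psi> \<in> C_time_H1 T" "f \<in> L2_time_H1_pw T A" "c \<in> sqint nat_measure" "t \<in> {0..T}"
  shows "mild_wcoef c (full_source f \<psi>) t \<in> sqint nat_measure"
  by (rule mild_wcoef_sqint[OF full_source_props[OF assms(1,2)] assms(3,4)])

section \<open>Lipschitz estimate, uniqueness and the a priori bound\<close>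

text \<open>The initial datum and \<open>f\<close> cancel, and the difference of the sources is the
  control source of the difference of the trajectories, to which the smoothing estimate
  applies.\<close>

lemma mild_wcoef_lipschitz:
  assumes \<psi>: "\<psi> \<in> C_time_H1 T" "\<psi>' \<in> C_time_H1 T" and f: "f \<in> L2_time_H1_pw T A" and t: "t \<in> {0..T}"
  shows "(l2norm nat_measure (\<lambda>k. mild_wcoef c (full_source f \<psi>) t k - mild_wcoef c (full_source f \<psi>') t k))\<^sup>2
     \<le> (LINT s|ivl 0 t. \<kappa> s * (H1_norm (\<lambda>x. \<psi> s x - \<psi>' s x))\<^sup>2)"
proof -
  let ?d = "\<lambda>s x. \<psi> s x - \<psi>' s x"
  note src = full_source_props[OF \<psi>(1) f] and src' = full_source_props[OF \<psi>(2) f]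
  note cs = control_source_props[OF C_time_H1_diff[OF \<psi>]]
  have rt: "(0::real) \<le> 0" "0 \<le> t" "t \<le> T" using t by auto
  have AE: "AE s in ivl 0 t. \<forall>k. coef (control_source ?d s) k = coef (full_source f \<psi> s) k - coef (full_source f \<psi>' s) k"
  proof -
    have "AE s in ivl 0 T. \<forall>k. coef (control_source ?d s) k = coef (full_source f \<psi> s) k - coef (full_source f \<psi>' s) k"
      using pw_source_AE[OF src(1)] pw_source_AE[OF src'(1)]
    proof eventually_elim
      case (elim s)
      have "control_source ?d s = (\<lambda>x. full_source f \<psi> s x - full_source f \<psi>' s x)"
        by (simp add: full_source_def control_source_def algebra_simps)
      then show ?case using coef_diff[OF H1_pw_sqint[OF elim(1)] H1_pw_sqint[OF elim(2)]] by simp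
    qed
    then show ?thesis by (rule AE_ivl_sub) (use t in auto)
  qed
  have dd: "duhamel 0 t (full_source f \<psi>) k - duhamel 0 t (full_source f \<psi>') k = duhamel 0 t (control_source ?d) k" for k
  proof -
    note i = duhamel_estimate(1)[OF src rt, of k] and i' = duhamel_estimate(1)[OF src' rt, of k]
      and ic = duhamel_estimate(1)[OF cs rt, of k]
    have "duhamel 0 t (control_source ?d) k =
        (LINT s|ivl 0 t. texp k s * coef (full_source f \<psi> s) k - texp k s * coef (full_source f \<psi>' s) k)"
      unfolding duhamel_def
    proof (rule integral_cong_AE)
      show "AE s in ivl 0 t. texp k s * coef (control_source ?d s) k =
          texp k s * coef (full_source f \<psi> s) k - texp k s * coef (full_source f \<psi>' s) k"
        using AE by eventually_elim (simp add: right_diff_distrib)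
    qed (use i i' ic in \<open>auto intro!: borel_measurable_integrable\<close>)
    then show ?thesis using i i' by (simp add: duhamel_def)
  qed
  have "mild_wcoef c (full_source f \<psi>) t k - mild_wcoef c (full_source f \<psi>') t k =
      (- \<i> * cnj (texp k t)) * (of_real (weight k) * duhamel 0 t (control_source ?d) k)" for k
    unfolding dd[symmetric] mild_wcoef_def by (simp add: algebra_simps)
  then have "l2norm nat_measure (\<lambda>k. mild_wcoef c (full_source f \<psi>) t k - mild_wcoef c (full_source f \<psi>') t k) =
      l2norm nat_measure (\<lambda>k. of_real (weight k) * duhamel 0 t (control_source ?d) k)"
    by (simp only:) (rule l2norm_nat_unimodular, simp add: norm_mult)
  then have "(l2norm nat_measure (\<lambda>k. mild_wcoef c (full_source f \<psi>) t k - mild_wcoef c (full_source f \<psi>') t k))\<^sup>2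
      \<le> duhamel_const T * (LINT s|ivl 0 t. (\<bar>u s\<bar> * (mult_bound * H1_norm (?d s)))\<^sup>2)"
    using duhamel_estimate(3)[OF cs rt] by simp
  also have "\<dots> = (LINT s|ivl 0 t. \<kappa> s * (H1_norm (?d s))\<^sup>2)"
    unfolding integral_mult_right_zero[symmetric]
    by (rule Bochner_Integration.integral_cong) (auto simp: \<kappa>_def power_mult_distrib mult_ac)
  finally show ?thesis .
qed

lemma H1_norm_diff_continuous:
  assumes "\<psi> \<in> C_time_H1 T" "\<psi>' \<in> C_time_H1 T"
  shows "continuous_on {0..T} (\<lambda>s. (H1_norm (\<lambda>x. \<psi> s x - \<psi>' s x))\<^sup>2)"
  by (intro continuous_intros C_time_H1_norm_continuous[OF C_time_H1_diff[OF assms]])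

text \<open>Both solutions are fixed points of the same map, so the squared distance obeys
  Gronwall's inequality with \<open>a = 0\<close>.\<close>

lemma mild_solution_unique:
  assumes \<psi>0: "\<psi>0 \<in> H1_on 0 1" and f: "f \<in> L2_time_H1_pw T A"
    and m: "mild_solution T \<mu> u \<psi>0 f \<psi>" "mild_solution T \<mu> u \<psi>0 f \<psi>'" and t: "t \<in> {0..T}"
  shows "AE x in I01. \<psi>' t x = \<psi> t x"
proof -
  have C: "\<psi> \<in> C_time_H1 T" "\<psi>' \<in> C_time_H1 T"
    and h: "\<And>t. t \<in> {0..T} \<Longrightarrow> wcoef (\<psi> t) = mild_wcoef (wcoef \<psi>0) (full_source f \<psi>) t"
    "\<And>t. t \<in> {0..T} \<Longrightarrow> wcoef (\<psi>' t) = mild_wcoef (wcoef \<psi>0) (full_source f \<psi>') t"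
    using m mild_solution_iff[OF \<psi>0 f] by blast+
  define y where "y s = (H1_norm (\<lambda>x. \<psi> s x - \<psi>' s x))\<^sup>2" for s
  have "y t \<le> 2 * 0 * exp (2 * (LINT r|ivl 0 t. \<kappa> r))"
  proof (rule gronwall_integrable[OF \<kappa>_props])
    show "continuous_on {0..T} y" unfolding y_def by (rule H1_norm_diff_continuous[OF C])
    show "y s \<le> 0 + (LINT r|ivl 0 s. \<kappa> r * y r)" if s: "s \<in> {0..T}" for s
      using mild_wcoef_lipschitz[OF C f s, of "wcoef \<psi>0"]
      unfolding y_def H1_norm_diff[OF C_time_H1_D(1)[OF C(1) s] C_time_H1_D(1)[OF C(2) s]] h(1)[OF s] h(2)[OF s]
      by simp
  qed (use T t in \<open>auto simp: y_def\<close>)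
  then have "H1_norm (\<lambda>x. \<psi> t x - \<psi>' t x) \<le> 0" by (simp add: y_def)
  then have n: "l2norm nat_measure (\<lambda>k. wcoef (\<psi> t) k - wcoef (\<psi>' t) k) \<le> 0"
    using H1_norm_diff[OF C_time_H1_D(1)[OF C(1) t] C_time_H1_D(1)[OF C(2) t]] by simp
  have "wcoef (\<psi> t) k - wcoef (\<psi>' t) k = 0" for k
    by (rule l2norm_nat_eq_0[OF sqint_diff[OF H1_wcoef_sqint H1_wcoef_sqint] n])
       (use C_time_H1_D(1)[OF C(1) t] C_time_H1_D(1)[OF C(2) t] in auto)
  then have "coef (\<psi>' t) k = coef (\<psi> t) k" for k
    using weight_ge_1[of k] by (simp add: wcoef_def) (metis not_one_le_zero)
  then show ?thesis
    by (intro coef_eq_imp_AE H1_onD(1)[OF C_time_H1_D(1)[OF C(1) t]] H1_onD(1)[OF C_time_H1_D(1)[OF C(2) t]])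
qed

text \<open>Gronwall's inequality for the squared norm of an arbitrary mild solution. It is
  independent of how the solution was constructed, and the constant is fixed before the
  data.\<close>

lemma mild_solution_estimate:
  "\<exists>C>0. \<forall>\<psi>0\<in>H1_on 0 1. \<forall>f\<in>L2_time_H1_pw T A. \<forall>\<psi>. mild_solution T \<mu> u \<psi>0 f \<psi> \<longrightarrow>
     C_time_H1_norm T \<psi> \<le> C * (H1_norm \<psi>0 + L2_time_H1_pw_norm T A f)"
proof -
  define D where "D = duhamel_const T"
  define E where "E = exp (2 * (LINT r|ivl 0 T. 4 * \<kappa> r))"
  \<comment> \<open>Under the root stand the factor 2 of Gronwall's inequality, the constant
    \<open>2 + 4 * D\<close> that bounds the inhomogeneous term by \<open>(N + Q)^2\<close>, and the
    exponential \<open>E\<close> at the final time; the density is \<open>4 * \<kappa>\<close>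
    because two squares of sums are split.\<close>
  define C where "C = sqrt (2 * (2 + 4 * D) * E)"
  have D: "0 \<le> D" unfolding D_def by (rule D_nonneg)
  have E: "0 < E" by (simp add: E_def)
  have C: "0 < C" using D E by (simp add: C_def)
  have "C_time_H1_norm T \<psi> \<le> C * (H1_norm \<psi>0 + L2_time_H1_pw_norm T A f)"
    if \<psi>0: "\<psi>0 \<in> H1_on 0 1" and f: "f \<in> L2_time_H1_pw T A" and m: "mild_solution T \<mu> u \<psi>0 f \<psi>"
    for \<psi>0 f \<psi>
  proof -
    have \<psi>: "\<psi> \<in> C_time_H1 T" and h: "\<And>t. t \<in> {0..T} \<Longrightarrow> wcoef (\<psi> t) = mild_wcoef (wcoef \<psi>0) (full_source f \<psi>) t"
      using m mild_solution_iff[OF \<psi>0 f] by blast+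
    define N where "N = H1_norm \<psi>0"
    define Q where "Q = L2_time_H1_pw_norm T A f"
    have N: "0 \<le> N" unfolding N_def by (rule H1_norm_nonneg[OF \<psi>0])
    have Q: "0 \<le> Q" by (simp add: Q_def L2_time_H1_pw_norm_def)
    have Q2: "Q\<^sup>2 = (LINT s|ivl 0 T. (H1_pw_norm A (f s))\<^sup>2)"
      by (simp add: Q_def L2_time_H1_pw_norm_def)
    note src = full_source_props[OF \<psi> f]
    define y where "y s = (H1_norm (\<psi> s))\<^sup>2" for s
    define a where "a = (2 + 4 * D) * (N + Q)\<^sup>2"
    have a: "0 \<le> a" using D by (simp add: a_def)
    have yc: "continuous_on {0..T} y" unfolding y_def by (intro continuous_intros C_time_H1_norm_continuous \<psi>)
    have fi: "integrable (ivl 0 T) (\<lambda>s. (H1_pw_norm A (f s))\<^sup>2)"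
      using f by (simp add: L2_time_H1_pw_def)
    have ineq: "y t \<le> a + (LINT s|ivl 0 t. 4 * \<kappa> s * y s)" if t: "t \<in> {0..T}" for t
    proof -
      let ?m = "\<lambda>s. \<bar>u s\<bar> * (mult_bound * H1_norm (\<psi> s)) + H1_pw_norm A (f s)"
      let ?X = "\<lambda>k. of_real (weight k) * duhamel 0 t (full_source f \<psi>) k"
      have rt: "(0::real) \<le> 0" "0 \<le> t" "t \<le> T" using t by auto
      note est = duhamel_estimate[OF src rt]
      have c0: "wcoef \<psi>0 \<in> sqint nat_measure" by (rule H1_wcoef_sqint[OF \<psi>0])
      have N': "N = l2norm nat_measure (wcoef \<psi>0)" unfolding N_def by (rule H1_norm_wcoef[OF c0])
      have "H1_norm (\<psi> t) = l2norm nat_measure (mild_wcoef (wcoef \<psi>0) (full_source f \<psi>) t)"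
        using H1_norm_wcoef[OF H1_wcoef_sqint[OF C_time_H1_D(1)[OF \<psi> t]]] h[OF t] by simp
      also have "\<dots> = l2norm nat_measure (\<lambda>k. wcoef \<psi>0 k - \<i> * ?X k)"
        unfolding mild_wcoef_def[abs_def] by (rule l2norm_nat_unimodular) simp
      also have "\<dots> \<le> N + l2norm nat_measure ?X"
        using l2norm_triangle[OF c0 sqint_uminus[OF sqint_cmult[OF est(2)]], of \<i>]
        by (simp add: l2norm_cmult N')
      finally have "y t \<le> (N + l2norm nat_measure ?X)\<^sup>2"
        unfolding y_def by (intro power_mono H1_norm_nonneg C_time_H1_D(1)[OF \<psi> t])
      also have "\<dots> \<le> 2 * N\<^sup>2 + 2 * (l2norm nat_measure ?X)\<^sup>2"
        by (rule add_sq_le)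
      also have "\<dots> \<le> 2 * N\<^sup>2 + 2 * (D * (LINT s|ivl 0 t. (?m s)\<^sup>2))"
        using est(3) by (simp add: D_def)
      also have "(LINT s|ivl 0 t. (?m s)\<^sup>2) \<le> (LINT s|ivl 0 t. 2 * ((u s)\<^sup>2 * (mult_bound\<^sup>2 * y s)) + 2 * (H1_pw_norm A (f s))\<^sup>2)"
      proof (rule integral_mono)
        show "integrable (ivl 0 t) (\<lambda>s. (?m s)\<^sup>2)" by (rule time_bound_sub(2)[OF src(2) rt(1,3)])
        have "integrable (ivl 0 T) (\<lambda>s. (u s)\<^sup>2 * (mult_bound\<^sup>2 * y s))"
          by (intro integrable_weight_continuous u_props continuous_intros yc)
        then have "integrable (ivl 0 T) (\<lambda>s. 2 * ((u s)\<^sup>2 * (mult_bound\<^sup>2 * y s)) + 2 * (H1_pw_norm A (f s))\<^sup>2)"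
          using fi by simp
        then show "integrable (ivl 0 t) (\<lambda>s. 2 * ((u s)\<^sup>2 * (mult_bound\<^sup>2 * y s)) + 2 * (H1_pw_norm A (f s))\<^sup>2)"
          by (rule integrable_ivl_sub) (use rt in auto)
        show "(?m s)\<^sup>2 \<le> 2 * ((u s)\<^sup>2 * (mult_bound\<^sup>2 * y s)) + 2 * (H1_pw_norm A (f s))\<^sup>2" for s
          using add_sq_le[of "\<bar>u s\<bar> * (mult_bound * H1_norm (\<psi> s))" "H1_pw_norm A (f s)"]
          by (simp add: power_mult_distrib y_def)
      qed
      also have "\<dots> = 2 * (LINT s|ivl 0 t. (u s)\<^sup>2 * (mult_bound\<^sup>2 * y s)) + 2 * (LINT s|ivl 0 t. (H1_pw_norm A (f s))\<^sup>2)"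
      proof -
        have "integrable (ivl 0 T) (\<lambda>s. (u s)\<^sup>2 * (mult_bound\<^sup>2 * y s))"
          by (intro integrable_weight_continuous u_props continuous_intros yc)
        then have "integrable (ivl 0 t) (\<lambda>s. (u s)\<^sup>2 * (mult_bound\<^sup>2 * y s))"
          by (rule integrable_ivl_sub) (use rt in auto)
        moreover have "integrable (ivl 0 t) (\<lambda>s. (H1_pw_norm A (f s))\<^sup>2)"
          by (rule integrable_ivl_sub[OF fi]) (use rt in auto)
        ultimately show ?thesis by simp
      qed
      also have "(LINT s|ivl 0 t. (H1_pw_norm A (f s))\<^sup>2) \<le> Q\<^sup>2"
        unfolding Q2 by (rule integral_ivl_mono[OF fi]) (use rt in auto)
      finally have 1: "y t \<le> 2 * N\<^sup>2 + 2 * (D * (2 * (LINT s|ivl 0 t. (u s)\<^sup>2 * (mult_bound\<^sup>2 * y s)) + 2 * Q\<^sup>2))"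
        using D by (simp add: mult_left_mono)
      have 2: "(LINT s|ivl 0 t. 4 * \<kappa> s * y s) = 4 * D * (LINT s|ivl 0 t. (u s)\<^sup>2 * (mult_bound\<^sup>2 * y s))"
        unfolding integral_mult_right_zero[symmetric]
        by (rule Bochner_Integration.integral_cong) (auto simp: \<kappa>_def D_def mult_ac)
      have "2 * N\<^sup>2 + 4 * D * Q\<^sup>2 \<le> (2 + 4 * D) * (N\<^sup>2 + Q\<^sup>2)"
        using D by (simp add: algebra_simps)
      also have "\<dots> \<le> a" unfolding a_def
        using D N Q by (intro mult_left_mono) (auto simp: power2_sum)
      finally show ?thesis using 1 unfolding 2 by (simp add: algebra_simps)
    qed
    have "H1_norm (\<psi> t) \<le> C * (N + Q)" if t: "t \<in> {0..T}" for t
    proof -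
      have \<kappa>4: "integrable (ivl 0 T) (\<lambda>s. 4 * \<kappa> s)" "0 \<le> 4 * \<kappa> s" for s
        using \<kappa>_props by auto
      have "y t \<le> 2 * a * exp (2 * (LINT r|ivl 0 t. 4 * \<kappa> r))"
        by (rule gronwall_integrable[OF \<kappa>4 _ a yc _ ineq t]) (use T in \<open>auto simp: y_def\<close>)
      also have "\<dots> \<le> 2 * a * E"
        unfolding E_def using a t \<kappa>4
        by (intro mult_left_mono) (auto intro!: integral_ivl_mono)
      also have "\<dots> = (C * (N + Q))\<^sup>2"
        using D E by (simp add: C_def a_def power_mult_distrib)
      finally show ?thesis unfolding y_def
        by (rule power2_le_imp_le) (use C N Q in simp)
    qed
    then show ?thesis unfolding C_time_H1_norm_def N_def Q_def using T by (intro cSUP_least) auto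
  qed
  then show ?thesis using C by blast
qed

section \<open>Existence by Picard iteration\<close>

text \<open>The iteration runs on functions, whereas its convergence is established for their
  coordinate sequences at each instant; the limit sequence is turned back into a function by
  \<open>of_wcoef\<close>.\<close>

lemma mild_solution_exists:
  assumes \<psi>0: "\<psi>0 \<in> H1_on 0 1" and f: "f \<in> L2_time_H1_pw T A"
  shows "\<exists>\<psi>. mild_solution T \<mu> u \<psi>0 f \<psi>"
proof -
  let ?n = "l2norm nat_measure"
  define c where "c = wcoef \<psi>0"
  have c: "c \<in> sqint nat_measure" unfolding c_def by (rule H1_wcoef_sqint[OF \<psi>0])
  define \<Phi> where "\<Phi> \<psi> t = of_wcoef (mild_wcoef c (full_source f \<psi>) t)" for \<psi> t
  have \<Phi>h: "\<Phi> \<psi> t \<in> H1_on 0 1" "wcoef (\<Phi> \<psi> t) = mild_wcoef c (full_source f \<psi>) t"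
    if "\<psi> \<in> C_time_H1 T" "t \<in> {0..T}" for \<psi> t
    unfolding \<Phi>_def using of_wcoef[OF mild_wcoef_sqint'[OF that(1) f c that(2)]] by auto
  have \<Phi>C: "\<Phi> \<psi> \<in> C_time_H1 T" if \<psi>: "\<psi> \<in> C_time_H1 T" for \<psi>
  proof (rule C_time_H1_I)
    fix t assume t: "t \<in> {0..T}"
    show "\<Phi> \<psi> t \<in> H1_on 0 1" by (rule \<Phi>h(1)[OF \<psi> t])
    show "((\<lambda>s. ?n (\<lambda>k. wcoef (\<Phi> \<psi> s) k - wcoef (\<Phi> \<psi> t) k)) \<longlongrightarrow> 0) (at t within {0..T})"
    proof (rule Lim_transform_eventually[OF mild_wcoef_continuous[OF full_source_props[OF \<psi> f] c t]])
      show "\<forall>\<^sub>F s in at t within {0..T}. ?n (\<lambda>k. mild_wcoef c (full_source f \<psi>) s k - mild_wcoef c (full_source f \<psi>) t k) =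
          ?n (\<lambda>k. wcoef (\<Phi> \<psi> s) k - wcoef (\<Phi> \<psi> t) k)"
        unfolding eventually_at_filter
        by (intro always_eventually allI impI) (simp add: \<Phi>h(2)[OF \<psi>] \<Phi>h(2)[OF \<psi> t])
    qed
  qed
  \<comment> \<open>The iteration starts from the zero trajectory, which is trivially continuous;
    the initial datum enters with the first application of \<open>\<Phi>\<close>.\<close>
  define P where "P n = (\<Phi> ^^ n) (\<lambda>t. of_wcoef (\<lambda>k. 0))" for n
  have PS: "P (Suc n) = \<Phi> (P n)" for n by (simp add: P_def)
  have PC: "P n \<in> C_time_H1 T" for n
  proof (induction n)
    case 0
    show ?case unfolding P_def
      by (rule C_time_H1_I) (auto simp: of_wcoef l2norm_def)
  next
    case (Suc n)
    then show ?case unfolding PS by (rule \<Phi>C)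
  qed
  define d where "d n s = (H1_norm (\<lambda>x. P (Suc n) s x - P n s x))\<^sup>2" for n s
  have dc: "continuous_on {0..T} (d n)" for n
    unfolding d_def by (rule H1_norm_diff_continuous[OF PC PC])
  have dn: "d n t = (?n (\<lambda>k. wcoef (P (Suc n) t) k - wcoef (P n t) k))\<^sup>2" if "t \<in> {0..T}" for n t
    unfolding d_def using H1_norm_diff[OF C_time_H1_D(1)[OF PC that] C_time_H1_D(1)[OF PC that]] by simp
  have dstep: "d (Suc n) t \<le> (LINT s|ivl 0 t. \<kappa> s * d n s)" if t: "t \<in> {0..T}" for n t
    unfolding dn[OF t] using mild_wcoef_lipschitz[OF PC[of "Suc n"] PC[of n] f t, of c]
    unfolding PS[of "Suc n"] unfolding \<Phi>h(2)[OF PC t] d_def unfolding PS[of n] \<Phi>h(2)[OF PC t] .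
  define K where "K t = (LINT r|ivl 0 t. \<kappa> r)" for t
  have K0: "0 \<le> K t" for t unfolding K_def using \<kappa>_props(2) by simp
  have KT: "K t \<le> K T" if "t \<in> {0..T}" for t
    unfolding K_def by (rule integral_ivl_mono[OF \<kappa>_props(1)]) (use that \<kappa>_props in auto)
  obtain M where M: "0 \<le> M" "\<forall>s\<in>{0..T}. d 0 s \<le> M"
  proof -
    have "bounded (d 0 ` {0..T})" by (intro compact_imp_bounded compact_continuous_image dc) auto
    then obtain B where B: "\<forall>s\<in>{0..T}. \<bar>d 0 s\<bar> \<le> B" by (auto simp: bounded_iff)
    then have "\<forall>s\<in>{0..T}. d 0 s \<le> \<bar>B\<bar>" by fastforce
    then show ?thesis using that[of "\<bar>B\<bar>"] by simp
  qed
  \<comment> \<open>The weight has rate 4, so every step gains a factor \<open>1/4\<close> for the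
    squared increments and thus \<open>1/2\<close> for the increments, the rate required for the
    limit.\<close>
  have dbound: "\<forall>s\<in>{0..T}. d n s \<le> M / 4^n * exp (4 * K s)" for n
  proof (induction n)
    case 0
    show ?case
    proof
      fix s assume s: "s \<in> {0..T}"
      have "M * 1 \<le> M * exp (4 * K s)" using M(1) K0 by (intro mult_left_mono) auto
      then show "d 0 s \<le> M / 4^0 * exp (4 * K s)" using M(2) s by force
    qed
  next
    case (Suc n)
    show ?case
    proof
      fix t assume t: "t \<in> {0..T}"
      have "d (Suc n) t \<le> (LINT s|ivl 0 t. \<kappa> s * d n s)" by (rule dstep[OF t])
      also have "\<dots> \<le> (M / 4^n) / 4 * exp (4 * (LINT r|ivl 0 t. \<kappa> r))"
        by (rule weighted_integral_bound[OF \<kappa>_props _ dc t]) (use Suc M in \<open>auto simp: K_def\<close>)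
      finally show "d (Suc n) t \<le> M / 4^Suc n * exp (4 * K t)" by (simp add: K_def mult.commute)
    qed
  qed
  define R where "R = sqrt (M * exp (4 * K T))"
  have R0: "0 \<le> R" using M by (simp add: R_def)
  have step: "?n (\<lambda>k. wcoef (P (Suc n) t) k - wcoef (P n t) k) \<le> R * (1/2)^n" if t: "t \<in> {0..T}" for n t
  proof (rule power2_le_imp_le)
    have q: "((1/2)^n)\<^sup>2 = 1 / (4::real)^n"
      by (simp add: power2_eq_square power_divide flip: power_mult_distrib)
    have "(?n (\<lambda>k. wcoef (P (Suc n) t) k - wcoef (P n t) k))\<^sup>2 \<le> M / 4^n * exp (4 * K t)"
      using dbound[of n] t unfolding dn[OF t, symmetric] by blast
    also have "\<dots> \<le> M / 4^n * exp (4 * K T)"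
      using KT[OF t] M by (intro mult_left_mono) auto
    also have "\<dots> = (R * (1/2)^n)\<^sup>2" using M by (simp add: R_def power_mult_distrib q)
    finally show "(?n (\<lambda>k. wcoef (P (Suc n) t) k - wcoef (P n t) k))\<^sup>2 \<le> (R * (1/2)^n)\<^sup>2" .
  qed (use R0 in simp)
  have Ps: "wcoef (P n t) \<in> sqint nat_measure" if "t \<in> {0..T}" for n t
    by (rule H1_wcoef_sqint[OF C_time_H1_D(1)[OF PC that]])
  \<comment> \<open>The limit is taken separately at each instant, but \<open>R\<close> does not
    depend on \<open>t\<close>; the continuity of the limit rests on this.\<close>
  have "\<forall>t\<in>{0..T}. \<exists>y. y \<in> sqint nat_measure \<and> (\<forall>n. ?n (\<lambda>k. y k - wcoef (P n t) k) \<le> 2 * R * (1/2)^n)"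
  proof
    fix t assume t: "t \<in> {0..T}"
    show "\<exists>y. y \<in> sqint nat_measure \<and> (\<forall>n. ?n (\<lambda>k. y k - wcoef (P n t) k) \<le> 2 * R * (1/2)^n)"
      using sqint_nat_limit[of "\<lambda>n. wcoef (P n t)" R, OF Ps[OF t] step[OF t]] by blast
  qed
  then obtain h where h: "\<forall>t\<in>{0..T}. h t \<in> sqint nat_measure \<and> (\<forall>n. ?n (\<lambda>k. h t k - wcoef (P n t) k) \<le> 2 * R * (1/2)^n)"
    by (rule bchoice[THEN exE])
  define \<psi> where "\<psi> t = of_wcoef (h t)" for t
  have \<psi>h: "\<psi> t \<in> H1_on 0 1" "wcoef (\<psi> t) = h t" if "t \<in> {0..T}" for t
    unfolding \<psi>_def using of_wcoef h that by auto
  have hs: "h t \<in> sqint nat_measure" if "t \<in> {0..T}" for t using h that by blast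
  have hP: "?n (\<lambda>k. h t k - wcoef (P n t) k) \<le> 2 * R * (1/2)^n" if "t \<in> {0..T}" for n t
    using h that by blast
  have geo: "(\<lambda>n. 2 * R * (1/2)^n) \<longlonglongrightarrow> 0"
    using tendsto_mult[OF tendsto_const LIMSEQ_realpow_zero[of "1/2"], of "2 * R"] by simp
  have \<psi>C: "\<psi> \<in> C_time_H1 T"
  proof (rule C_time_H1_I[OF \<psi>h(1)])
    fix t assume t: "t \<in> {0..T}"
    show "((\<lambda>s. ?n (\<lambda>k. wcoef (\<psi> s) k - wcoef (\<psi> t) k)) \<longlongrightarrow> 0) (at t within {0..T})"
    proof (rule tendstoI)
      fix e :: real assume e: "0 < e"
      have "eventually (\<lambda>n. 2 * R * (1/2)^n < e / 3) sequentially"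
        by (rule order_tendstoD(2)[OF geo]) (use e in simp)
      then obtain n where n: "2 * R * (1/2)^n < e / 3" by (auto simp: eventually_sequentially)
      have "\<forall>\<^sub>F s in at t within {0..T}. ?n (\<lambda>k. wcoef (P n s) k - wcoef (P n t) k) < e / 3"
        by (rule order_tendstoD(2)[OF C_time_H1_D(2)[OF PC t]]) (use e in simp)
      moreover have "\<forall>\<^sub>F s in at t within {0..T}. s \<in> {0..T}"
        unfolding eventually_at_filter by (intro always_eventually) simp
      ultimately show "\<forall>\<^sub>F s in at t within {0..T}. dist (?n (\<lambda>k. wcoef (\<psi> s) k - wcoef (\<psi> t) k)) 0 < e"
      proof eventually_elim
        case (elim s)
        note s = elim(2)
        have "?n (\<lambda>k. h s k - h t k) \<le> ?n (\<lambda>k. h s k - wcoef (P n s) k) + ?n (\<lambda>k. wcoef (P n s) k - h t k)"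
          by (rule l2norm_triangle_diff[OF hs[OF s] Ps[OF s] hs[OF t]])
        also have "?n (\<lambda>k. wcoef (P n s) k - h t k) \<le> ?n (\<lambda>k. wcoef (P n s) k - wcoef (P n t) k) + ?n (\<lambda>k. wcoef (P n t) k - h t k)"
          by (rule l2norm_triangle_diff[OF Ps[OF s] Ps[OF t] hs[OF t]])
        also have "?n (\<lambda>k. wcoef (P n t) k - h t k) = ?n (\<lambda>k. h t k - wcoef (P n t) k)"
          by (rule l2norm_minus_commute)
        finally have "?n (\<lambda>k. h s k - h t k) < e"
          using hP[OF s, of n] hP[OF t, of n] n elim(1) by linarith
        then show ?case using \<psi>h(2)[OF s] \<psi>h(2)[OF t] by simp
      qed
    qed
  qed
  have fix_pt: "wcoef (\<psi> t) = mild_wcoef c (full_source f \<psi>) t" if t: "t \<in> {0..T}" for t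
  proof -
    let ?F = "mild_wcoef c (full_source f \<psi>) t"
    have Fs: "?F \<in> sqint nat_measure" by (rule mild_wcoef_sqint'[OF \<psi>C f c t])
    \<comment> \<open>Both the limit and the image of the limit under the map are close to the same
      iterate \<open>P (Suc n)\<close>: the first by the rate of convergence, the second by the
      Lipschitz estimate against \<open>P n\<close>.\<close>
    have b: "?n (\<lambda>k. h t k - ?F k) \<le> 2 * R * (1/2)^Suc n + sqrt (K T) * (2 * R * (1/2)^n)" for n
    proof -
      have "(?n (\<lambda>k. ?F k - wcoef (P (Suc n) t) k))\<^sup>2 \<le> (LINT s|ivl 0 t. \<kappa> s * (H1_norm (\<lambda>x. \<psi> s x - P n s x))\<^sup>2)"
        using mild_wcoef_lipschitz[OF \<psi>C PC[of n] f t, of c] unfolding PS[of n] \<Phi>h(2)[OF PC t] .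
      also have "\<dots> \<le> (LINT s|ivl 0 t. \<kappa> s * (2 * R * (1/2)^n)\<^sup>2)"
      proof (rule integral_mono)
        show "integrable (ivl 0 t) (\<lambda>s. \<kappa> s * (H1_norm (\<lambda>x. \<psi> s x - P n s x))\<^sup>2)"
          by (rule integrable_ivl_sub[OF integrable_weight_continuous[OF \<kappa>_props(1) H1_norm_diff_continuous[OF \<psi>C PC]]])
             (use t in auto)
        have "integrable (ivl 0 t) \<kappa>" by (rule integrable_ivl_sub[OF \<kappa>_props(1)]) (use t in auto)
        then show "integrable (ivl 0 t) (\<lambda>s. \<kappa> s * (2 * R * (1/2)^n)\<^sup>2)" by simp
        fix s assume "s \<in> space (ivl 0 t)"
        then have s: "s \<in> {0..T}" using t by auto
        have "H1_norm (\<lambda>x. \<psi> s x - P n s x) \<le> 2 * R * (1/2)^n"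
          using H1_norm_diff[OF \<psi>h(1)[OF s] C_time_H1_D(1)[OF PC s]] hP[OF s] \<psi>h(2)[OF s] by simp
        then show "\<kappa> s * (H1_norm (\<lambda>x. \<psi> s x - P n s x))\<^sup>2 \<le> \<kappa> s * (2 * R * (1/2)^n)\<^sup>2"
          by (intro mult_left_mono power_mono \<kappa>_props H1_norm_nonneg H1_on_diff \<psi>h(1)[OF s] C_time_H1_D(1)[OF PC s]) auto
      qed
      also have "\<dots> = K t * (2 * R * (1/2)^n)\<^sup>2" unfolding K_def by (rule integral_mult_left_zero)
      also have "\<dots> \<le> K T * (2 * R * (1/2)^n)\<^sup>2" by (intro mult_right_mono KT[OF t]) simp
      also have "\<dots> = (sqrt (K T) * (2 * R * (1/2)^n))\<^sup>2" using K0[of T] by (simp add: power_mult_distrib)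
      finally have 1: "?n (\<lambda>k. ?F k - wcoef (P (Suc n) t) k) \<le> sqrt (K T) * (2 * R * (1/2)^n)"
        by (rule power2_le_imp_le) (use K0[of T] R0 in simp)
      have "?n (\<lambda>k. h t k - ?F k) \<le> ?n (\<lambda>k. h t k - wcoef (P (Suc n) t) k) + ?n (\<lambda>k. wcoef (P (Suc n) t) k - ?F k)"
        by (rule l2norm_triangle_diff[OF hs[OF t] Ps[OF t] Fs])
      also have "?n (\<lambda>k. wcoef (P (Suc n) t) k - ?F k) = ?n (\<lambda>k. ?F k - wcoef (P (Suc n) t) k)"
        by (rule l2norm_minus_commute)
      finally show ?thesis using 1 hP[OF t, of "Suc n"] by linarith
    qed
    have "(\<lambda>n. 2 * R * (1/2)^Suc n + sqrt (K T) * (2 * R * (1/2)^n)) \<longlonglongrightarrow> 0 + sqrt (K T) * 0"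
      by (intro tendsto_add tendsto_mult tendsto_const LIMSEQ_Suc[OF geo] geo)
    then have "?n (\<lambda>k. h t k - ?F k) \<le> 0 + sqrt (K T) * 0"
      by (rule LIMSEQ_le_const) (use b in blast)
    then have z: "?n (\<lambda>k. h t k - ?F k) \<le> 0" by simp
    have "h t k - ?F k = 0" for k
      by (rule l2norm_nat_eq_0[OF sqint_diff[OF hs[OF t] Fs] z])
    then show ?thesis unfolding \<psi>h(2)[OF t] by (simp add: fun_eq_iff)
  qed
  have "mild_solution T \<mu> u \<psi>0 f \<psi>"
    unfolding mild_solution_iff[OF \<psi>0 f] using \<psi>C fix_pt by (simp add: c_def)
  then show ?thesis by blast
qed

end

theorem proposition4p1:
  fixes N :: nat and A :: "real set" and T :: real
    and \<mu> u :: "real \<Rightarrow> real"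
  assumes "1 \<le> N" and "finite A" and "card A = N" and "A \<subseteq> {0<..<1}" and "0 < T"
    and "(\<lambda>x. complex_of_real (\<mu> x)) \<in> H1_pw A"
    and "u \<in> L2_time_real T"
  shows "(\<forall>\<psi>0 \<in> H1_on 0 1. \<forall>f \<in> L2_time_H1_pw T A.
            \<exists>\<psi>. mild_solution T \<mu> u \<psi>0 f \<psi> \<and>
                (\<forall>\<psi>'. mild_solution T \<mu> u \<psi>0 f \<psi>' \<longrightarrow>
                   (\<forall>t\<in>{0..T}. AE x in lebesgue_on {0<..<1}. \<psi>' t x = \<psi> t x)))
       \<and> (\<exists>C>0. \<forall>\<psi>0 \<in> H1_on 0 1. \<forall>f \<in> L2_time_H1_pw T A. \<forall>\<psi>.
            mild_solution T \<mu> u \<psi>0 f \<psi> \<longrightarrow>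
              C_time_H1_norm T \<psi> \<le> C * (H1_norm \<psi>0 + L2_time_H1_pw_norm T A f))"
proof -
  interpret bilinear_control A T \<mu> u
    by unfold_locales (use assms in auto)
  show ?thesis
  proof (intro conjI ballI)
    fix \<psi>0 f assume \<psi>0: "\<psi>0 \<in> H1_on 0 1" and f: "f \<in> L2_time_H1_pw T A"
    obtain \<psi> where "mild_solution T \<mu> u \<psi>0 f \<psi>" using mild_solution_exists[OF \<psi>0 f] by blast
    then show "\<exists>\<psi>. mild_solution T \<mu> u \<psi>0 f \<psi> \<and>
                (\<forall>\<psi>'. mild_solution T \<mu> u \<psi>0 f \<psi>' \<longrightarrow>
                   (\<forall>t\<in>{0..T}. AE x in lebesgue_on {0<..<1}. \<psi>' t x = \<psi> t x))"
      using mild_solution_unique[OF \<psi>0 f] by blast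
  qed (rule mild_solution_estimate)
qed

end
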